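(* Let $T=2\pi p/q$ with $p,q\in\mathbb{N}^+$, $\gcd(p,q)=1$, and $\Omega=(0,T)\times(0,\pi)$. Assume: (A1) $\alpha,\beta$ are real-valued and belong to $W^3(0,\pi)=\{y\in L^1(0,\pi): y^{(3)}\text{ exists in the weak sense and belongs to }L^1(0,\pi)\}$. (A2) $\eta(0)=1$, $\rho(x)=\rho(0)e^{4\int_0^x\beta(s)\,ds}>1$, $\eta(x)=e^{4\int_0^x\alpha(s)\,ds}$, and $\int_0^\pi(\rho/\eta)^{1/4}\,dx=\pi$. Let $L$ be the beam operator and $a$ the constant in the eigenvalue asymptotics, both defined in the context, and assume that $a$ is irrational. Let $g:\mathbb{R}\to\mathbb{R}$ be monotone and continuous with $|g(u)|<M$ for some constant $M>0$ and all $u\in\mathbb{R}$; write $g(\pm\infty)=\lim_{u\to\pm\infty}g(u)$. Let $f$ be a real-valued function on $\Omega$ and assume: (A3) $\hat f:=\rho^{-1}f\in L^\infty(\Omega)$ has a decomposition $\hat f=f^*+f^{**}$, where $f^*\in R(L)$ (the range of $L$) and, for some $\epsilon>0$, $$\min\{g(-\infty),g(+\infty)\}+\epsilon\le f^{**}(t,x)\le\max\{g(-\infty),g(+\infty)\}-\epsilon\quad\text{for a.e. }(t,x)\in\Omega.$$ Then there exists at least one (weak) periodic solution $u$ of the problem $$\rho(x)u_{tt}+(\eta(x)u_{xx})_{xx}+\rho(x)g(u)=f(t,x),\quad (t,x)\in\Omega,$$ $$u(t,x)=2(\alpha(x)+\beta(x))u_x(t,x)+u_{xx}(t,x)=0\quad\text{at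 }x=0\text{ and }x=\pi,$$ $$u(0,x)=u(T,x),\qquad u_t(0,x)=u_t(T,x).$$ That is, there is $u\in L^2(\Omega)$ with $$\int_\Omega u\big(\rho\psi_{tt}+(\eta\psi_{xx})_{xx}\big)\,dt\,dx+\int_\Omega g(u)\psi\rho\,dt\,dx=\int_\Omega f\psi\,dt\,dx\quad\forall\psi\in\Psi,$$ where $\Psi$ is the space of test functions defined in the context.
   Context: $L^2(\Omega)$ is the weighted space with inner product $\langle u,v\rangle=\int_\Omega u\,\overline{v}\,\rho\,dt\,dx$ and norm $\|\cdot\|$; $L^\infty(\Omega)$ has the essential-supremum norm. Test functions: $\Psi$ is the set of functions $\psi$ that are $C^\infty$ on $\Omega$ (up to the boundary), satisfy $\psi=2(\alpha+\beta)\psi_x+\psi_{xx}=0$ at $x=0$ and $x=\pi$, and satisfy $\psi(0,x)=\psi(T,x)$, $\psi_t(0,x)=\psi_t(T,x)$. Beam operator: $D(L)$ is the set of $u\in L^2(\Omega)$ for which there is $h\in L^2(\Omega)$ with $\int_\Omega u(\rho\psi_{tt}+(\eta\psi_{xx})_{xx})\,dt\,dx=\int_\Omega h\psi\rho\,dt\,dx$ for all $\psi\in\Psi$, and then $Lu:=h$. On $\Psi$ this is $L\psi=\rho^{-1}(\rho\psi_{tt}+(\eta\psi_{xx})_{xx})$. Eigenvalues and the constant $a$: let $\mu_n$, $n\in\mathbb{N}^+$, be the eigenvalues (in nondecreasing order, counted with multiplicity) of the problem $\frac{1}{\rho}(\eta\varphi'')''=\mu\varphi$ on $(0,\pi)$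 with $\varphi=2(\alpha+\beta)\varphi'+\varphi''=0$ at $x=0$ and $x=\pi$. It is a known result (Badanin–Korotyaev), which may be taken as given, that under (A1) and (A2) $$\mu_n=n^4+2n^2a+b_n+o\big(\tfrac1n\big)\quad (n\to\infty),$$ where $a$ is a real constant (depending on $\alpha,\beta$) and $(b_n)$ is a bounded sequence; in particular $a=\lim_{n\to\infty}(\mu_n-n^4)/(2n^2)$. *)

theory Defs
  imports
    "HOL-Analysis.Analysis"
    "HOL-Library.Function_Algebras"
    "HOL-Library.Landau_Symbols"
begin

section \<open>Coefficients\<close>

definition test_function_1d :: "(real \<Rightarrow> real) \<Rightarrow> bool" where
  "test_function_1d \<phi> \<longleftrightarrow>
     (\<forall>k x. (deriv ^^ k) \<phi> differentiable (at x)) \<and>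
     (\<exists>c d. 0 < c \<and> c \<le> d \<and> d < pi \<and> (\<forall>x. x \<notin> {c..d} \<longrightarrow> \<phi> x = 0))"

text \<open>Elements of \<open>W\<^sup>3(0,\<pi>)\<close> are classes modulo null sets, and each class has exactly one representative
  continuous on \<open>[0,\<pi>]\<close>. Boundary conditions involve point values of the coefficients, so
  statements about \<open>W3\<close> functions with boundary values also require \<open>continuous_on {0..pi}\<close>.\<close>

definition W3 :: "(real \<Rightarrow> real) set" where
  "W3 = {y. set_integrable lebesgue {0<..<pi} y \<and>
     (\<exists>z. set_integrable lebesgue {0<..<pi} z \<and>
        (\<forall>\<phi>. test_function_1d \<phi> \<longrightarrow>
           (LINT x:{0<..<pi}|lebesgue. y x * (deriv ^^ 3) \<phi> x)
             = - (LINT x:{0<..<pi}|lebesgue. z x * \<phi> x)))}"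

section \<open>Function spaces on the space-time rectangle\<close>

text \<open>Points of the rectangle are pairs \<open>(t, x)\<close>.\<close>

definition Omega :: "real \<Rightarrow> (real \<times> real) set" where
  "Omega T = {0<..<T} \<times> {0<..<pi}"

definition L2 :: "real \<Rightarrow> (real \<Rightarrow> real) \<Rightarrow> (real \<times> real \<Rightarrow> 'a::euclidean_space) set" where
  "L2 T \<rho> = {u. u \<in> borel_measurable (lebesgue_on (Omega T)) \<and>
     integrable (lebesgue_on (Omega T)) (\<lambda>z. (norm (u z))\<^sup>2 * \<rho> (snd z))}"

definition Linf :: "real \<Rightarrow> (real \<times> real \<Rightarrow> 'a::euclidean_space) set" where
  "Linf T = {u. u \<in> borel_measurable (lebesgue_on (Omega T)) \<and>
     (\<exists>C. AE z in lebesgue_on (Omega T). norm (u z) \<le> C)}"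

text \<open>Partial derivatives on the closed rectangle, one-sided on its boundary.\<close>

definition Dt :: "real \<Rightarrow> (real \<times> real \<Rightarrow> complex) \<Rightarrow> real \<times> real \<Rightarrow> complex" where
  "Dt T \<psi> = (\<lambda>(t, x). vector_derivative (\<lambda>s. \<psi> (s, x)) (at t within {0..T}))"

definition Dx :: "(real \<times> real \<Rightarrow> complex) \<Rightarrow> real \<times> real \<Rightarrow> complex" where
  "Dx \<psi> = (\<lambda>(t, x). vector_derivative (\<lambda>y. \<psi> (t, y)) (at x within {0..pi}))"

primrec Ck_closed :: "real \<Rightarrow> nat \<Rightarrow> (real \<times> real \<Rightarrow> complex) \<Rightarrow> bool" where
  "Ck_closed T 0 \<psi> \<longleftrightarrow> continuous_on ({0..T} \<times> {0..pi}) \<psi>"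
| "Ck_closed T (Suc k) \<psi> \<longleftrightarrow>
     continuous_on ({0..T} \<times> {0..pi}) \<psi> \<and>
     (\<forall>t\<in>{0..T}. \<forall>x\<in>{0..pi}.
        (\<lambda>s. \<psi> (s, x)) differentiable (at t within {0..T}) \<and>
        (\<lambda>y. \<psi> (t, y)) differentiable (at x within {0..pi})) \<and>
     Ck_closed T k (Dt T \<psi>) \<and> Ck_closed T k (Dx \<psi>)"

definition smooth_closed :: "real \<Rightarrow> (real \<times> real \<Rightarrow> complex) \<Rightarrow> bool" where
  "smooth_closed T \<psi> \<longleftrightarrow> (\<forall>k. Ck_closed T k \<psi>)"

definition test_functions ::
    "real \<Rightarrow> (real \<Rightarrow> real) \<Rightarrow> (real \<Rightarrow> real) \<Rightarrow> (real \<times> real \<Rightarrow> complex) set" where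
  "test_functions T \<alpha> \<beta> = {\<psi>. smooth_closed T \<psi> \<and>
     (\<forall>t\<in>{0..T}. \<forall>x\<in>{0, pi}.
        \<psi> (t, x) = 0 \<and>
        (2 * (\<alpha> x + \<beta> x)) *\<^sub>R Dx \<psi> (t, x) + Dx (Dx \<psi>) (t, x) = 0) \<and>
     (\<forall>x\<in>{0..pi}. \<psi> (0, x) = \<psi> (T, x) \<and> Dt T \<psi> (0, x) = Dt T \<psi> (T, x))}"

section \<open>Beam operator\<close>

text \<open>\<open>\<rho> \<psi>\<^sub>t\<^sub>t + (\<eta> \<psi>\<^sub>x\<^sub>x)\<^sub>x\<^sub>x\<close>.\<close>

definition beam_expr ::
    "real \<Rightarrow> (real \<Rightarrow> real) \<Rightarrow> (real \<Rightarrow> real) \<Rightarrow> (real \<times> real \<Rightarrow> complex) \<Rightarrow> real \<times> real \<Rightarrow> complex" where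
  "beam_expr T \<rho> \<eta> \<psi> z =
     \<rho> (snd z) *\<^sub>R Dt T (Dt T \<psi>) z + Dx (Dx (\<lambda>w. \<eta> (snd w) *\<^sub>R Dx (Dx \<psi>) w)) z"

text \<open>The graph of \<open>L\<close>: all pairs \<open>(u, h)\<close> with \<open>u \<in> D(L)\<close> and \<open>L u = h\<close>. A graph avoids choosing a
  representative of \<open>L u\<close>, which is determined only almost everywhere.\<close>

definition beam_graph ::
    "real \<Rightarrow> (real \<Rightarrow> real) \<Rightarrow> (real \<Rightarrow> real) \<Rightarrow> (real \<Rightarrow> real) \<Rightarrow> (real \<Rightarrow> real)
      \<Rightarrow> ((real \<times> real \<Rightarrow> complex) \<times> (real \<times> real \<Rightarrow> complex)) set" where
  "beam_graph T \<alpha> \<beta> \<rho> \<eta> = {(u, h). u \<in> L2 T \<rho> \<and> h \<in> L2 T \<rho> \<and>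
     (\<forall>\<psi>\<in>test_functions T \<alpha> \<beta>.
        (LINT z|lebesgue_on (Omega T). u z * beam_expr T \<rho> \<eta> \<psi> z)
          = (LINT z|lebesgue_on (Omega T). \<rho> (snd z) *\<^sub>R (h z * \<psi> z)))}"

definition beam_range ::
    "real \<Rightarrow> (real \<Rightarrow> real) \<Rightarrow> (real \<Rightarrow> real) \<Rightarrow> (real \<Rightarrow> real) \<Rightarrow> (real \<Rightarrow> real)
      \<Rightarrow> (real \<times> real \<Rightarrow> complex) set" where
  "beam_range T \<alpha> \<beta> \<rho> \<eta> = Range (beam_graph T \<alpha> \<beta> \<rho> \<eta>)"

definition weak_periodic_solution ::
    "real \<Rightarrow> (real \<Rightarrow> real) \<Rightarrow> (real \<Rightarrow> real) \<Rightarrow> (real \<Rightarrow> real) \<Rightarrow> (real \<Rightarrow> real)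
      \<Rightarrow> (real \<Rightarrow> real) \<Rightarrow> (real \<times> real \<Rightarrow> real) \<Rightarrow> (real \<times> real \<Rightarrow> real) \<Rightarrow> bool" where
  "weak_periodic_solution T \<alpha> \<beta> \<rho> \<eta> g f u \<longleftrightarrow> u \<in> L2 T \<rho> \<and>
     (\<forall>\<psi>\<in>test_functions T \<alpha> \<beta>.
        (LINT z|lebesgue_on (Omega T). u z *\<^sub>R beam_expr T \<rho> \<eta> \<psi> z)
          + (LINT z|lebesgue_on (Omega T). (g (u z) * \<rho> (snd z)) *\<^sub>R \<psi> z)
          = (LINT z|lebesgue_on (Omega T). f z *\<^sub>R \<psi> z))"

section \<open>Eigenvalues of the spatial operator\<close>

text \<open>\<open>\<phi>1, \<phi>2\<close> are the first two derivatives of \<open>\<phi>\<close>, and \<open>w1, w2\<close> those of \<open>\<eta> \<phi>''\<close>. Functions vanish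
  outside \<open>[0,\<pi>]\<close>, so that two eigenfunctions agreeing on \<open>[0,\<pi>]\<close> are equal and the dimension
  of the eigenspace is the multiplicity of the eigenvalue.\<close>

definition beam_eigenspace ::
    "(real \<Rightarrow> real) \<Rightarrow> (real \<Rightarrow> real) \<Rightarrow> (real \<Rightarrow> real) \<Rightarrow> (real \<Rightarrow> real) \<Rightarrow> complex
      \<Rightarrow> (real \<Rightarrow> complex) set" where
  "beam_eigenspace \<alpha> \<beta> \<rho> \<eta> \<nu> = {\<phi>.
     (\<forall>x. x \<notin> {0..pi} \<longrightarrow> \<phi> x = 0) \<and>
     (\<exists>\<phi>1 \<phi>2 w1 w2.
        (\<forall>x\<in>{0..pi}.
           (\<phi> has_vector_derivative \<phi>1 x) (at x within {0..pi}) \<and>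
           (\<phi>1 has_vector_derivative \<phi>2 x) (at x within {0..pi}) \<and>
           ((\<lambda>y. \<eta> y *\<^sub>R \<phi>2 y) has_vector_derivative w1 x) (at x within {0..pi}) \<and>
           (w1 has_vector_derivative w2 x) (at x within {0..pi}) \<and>
           (1 / \<rho> x) *\<^sub>R w2 x = \<nu> * \<phi> x) \<and>
        (\<forall>x\<in>{0, pi}. \<phi> x = 0 \<and> (2 * (\<alpha> x + \<beta> x)) *\<^sub>R \<phi>1 x + \<phi>2 x = 0))}"

definition beam_multiplicity ::
    "(real \<Rightarrow> real) \<Rightarrow> (real \<Rightarrow> real) \<Rightarrow> (real \<Rightarrow> real) \<Rightarrow> (real \<Rightarrow> real) \<Rightarrow> complex \<Rightarrow> nat" where
  "beam_multiplicity \<alpha> \<beta> \<rho> \<eta> \<nu> =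
     vector_space.dim (\<lambda>(c::complex) \<phi> x. c * \<phi> x) (beam_eigenspace \<alpha> \<beta> \<rho> \<eta> \<nu>)"

text \<open>\<open>(\<mu> n)\<close>, \<open>n \<ge> 1\<close>, lists all eigenvalues in nondecreasing order, each as often as its
  multiplicity; numbers that are not eigenvalues have multiplicity \<open>0\<close>. The value \<open>\<mu> 0\<close> plays no role.\<close>

definition beam_eigenvalues ::
    "(real \<Rightarrow> real) \<Rightarrow> (real \<Rightarrow> real) \<Rightarrow> (real \<Rightarrow> real) \<Rightarrow> (real \<Rightarrow> real) \<Rightarrow> (nat \<Rightarrow> real) \<Rightarrow> bool" where
  "beam_eigenvalues \<alpha> \<beta> \<rho> \<eta> \<mu> \<longleftrightarrow>
     mono_on {1..} \<mu> \<and>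
     (\<forall>\<nu>::complex. finite {n\<in>{1..}. complex_of_real (\<mu> n) = \<nu>} \<and>
        card {n\<in>{1..}. complex_of_real (\<mu> n) = \<nu>} = beam_multiplicity \<alpha> \<beta> \<rho> \<eta> \<nu>)"

end

theory Submission
  imports Defs "HOL-Complex_Analysis.Great_Picard" "HOL-Computational_Algebra.Polynomial"
begin

text \<open>Separation of variables diagonalises the beam operator: products of trigonometric functions of
  \<open>t\<close> with eigenfunctions of the spatial problem are orthonormal for the weight \<open>\<rho>\<close>, complete on the
  test functions, and \<open>L\<close> acts on them by \<open>\<lambda> = \<mu>\<^sub>n - (q m / p)\<^sup>2\<close>. Since \<open>a\<close> is irrational, the
  asymptotics of \<open>\<mu>\<^sub>n\<close> leave only finitely many \<open>\<lambda>\<close> in every bounded interval. The kernel of \<open>L\<close> is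
  therefore finite dimensional and \<open>L\<close> has a compact inverse on its complement.

  Brouwer's fixed point theorem solves the Galerkin equations, with the zero eigenvalues replaced by
  a small \<open>\<delta>\<close>. The components outside the kernel are bounded and relatively compact because \<open>g\<close> is bounded.
  As \<open>f\<^sup>*\<close> lies in the range of \<open>L\<close>, it is orthogonal to the kernel, and the strict inequalities for
  \<open>f\<^sup>*\<^sup>*\<close> make \<open>(g u - f\<^sup>*\<^sup>*) u\<close> coercive, which bounds the kernel components (Landesman--Lazer). A
  subsequence of Galerkin solutions converges to a weak solution.\<close>

text \<open>Three obstacles shape the proof. The eigenfunctions inherit only finite smoothness from
  the coefficients, so the modes need not be test functions, and that f* lies in the range of L
  cannot be tested on the kernel directly. Each kernel mode is therefore replaced by products with
  polynomials that satisfy the boundary conditions exactly and whose images under the operator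
  converge too. Next, the list \<open>\<mu>\<close> prescribes eigenvalues but supplies no
  eigenfunctions; an orthonormal system is built from a compact solution operator and is matched
  with \<open>\<mu>\<close> by value alone. Finally, boundedness of \<open>g\<close> controls only
  the modes with non-zero eigenvalue. When the Galerkin equation is multiplied by its own solution,
  the shift \<open>\<delta>\<close> produces a sum of squares of favourable sign, so it drops out
  and the gap \<open>\<epsilon>\<close> yields an L1 bound uniform in the dimension; on the
  finite-dimensional kernel this bounds every coefficient. Strong convergence comes from dividing
  square-summable residual coefficients by the eigenvalues, which makes the tails uniformly
  small.\<close>

section \<open>Brouwer fixed points in boxes\<close>

text \<open>The dimension \<open>n\<close> will be the number of Galerkin modes, a value rather than
  a type, so points are functions of which only the first \<open>n\<close> entries count. On the
  grid of mesh 1/(k+1), Kuhn's lemma finds a cell in which every coordinate is moved up by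
  \<open>f\<close> at some vertex and down at another; a limit of such cells is a fixed
  point.\<close>

lemma brouwer_nat_cube:
  fixes f :: "(nat \<Rightarrow> real) \<Rightarrow> nat \<Rightarrow> real"
  assumes range: "\<And>x i. \<lbrakk>\<And>j. j < n \<Longrightarrow> 0 \<le> x j \<and> x j \<le> 1; i < n\<rbrakk> \<Longrightarrow> 0 \<le> f x i \<and> f x i \<le> 1"
    and cont: "\<And>X x i. \<lbrakk>\<And>k j. j < n \<Longrightarrow> 0 \<le> X k j \<and> X k j \<le> 1;
        \<And>j. j < n \<Longrightarrow> (\<lambda>k. X k j) \<longlonglongrightarrow> x j; i < n\<rbrakk> \<Longrightarrow> (\<lambda>k::nat. f (X k) i) \<longlonglongrightarrow> f x i"
  shows "\<exists>x. \<forall>i<n. 0 \<le> x i \<and> x i \<le> 1 \<and> f x i = x i"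
proof -
  define sc :: "nat \<Rightarrow> (nat \<Rightarrow> nat) \<Rightarrow> nat \<Rightarrow> real" where "sc k y j = real (y j) / real (Suc k)" for k y j
  \<comment> \<open>Label 0 means that \<open>f\<close> does not lower coordinate \<open>i\<close>,
    label 1 that it does not raise it. The faces carry the labels that Kuhn's lemma prescribes, and
    these agree with the weak inequalities because \<open>f\<close> maps into the cube.\<close>
  define label :: "nat \<Rightarrow> (nat \<Rightarrow> nat) \<Rightarrow> nat \<Rightarrow> nat" where
    "label k y i = (if y i = 0 then 0 else if y i = Suc k then 1
       else if sc k y i \<le> f (sc k y) i then 0 else 1)" for k y i
  have sc01: "0 \<le> sc k y j \<and> sc k y j \<le> 1" if "y j \<le> Suc k" for k y j
    using that by (simp add: sc_def field_simps)
  define RS where "RS q y \<longleftrightarrow> (\<forall>j<n. q j \<le> y j \<and> y j \<le> q j + 1)" for q y :: "nat \<Rightarrow> nat"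
  define PQ where "PQ k q \<longleftrightarrow> (\<forall>i<n. q i < Suc k) \<and> (\<forall>i<n. \<exists>r s. RS q r \<and> RS q s \<and>
          label k r i = 0 \<and> label k s i \<noteq> 0)" for k q
  have "\<exists>q. PQ k q" for k
  proof -
    obtain q where q: "\<forall>i<n. q i < Suc k"
      "\<forall>i<n. \<exists>r s. (\<forall>j<n. q j \<le> r j \<and> r j \<le> q j + 1) \<and>
          (\<forall>j<n. q j \<le> s j \<and> s j \<le> q j + 1) \<and> label k r i \<noteq> label k s i"
      by (rule kuhn_lemma[of "Suc k" n "label k"]) (auto simp: label_def)
    have lab: "label k r i = 0 \<or> label k r i = 1" for r i by (auto simp: label_def)
    have "\<exists>r s. RS q r \<and> RS q s \<and>
        label k r i = 0 \<and> label k s i \<noteq> 0" if i: "i < n" for i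
    proof -
      obtain r s where "\<forall>j<n. q j \<le> r j \<and> r j \<le> q j + 1" "\<forall>j<n. q j \<le> s j \<and> s j \<le> q j + 1"
        "label k r i \<noteq> label k s i"
        using q(2) i by blast
      then have "RS q r" "RS q s" "label k r i = 0 \<and> label k s i \<noteq> 0 \<or> label k s i = 0 \<and> label k r i \<noteq> 0"
        using lab[of r i] lab[of s i] by (auto simp: RS_def)
      then show ?thesis by blast
    qed
    then show ?thesis using q(1) unfolding PQ_def by blast
  qed
  then obtain Q where Q: "\<And>k. PQ k (Q k)" by metis
  have Q1: "Q k i < Suc k" if "i < n" for k i using Q[of k] that unfolding PQ_def by blast
  define r where "r k i = (SOME y. RS (Q k) y \<and> label k y i = 0)" for k i
  define s where "s k i = (SOME y. RS (Q k) y \<and> label k y i \<noteq> 0)" for k i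
  have r: "RS (Q k) (r k i) \<and> label k (r k i) i = 0" and s: "RS (Q k) (s k i) \<and> label k (s k i) i \<noteq> 0"
    if i: "i < n" for k i
  proof -
    obtain r' s' where "RS (Q k) r'" "RS (Q k) s'" "label k r' i = 0" "label k s' i \<noteq> 0"
      using Q[of k] i unfolding PQ_def by blast
    then have ex: "\<exists>y. RS (Q k) y \<and> label k y i = 0" "\<exists>y. RS (Q k) y \<and> label k y i \<noteq> 0" by auto
    show "RS (Q k) (r k i) \<and> label k (r k i) i = 0" "RS (Q k) (s k i) \<and> label k (s k i) i \<noteq> 0"
      unfolding r_def s_def using someI_ex[OF ex(1)] someI_ex[OF ex(2)] by simp_all
  qed
  have rs: "\<And>k i j. i < n \<Longrightarrow> j < n \<Longrightarrow> Q k j \<le> r k i j \<and> r k i j \<le> Q k j + 1"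
      "\<And>k i j. i < n \<Longrightarrow> j < n \<Longrightarrow> Q k j \<le> s k i j \<and> s k i j \<le> Q k j + 1"
      "\<And>k i. i < n \<Longrightarrow> label k (r k i) i = 0" "\<And>k i. i < n \<Longrightarrow> label k (s k i) i \<noteq> 0"
    using r s unfolding RS_def by blast+
  have Qb: "norm (sc k (Q k) j) \<le> 1" if "j \<in> {..<n}" for k j
    using sc01[of "Q k" j k] Q1[of j k] that by auto
  obtain h where h: "strict_mono (h::nat\<Rightarrow>nat)"
    "\<And>j. j \<in> {..<n} \<Longrightarrow> \<exists>l. (\<lambda>k. sc (h k) (Q (h k)) j) \<longlonglongrightarrow> l"
    by (rule function_convergent_subsequence[where S = "{..<n}" and f = "\<lambda>k. sc k (Q k)" and M = 1,
      OF countable_finite[OF finite_lessThan] Qb], assumption, rule that)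
  define x where "x j = lim (\<lambda>k. sc (h k) (Q (h k)) j)" for j
  have x: "(\<lambda>k. sc (h k) (Q (h k)) j) \<longlonglongrightarrow> x j" if "j < n" for j
    using h(2)[of j] that unfolding x_def by (simp add: convergent_def convergent_LIMSEQ_iff[symmetric])
  \<comment> \<open>Every vertex of a cell differs from the lower corner by at most the mesh, so all
    choices of vertices share one limit.\<close>
  have near: "(\<lambda>k. sc (h k) (y (h k)) j) \<longlonglongrightarrow> x j"
    if "j < n" "\<And>k. Q k j \<le> y k j \<and> y k j \<le> Q k j + 1" for y j
  proof -
    have "(\<lambda>k. 1 / real (Suc (h k))) \<longlonglongrightarrow> 0"
      using LIMSEQ_subseq_LIMSEQ[OF LIMSEQ_inverse_real_of_nat h(1)] by (simp add: o_def field_simps)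
    then have "(\<lambda>k. sc (h k) (y (h k)) j - sc (h k) (Q (h k)) j) \<longlonglongrightarrow> 0"
    proof (rule Lim_null_comparison[rotated], intro always_eventually allI)
      fix k
      have "real (Q (h k) j) \<le> real (y (h k) j)" "real (y (h k) j) \<le> real (Q (h k) j) + 1"
        using that(2)[of "h k"] by linarith+
      then have "\<bar>real (y (h k) j) - real (Q (h k) j)\<bar> / real (Suc (h k)) \<le> 1 / real (Suc (h k))"
        by (intro divide_right_mono) auto
      then show "norm (sc (h k) (y (h k)) j - sc (h k) (Q (h k)) j) \<le> 1 / real (Suc (h k))"
        by (simp add: sc_def diff_divide_distrib[symmetric])
    qed
    from tendsto_add[OF this x[OF that(1)]] show ?thesis by simp
  qed
  have "0 \<le> x i \<and> x i \<le> 1 \<and> f x i = x i" if i: "i < n" for i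
  proof -
    have x0: "0 \<le> x i" by (rule LIMSEQ_le_const[OF x[OF i]]) (auto simp: sc_def)
    have x1: "x i \<le> 1" 
      using sc01 Q1[OF i] less_imp_le by (intro LIMSEQ_le_const2[OF x[OF i]]) blast
    have bnd: "0 \<le> sc k (r k i) j \<and> sc k (r k i) j \<le> 1 \<and> 0 \<le> sc k (s k i) j \<and> sc k (s k i) j \<le> 1"
      if "j < n" for k j
    proof -
      have "r k i j \<le> Suc k" "s k i j \<le> Suc k"
        using rs(1,2)[OF i that, of k] Q1[OF that, of k] by auto
      then show ?thesis using sc01 by blast
    qed
    have 1: "(\<lambda>k. f (sc (h k) (r (h k) i)) i) \<longlonglongrightarrow> f x i"
      using i rs(1)[OF i] bnd by (intro cont near[of _ "\<lambda>k. r k i"]) auto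
    have 2: "(\<lambda>k. f (sc (h k) (s (h k) i)) i) \<longlonglongrightarrow> f x i"
      using i rs(2)[OF i] bnd by (intro cont near[of _ "\<lambda>k. s k i"]) auto
    have "sc k (r k i) i \<le> f (sc k (r k i)) i" for k
    proof (cases "r k i i = 0")
      case True
      then show ?thesis using range[OF _ i, of "sc k (r k i)"] bnd by (simp add: sc_def)
    next
      case False
      then show ?thesis using rs(3)[OF i, of k] by (auto simp: label_def split: if_splits)
    qed
    then have "x i \<le> f x i"
      using i rs(1)[OF i] by (intro LIMSEQ_le[OF near[of _ "\<lambda>k. r k i"] 1]) auto
    moreover have "f (sc k (s k i)) i \<le> sc k (s k i) i" for k
    proof (cases "s k i i = Suc k")
      case True
      then show ?thesis using range[OF _ i, of "sc k (s k i)"] bnd by (simp add: sc_def)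
    next
      case False
      then show ?thesis using rs(4)[OF i, of k] by (auto simp: label_def split: if_splits)
    qed
    then have "f x i \<le> x i"
      using i rs(2)[OF i] by (intro LIMSEQ_le[OF 2 near[of _ "\<lambda>k. s k i"]]) auto
    ultimately show ?thesis using x0 x1 by simp
  qed
  then show ?thesis by blast
qed

lemma brouwer_nat_box:
  fixes f :: "(nat \<Rightarrow> real) \<Rightarrow> nat \<Rightarrow> real"
  assumes C: "C > 0"
    and range: "\<And>x i. \<lbrakk>\<And>j. j < n \<Longrightarrow> \<bar>x j\<bar> \<le> C; i < n\<rbrakk> \<Longrightarrow> \<bar>f x i\<bar> \<le> C"
    and cont: "\<And>X x i. \<lbrakk>\<And>k j. j < n \<Longrightarrow> \<bar>X k j\<bar> \<le> C;
        \<And>j. j < n \<Longrightarrow> (\<lambda>k. X k j) \<longlonglongrightarrow> x j; i < n\<rbrakk> \<Longrightarrow> (\<lambda>k::nat. f (X k) i) \<longlonglongrightarrow> f x i"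
  shows "\<exists>x. \<forall>i<n. \<bar>x i\<bar> \<le> C \<and> f x i = x i"
proof -
  define g where "g y i = (f (\<lambda>j. C * (2 * y j - 1)) i / C + 1) / 2" for y i
  have abs: "\<bar>C * (2 * y - 1)\<bar> \<le> C" if "0 \<le> y" "y \<le> 1" for y :: real
  proof -
    have "\<bar>2 * y - 1\<bar> \<le> 1" using that by auto
    then show ?thesis using C by (simp add: abs_mult)
  qed
  have "\<exists>y. \<forall>i<n. 0 \<le> y i \<and> y i \<le> 1 \<and> g y i = y i"
  proof (rule brouwer_nat_cube)
    fix x :: "nat \<Rightarrow> real" and i assume x: "\<And>j. j < n \<Longrightarrow> 0 \<le> x j \<and> x j \<le> 1" and i: "i < n"
    have "\<bar>f (\<lambda>j. C * (2 * x j - 1)) i\<bar> \<le> C"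
      using x abs by (intro range i) auto
    then show "0 \<le> g x i \<and> g x i \<le> 1"
      using C by (auto simp: g_def field_simps abs_le_iff)
  next
    fix X :: "nat \<Rightarrow> nat \<Rightarrow> real" and x i assume X: "\<And>k j. j < n \<Longrightarrow> 0 \<le> X k j \<and> X k j \<le> 1"
      "\<And>j. j < n \<Longrightarrow> (\<lambda>k. X k j) \<longlonglongrightarrow> x j" "i < n"
    have "(\<lambda>k. f (\<lambda>j. C * (2 * X k j - 1)) i) \<longlonglongrightarrow> f (\<lambda>j. C * (2 * x j - 1)) i"
      using X abs by (intro cont tendsto_intros) auto
    then show "(\<lambda>k. g (X k) i) \<longlonglongrightarrow> g x i"
      unfolding g_def using C by (intro tendsto_intros) auto
  qed
  then obtain y where y: "\<And>i. i < n \<Longrightarrow> 0 \<le> y i \<and> y i \<le> 1 \<and> g y i = y i" by blast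
  have "\<bar>C * (2 * y i - 1)\<bar> \<le> C \<and> f (\<lambda>j. C * (2 * y j - 1)) i = C * (2 * y i - 1)" if i: "i < n" for i
  proof
    show "\<bar>C * (2 * y i - 1)\<bar> \<le> C" using y[OF i] by (intro abs) auto
    have "g y i = y i" using y[OF i] by blast
    then show "f (\<lambda>j. C * (2 * y j - 1)) i = C * (2 * y i - 1)" using C by (simp add: g_def field_simps)
  qed
  then show ?thesis by (intro exI[of _ "\<lambda>j. C * (2 * y j - 1)"]) simp
qed

section \<open>Small divisors\<close>

text \<open>Only finitely many integers are in range and none of them cancels the irrational
  \<open>c\<close>. The 1 inserted into \<open>S\<close> keeps the set non-empty when no integer is
  in range.\<close>

lemma irrational_shift_bounded_below:
  fixes c D :: real
  assumes "c \<notin> \<rat>"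
  obtains \<gamma> where "\<gamma> > 0" "\<And>d::int. \<bar>real_of_int d\<bar> \<le> D \<Longrightarrow> \<gamma> \<le> \<bar>real_of_int d + c\<bar>"
proof -
  define S where "S = insert 1 ((\<lambda>d. \<bar>real_of_int d + c\<bar>) ` {-\<lceil>D\<rceil>..\<lceil>D\<rceil>})"
  have fin: "finite S" "S \<noteq> {}" by (auto simp: S_def)
  have "real_of_int d + c \<noteq> 0" for d
  proof
    assume "real_of_int d + c = 0"
    then have "c = real_of_int (- d)" by simp
    then show False using assms Rats_of_int by metis
  qed
  then have "\<forall>s\<in>S. s > 0" by (auto simp: S_def)
  then have "Min S > 0" using fin by simp
  moreover have "Min S \<le> \<bar>real_of_int d + c\<bar>" if "\<bar>real_of_int d\<bar> \<le> D" for d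
  proof -
    have "real_of_int d \<le> \<lceil>D\<rceil>" "- real_of_int d \<le> \<lceil>D\<rceil>" using that by linarith+
    then have "d \<in> {-\<lceil>D\<rceil>..\<lceil>D\<rceil>}" unfolding atLeastAtMost_iff by linarith
    then show ?thesis using fin by (intro Min_le) (auto simp: S_def)
  qed
  ultimately show ?thesis by (rule that)
qed

text \<open>With \<open>d = p n\<^sup>2 - q \<bar>m\<bar>\<close> the divisor times \<open>p\<^sup>2\<close> is \<open>2 p n\<^sup>2 (d + a p) - d\<^sup>2 + O(1)\<close>: either the integer \<open>d\<close>
  is large, or \<open>d + a p\<close> stays away from \<open>0\<close> because \<open>a p\<close> is irrational.\<close>

lemma finite_small_divisors:
  fixes p q :: nat and a R :: real and \<mu> b :: "nat \<Rightarrow> real"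
  assumes p: "p > 0" and q: "q > 0" and a: "a \<notin> \<rat>" and b: "bounded (range b)"
    and asy: "(\<lambda>n. \<mu> n - (real n ^ 4 + 2 * real n ^ 2 * a + b n)) \<in> o(\<lambda>n. 1 / real n)"
  shows "finite {(n, m::int). 1 \<le> n \<and> \<bar>\<mu> n - (real q / real p)\<^sup>2 * (real_of_int m)\<^sup>2\<bar> \<le> R}"
proof -
  define w where "w = real q / real p"
  have w: "w > 0" using p q by (simp add: w_def)
  obtain B where B: "\<And>n. \<bar>b n\<bar> \<le> B" using b by (auto simp: bounded_iff)
  have "eventually (\<lambda>n. norm (\<mu> n - (real n ^ 4 + 2 * real n ^ 2 * a + b n)) \<le> 1 * norm (1 / real n)) at_top"
    using landau_o.smallD[OF asy, of 1] by simp
  then obtain N0 where N0: "\<And>n. n \<ge> N0 \<Longrightarrow> \<bar>\<mu> n - (real n ^ 4 + 2 * real n ^ 2 * a + b n)\<bar> \<le> 1 / real n"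
    unfolding eventually_sequentially by auto
  have asy': "\<bar>\<mu> n - (real n ^ 4 + 2 * real n ^ 2 * a)\<bar> \<le> B + 1" if "n \<ge> N0" "n \<ge> 1" for n
  proof -
    have "1 / real n \<le> 1" using that by simp
    then show ?thesis using N0[OF that(1)] B[of n] by linarith
  qed
  define R' where "R' = (real p)\<^sup>2 * (\<bar>R\<bar> + B + 1)"
  \<comment> \<open>The summand 1 leaves \<open>p n\<^sup>2\<close> over after
    \<open>\<bar>d\<bar> s\<close> has absorbed the term
    \<open>2 a p\<^sup>2 n\<^sup>2\<close>.\<close>
  define D where "D = 2 * \<bar>a\<bar> * real p + 1"
  have ap: "a * real p \<notin> \<rat>"
  proof
    assume "a * real p \<in> \<rat>"
    then have "a * real p / real p \<in> \<rat>" by (rule Rats_divide) simp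
    then show False using p a by simp
  qed
  obtain \<gamma> where \<gamma>: "\<gamma> > 0" "\<And>d::int. \<bar>real_of_int d\<bar> \<le> D \<Longrightarrow> \<gamma> \<le> \<bar>real_of_int d + a * real p\<bar>"
    using irrational_shift_bounded_below[OF ap] by blast
  obtain N2 :: nat where N2: "real N2 > R'" using reals_Archimedean2 by blast
  \<comment> \<open>For \<open>\<bar>d\<bar> \<le> D\<close> the gap \<open>\<gamma>\<close> gives
    \<open>2 p n\<^sup>2 \<gamma> \<le> R' + D\<^sup>2\<close>; this threshold contradicts
    it.\<close>
  obtain N3 :: nat where N3: "real N3 > (R' + D\<^sup>2) / (2 * real p * \<gamma>)" using reals_Archimedean2 by blast
  define N1 where "N1 = N0 + N2 + N3 + 1"
  have large: "R < \<bar>\<mu> n - w\<^sup>2 * (real_of_int m)\<^sup>2\<bar>" if n: "n \<ge> N1" for n m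
  proof (rule ccontr)
    assume "\<not> ?thesis"
    then have "\<bar>(real n ^ 4 + 2 * real n ^ 2 * a) - w\<^sup>2 * (real_of_int m)\<^sup>2\<bar> \<le> \<bar>R\<bar> + B + 1"
      using asy'[of n] n unfolding N1_def by linarith
    then have "(real p)\<^sup>2 * \<bar>(real n ^ 4 + 2 * real n ^ 2 * a) - w\<^sup>2 * (real_of_int m)\<^sup>2\<bar> \<le> R'"
      unfolding R'_def by (intro mult_left_mono) auto
    then have "\<bar>(real p)\<^sup>2 * ((real n ^ 4 + 2 * real n ^ 2 * a) - w\<^sup>2 * (real_of_int m)\<^sup>2)\<bar> \<le> R'"
      by (simp add: abs_mult)
    moreover define k where "k = \<bar>real_of_int m\<bar>"
    define d where "d = real p * (real n)\<^sup>2 - real q * k"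
    define s where "s = real p * (real n)\<^sup>2 + real q * k"
    have "(real p)\<^sup>2 * ((real n ^ 4 + 2 * real n ^ 2 * a) - w\<^sup>2 * (real_of_int m)\<^sup>2)
        = d * s + 2 * a * (real p)\<^sup>2 * (real n)\<^sup>2"
    proof -
      have "(real p)\<^sup>2 * w\<^sup>2 = (real q)\<^sup>2" using p by (simp add: w_def power_divide)
      then have "(real p)\<^sup>2 * (w\<^sup>2 * (real_of_int m)\<^sup>2) = (real q)\<^sup>2 * (real_of_int m)\<^sup>2"
        by (simp add: mult.assoc[symmetric])
      moreover have "d * s = (real p)\<^sup>2 * real n ^ 4 - (real q)\<^sup>2 * (real_of_int m)\<^sup>2"
        by (simp add: d_def s_def k_def algebra_simps power2_eq_square power4_eq_xxxx)
      ultimately show ?thesis by (simp add: right_diff_distrib distrib_left)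
    qed
    ultimately have ds: "\<bar>d * s + 2 * a * (real p)\<^sup>2 * (real n)\<^sup>2\<bar> \<le> R'" by simp
    have n1: "real n \<ge> 1" using n by (simp add: N1_def)
    have nn: "real n \<le> (real n)\<^sup>2" using n1 by (simp add: power2_eq_square)
    have p1: "real p \<ge> 1" using p by simp
    have di: "d = real_of_int (int p * (int n)\<^sup>2 - int q * \<bar>m\<bar>)" by (simp add: d_def k_def)
    show False
    proof (cases "\<bar>d\<bar> \<le> D")
      case True
      have s: "s = 2 * real p * (real n)\<^sup>2 - d" by (simp add: s_def d_def)
      have eq: "d * s + 2 * a * (real p)\<^sup>2 * (real n)\<^sup>2 = 2 * real p * (real n)\<^sup>2 * (d + a * real p) - d\<^sup>2"
        unfolding s by (simp add: algebra_simps power2_eq_square)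
      have d2: "d\<^sup>2 \<le> D\<^sup>2" using True by (simp add: abs_le_square_iff[symmetric])
      have "2 * real p * (real n)\<^sup>2 * \<gamma> \<le> 2 * real p * (real n)\<^sup>2 * \<bar>d + a * real p\<bar>"
        using \<gamma>(2)[of "int p * (int n)\<^sup>2 - int q * \<bar>m\<bar>"] True unfolding di[symmetric] by (intro mult_left_mono) auto
      also have "\<dots> = \<bar>2 * real p * (real n)\<^sup>2 * (d + a * real p)\<bar>" by (simp add: abs_mult)
      also have "\<dots> \<le> R' + D\<^sup>2" using ds d2 zero_le_power2[of d] unfolding eq by linarith
      finally have "(real n)\<^sup>2 \<le> (R' + D\<^sup>2) / (2 * real p * \<gamma>)"
        using p \<gamma>(1) by (simp add: field_simps)
      then have "real n < real N3" using N3 nn by linarith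
      then show False using n by (simp add: N1_def)
    next
      case False
      have s: "s \<ge> real p * (real n)\<^sup>2" by (simp add: s_def k_def)
      have sp: "real p * (real n)\<^sup>2 \<ge> 0" by simp
      have "s \<ge> 0" using s sp by linarith
      then have "\<bar>d * s\<bar> = \<bar>d\<bar> * s" by (simp add: abs_mult)
      also have "\<dots> \<ge> \<bar>d\<bar> * (real p * (real n)\<^sup>2)" using s by (intro mult_left_mono) auto
      finally have "\<bar>d * s\<bar> \<ge> \<bar>d\<bar> * (real p * (real n)\<^sup>2)" .
      moreover have "D * (real p * (real n)\<^sup>2) \<le> \<bar>d\<bar> * (real p * (real n)\<^sup>2)"
        using False by (intro mult_right_mono) auto
      moreover have "\<bar>2 * a * (real p)\<^sup>2 * (real n)\<^sup>2\<bar> = (2 * \<bar>a\<bar> * real p) * (real p * (real n)\<^sup>2)"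
        by (simp add: abs_mult power2_eq_square)
      ultimately have "real p * (real n)\<^sup>2 \<le> \<bar>d * s + 2 * a * (real p)\<^sup>2 * (real n)\<^sup>2\<bar>"
        unfolding D_def by (simp add: algebra_simps)
      then have "real p * (real n)\<^sup>2 \<le> R'" using ds by linarith
      moreover have "1 * (real n)\<^sup>2 \<le> real p * (real n)\<^sup>2" using p1 by (intro mult_right_mono) auto
      ultimately have "real n < real N2" using N2 nn by linarith
      then show False using n by (simp add: N1_def)
    qed
  qed
  have fin: "finite {m::int. \<bar>\<mu> n - w\<^sup>2 * (real_of_int m)\<^sup>2\<bar> \<le> R}" for n
  proof (rule finite_subset)
    define c where "c = \<lceil>(\<bar>R\<bar> + \<bar>\<mu> n\<bar>) / w\<^sup>2\<rceil>"
    show "{m::int. \<bar>\<mu> n - w\<^sup>2 * (real_of_int m)\<^sup>2\<bar> \<le> R} \<subseteq> {-c..c}"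
    proof
      fix m :: int assume "m \<in> {m. \<bar>\<mu> n - w\<^sup>2 * (real_of_int m)\<^sup>2\<bar> \<le> R}"
      then have "w\<^sup>2 * (real_of_int m)\<^sup>2 \<le> \<bar>R\<bar> + \<bar>\<mu> n\<bar>" by simp
      then have "(real_of_int m)\<^sup>2 \<le> (\<bar>R\<bar> + \<bar>\<mu> n\<bar>) / w\<^sup>2" using w by (simp add: field_simps)
      then have "(real_of_int m)\<^sup>2 \<le> real_of_int c" unfolding c_def by linarith
      then have "m\<^sup>2 \<le> c" by (metis of_int_le_iff of_int_power)
      moreover have "\<bar>m\<bar> \<le> m\<^sup>2"
        using mult_left_mono[of 1 "\<bar>m\<bar>" "\<bar>m\<bar>"] by (cases "m = 0") (auto simp: power2_eq_square)
      ultimately show "m \<in> {-c..c}" by auto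
    qed
  qed simp
  have "{(n, m::int). 1 \<le> n \<and> \<bar>\<mu> n - w\<^sup>2 * (real_of_int m)\<^sup>2\<bar> \<le> R}
      \<subseteq> (SIGMA n:{..<N1}. {m. \<bar>\<mu> n - w\<^sup>2 * (real_of_int m)\<^sup>2\<bar> \<le> R})"
    using large by (auto simp: not_le[symmetric])
  then show ?thesis unfolding w_def[symmetric] by (rule finite_subset) (auto intro: fin)
qed

section \<open>Compact symmetric operators\<close>

text \<open>The space need not be complete: all limits are supplied by the compactness of \<open>K\<close>.\<close>

locale compact_symmetric =
  fixes K :: "'a::real_inner \<Rightarrow> 'a"
  assumes lin: "linear K"
    and sym: "K x \<bullet> y = x \<bullet> K y"
    and cpt: "(\<And>n. norm (X n) \<le> 1) \<Longrightarrow> \<exists>r y. strict_mono (r::nat \<Rightarrow> nat) \<and> (\<lambda>n. K (X (r n))) \<longlonglongrightarrow> y"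
begin

text \<open>Otherwise some vectors of the unit ball would have images of norm above
  \<open>n\<close>, and no subsequence of these images could converge, against
  \<open>cpt\<close>.\<close>

lemma bounded_linear: "bounded_linear K"
proof -
  have "\<exists>C. \<forall>x. norm x \<le> 1 \<longrightarrow> norm (K x) \<le> C"
  proof (rule ccontr)
    assume "\<not> ?thesis"
    then have "\<forall>n::nat. \<exists>x. norm x \<le> 1 \<and> norm (K x) > real n" by (meson not_le)
    then obtain X where X: "\<And>n. norm (X n) \<le> 1" "\<And>n::nat. norm (K (X n)) > real n" by metis
    obtain r y where r: "strict_mono (r::nat\<Rightarrow>nat)" "(\<lambda>n. K (X (r n))) \<longlonglongrightarrow> y"
      using cpt[of X] X(1) by blast
    then have "bounded (range (\<lambda>n. K (X (r n))))"
      using convergent_imp_bounded by blast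
    then obtain B where B: "\<And>n. norm (K (X (r n))) \<le> B" unfolding bounded_iff by blast
    obtain n :: nat where "real n > B" using reals_Archimedean2 by blast
    moreover have "r n \<ge> n" using r(1) by (rule seq_suble)
    ultimately have "real (r n) > B" by simp
    then show False using B[of n] X(2)[of "r n"] by linarith
  qed
  then obtain C where C: "\<And>x. norm x \<le> 1 \<Longrightarrow> norm (K x) \<le> C" by blast
  have "norm (K x) \<le> norm x * C" for x
  proof (cases "x = 0")
    case False
    have "norm (K ((1 / norm x) *\<^sub>R x)) \<le> C" using False by (intro C) simp
    then have "norm (K x) / norm x \<le> C" by (simp add: linear_cmul[OF lin])
    then show ?thesis using False by (simp add: field_simps)
  qed (simp add: linear_0[OF lin])
  then show ?thesis using lin
    by (intro bounded_linear_intro[of _ C]) (auto simp: linear_add linear_cmul)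
qed

definition onorm_on :: "'a set \<Rightarrow> real" where
  "onorm_on Y = Sup ((\<lambda>x. norm (K x)) ` {x \<in> Y. norm x \<le> 1})"

lemma onorm_on_ge:
  assumes "x \<in> Y" "subspace Y"
  shows "norm (K x) \<le> onorm_on Y * norm x"
proof -
  obtain C where C: "\<And>x. norm (K x) \<le> norm x * C" "C > 0"
    using bounded_linear.pos_bounded[OF bounded_linear] by blast
  have bdd: "bdd_above ((\<lambda>x. norm (K x)) ` {x \<in> Y. norm x \<le> 1})"
  proof (rule bdd_aboveI2)
    fix x assume "x \<in> {x \<in> Y. norm x \<le> 1}"
    then have "norm x * C \<le> 1 * C" using C(2) by (intro mult_right_mono) auto
    then show "norm (K x) \<le> C" using C(1)[of x] by simp
  qed
  show ?thesis
  proof (cases "x = 0")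
    case False
    have "(1 / norm x) *\<^sub>R x \<in> {x \<in> Y. norm x \<le> 1}"
      using assms False by (auto intro: subspace_scale)
    then have "norm (K ((1 / norm x) *\<^sub>R x)) \<le> onorm_on Y"
      unfolding onorm_on_def by (intro cSUP_upper[OF _ bdd])
    then show ?thesis using False by (simp add: linear_cmul[OF lin] field_simps)
  qed (simp add: linear_0[OF lin])
qed

text \<open>The norm is attained. Along a maximising sequence symmetry forces
  \<open>K (K x) - s\<^sup>2 x\<close> to zero, and compactness of \<open>K\<close> then makes the
  sequence itself converge. Factoring \<open>K\<^sup>2 - s\<^sup>2\<close> turns the limit into an
  eigenvector for \<open>s\<close> or \<open>- s\<close>.\<close>

lemma eigenvector_on:
  assumes Y: "subspace Y" "closed Y" and inv: "\<And>x. x \<in> Y \<Longrightarrow> K x \<in> Y"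
    and pos: "onorm_on Y > 0"
  obtains x c where "x \<in> Y" "norm x = 1" "K x = c *\<^sub>R x" "\<bar>c\<bar> = onorm_on Y"
proof -
  define s where "s = onorm_on Y"
  have s: "s > 0" using pos by (simp add: s_def)
  interpret bounded_linear K by (rule bounded_linear)
  have "\<exists>x. x \<in> Y \<and> norm x \<le> 1 \<and> s - 1 / real (Suc n) < norm (K x)" for n
  proof -
    have "s - 1 / real (Suc n) < s" by simp
    moreover have "(\<lambda>x. norm (K x)) ` {x \<in> Y. norm x \<le> 1} \<noteq> {}" using subspace_0[OF Y(1)] by force
    ultimately obtain v where "v \<in> (\<lambda>x. norm (K x)) ` {x \<in> Y. norm x \<le> 1}" "s - 1 / real (Suc n) < v"
      unfolding s_def onorm_on_def by (rule less_cSupE)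
    then show ?thesis by auto
  qed
  then obtain X where X: "\<And>n. X n \<in> Y" "\<And>n. norm (X n) \<le> 1" "\<And>n. s - 1 / real (Suc n) < norm (K (X n))"
    by metis
  have le_s: "norm (K (X n)) \<le> s" for n
  proof -
    have "norm (K (X n)) \<le> s * norm (X n)" using onorm_on_ge[OF X(1) Y(1)] by (simp add: s_def)
    also have "\<dots> \<le> s * 1" using s X(2) by (intro mult_left_mono) auto
    finally show ?thesis by simp
  qed
  have norm_lim: "(\<lambda>n. norm (K (X n))) \<longlonglongrightarrow> s"
  proof (rule tendsto_sandwich)
    have "(\<lambda>n. 1 / real (Suc n)) \<longlonglongrightarrow> 0" using LIMSEQ_inverse_real_of_nat by (simp add: field_simps)
    then show "(\<lambda>n. s - 1 / real (Suc n)) \<longlonglongrightarrow> s"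
      using tendsto_diff[OF tendsto_const, of "\<lambda>n. 1 / real (Suc n)" 0 sequentially s] by simp
    show "\<forall>\<^sub>F n in sequentially. s - 1 / real (Suc n) \<le> norm (K (X n))"
      using X(3) by (intro always_eventually allI) (rule less_imp_le)
  qed (use le_s in auto)
  define D where "D n = K (K (X n)) - s\<^sup>2 *\<^sub>R X n" for n
  \<comment> \<open>Symmetry turns the mixed term of the expanded square into the squared norm of
    \<open>K (X n)\<close>. The leading term is at most \<open>s\<^sup>2\<close> times that same
    square, because \<open>K\<close> maps \<open>Y\<close> into itself.\<close>
  have D: "(norm (D n))\<^sup>2 \<le> s\<^sup>2 * (s\<^sup>2 - (norm (K (X n)))\<^sup>2)" for n
  proof -
    have "norm (K (K (X n))) \<le> s * norm (K (X n))"
      using onorm_on_ge[OF inv[OF X(1)] Y(1)] by (simp add: s_def)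
    then have "(norm (K (K (X n))))\<^sup>2 \<le> s\<^sup>2 * (norm (K (X n)))\<^sup>2"
      by (metis norm_ge_zero power_mono power_mult_distrib)
    moreover have "K (K (X n)) \<bullet> X n = (norm (K (X n)))\<^sup>2"
      by (simp add: sym power2_norm_eq_inner)
    moreover have "(norm (D n))\<^sup>2 = (norm (K (K (X n))))\<^sup>2 - 2 * s\<^sup>2 * (K (K (X n)) \<bullet> X n) + s\<^sup>2 * s\<^sup>2 * (norm (X n))\<^sup>2"
      unfolding D_def power2_norm_eq_inner by (simp add: inner_diff_left inner_diff_right inner_commute algebra_simps)
    moreover have "s\<^sup>2 * s\<^sup>2 * (norm (X n))\<^sup>2 \<le> s\<^sup>2 * s\<^sup>2 * 1"
      using X(2)[of n] by (intro mult_left_mono) (auto simp: power_le_one)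
    ultimately show ?thesis by (simp add: algebra_simps)
  qed
  have "(\<lambda>n. s\<^sup>2 * (s\<^sup>2 - (norm (K (X n)))\<^sup>2)) \<longlonglongrightarrow> s\<^sup>2 * (s\<^sup>2 - s\<^sup>2)"
    by (intro tendsto_intros norm_lim)
  then have "(\<lambda>n. s\<^sup>2 * (s\<^sup>2 - (norm (K (X n)))\<^sup>2)) \<longlonglongrightarrow> 0" by simp
  then have "(\<lambda>n. (norm (D n))\<^sup>2) \<longlonglongrightarrow> 0"
    by (rule Lim_null_comparison[rotated]) (auto intro!: always_eventually D)
  then have "(\<lambda>n. sqrt ((norm (D n))\<^sup>2)) \<longlonglongrightarrow> sqrt 0" by (rule tendsto_real_sqrt)
  then have D0: "D \<longlonglongrightarrow> 0" by (simp add: tendsto_norm_zero_iff)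
  obtain r y where r: "strict_mono (r::nat\<Rightarrow>nat)" and y: "(\<lambda>n. K (X (r n))) \<longlonglongrightarrow> y"
    using cpt[of X] X(2) by blast
  \<comment> \<open>\<open>X\<close> is recovered from its second image up to the vanishing error
    \<open>D\<close>, so convergence of the images carries over to \<open>X\<close>.\<close>
  have "(\<lambda>n. (1 / s\<^sup>2) *\<^sub>R (K (K (X (r n))) - D (r n))) \<longlonglongrightarrow> (1 / s\<^sup>2) *\<^sub>R (K y - 0)"
    using LIMSEQ_subseq_LIMSEQ[OF D0 r] by (intro tendsto_intros tendsto y) (simp add: o_def)
  moreover have "(1 / s\<^sup>2) *\<^sub>R (K (K (X (r n))) - D (r n)) = X (r n)" for n
    using s by (simp add: D_def)
  ultimately have lim: "(\<lambda>n. X (r n)) \<longlonglongrightarrow> (1 / s\<^sup>2) *\<^sub>R K y" by simp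
  define x where "x = (1 / s\<^sup>2) *\<^sub>R K y"
  have lim: "(\<lambda>n. X (r n)) \<longlonglongrightarrow> x" using lim by (simp add: x_def)
  have xY: "x \<in> Y" by (rule closed_sequentially[OF Y(2) X(1) lim])
  have Kx: "K x = y" using LIMSEQ_unique[OF tendsto[OF lim] y] .
  then have KKx: "K (K x) = s\<^sup>2 *\<^sub>R x" using s by (simp add: x_def)
  have "(\<lambda>n. norm (K (X (r n)))) \<longlonglongrightarrow> norm y" by (intro tendsto_norm y)
  moreover have "(\<lambda>n. norm (K (X (r n)))) \<longlonglongrightarrow> s"
    using LIMSEQ_subseq_LIMSEQ[OF norm_lim r] by (simp add: o_def)
  ultimately have "norm (K x) = s" using LIMSEQ_unique Kx by blast
  then have x0: "x \<noteq> 0" using s zero by fastforce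
  have norm1: thesis if "z \<in> Y" "z \<noteq> 0" "K z = c *\<^sub>R z" "\<bar>c\<bar> = s" for z c
  proof (rule \<open>\<And>x c. \<lbrakk>x \<in> Y; norm x = 1; K x = c *\<^sub>R x; \<bar>c\<bar> = onorm_on Y\<rbrakk> \<Longrightarrow> thesis\<close>)
    show "(1 / norm z) *\<^sub>R z \<in> Y" using that Y(1) by (simp add: subspace_scale)
    show "norm ((1 / norm z) *\<^sub>R z) = 1" using that by simp
    show "K ((1 / norm z) *\<^sub>R z) = c *\<^sub>R ((1 / norm z) *\<^sub>R z)" using that by (simp add: scaleR)
    show "\<bar>c\<bar> = onorm_on Y" using that by (simp add: s_def)
  qed
  \<comment> \<open>If \<open>K x + s x\<close> vanishes, \<open>x\<close> has eigenvalue
    \<open>- s\<close>; otherwise this vector has eigenvalue \<open>s\<close>.\<close>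
  show thesis
  proof (cases "K x + s *\<^sub>R x = 0")
    case True
    then have "K x = (- s) *\<^sub>R x" by (simp add: eq_neg_iff_add_eq_0)
    then show thesis using norm1[OF xY x0, of "- s"] s by simp
  next
    case False
    have "K (K x + s *\<^sub>R x) = s *\<^sub>R (K x + s *\<^sub>R x)"
      by (simp add: add scaleR KKx scaleR_right_distrib power2_eq_square add.commute)
    moreover have "K x + s *\<^sub>R x \<in> Y" using Y(1) xY inv by (simp add: subspace_add subspace_scale)
    ultimately show thesis using norm1[OF _ False, of s] s by simp
  qed
qed

text \<open>For a unit vector the eigenvalue is forced to be \<open>K b \<bullet> b\<close>, so no
  separate assignment of eigenvalues has to be carried along.\<close>

definition orthonormal_eigenvectors :: "'a set \<Rightarrow> bool" where
  "orthonormal_eigenvectors \<B> \<longleftrightarrow> (\<forall>b\<in>\<B>. norm b = 1 \<and> K b = (K b \<bullet> b) *\<^sub>R b) \<and>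
     (\<forall>b\<in>\<B>. \<forall>c\<in>\<B>. b \<noteq> c \<longrightarrow> b \<bullet> c = 0)"

text \<open>Orthonormal eigenvectors with eigenvalues of modulus at least \<open>\<delta>\<close>
  have images at mutual distance at least \<open>\<delta>\<close>. Infinitely many of them would
  leave no convergent subsequence.\<close>

lemma finite_large_eigenvalues:
  assumes \<B>: "orthonormal_eigenvectors \<B>" and \<delta>: "\<delta> > 0"
  shows "finite {b \<in> \<B>. \<delta> \<le> \<bar>K b \<bullet> b\<bar>}"
proof (rule ccontr)
  assume "infinite {b \<in> \<B>. \<delta> \<le> \<bar>K b \<bullet> b\<bar>}"
  then obtain X :: "nat \<Rightarrow> 'a" where X: "inj X" "range X \<subseteq> {b \<in> \<B>. \<delta> \<le> \<bar>K b \<bullet> b\<bar>}"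
    using infinite_countable_subset by blast
  have XB: "X n \<in> \<B>" "\<delta> \<le> \<bar>K (X n) \<bullet> X n\<bar>" for n using X(2) by auto
  have nX: "norm (X n) = 1" and KX: "K (X n) = (K (X n) \<bullet> X n) *\<^sub>R X n" for n
    using \<B> XB(1) unfolding orthonormal_eigenvectors_def by blast+
  obtain r y where r: "strict_mono (r::nat\<Rightarrow>nat)" and y: "(\<lambda>n. K (X (r n))) \<longlonglongrightarrow> y"
    using cpt[of X] nX by auto
  have "Cauchy (\<lambda>n. K (X (r n)))" using y by (rule LIMSEQ_imp_Cauchy)
  then obtain N where N: "norm (K (X (r m)) - K (X (r n))) < \<delta>" if "m \<ge> N" "n \<ge> N" for m n
    using CauchyD[OF _ \<delta>] by blast
  define u v where "u = X (r N)" and "v = X (r (Suc N))"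
  have "r N \<noteq> r (Suc N)" using r by (simp add: strict_mono_eq)
  then have "u \<noteq> v" using X(1) by (auto simp: u_def v_def inj_eq)
  then have orth: "u \<bullet> v = 0"
    using \<B> XB(1) unfolding orthonormal_eigenvectors_def u_def v_def by blast
  have "\<delta> * 1 \<le> \<bar>(K u - K v) \<bullet> u\<bar>"
  proof -
    have "K v \<bullet> u = 0" using orth KX[of "r (Suc N)"] unfolding v_def[symmetric]
      by (metis inner_commute inner_scaleR_left mult_zero_right)
    then show ?thesis using XB(2)[of "r N"] by (simp add: inner_diff_left u_def)
  qed
  also have "\<dots> \<le> norm (K u - K v) * norm u" by (rule Cauchy_Schwarz_ineq2)
  finally show False using N[of N "Suc N"] nX[of "r N"] by (simp add: u_def v_def)
qed

text \<open>Take a maximal orthonormal family of eigenvectors. On the complement of the finitely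
  many with eigenvalue of modulus at least \<open>\<delta>\<close>, the norm of \<open>K\<close> is
  below \<open>\<delta>\<close>, as a norm-attaining eigenvector there could be added to the family.
  Hence \<open>K\<close> nearly annihilates what a finite projection leaves over. Only values of
  \<open>K\<close> are approximated, not arbitrary vectors.\<close>

theorem spectral_theorem:
  obtains \<B> where "orthonormal_eigenvectors \<B>"
    "\<And>\<delta>. \<delta> > 0 \<Longrightarrow> finite {b \<in> \<B>. \<delta> \<le> \<bar>K b \<bullet> b\<bar>}"
    "\<And>h \<delta>. \<delta> > 0 \<Longrightarrow> \<exists>F c. finite F \<and> F \<subseteq> \<B> \<and> norm (K h - (\<Sum>b\<in>F. c b *\<^sub>R b)) < \<delta>"
proof -
  have "\<exists>M\<in>Collect orthonormal_eigenvectors. \<forall>X\<in>Collect orthonormal_eigenvectors. M \<subseteq> X \<longrightarrow> X = M"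
  proof (rule subset_Zorn')
    fix C assume C: "subset.chain (Collect orthonormal_eigenvectors) C"
    have "b \<bullet> c = 0" if bc: "b \<in> \<Union>C" "c \<in> \<Union>C" "b \<noteq> c" for b c
    proof -
      obtain A B where AB: "A \<in> C" "B \<in> C" "b \<in> A" "c \<in> B" using bc by blast
      then have "A \<subseteq> B \<or> B \<subseteq> A" using C by (meson subset_chain_def)
      then obtain E where "E \<in> C" "b \<in> E" "c \<in> E" using AB by blast
      moreover have "orthonormal_eigenvectors E" using C \<open>E \<in> C\<close> by (auto simp: subset_chain_def)
      ultimately show ?thesis using bc unfolding orthonormal_eigenvectors_def by blast
    qed
    moreover have "norm b = 1 \<and> K b = (K b \<bullet> b) *\<^sub>R b" if "b \<in> \<Union>C" for b
      using that C unfolding subset_chain_def orthonormal_eigenvectors_def by blast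
    ultimately show "\<Union>C \<in> Collect orthonormal_eigenvectors"
      unfolding orthonormal_eigenvectors_def by blast
  qed
  then obtain \<B> where \<B>: "orthonormal_eigenvectors \<B>"
    and max: "\<And>X. orthonormal_eigenvectors X \<Longrightarrow> \<B> \<subseteq> X \<Longrightarrow> X = \<B>" by auto
  note fin = finite_large_eigenvalues[OF \<B>]
  have on: "norm b = 1" "K b = (K b \<bullet> b) *\<^sub>R b" if "b \<in> \<B>" for b
    using \<B> that unfolding orthonormal_eigenvectors_def by blast+
  have orth: "b \<bullet> c = 0" if "b \<in> \<B>" "c \<in> \<B>" "b \<noteq> c" for b c
    using \<B> that unfolding orthonormal_eigenvectors_def by blast
  have "\<exists>F c. finite F \<and> F \<subseteq> \<B> \<and> norm (K h - (\<Sum>b\<in>F. c b *\<^sub>R b)) < \<delta>'" if \<delta>': "\<delta>' > 0" for h \<delta>'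
  proof -
    \<comment> \<open>The remainder of the projection has at most the norm of \<open>h\<close>, so
      its image has norm at most \<open>\<delta> * norm h\<close>; the 1 covers
      \<open>h = 0\<close>.\<close>
    define \<delta> where "\<delta> = \<delta>' / (norm h + 1)"
    have \<delta>: "\<delta> > 0" using \<delta>' by (simp add: \<delta>_def add_nonneg_pos)
    define F where "F = {b \<in> \<B>. \<delta> \<le> \<bar>K b \<bullet> b\<bar>}"
    have F: "finite F" "F \<subseteq> \<B>" using fin[OF \<delta>] by (auto simp: F_def)
    define Y where "Y = {x. \<forall>b\<in>F. b \<bullet> x = 0}"
    have Y: "subspace Y" unfolding Y_def by (auto simp: subspace_def inner_add_right)
    have "Y = (\<Inter>b\<in>F. {x. b \<bullet> x = 0})" by (auto simp: Y_def)
    then have "closed Y" by (auto intro: closed_hyperplane)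
    have inv: "K x \<in> Y" if "x \<in> Y" for x
    proof -
      have "b \<bullet> K x = 0" if b: "b \<in> F" for b
      proof -
        have "K b = (K b \<bullet> b) *\<^sub>R b" using on(2) F b by blast
        then have "b \<bullet> K x = ((K b \<bullet> b) *\<^sub>R b) \<bullet> x" using sym[of b x] by metis
        then show ?thesis using \<open>x \<in> Y\<close> b by (simp add: Y_def)
      qed
      then show ?thesis by (simp add: Y_def)
    qed
    have small: "onorm_on Y < \<delta>"
    proof (rule ccontr)
      assume "\<not> ?thesis"
      then have ge: "onorm_on Y \<ge> \<delta>" by simp
      then obtain x c where x: "x \<in> Y" "norm x = 1" "K x = c *\<^sub>R x" "\<bar>c\<bar> = onorm_on Y"
        using eigenvector_on[OF Y \<open>closed Y\<close> inv] \<delta> by (metis less_le_trans)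
      \<comment> \<open>Members of \<open>F\<close> are orthogonal to \<open>x\<close> by the choice
        of \<open>Y\<close>; the others belong to an eigenvalue of smaller modulus.\<close>
      have xb: "b \<bullet> x = 0" if b: "b \<in> \<B>" for b
      proof (cases "b \<in> F")
        case False
        then have lt: "\<bar>K b \<bullet> b\<bar> < \<delta>" using b by (auto simp: F_def)
        have "K b \<bullet> x = b \<bullet> K x" by (rule sym)
        then have "(K b \<bullet> b) * (b \<bullet> x) = c * (b \<bullet> x)"
          using on(2)[OF b] x(3) by (metis inner_scaleR_left inner_scaleR_right)
        moreover have "K b \<bullet> b \<noteq> c" using lt ge x(4) by auto
        ultimately show ?thesis by simp
      qed (use x(1) in \<open>auto simp: Y_def\<close>)
      have xx: "x \<bullet> x = 1" using x(2) by (simp add: power2_norm_eq_inner[symmetric])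
      have "orthonormal_eigenvectors (insert x \<B>)"
        unfolding orthonormal_eigenvectors_def
      proof (intro conjI ballI impI)
        fix b assume "b \<in> insert x \<B>"
        then show "norm b = 1" "K b = (K b \<bullet> b) *\<^sub>R b" using on x xx by auto
      next
        fix b d assume "b \<in> insert x \<B>" "d \<in> insert x \<B>" "b \<noteq> d"
        then show "b \<bullet> d = 0" using orth xb by (auto simp: inner_commute)
      qed
      then have "x \<in> \<B>" using max[of "insert x \<B>"] by blast
      then show False using xb xx by fastforce
    qed
    define P where "P = (\<Sum>b\<in>F. (b \<bullet> h) *\<^sub>R b)"
    have bP: "b \<bullet> P = b \<bullet> h" if b: "b \<in> F" for b
    proof -
      have "b \<bullet> P = (\<Sum>d\<in>F. (d \<bullet> h) * (b \<bullet> d))" by (simp add: P_def inner_sum_right)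
      also have "\<dots> = (\<Sum>d\<in>F. if d = b then b \<bullet> h else 0)"
        using b F on(1) by (intro sum.cong) (auto simp: orth subset_iff power2_norm_eq_inner[symmetric])
      finally show ?thesis using b F by simp
    qed
    have PY: "h - P \<in> Y" using bP by (simp add: Y_def inner_diff_right)
    have "P \<bullet> y = (\<Sum>b\<in>F. (b \<bullet> h) * (b \<bullet> y))" for y by (simp add: P_def inner_sum_left)
    then have Ph: "P \<bullet> (h - P) = 0" using PY by (simp add: Y_def)
    have "(norm (P + (h - P)))\<^sup>2 = (norm P)\<^sup>2 + (norm (h - P))\<^sup>2"
      by (rule norm_add_Pythagorean) (use Ph in \<open>simp only: orthogonal_def\<close>)
    then have "(norm (h - P))\<^sup>2 \<le> (norm h)\<^sup>2" by simp
    then have hP: "norm (h - P) \<le> norm h" by (rule power2_le_imp_le) simp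
    have "norm (K (h - P)) \<le> onorm_on Y * norm (h - P)" by (rule onorm_on_ge[OF PY Y])
    also have "\<dots> \<le> \<delta> * norm h"
      using small hP \<delta> by (intro mult_mono) auto
    also have "\<dots> < \<delta>'" using \<delta>' by (simp add: \<delta>_def field_simps add_pos_nonneg)
    finally have "norm (K (h - P)) < \<delta>'" .
    moreover have "K (h - P) = K h - (\<Sum>b\<in>F. ((b \<bullet> h) * (K b \<bullet> b)) *\<^sub>R b)"
    proof -
      have "K P = (\<Sum>b\<in>F. (b \<bullet> h) *\<^sub>R K b)"
        unfolding P_def by (simp add: linear_sum[OF lin] linear_cmul[OF lin])
      also have "\<dots> = (\<Sum>b\<in>F. ((b \<bullet> h) * (K b \<bullet> b)) *\<^sub>R b)"
        using on(2) F by (intro sum.cong refl) (metis scaleR_scaleR subsetD)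
      finally show ?thesis by (simp add: linear_diff[OF lin])
    qed
    ultimately show ?thesis using F
      by (intro exI[of _ F] exI[of _ "\<lambda>b. (b \<bullet> h) * (K b \<bullet> b)"]) simp
  qed
  then show ?thesis using that[OF \<B> fin] by blast
qed

end

section \<open>The inner product space of continuous functions\<close>

text \<open>Functions vanish outside \<open>[0,\<pi>]\<close>, so that the inner product of \<open>L\<^sup>2(0,\<pi>)\<close> is definite.\<close>

typedef cpi = "{f :: real \<Rightarrow> real. continuous_on {0..pi} f \<and> (\<forall>x. x \<notin> {0..pi} \<longrightarrow> f x = 0)}"
  morphisms fun_of Abs_cpi
  by (intro exI[of _ "\<lambda>_. 0"]) simp

setup_lifting type_definition_cpi

lemma continuous_fun_of [continuous_intros]: "continuous_on {0..pi} (fun_of f)"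
  and fun_of_outside: "x \<notin> {0..pi} \<Longrightarrow> fun_of f x = 0"
  using fun_of[of f] by auto

lemma cpi_eqI: "(\<And>x. x \<in> {0..pi} \<Longrightarrow> fun_of f x = fun_of g x) \<Longrightarrow> f = g"
  by (metis fun_of_inject fun_of_outside ext)

definition cpi_of :: "(real \<Rightarrow> real) \<Rightarrow> cpi" where
  "cpi_of f = Abs_cpi (\<lambda>x. if x \<in> {0..pi} then f x else 0)"

lemma fun_of_cpi_of: "continuous_on {0..pi} f \<Longrightarrow> x \<in> {0..pi} \<Longrightarrow> fun_of (cpi_of f) x = f x"
  unfolding cpi_of_def
  by (subst Abs_cpi_inverse) (auto intro: continuous_on_eq)

instantiation cpi :: real_vector
begin

lift_definition zero_cpi :: cpi is "\<lambda>_. 0" by simp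
lift_definition plus_cpi :: "cpi \<Rightarrow> cpi \<Rightarrow> cpi" is "\<lambda>f g x. f x + g x"
  by (auto intro: continuous_intros)
lift_definition minus_cpi :: "cpi \<Rightarrow> cpi \<Rightarrow> cpi" is "\<lambda>f g x. f x - g x"
  by (auto intro: continuous_intros)
lift_definition uminus_cpi :: "cpi \<Rightarrow> cpi" is "\<lambda>f x. - f x"
  by (auto intro: continuous_intros)
lift_definition scaleR_cpi :: "real \<Rightarrow> cpi \<Rightarrow> cpi" is "\<lambda>c f x. c * f x"
  by (auto intro: continuous_intros)

instance
  by standard (transfer; auto simp: algebra_simps fun_eq_iff)+

end

instantiation cpi :: real_inner
begin

definition inner_cpi :: "cpi \<Rightarrow> cpi \<Rightarrow> real" where
  "inner_cpi f g = integral {0..pi} (\<lambda>x. fun_of f x * fun_of g x)"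
definition norm_cpi :: "cpi \<Rightarrow> real" where "norm_cpi f = sqrt (inner f f)"
definition dist_cpi :: "cpi \<Rightarrow> cpi \<Rightarrow> real" where "dist_cpi f g = norm (f - g)"
definition sgn_cpi :: "cpi \<Rightarrow> cpi" where "sgn_cpi f = inverse (norm f) *\<^sub>R f"
definition uniformity_cpi :: "(cpi \<times> cpi) filter" where
  "uniformity_cpi = (INF e\<in>{0<..}. principal {(x, y). dist x y < e})"
definition open_cpi :: "cpi set \<Rightarrow> bool" where
  "open_cpi U \<longleftrightarrow> (\<forall>x\<in>U. \<forall>\<^sub>F (x', y) in uniformity. x' = x \<longrightarrow> y \<in> U)"

instance
proof
  fix f g h :: cpi and r :: real
  have int: "(\<lambda>x. fun_of f x * fun_of g x) integrable_on {0..pi}" for f g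
    by (intro integrable_continuous_interval continuous_intros)
  show "inner f g = inner g f" by (simp add: inner_cpi_def mult.commute)
  show "inner (f + g) h = inner f h + inner g h"
    using integral_add[OF int[of f h] int[of g h]]
    by (simp add: inner_cpi_def plus_cpi.rep_eq distrib_right)
  show "inner (r *\<^sub>R f) g = r * inner f g"
    by (simp add: inner_cpi_def scaleR_cpi.rep_eq mult.assoc integral_mult_right)
  show "0 \<le> inner f f" unfolding inner_cpi_def by (intro integral_nonneg int) simp
  show "inner f f = 0 \<longleftrightarrow> f = 0"
  proof
    assume "inner f f = 0"
    then have "\<forall>x\<in>{0..pi}. fun_of f x * fun_of f x = 0"
      unfolding inner_cpi_def
      by (subst (asm) integral_eq_0_iff) (simp_all only: zero_le_square pi_gt_zero, intro continuous_intros)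
    then show "f = 0" by (intro cpi_eqI) (simp add: zero_cpi.rep_eq)
  qed (simp add: inner_cpi_def zero_cpi.rep_eq)
qed (auto simp: norm_cpi_def dist_cpi_def sgn_cpi_def uniformity_cpi_def open_cpi_def)

end

lemma fun_of_sum: "fun_of (sum f A) x = (\<Sum>a\<in>A. fun_of (f a) x)"
  by (induction A rule: infinite_finite_induct) (auto simp: zero_cpi.rep_eq plus_cpi.rep_eq)

section \<open>Regularity of the coefficients\<close>

text \<open>A family closed under differentiation; \<open>bump 1 0\<close> is the standard smooth
  bump, and the pairs \<open>P\<close>, \<open>m\<close> describe its derivatives.\<close>

definition bump :: "real poly \<Rightarrow> nat \<Rightarrow> real \<Rightarrow> real" where
  "bump P m x = (if \<bar>x\<bar> < 1 then poly P x * inverse (1 - x\<^sup>2) ^ m * exp (- inverse (1 - x\<^sup>2)) else 0)"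

text \<open>The numerator of the derivative over the common power \<open>m + 2\<close> of 1 - x^2,
  which is the polynomial \<open>[:1, 0, -1:]\<close>.\<close>

definition bump_deriv :: "real poly \<Rightarrow> nat \<Rightarrow> real poly" where
  "bump_deriv P m = pderiv P * [:1, 0, -1:]\<^sup>2 + smult (2 * real m) ([:0, 1:] * P * [:1, 0, -1:]) - [:0, 2:] * P"

text \<open>With \<open>v\<close> the reciprocal of 1 - y^2, one term of the exponential series
  gives \<open>v ^ (m + 2) \<le> fact (m + 2) * exp v\<close>. The two powers beyond
  \<open>v ^ m\<close> turn into quadratic decay at the ends, enough for a zero derivative
  there.\<close>

lemma bump_decay:
  obtains C where "\<And>x y. \<bar>x\<bar> = 1 \<Longrightarrow> \<bar>bump P m y\<bar> \<le> C * (y - x)\<^sup>2"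
proof -
  have "compact (poly P ` {-1..1})" by (intro compact_continuous_image continuous_intros) auto
  then obtain D where D: "\<And>x. x \<in> {-1..1} \<Longrightarrow> \<bar>poly P x\<bar> \<le> D"
    by (meson compact_imp_bounded bounded_real imageI)
  have D0: "D \<ge> 0" using D[of 0] by auto
  define C where "C = D * fact (m + 2) * 4"
  have "\<bar>bump P m y\<bar> \<le> C * (y - x)\<^sup>2" if x: "\<bar>x\<bar> = 1" for x y
  proof (cases "\<bar>y\<bar> < 1")
    case True
    define u where "u = 1 - y\<^sup>2"
    have u: "u > 0" using True by (simp add: u_def abs_square_less_1)
    define v where "v = inverse u"
    have v: "v > 0" "v * u = 1" using u by (simp_all add: v_def)
    have "v ^ (m + 2) / fact (m + 2) \<le> exp v"
    proof -
      have s: "summable (\<lambda>n. v ^ n / fact n)" using summable_exp[of v] by (simp add: field_simps)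
      have "(\<Sum>n\<in>{m + 2}. v ^ n / fact n) \<le> (\<Sum>n. v ^ n / fact n)"
        using v by (intro sum_le_suminf s) auto
      then show ?thesis by (simp add: exp_def divide_inverse mult.commute)
    qed
    then have "v ^ (m + 2) \<le> fact (m + 2) * exp v" by (simp only: pos_divide_le_eq fact_gt_zero mult.commute)
    then have "v ^ (m + 2) * exp (- v) \<le> fact (m + 2) * exp v * exp (- v)" by (intro mult_right_mono) auto
    then have "v ^ (m + 2) * exp (- v) \<le> fact (m + 2)" by (simp only: mult.assoc exp_add[symmetric]) simp
    then have "v ^ (m + 2) * exp (- v) * u\<^sup>2 \<le> fact (m + 2) * u\<^sup>2" by (intro mult_right_mono) auto
    moreover have "v ^ (m + 2) * exp (- v) * u\<^sup>2 = v ^ m * exp (- v) * (v * u)\<^sup>2"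
      by (simp only: power_add power_mult_distrib mult_ac)
    ultimately have "v ^ m * exp (- v) \<le> fact (m + 2) * u\<^sup>2" by (simp only: v(2) power_one mult_1_right)
    then have "\<bar>poly P y\<bar> * (v ^ m * exp (- v)) \<le> D * (fact (m + 2) * u\<^sup>2)"
      using True v D0 by (intro mult_mono[OF D]) auto
    moreover have "\<bar>bump P m y\<bar> = \<bar>poly P y\<bar> * (v ^ m * exp (- v))"
      using True v by (simp add: bump_def u_def v_def abs_mult)
    moreover have "u\<^sup>2 \<le> (2 * \<bar>y - x\<bar>)\<^sup>2"
    proof (rule power_mono)
      have "u = (1 - \<bar>y\<bar>) * (1 + \<bar>y\<bar>)" by (simp add: u_def power2_eq_square algebra_simps)
      also have "\<dots> \<le> (1 - \<bar>y\<bar>) * 2" using True by (intro mult_left_mono) auto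
      also have "\<dots> \<le> 2 * \<bar>y - x\<bar>" using abs_triangle_ineq2_sym[of x y] x by simp
      finally show "u \<le> 2 * \<bar>y - x\<bar>" .
    qed (use u in auto)
    then have "D * (fact (m + 2) * u\<^sup>2) \<le> D * (fact (m + 2) * (2 * \<bar>y - x\<bar>)\<^sup>2)"
      using D0 by (intro mult_left_mono) auto
    ultimately show ?thesis by (simp add: C_def power_mult_distrib algebra_simps)
  next
    case False
    then show ?thesis using D0 by (simp add: bump_def C_def)
  qed
  then show ?thesis by (rule that)
qed

text \<open>Only the points 1 and -1 need an argument; there both functions vanish, and
  \<open>bump_decay\<close> sends the difference quotient to zero.\<close>

lemma bump_has_derivative: "(bump P m has_real_derivative bump (bump_deriv P m) (m + 2) x) (at x)"
proof -
  consider "\<bar>x\<bar> < 1" | "\<bar>x\<bar> > 1" | "\<bar>x\<bar> = 1" by linarith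
  then show ?thesis
  proof cases
    case 1
    define u where "u = 1 - x\<^sup>2"
    have u: "u > 0" using 1 by (simp add: u_def abs_square_less_1)
    define v where "v = inverse u"
    have v: "v * u = 1" using u by (simp add: v_def)
    have dv: "((\<lambda>x. inverse (1 - x\<^sup>2)) has_real_derivative 2 * x * (v * v)) (at x)"
      using u unfolding u_def v_def by (auto intro!: derivative_eq_intros simp: power2_eq_square)
    have "((\<lambda>x. poly P x * inverse (1 - x\<^sup>2) ^ m * exp (- inverse (1 - x\<^sup>2))) has_real_derivative
       (poly (pderiv P) x * v ^ m + poly P x * (real m * (2 * x * (v * v)) * v ^ (m - 1))) * exp (- v)
        - poly P x * v ^ m * (exp (- v) * (2 * x * (v * v)))) (at x)"
      by (rule derivative_eq_intros dv poly_DERIV refl)+ (simp add: u_def v_def algebra_simps)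
    moreover have "(poly (pderiv P) x * v ^ m + poly P x * (real m * (2 * x * (v * v)) * v ^ (m - 1))) * exp (- v)
        - poly P x * v ^ m * (exp (- v) * (2 * x * (v * v))) = bump (bump_deriv P m) (m + 2) x"
    proof -
      have P: "poly (bump_deriv P m) x = poly (pderiv P) x * u\<^sup>2 + 2 * real m * (x * poly P x * u) - 2 * x * poly P x"
        by (simp add: bump_deriv_def u_def power2_eq_square algebra_simps)
      have "real m * (2 * x * (v * v)) * v ^ (m - 1) = real m * (2 * x * v) * v ^ m" by (cases m) auto
      then have "(poly (pderiv P) x * v ^ m + poly P x * (real m * (2 * x * (v * v)) * v ^ (m - 1))) * exp (- v)
          - poly P x * v ^ m * (exp (- v) * (2 * x * (v * v)))
        = v ^ m * exp (- v) * (poly (pderiv P) x * (v * u)\<^sup>2 + poly P x * (real m * (2 * x * (v * (v * u)))) - poly P x * (2 * x * (v * v)))"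
        unfolding v by (simp only: power_one mult_1_right) (simp add: algebra_simps)
      also have "\<dots> = poly (bump_deriv P m) x * v ^ (m + 2) * exp (- v)"
        unfolding P by (simp add: power_add power2_eq_square algebra_simps)
      finally show ?thesis using 1 by (simp add: bump_def u_def[symmetric] v_def[symmetric])
    qed
    ultimately have "((\<lambda>x. poly P x * inverse (1 - x\<^sup>2) ^ m * exp (- inverse (1 - x\<^sup>2))) has_real_derivative bump (bump_deriv P m) (m + 2) x) (at x)"
      by simp
    then show ?thesis
    proof (rule has_field_derivative_transform_within_open)
      show "open {-1<..<1::real}" by simp
    qed (use 1 in \<open>auto simp: bump_def\<close>)
  next
    case 2
    have "((\<lambda>_. 0) has_real_derivative 0) (at x)" by simp
    then have "(bump P m has_real_derivative 0) (at x)"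
    proof (rule has_field_derivative_transform_within_open)
      show "open (- {-1..1::real})" by (intro open_Compl) auto
    qed (use 2 in \<open>auto simp: bump_def\<close>)
    then show ?thesis using 2 by (simp add: bump_def)
  next
    case 3
    obtain C where C: "\<And>x y. \<bar>x\<bar> = 1 \<Longrightarrow> \<bar>bump P m y\<bar> \<le> C * (y - x)\<^sup>2" using bump_decay by blast
    have b0: "bump P' m' x = 0" for P' m' using 3 by (simp add: bump_def)
    have "((\<lambda>y. (bump P m y - bump P m x) / (y - x)) \<longlongrightarrow> 0) (at x)"
    proof (rule Lim_null_comparison)
      show "\<forall>\<^sub>F y in at x. norm ((bump P m y - bump P m x) / (y - x)) \<le> \<bar>C\<bar> * \<bar>y - x\<bar>"
        unfolding eventually_at_filter
      proof (intro always_eventually allI impI)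
        fix y assume "y \<noteq> x"
        then have p: "\<bar>y - x\<bar> > 0" by simp
        have "\<bar>bump P m y\<bar> \<le> \<bar>C\<bar> * \<bar>y - x\<bar> * \<bar>y - x\<bar>"
          using C[OF 3, of y] mult_right_mono[OF abs_ge_self[of C], of "(y - x)\<^sup>2"]
          by (simp add: power2_eq_square abs_mult[symmetric] mult.assoc)
        then show "norm ((bump P m y - bump P m x) / (y - x)) \<le> \<bar>C\<bar> * \<bar>y - x\<bar>"
          using p by (simp add: b0 pos_divide_le_eq)
      qed
      have "((\<lambda>y. \<bar>C\<bar> * \<bar>y - x\<bar>) \<longlongrightarrow> \<bar>C\<bar> * \<bar>x - x\<bar>) (at x)" by (intro tendsto_intros)
      then show "((\<lambda>y. \<bar>C\<bar> * \<bar>y - x\<bar>) \<longlongrightarrow> 0) (at x)" by simp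
    qed
    then show ?thesis unfolding has_field_derivative_iff by (simp add: b0)
  qed
qed

section \<open>Calculus of test functions on the interval\<close>

lemma derivs_smooth:
  assumes "\<And>k x. (F k has_real_derivative F (Suc k) x) (at x)"
  shows "(deriv ^^ k) (F 0) = F k"
proof (induction k)
  case (Suc k)
  have "deriv (F k) = F (Suc k)" using assms by (intro ext DERIV_imp_deriv)
  then show ?case using Suc by simp
qed simp

lemma test_function_1dI:
  assumes "\<And>k x. (F k has_real_derivative F (Suc k) x) (at x)"
    and "0 < c" "c \<le> d" "d < pi" "\<And>x. x \<notin> {c..d} \<Longrightarrow> F 0 x = 0"
  shows "test_function_1d (F 0)"
  unfolding test_function_1d_def derivs_smooth[of F, OF assms(1)]
  using assms by (auto simp: real_differentiable_def)

lemma test_function_1d_bump: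
  assumes h: "h > 0" "0 < x0 - h" "x0 + h < pi"
  shows "test_function_1d (\<lambda>y. bump 1 0 ((y - x0) / h))"
proof -
  \<comment> \<open>Polynomial and exponent of the k-th derivative of the standard bump.\<close>
  define Pm where "Pm k = ((\<lambda>(P, m). (bump_deriv P m, m + 2)) ^^ k) (1, 0)" for k
  define F where "F k y = (1 / h) ^ k * bump (fst (Pm k)) (snd (Pm k)) ((y - x0) / h)" for k y
  have Pm: "Pm (Suc k) = (bump_deriv (fst (Pm k)) (snd (Pm k)), snd (Pm k) + 2)" for k
    by (simp add: Pm_def case_prod_beta)
  have F: "(F k has_real_derivative F (Suc k) y) (at y)" for k y
  proof -
    have "((\<lambda>y. (y - x0) / h) has_real_derivative 1 / h) (at y)"
      using h by (auto intro!: derivative_eq_intros)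
    from DERIV_cmult[OF DERIV_chain2[OF bump_has_derivative this], of "(1 / h) ^ k"]
    show ?thesis unfolding F_def Pm by (simp add: mult_ac)
  qed
  have "F 0 = (\<lambda>y. bump 1 0 ((y - x0) / h))" by (simp add: F_def Pm_def fun_eq_iff)
  moreover have "test_function_1d (F 0)"
  proof (rule test_function_1dI[of F, OF F])
    show "F 0 y = 0" if "y \<notin> {x0 - h..x0 + h}" for y
    proof -
      have "\<bar>y - x0\<bar> > h" using that by auto
      then have "\<not> \<bar>(y - x0) / h\<bar> < 1" using h by (simp add: abs_divide)
      then show ?thesis by (simp add: F_def bump_def)
    qed
  qed (use h in auto)
  ultimately show ?thesis by simp
qed

lemma test_function_1d_deriv:
  assumes "test_function_1d \<phi>"
  shows "((deriv ^^ k) \<phi> has_real_derivative (deriv ^^ Suc k) \<phi> x) (at x)"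
  using assms by (auto simp: test_function_1d_def DERIV_deriv_iff_real_differentiable)

lemma test_function_1d_continuous:
  assumes "test_function_1d \<phi>"
  shows "continuous_on S ((deriv ^^ k) \<phi>)"
  using test_function_1d_deriv[OF assms, of k]
  by (meson DERIV_isCont continuous_at_imp_continuous_on)

lemma test_function_1d_combination:
  assumes "test_function_1d \<phi>" "test_function_1d \<psi>"
  shows "test_function_1d (\<lambda>x. \<phi> x + a * \<psi> x)"
    and "(deriv ^^ k) (\<lambda>x. \<phi> x + a * \<psi> x) = (\<lambda>x. (deriv ^^ k) \<phi> x + a * (deriv ^^ k) \<psi> x)"
proof -
  define F where "F k x = (deriv ^^ k) \<phi> x + a * (deriv ^^ k) \<psi> x" for k x
  have F: "(F k has_real_derivative F (Suc k) x) (at x)" for k x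
    unfolding F_def by (intro DERIV_add DERIV_cmult test_function_1d_deriv assms)
  have F0: "F 0 = (\<lambda>x. \<phi> x + a * \<psi> x)" by (simp add: F_def fun_eq_iff)
  show "(deriv ^^ k) (\<lambda>x. \<phi> x + a * \<psi> x) = (\<lambda>x. (deriv ^^ k) \<phi> x + a * (deriv ^^ k) \<psi> x)"
    using derivs_smooth[of F, OF F, of k] unfolding F0 by (simp add: F_def fun_eq_iff)
  obtain c d c' d' where 1: "0 < c" "c \<le> d" "d < pi" "\<And>x. x \<notin> {c..d} \<Longrightarrow> \<phi> x = 0"
    and 2: "0 < c'" "c' \<le> d'" "d' < pi" "\<And>x. x \<notin> {c'..d'} \<Longrightarrow> \<psi> x = 0"
    using assms unfolding test_function_1d_def by blast
  show "test_function_1d (\<lambda>x. \<phi> x + a * \<psi> x)" unfolding F0[symmetric]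
  proof (rule test_function_1dI[of F "min c c'" "max d d'", OF F])
    show "F 0 x = 0" if "x \<notin> {min c c'..max d d'}" for x
    proof -
      have "x \<notin> {c..d}" "x \<notin> {c'..d'}" using that by auto
      then show ?thesis using 1(4) 2(4) by (simp add: F0)
    qed
  qed (use 1 2 in auto)
qed

text \<open>The zero integral is what makes the primitive vanish again to the right of the
  support.\<close>

lemma test_function_1d_antiderivative:
  assumes \<phi>: "test_function_1d \<phi>" and 0: "integral {0..pi} \<phi> = 0"
  obtains \<omega> where "test_function_1d \<omega>" "deriv \<omega> = \<phi>"
proof -
  obtain c d where cd: "0 < c" "c \<le> d" "d < pi" "\<And>x. x \<notin> {c..d} \<Longrightarrow> \<phi> x = 0"
    using \<phi> unfolding test_function_1d_def by blast
  have cont: "continuous_on S \<phi>" for S using test_function_1d_continuous[OF \<phi>, of S 0] by simp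
  define \<omega> where "\<omega> x = (if x \<le> 0 then 0 else integral {0..x} \<phi>)" for x
  have int: "\<phi> integrable_on {a..b}" for a b by (intro integrable_continuous_interval cont)
  have zero: "integral {a..b} \<phi> = 0" if "b < c \<or> a > d" for a b
    using that cd by (subst integral_cong[of _ _ "\<lambda>_. 0"]) auto
  have outside: "\<omega> x = 0" if "x \<notin> {c..d}" for x
  proof (cases "x < c")
    case True
    then show ?thesis using zero[of x 0] by (simp add: \<omega>_def)
  next
    case False
    then have x: "x > d" using that by auto
    have "integral {0..x} \<phi> = 0"
    proof (cases "x \<le> pi")
      case True
      then have "integral {0..x} \<phi> + integral {x..pi} \<phi> = 0"
        using 0 x cd by (subst Henstock_Kurzweil_Integration.integral_combine) (auto intro: int)
      then show ?thesis using zero[of pi x] x by simp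
    next
      case False
      then have "integral {0..x} \<phi> = integral {0..pi} \<phi> + integral {pi..x} \<phi>"
        using 0 x cd by (subst Henstock_Kurzweil_Integration.integral_combine) (auto intro: int)
      then show ?thesis using zero[of x pi] cd 0 by simp
    qed
    then show ?thesis by (simp add: \<omega>_def)
  qed
  have der: "(\<omega> has_real_derivative \<phi> x) (at x)" for x
  proof (cases "x < c")
    case True
    have "((\<lambda>_. 0) has_real_derivative 0) (at x)" by simp
    then have "(\<omega> has_real_derivative 0) (at x)"
      by (rule has_field_derivative_transform_within_open[of _ _ _ "{..<c}"]) (use True outside in auto)
    then show ?thesis using cd True by simp
  next
    case False
    then have x: "x > 0" using cd by simp
    have "((\<lambda>y. integral {0..y} \<phi>) has_real_derivative \<phi> x) (at x within {0..x + 1})"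
      using x cont by (intro integral_has_real_derivative) auto
    then have "((\<lambda>y. integral {0..y} \<phi>) has_real_derivative \<phi> x) (at x)"
      using x by (subst (asm) at_within_interior) (auto simp: interior_atLeastAtMost_real)
    then show ?thesis
      by (rule has_field_derivative_transform_within_open[of _ _ _ "{0<..}"]) (use x in \<open>auto simp: \<omega>_def\<close>)
  qed
  define F where "F k = (case k of 0 \<Rightarrow> \<omega> | Suc k \<Rightarrow> (deriv ^^ k) \<phi>)" for k
  have "(F k has_real_derivative F (Suc k) x) (at x)" for k x
    using der[of x] test_function_1d_deriv[OF \<phi>] by (cases k) (auto simp: F_def)
  from test_function_1dI[of F, OF this cd(1-3)] outside have "test_function_1d \<omega>" by (simp add: F_def)
  moreover have "deriv \<omega> = \<phi>" using der by (intro ext DERIV_imp_deriv)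
  ultimately show ?thesis by (rule that)
qed

lemma test_function_1d_boundary:
  assumes "test_function_1d \<phi>"
  shows "\<phi> 0 = 0" "\<phi> pi = 0"
  using assms pi_gt_zero unfolding test_function_1d_def by (metis atLeastAtMost_iff leD less_le_trans)+

text \<open>If the value were non-zero, a narrow bump at \<open>x0\<close> would see only one sign
  of \<open>f\<close>. Multiplying by \<open>f x0\<close> makes the integrand nonnegative for either
  sign, and a nonnegative continuous function with integral zero vanishes.\<close>

lemma fundamental_lemma:
  assumes f: "continuous_on {0..pi} f"
    and 0: "\<And>\<phi>. test_function_1d \<phi> \<Longrightarrow> integral {0..pi} (\<lambda>x. f x * \<phi> x) = 0"
    and x0: "0 < x0" "x0 < pi"
  shows "f x0 = (0::real)"
proof (rule ccontr)
  assume nz: "f x0 \<noteq> 0"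
  obtain \<delta> where \<delta>: "\<delta> > 0" "\<And>y. y \<in> {0..pi} \<Longrightarrow> \<bar>y - x0\<bar> < \<delta> \<Longrightarrow> \<bar>f y - f x0\<bar> < \<bar>f x0\<bar>"
    using f nz x0 unfolding continuous_on_iff dist_real_def
    by (metis atLeastAtMost_iff less_imp_le zero_less_abs_iff)
  \<comment> \<open>Half the minimum keeps the support of the bump inside the interval and inside
    the neighbourhood where \<open>f\<close> keeps its sign.\<close>
  define h where "h = min \<delta> (min x0 (pi - x0)) / 2"
  have h: "h > 0" "0 < x0 - h" "x0 + h < pi" "h < \<delta>" using \<delta> x0 by (auto simp: h_def min_def field_simps)
  define \<phi> where "\<phi> y = bump 1 0 ((y - x0) / h)" for y
  have \<phi>: "test_function_1d \<phi>" unfolding \<phi>_def by (rule test_function_1d_bump) (use h in auto)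
  have \<phi>0: "\<phi> y \<ge> 0" for y by (simp add: \<phi>_def bump_def)
  have pos: "f x0 * f y * \<phi> y \<ge> 0" if y: "y \<in> {0..pi}" for y
  proof (cases "\<bar>y - x0\<bar> < h")
    case True
    then have "\<bar>f y - f x0\<bar> < \<bar>f x0\<bar>" using \<delta>(2)[OF y] h by auto
    then have "f x0 * f y \<ge> 0" by (cases "f x0 > 0") (auto simp: mult_nonneg_nonneg mult_nonpos_nonpos)
    then show ?thesis using \<phi>0 by simp
  next
    case False
    then have "\<not> \<bar>(y - x0) / h\<bar> < 1" using h by (simp add: abs_divide)
    then show ?thesis by (simp add: \<phi>_def bump_def)
  qed
  have cont: "continuous_on {0..pi} (\<lambda>y. f x0 * f y * \<phi> y)"
    using f test_function_1d_continuous[OF \<phi>, of _ 0] by (intro continuous_intros) auto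
  have "integral {0..pi} (\<lambda>y. f x0 * f y * \<phi> y) = 0"
    using 0[OF \<phi>] by (simp add: mult.assoc)
  then have "f x0 * f x0 * \<phi> x0 = 0"
    using integral_eq_0_iff[OF cont pi_gt_zero pos] x0 by auto
  moreover have "\<phi> x0 > 0" by (simp add: \<phi>_def bump_def)
  ultimately show False using nz by simp
qed

text \<open>A test function with integral \<open>0\<close> is the derivative of a test function; subtracting a multiple of
  one fixed bump reduces to this case.\<close>

lemma weak_antiderivative_step:
  fixes A :: "(real \<Rightarrow> real) \<Rightarrow> real"
  assumes f: "continuous_on {0..pi} f"
    and lin: "\<And>\<phi> \<psi> a. test_function_1d \<phi> \<Longrightarrow> test_function_1d \<psi> \<Longrightarrow> A (\<lambda>x. \<phi> x + a * \<psi> x) = A \<phi> + a * A \<psi>"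
    and A: "\<And>\<phi>. test_function_1d \<phi> \<Longrightarrow> A (deriv \<phi>) = integral {0..pi} (\<lambda>x. f x * deriv \<phi> x)"
  shows "\<exists>k. \<forall>\<phi>. test_function_1d \<phi> \<longrightarrow> A \<phi> = integral {0..pi} (\<lambda>x. (f x + k) * \<phi> x)"
proof -
  define \<theta> where "\<theta> y = bump 1 0 ((y - pi / 2) / 1)" for y
  have \<theta>: "test_function_1d \<theta>" unfolding \<theta>_def
    by (rule test_function_1d_bump) (use pi_gt3 in auto)
  have cont: "continuous_on S \<phi>" if "test_function_1d \<phi>" for \<phi> S
    using test_function_1d_continuous[OF that, of S 0] by simp
  define s where "s = integral {0..pi} \<theta>"
  have "s \<noteq> 0"
  proof
    assume "s = 0"
    moreover have "\<And>x. x \<in> {0..pi} \<Longrightarrow> \<theta> x \<ge> 0" by (simp add: \<theta>_def bump_def)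
    ultimately have "\<theta> (pi / 2) = 0" using integral_eq_0_iff[OF cont[OF \<theta>], of 0 pi] by (simp add: s_def)
    then show False by (simp add: \<theta>_def bump_def)
  qed
  \<comment> \<open>Chosen so that the claim holds for \<open>\<theta>\<close>.\<close>
  define k where "k = (A \<theta> - integral {0..pi} (\<lambda>x. f x * \<theta> x)) / s"
  have "A \<phi> = integral {0..pi} (\<lambda>x. (f x + k) * \<phi> x)" if \<phi>: "test_function_1d \<phi>" for \<phi>
  proof -
    \<comment> \<open>Subtracting this multiple of \<open>\<theta>\<close> leaves a function with
      integral zero.\<close>
    define t where "t = integral {0..pi} \<phi> / s"
    define \<phi>' where "\<phi>' x = \<phi> x + (- t) * \<theta> x" for x
    have \<phi>': "test_function_1d \<phi>'" unfolding \<phi>'_def by (rule test_function_1d_combination(1)[OF \<phi> \<theta>])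
    have int: "\<phi> integrable_on {0..pi}" "\<theta> integrable_on {0..pi}" "(\<lambda>x. f x * \<phi> x) integrable_on {0..pi}"
      "(\<lambda>x. f x * \<theta> x) integrable_on {0..pi}"
      by (intro integrable_continuous_interval cont \<phi> \<theta> continuous_intros f)+
    have "integral {0..pi} \<phi>' = integral {0..pi} \<phi> - t * s"
      unfolding \<phi>'_def s_def using integral_add[OF int(1) integrable_on_cmult_left[OF int(2), of "- t"]] by simp
    then have "integral {0..pi} \<phi>' = 0" using \<open>s \<noteq> 0\<close> by (simp add: t_def)
    then obtain \<omega> where \<omega>: "test_function_1d \<omega>" "deriv \<omega> = \<phi>'"
      using test_function_1d_antiderivative[OF \<phi>'] by blast
    have "A \<phi>' = integral {0..pi} (\<lambda>x. f x * \<phi>' x)" using A[OF \<omega>(1)] by (simp add: \<omega>(2))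
    also have "\<dots> = integral {0..pi} (\<lambda>x. f x * \<phi> x - t * (f x * \<theta> x))"
      by (simp add: \<phi>'_def algebra_simps)
    also have "\<dots> = integral {0..pi} (\<lambda>x. f x * \<phi> x) - t * integral {0..pi} (\<lambda>x. f x * \<theta> x)"
      using integral_diff[OF int(3) integrable_on_cmult_left[OF int(4), of t]] by simp
    finally have "A \<phi> - t * A \<theta> = integral {0..pi} (\<lambda>x. f x * \<phi> x) - t * integral {0..pi} (\<lambda>x. f x * \<theta> x)"
      unfolding \<phi>'_def lin[OF \<phi> \<theta>] by simp
    moreover have "t * (A \<theta> - integral {0..pi} (\<lambda>x. f x * \<theta> x)) = k * integral {0..pi} \<phi>"
      by (simp add: t_def k_def)
    moreover have "integral {0..pi} (\<lambda>x. (f x + k) * \<phi> x) = integral {0..pi} (\<lambda>x. f x * \<phi> x) + k * integral {0..pi} \<phi>"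
      using integral_add[OF int(3) integrable_on_cmult_left[OF int(1), of k]] by (simp add: distrib_right)
    ultimately show ?thesis by (simp add: algebra_simps)
  qed
  then show ?thesis by blast
qed

section \<open>Integration by parts against test functions\<close>

lemma test_function_by_parts:
  assumes \<phi>: "test_function_1d \<phi>" and f': "continuous_on {0..pi} f'"
    and f: "\<And>x. x \<in> {0..pi} \<Longrightarrow> (f has_real_derivative f' x) (at x within {0..pi})"
  shows "integral {0..pi} (\<lambda>x. f' x * \<phi> x) = integral {0..pi} (\<lambda>x. - f x * deriv \<phi> x)"
proof -
  have c: "continuous_on {0..pi} f" using f by (intro DERIV_continuous_on)
  have cont: "continuous_on {0..pi} \<phi>" "continuous_on {0..pi} (deriv \<phi>)"
    using test_function_1d_continuous[OF \<phi>, of _ 0] test_function_1d_continuous[OF \<phi>, of _ 1] by simp_all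
  have der: "(\<phi> has_real_derivative deriv \<phi> x) (at x within S)" for x S
    using test_function_1d_deriv[OF \<phi>, of 0 x] has_field_derivative_at_within by fastforce
  have "((\<lambda>x. f' x * \<phi> x + f x * deriv \<phi> x) has_integral f pi * \<phi> pi - f 0 * \<phi> 0) {0..pi}"
    using f der by (intro fundamental_theorem_of_calculus)
      (auto simp: has_real_derivative_iff_has_vector_derivative[symmetric] intro!: derivative_eq_intros)
  then have "integral {0..pi} (\<lambda>x. f' x * \<phi> x + f x * deriv \<phi> x) = 0"
    using test_function_1d_boundary[OF \<phi>] by (simp add: integral_unique)
  moreover have "(\<lambda>x. f' x * \<phi> x) integrable_on {0..pi}" "(\<lambda>x. f x * deriv \<phi> x) integrable_on {0..pi}"
    by (intro integrable_continuous_interval continuous_intros cont c f')+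
  ultimately show ?thesis by (simp add: Henstock_Kurzweil_Integration.integral_add)
qed

text \<open>The primitive of an integrable \<open>z\<close> need not be differentiable everywhere,
  so Fubini on the triangle x < s replaces the product rule. Integrating in \<open>s\<close> yields
  \<open>- (z x * \<phi> x)\<close>, as \<open>\<phi>\<close> vanishes at \<open>pi\<close>;
  integrating in \<open>x\<close> yields the primitive of \<open>z\<close>.\<close>

lemma by_parts_L1_borel:
  assumes \<phi>: "test_function_1d \<phi>" and zi: "integrable lborel z" and z0: "\<And>x. x \<notin> {0<..<pi} \<Longrightarrow> z x = 0"
  shows "(LINT x|lborel. z x * \<phi> x)
    = integral {0..pi} (\<lambda>s. - (LINT x|lborel. indicator {..<s} x * z x) * deriv \<phi> s)"
proof -
  define \<phi>' where "\<phi>' = deriv \<phi>"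
  have cont': "continuous_on S \<phi>'" for S unfolding \<phi>'_def using test_function_1d_continuous[OF \<phi>, of _ 1] by simp
  have der: "(\<phi> has_real_derivative \<phi>' x) (at x within S)" for x S
    unfolding \<phi>'_def using test_function_1d_deriv[OF \<phi>, of 0 x] has_field_derivative_at_within by fastforce
  have zm [measurable]: "z \<in> borel_measurable borel" using zi by auto
  have \<phi>'m [measurable]: "\<phi>' \<in> borel_measurable borel"
    by (rule borel_measurable_continuous_onI[OF cont'])
  define f where "f = (\<lambda>(x, s). z x * (indicator {0<..<pi} s * \<phi>' s) * indicator {p. fst p < snd p} (x, s))"
  have "open {p :: real \<times> real. fst p < snd p}" by (intro open_Collect_less continuous_intros)
  then have [measurable]: "{p :: real \<times> real. fst p < snd p} \<in> sets borel" by simp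
  have ind_int: "integrable lborel (\<lambda>s. indicator {a<..<b} s * \<phi>' s)" for a b
  proof -
    have "set_integrable lborel {a..b} \<phi>'"
      by (rule borel_integrable_atLeastAtMost') (rule cont')
    then have "set_integrable lborel {a<..<b} \<phi>'" by (rule set_integrable_subset) auto
    then show ?thesis by (simp add: set_integrable_def)
  qed
  have fm: "f \<in> borel_measurable (lborel \<Otimes>\<^sub>M lborel)"
  proof -
    have [measurable]: "(\<lambda>p :: real \<times> real. indicator {p. fst p < snd p} p :: real) \<in> borel_measurable (borel \<Otimes>\<^sub>M borel)"
      by (subst borel_prod) measurable
    have "f \<in> borel_measurable (borel \<Otimes>\<^sub>M borel)"
      unfolding f_def case_prod_beta prod.collapse by measurable
    then show ?thesis
      by (simp add: measurable_cong_sets[OF sets_pair_measure_cong[OF sets_lborel sets_lborel] refl])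
  qed
  have fint: "integrable (lborel \<Otimes>\<^sub>M lborel) f"
  proof (rule lborel_pair.Fubini_integrable[OF fm])
    have inner: "integrable lborel (\<lambda>s. f (x, s))" for x
    proof -
      have "integrable lborel (\<lambda>s. z x * (indicator {max 0 x<..<pi} s * \<phi>' s))"
        by (intro integrable_mult_right ind_int)
      moreover have "f (x, s) = z x * (indicator {max 0 x<..<pi} s * \<phi>' s)" for s
        using z0[of x] by (cases "x \<le> 0") (auto simp: f_def indicator_def)
      ultimately show ?thesis by simp
    qed
    show "AE x in lborel. integrable lborel (\<lambda>s. f (x, s))" using inner by simp
    have nb: "(\<integral>s. norm (f (x, s)) \<partial>lborel) \<le> \<bar>z x\<bar> * (\<integral>s. norm (indicator {0<..<pi} s * \<phi>' s) \<partial>lborel)" for x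
    proof -
      have "(\<integral>s. norm (f (x, s)) \<partial>lborel) \<le> (\<integral>s. \<bar>z x\<bar> * norm (indicator {0<..<pi} s * \<phi>' s) \<partial>lborel)"
        using inner[of x] ind_int[of 0 pi]
        by (intro integral_mono integrable_norm integrable_mult_right) (auto simp: f_def abs_mult indicator_def)
      then show ?thesis by simp
    qed
    show "integrable lborel (\<lambda>x. \<integral>s. norm (f (x, s)) \<partial>lborel)"
    proof (rule Bochner_Integration.integrable_bound)
      show "integrable lborel (\<lambda>x. \<bar>z x\<bar> * (\<integral>s. norm (indicator {0<..<pi} s * \<phi>' s) \<partial>lborel))"
        using zi by (intro integrable_mult_left integrable_abs)
      show "(\<lambda>x. \<integral>s. norm (f (x, s)) \<partial>lborel) \<in> borel_measurable lborel"
        using fm by (intro lborel.borel_measurable_lebesgue_integral) simp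
      show "AE x in lborel. norm (\<integral>s. norm (f (x, s)) \<partial>lborel) \<le>
          norm (\<bar>z x\<bar> * (\<integral>s. norm (indicator {0<..<pi} s * \<phi>' s) \<partial>lborel))"
        using nb by (intro AE_I2) (auto intro: order_trans[OF nb])
    qed
  qed
  have "(\<integral>s. (\<integral>x. f (x, s) \<partial>lborel) \<partial>lborel) = (\<integral>x. (\<integral>s. f (x, s) \<partial>lborel) \<partial>lborel)"
    using lborel_pair.Fubini_integral[of "\<lambda>x s. f (x, s)"] fint by simp
  moreover have "(\<integral>s. f (x, s) \<partial>lborel) = - (z x * \<phi> x)" for x
  proof (cases "x \<in> {0<..<pi}")
    case True
    have "(\<integral>s. f (x, s) \<partial>lborel) = (\<integral>s. z x * (indicator {x<..<pi} s * \<phi>' s) \<partial>lborel)"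
      using True by (intro Bochner_Integration.integral_cong) (auto simp: f_def indicator_def)
    also have "\<dots> = z x * (LINT s:{x<..<pi}|lborel. \<phi>' s)" by (simp add: set_lebesgue_integral_def)
    also have "(LINT s:{x<..<pi}|lborel. \<phi>' s) = integral {x<..<pi} \<phi>'"
      using ind_int[of x pi] by (intro set_borel_integral_eq_integral) (auto simp: set_integrable_def)
    also have "\<dots> = integral {x..pi} \<phi>'" by (simp add: integral_open_interval_real)
    also have "\<dots> = \<phi> pi - \<phi> x"
      using True der by (intro integral_unique fundamental_theorem_of_calculus)
        (auto simp: has_real_derivative_iff_has_vector_derivative[symmetric])
    finally show ?thesis using test_function_1d_boundary[OF \<phi>] by simp
  qed (simp add: f_def z0)
  moreover have inner2: "(\<integral>x. f (x, s) \<partial>lborel) = indicator {0<..<pi} s * ((LINT x|lborel. indicator {..<s} x * z x) * \<phi>' s)" for s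
  proof -
    have "f (x, s) = (indicator {..<s} x * z x) * (indicator {0<..<pi} s * \<phi>' s)" for x
      by (simp add: f_def indicator_def)
    then show ?thesis by simp
  qed
  ultimately have eq: "(LINT x|lborel. z x * \<phi> x) = - (LINT s:{0<..<pi}|lborel. (LINT x|lborel. indicator {..<s} x * z x) * \<phi>' s)"
    by (simp add: set_lebesgue_integral_def)
  have "set_integrable lborel {0<..<pi} (\<lambda>s. (LINT x|lborel. indicator {..<s} x * z x) * \<phi>' s)"
    using lborel_pair.integrable_snd[of "\<lambda>x s. f (x, s)"] fint inner2 by (simp add: set_integrable_def)
  then have "(LINT s:{0<..<pi}|lborel. (LINT x|lborel. indicator {..<s} x * z x) * \<phi>' s)
      = integral {0..pi} (\<lambda>s. (LINT x|lborel. indicator {..<s} x * z x) * \<phi>' s)"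
    by (simp add: set_borel_integral_eq_integral integral_open_interval_real)
  then show ?thesis by (simp add: eq \<phi>'_def)
qed

text \<open>Passes to a Borel representative \<open>y\<close> of \<open>z\<close>, for which the
  product measure is available; \<open>transfer\<close> shows that the integrals agree.\<close>

lemma by_parts_L1:
  assumes \<phi>: "test_function_1d \<phi>" and z: "set_integrable lebesgue {0<..<pi} z"
  shows "(LINT x:{0<..<pi}|lebesgue. z x * \<phi> x)
    = integral {0..pi} (\<lambda>s. - (LINT x:{0<..<s}|lebesgue. z x) * deriv \<phi> s)"
proof -
  have zi: "integrable lebesgue (\<lambda>x. indicator {0<..<pi} x * z x)" using z by (simp add: set_integrable_def)
  then obtain z' where z'm: "z' \<in> borel_measurable lborel"
    and z': "AE x in lborel. indicator {0<..<pi} x * z x = z' x"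
    using completion_ex_borel_measurable_real[of "\<lambda>x. indicator {0<..<pi} x * z x" lborel] by auto
  define y where "y x = indicator {0<..<pi} x * z' x" for x
  have ym [measurable]: "y \<in> borel_measurable lborel" unfolding y_def using z'm by measurable
  have AEy: "AE x in lebesgue. indicator {0<..<pi} x * z x = y x"
    by (rule AE_completion) (use z' in \<open>auto simp: y_def indicator_def\<close>)
  have transfer: "(LINT x|lebesgue. (indicator {0<..<pi} x * z x) * h x) = (LINT x|lborel. y x * h x)"
    if [measurable]: "h \<in> borel_measurable borel" for h
  proof -
    have "(LINT x|lebesgue. (indicator {0<..<pi} x * z x) * h x) = (LINT x|lebesgue. y x * h x)"
    proof (rule integral_cong_AE)
      have h: "h \<in> borel_measurable lebesgue" by (rule measurable_completion) simp
      show "(\<lambda>x. (indicator {0<..<pi} x * z x) * h x) \<in> borel_measurable lebesgue"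
        by (rule borel_measurable_times[OF borel_measurable_integrable[OF zi] h])
      show "(\<lambda>x. y x * h x) \<in> borel_measurable lebesgue" by (rule measurable_completion) simp
      show "AE x in lebesgue. (indicator {0<..<pi} x * z x) * h x = y x * h x" using AEy by eventually_elim simp
    qed
    also have "\<dots> = (LINT x|lborel. y x * h x)" by (rule integral_completion) simp
    finally show ?thesis .
  qed
  have "integrable lebesgue y"
    by (rule integrable_cong_AE_imp[OF zi measurable_completion[OF ym]]) (use AEy in \<open>auto simp: eq_commute\<close>)
  then have yi: "integrable lborel y" by (simp add: integrable_completion)
  have "(LINT x:{0<..<pi}|lebesgue. z x * \<phi> x) = (LINT x|lborel. y x * \<phi> x)"
    using transfer[of \<phi>] borel_measurable_continuous_onI[OF test_function_1d_continuous[OF \<phi>, of UNIV 0]]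
    by (simp add: set_lebesgue_integral_def mult.assoc)
  also have "\<dots> = integral {0..pi} (\<lambda>s. - (LINT x|lborel. indicator {..<s} x * y x) * deriv \<phi> s)"
    by (rule by_parts_L1_borel[OF \<phi> yi]) (simp add: y_def)
  also have "\<dots> = integral {0..pi} (\<lambda>s. - (LINT x:{0<..<s}|lebesgue. z x) * deriv \<phi> s)"
  proof (rule integral_cong)
    fix s assume s: "s \<in> {0..pi}"
    have "(LINT x:{0<..<s}|lebesgue. z x) = (LINT x|lebesgue. (indicator {0<..<pi} x * z x) * indicator {..<s} x)"
      unfolding set_lebesgue_integral_def using s by (intro Bochner_Integration.integral_cong) (auto simp: indicator_def)
    also have "\<dots> = (LINT x|lborel. indicator {..<s} x * y x)" by (subst transfer) (auto simp: mult.commute)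
    finally show "- (LINT x|lborel. indicator {..<s} x * y x) * deriv \<phi> s = - (LINT x:{0<..<s}|lebesgue. z x) * deriv \<phi> s" by simp
  qed
  finally show ?thesis .
qed

text \<open>One weak derivative is removed at a time. \<open>A n\<close> pairs
  \<open>\<alpha>\<close> with the n-th derivative of a test function. The primitive
  \<open>Z\<close> of the weak third derivative represents \<open>A 3\<close>, and its
  antiderivatives \<open>G\<close> and \<open>E\<close> represent \<open>A 2\<close> and
  \<open>A 1\<close>, each step fixing one constant. The fundamental lemma identifies
  \<open>\<alpha>\<close> with \<open>E + k3\<close>, whose derivative is explicit.\<close>

lemma W3_continuously_differentiable:
  assumes "\<alpha> \<in> W3" and cont: "continuous_on {0..pi} \<alpha>"
  obtains \<alpha>' where "continuous_on {0..pi} \<alpha>'" "\<And>x. x \<in> {0..pi} \<Longrightarrow> (\<alpha> has_real_derivative \<alpha>' x) (at x within {0..pi})"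
proof -
  obtain z where z: "set_integrable lebesgue {0<..<pi} z" and
    weak: "\<And>\<phi>. test_function_1d \<phi> \<Longrightarrow>
      (LINT x:{0<..<pi}|lebesgue. \<alpha> x * (deriv ^^ 3) \<phi> x) = - (LINT x:{0<..<pi}|lebesgue. z x * \<phi> x)"
    using assms(1) unfolding W3_def by blast
  define Z where "Z s = (LINT x:{0<..<s}|lebesgue. z x)" for s
  have Zc: "continuous_on {0..pi} Z"
  proof -
    have sub: "set_integrable lebesgue {0<..<s} z" if "s \<le> pi" for s
      using z by (rule set_integrable_subset) (use that in auto)
    have zi: "z integrable_on {0..pi}"
      using set_lebesgue_integral_eq_integral(1)[OF z] by (simp add: integrable_on_open_interval_real)
    have "continuous_on {0..pi} (\<lambda>s. integral {0..s} z)" by (rule indefinite_integral_continuous_1[OF zi])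
    moreover have "integral {0..s} z = Z s" if "s \<in> {0..pi}" for s
      using set_lebesgue_integral_eq_integral(2)[OF sub[of s]] that by (simp add: Z_def integral_open_interval_real)
    ultimately show ?thesis by (rule continuous_on_eq)
  qed
  define A where "A n \<phi> = integral {0..pi} (\<lambda>x. \<alpha> x * (deriv ^^ n) \<phi> x)" for n :: nat and \<phi>
  have ci: "(\<lambda>x. \<alpha> x * (deriv ^^ n) \<phi> x) integrable_on {0..pi}" if "test_function_1d \<phi>" for n \<phi>
    by (intro integrable_continuous_interval continuous_intros cont test_function_1d_continuous that)
  have lin: "A n (\<lambda>x. \<phi> x + a * \<psi> x) = A n \<phi> + a * A n \<psi>" if "test_function_1d \<phi>" "test_function_1d \<psi>" for n \<phi> \<psi> a
  proof -
    have "A n (\<lambda>x. \<phi> x + a * \<psi> x) = integral {0..pi} (\<lambda>x. \<alpha> x * (deriv ^^ n) \<phi> x + a * (\<alpha> x * (deriv ^^ n) \<psi> x))"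
      unfolding A_def test_function_1d_combination(2)[OF that] by (simp add: algebra_simps)
    also have "\<dots> = A n \<phi> + a * A n \<psi>"
      unfolding A_def using integral_add[OF ci[OF that(1), of n] integrable_on_cmult_left[OF ci[OF that(2), of n], of a]] by simp
    finally show ?thesis .
  qed
  have Aderiv: "A n (deriv \<phi>) = A (Suc n) \<phi>" for n \<phi> by (simp add: A_def funpow_swap1)
  have A3: "A 3 \<phi> = integral {0..pi} (\<lambda>x. Z x * deriv \<phi> x)" if \<phi>: "test_function_1d \<phi>" for \<phi>
  proof -
    have "set_integrable lebesgue {0<..<pi} (\<lambda>x. \<alpha> x * (deriv ^^ 3) \<phi> x)"
      by (rule set_integrable_subset[OF absolutely_integrable_continuous_real[of 0 pi]])
        (auto intro!: continuous_intros cont test_function_1d_continuous \<phi>)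
    then have "A 3 \<phi> = (LINT x:{0<..<pi}|lebesgue. \<alpha> x * (deriv ^^ 3) \<phi> x)"
      by (simp add: A_def set_lebesgue_integral_eq_integral integral_open_interval_real)
    then show ?thesis using weak[OF \<phi>] by_parts_L1[OF \<phi> z] by (simp add: Z_def)
  qed
  have antider: "((\<lambda>x. integral {0..x} f) has_real_derivative f x) (at x within {0..pi})"
    if "continuous_on {0..pi} f" "x \<in> {0..pi}" for f :: "real \<Rightarrow> real" and x
    using integral_has_real_derivative[OF that] .
  have step: "A 2 (deriv \<phi>) = integral {0..pi} (\<lambda>x. Z x * deriv \<phi> x)" if "test_function_1d \<phi>" for \<phi>
    using A3[OF that] by (simp add: Aderiv numeral_3_eq_3 numeral_2_eq_2)
  obtain k1 where k1: "\<And>\<phi>. test_function_1d \<phi> \<Longrightarrow> A 2 \<phi> = integral {0..pi} (\<lambda>x. (Z x + k1) * \<phi> x)"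
    using weak_antiderivative_step[of Z "A 2", OF Zc lin step] by blast
  \<comment> \<open>The minus sign offsets the one from integration by parts; likewise for
    \<open>E\<close>.\<close>
  define G where "G x = - integral {0..x} (\<lambda>x. Z x + k1)" for x
  have Gd: "(G has_real_derivative - (Z x + k1)) (at x within {0..pi})" if "x \<in> {0..pi}" for x
    unfolding G_def using that by (intro DERIV_minus antider continuous_intros Zc)
  have Gc: "continuous_on {0..pi} G" using Gd by (intro DERIV_continuous_on)
  have A2: "A 2 \<phi> = integral {0..pi} (\<lambda>x. G x * deriv \<phi> x)" if \<phi>: "test_function_1d \<phi>" for \<phi>
  proof -
    have "integral {0..pi} (\<lambda>x. (Z x + k1) * \<phi> x) = integral {0..pi} (\<lambda>x. - (- G x) * deriv \<phi> x)"
      using DERIV_minus[OF Gd, unfolded minus_minus] by (intro test_function_by_parts \<phi> continuous_intros Zc) auto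
    then show ?thesis using k1[OF \<phi>] by simp
  qed
  have step: "A 1 (deriv \<phi>) = integral {0..pi} (\<lambda>x. G x * deriv \<phi> x)" if "test_function_1d \<phi>" for \<phi>
    using A2[OF that] by (simp add: Aderiv numeral_3_eq_3 numeral_2_eq_2)
  obtain k2 where k2: "\<And>\<phi>. test_function_1d \<phi> \<Longrightarrow> A 1 \<phi> = integral {0..pi} (\<lambda>x. (G x + k2) * \<phi> x)"
    using weak_antiderivative_step[of G "A 1", OF Gc lin step] by blast
  define E where "E x = - integral {0..x} (\<lambda>x. G x + k2)" for x
  have Ed: "(E has_real_derivative - (G x + k2)) (at x within {0..pi})" if "x \<in> {0..pi}" for x
    unfolding E_def using that by (intro DERIV_minus antider continuous_intros Gc)
  have Ec: "continuous_on {0..pi} E" using Ed by (intro DERIV_continuous_on)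
  have A1: "A 1 \<phi> = integral {0..pi} (\<lambda>x. E x * deriv \<phi> x)" if \<phi>: "test_function_1d \<phi>" for \<phi>
  proof -
    have "integral {0..pi} (\<lambda>x. (G x + k2) * \<phi> x) = integral {0..pi} (\<lambda>x. - (- E x) * deriv \<phi> x)"
      using DERIV_minus[OF Ed, unfolded minus_minus] by (intro test_function_by_parts \<phi> continuous_intros Gc) auto
    then show ?thesis using k2[OF \<phi>] by simp
  qed
  have step: "A 0 (deriv \<phi>) = integral {0..pi} (\<lambda>x. E x * deriv \<phi> x)" if "test_function_1d \<phi>" for \<phi>
    using A1[OF that] by (simp add: Aderiv numeral_3_eq_3 numeral_2_eq_2)
  obtain k3 where k3: "\<And>\<phi>. test_function_1d \<phi> \<Longrightarrow> A 0 \<phi> = integral {0..pi} (\<lambda>x. (E x + k3) * \<phi> x)"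
    using weak_antiderivative_step[of E "A 0", OF Ec lin step] by blast
  have dc: "continuous_on {0..pi} (\<lambda>x. \<alpha> x - (E x + k3))" by (intro continuous_intros cont Ec)
  have "integral {0..pi} (\<lambda>x. (\<alpha> x - (E x + k3)) * \<phi> x) = 0" if \<phi>: "test_function_1d \<phi>" for \<phi>
  proof -
    have "(\<lambda>x. (E x + k3) * \<phi> x) integrable_on {0..pi}"
      using test_function_1d_continuous[OF \<phi>, of _ 0] by (intro integrable_continuous_interval continuous_intros Ec) auto
    then show ?thesis using integral_diff[OF ci[OF \<phi>, of 0]] k3[OF \<phi>] by (simp add: A_def left_diff_distrib)
  qed
  then have open_eq: "\<alpha> x - (E x + k3) = 0" if "0 < x" "x < pi" for x
    using fundamental_lemma[OF dc _ that] by blast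
  \<comment> \<open>Continuity carries the identity to the end points, where boundary values of
    \<open>\<alpha>\<close> matter.\<close>
  have "\<alpha> x - (E x + k3) = 0" if "x \<in> {0..pi}" for x
    using continuous_constant_on_closure[of "{0<..<pi}" "\<lambda>x. \<alpha> x - (E x + k3)" 0 x] dc open_eq that by simp
  then have eq: "E x + k3 = \<alpha> x" if "x \<in> {0..pi}" for x using that by simp
  show ?thesis
  proof (rule that)
    show "continuous_on {0..pi} (\<lambda>x. - (G x + k2))" by (intro continuous_intros Gc)
    fix x assume x: "x \<in> {0..pi}"
    have "((\<lambda>x. E x + k3) has_real_derivative - (G x + k2) + 0) (at x within {0..pi})"
      by (intro DERIV_add Ed x DERIV_const)
    then have "((\<lambda>x. E x + k3) has_real_derivative - (G x + k2)) (at x within {0..pi})" by simp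
    then show "(\<alpha> has_real_derivative - (G x + k2)) (at x within {0..pi})"
      by (rule has_field_derivative_transform_within[OF _ zero_less_one x]) (rule eq)
  qed
qed

section \<open>The spatial boundary value problem\<close>

text \<open>\<open>\<eta>1\<close> and \<open>\<eta>2\<close> are the derivatives of
  \<open>\<eta>\<close> that appear when the product rule is applied to the iterated operator.
  \<open>\<alpha>\<close> and \<open>\<beta>\<close> act through the boundary coefficient
  \<open>\<kappa>\<close>.\<close>

locale beam =
  fixes \<alpha> \<beta> \<rho> \<eta> \<eta>1 \<eta>2 :: "real \<Rightarrow> real"
  assumes \<eta>1: "x \<in> {0..pi} \<Longrightarrow> (\<eta> has_real_derivative \<eta>1 x) (at x within {0..pi})"
    and \<eta>2: "x \<in> {0..pi} \<Longrightarrow> (\<eta>1 has_real_derivative \<eta>2 x) (at x within {0..pi})"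
    and \<eta>2_cont: "continuous_on {0..pi} \<eta>2"
    and \<eta>_pos: "x \<in> {0..pi} \<Longrightarrow> \<eta> x > 0"
    and \<rho>_cont: "continuous_on {0..pi} \<rho>"
    and \<rho>_pos: "x \<in> {0..pi} \<Longrightarrow> \<rho> x > 0"
begin

lemma \<eta>_cont: "continuous_on {0..pi} \<eta>" and \<eta>1_cont: "continuous_on {0..pi} \<eta>1"
  by (rule DERIV_continuous_on[OF \<eta>1] DERIV_continuous_on[OF \<eta>2], assumption)+

lemma \<eta>_nz: "x \<in> {0..pi} \<Longrightarrow> \<eta> x \<noteq> 0" and \<rho>_nz: "x \<in> {0..pi} \<Longrightarrow> \<rho> x \<noteq> 0"
  using \<eta>_pos[of x] \<rho>_pos[of x] by auto

definition \<kappa> :: "real \<Rightarrow> real" where "\<kappa> x = 2 * (\<alpha> x + \<beta> x)"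

text \<open>The arguments \<open>u1\<close>, \<open>u2\<close> are the first two derivatives of \<open>u\<close>, and \<open>w1\<close>, \<open>w2\<close> those of \<open>\<eta> u2\<close>.\<close>

definition beam_dom :: "(real \<Rightarrow> 'a::real_normed_vector) \<Rightarrow> (real \<Rightarrow> 'a) \<Rightarrow> (real \<Rightarrow> 'a) \<Rightarrow> (real \<Rightarrow> 'a) \<Rightarrow> (real \<Rightarrow> 'a) \<Rightarrow> bool" where
  "beam_dom u u1 u2 w1 w2 \<longleftrightarrow>
    (\<forall>x\<in>{0..pi}. (u has_vector_derivative u1 x) (at x within {0..pi}) \<and>
       (u1 has_vector_derivative u2 x) (at x within {0..pi}) \<and>
       ((\<lambda>y. \<eta> y *\<^sub>R u2 y) has_vector_derivative w1 x) (at x within {0..pi}) \<and>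
       (w1 has_vector_derivative w2 x) (at x within {0..pi})) \<and>
    (\<forall>x\<in>{0, pi}. u x = 0 \<and> \<kappa> x *\<^sub>R u1 x + u2 x = 0)"

lemma vector_derivative_continuous_on:
  "(\<And>x. x \<in> S \<Longrightarrow> (f has_vector_derivative f' x) (at x within S)) \<Longrightarrow> continuous_on S f"
  using has_vector_derivative_continuous continuous_on_eq_continuous_within by blast

lemma beam_dom_continuous:
  assumes "beam_dom u u1 u2 w1 w2"
  shows "continuous_on {0..pi} u" "continuous_on {0..pi} u1" "continuous_on {0..pi} w1"
    "continuous_on {0..pi} (\<lambda>x. \<eta> x *\<^sub>R u2 x)" "continuous_on {0..pi} u2"
proof -
  show c: "continuous_on {0..pi} u" "continuous_on {0..pi} u1" "continuous_on {0..pi} w1"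
    "continuous_on {0..pi} (\<lambda>x. \<eta> x *\<^sub>R u2 x)"
    using assms unfolding beam_dom_def by (auto intro!: vector_derivative_continuous_on)
  have "continuous_on {0..pi} (\<lambda>x. inverse (\<eta> x) *\<^sub>R (\<eta> x *\<^sub>R u2 x))"
    by (intro continuous_on_scaleR continuous_on_inverse c \<eta>_cont ballI \<eta>_nz)
  then show "continuous_on {0..pi} u2"
    by (rule continuous_on_eq) (simp add: \<eta>_nz)
qed

text \<open>Lagrange's identity: the difference of the integrands is the derivative of the boundary
  form \<open>\<Phi>\<close>. At an end both functions vanish and each second derivative is
  \<open>- \<kappa>\<close> times the first, so the two remaining terms cancel. \<open>v\<close> is
  vector-valued because it will be a section of a complex test function.\<close>

lemma beam_dom_symmetric:
  fixes v :: "real \<Rightarrow> 'a::banach"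
  assumes u: "beam_dom u u1 u2 w1 w2" and v: "beam_dom v v1 v2 z1 z2"
    and c: "continuous_on {0..pi} w2" "continuous_on {0..pi} z2"
  shows "integral {0..pi} (\<lambda>x. w2 x *\<^sub>R v x) = integral {0..pi} (\<lambda>x. u x *\<^sub>R z2 x)"
proof -
  define \<Phi> where "\<Phi> x = w1 x *\<^sub>R v x - (\<eta> x *\<^sub>R u2 x) *\<^sub>R v1 x + u1 x *\<^sub>R (\<eta> x *\<^sub>R v2 x) - u x *\<^sub>R z1 x" for x
  have "((\<lambda>x. w2 x *\<^sub>R v x - u x *\<^sub>R z2 x) has_integral \<Phi> pi - \<Phi> 0) {0..pi}"
  proof (rule fundamental_theorem_of_calculus)
    fix x :: real assume x: "x \<in> {0..pi}"
    note du = u[unfolded beam_dom_def, THEN conjunct1, rule_format, OF x, folded has_real_derivative_iff_has_vector_derivative]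
    note dv = v[unfolded beam_dom_def, THEN conjunct1, rule_format, OF x]
    have "(\<Phi> has_vector_derivative
        (w1 x *\<^sub>R v1 x + w2 x *\<^sub>R v x) - ((\<eta> x *\<^sub>R u2 x) *\<^sub>R v2 x + w1 x *\<^sub>R v1 x)
        + (u1 x *\<^sub>R z1 x + u2 x *\<^sub>R (\<eta> x *\<^sub>R v2 x)) - (u x *\<^sub>R z2 x + u1 x *\<^sub>R z1 x)) (at x within {0..pi})"
      unfolding \<Phi>_def
      by (intro has_vector_derivative_diff has_vector_derivative_add has_vector_derivative_scaleR) (use du dv in auto)
    then show "(\<Phi> has_vector_derivative w2 x *\<^sub>R v x - u x *\<^sub>R z2 x) (at x within {0..pi})"
      by (simp add: algebra_simps)
  qed simp
  moreover have "\<Phi> pi = 0" "\<Phi> 0 = 0"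
  proof -
    have "\<Phi> x = 0" if "x \<in> {0, pi}" for x
    proof -
      have "u x = 0" "u2 x = - \<kappa> x * u1 x" "v x = 0" "v2 x = - \<kappa> x *\<^sub>R v1 x"
        using u v that unfolding beam_dom_def by (auto simp: eq_neg_iff_add_eq_0 add.commute)
      then show ?thesis by (simp add: \<Phi>_def)
    qed
    then show "\<Phi> pi = 0" "\<Phi> 0 = 0" by auto
  qed
  ultimately have "((\<lambda>x. w2 x *\<^sub>R v x - u x *\<^sub>R z2 x) has_integral 0) {0..pi}" by simp
  moreover have "(\<lambda>x. w2 x *\<^sub>R v x) integrable_on {0..pi}" "(\<lambda>x. u x *\<^sub>R z2 x) integrable_on {0..pi}"
    using beam_dom_continuous[OF u] beam_dom_continuous[OF v] c
    by (auto intro!: integrable_continuous_interval continuous_intros)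
  ultimately show ?thesis by (simp add: has_integral_iff Henstock_Kurzweil_Integration.integral_diff)
qed

lemma beam_dom_C4:
  assumes "\<And>x. x \<in> {0..pi} \<Longrightarrow> (u has_vector_derivative u1 x) (at x within {0..pi})"
    "\<And>x. x \<in> {0..pi} \<Longrightarrow> (u1 has_vector_derivative u2 x) (at x within {0..pi})"
    "\<And>x. x \<in> {0..pi} \<Longrightarrow> (u2 has_vector_derivative u3 x) (at x within {0..pi})"
    "\<And>x. x \<in> {0..pi} \<Longrightarrow> (u3 has_vector_derivative u4 x) (at x within {0..pi})"
    and "\<And>x. x \<in> {0, pi} \<Longrightarrow> u x = 0 \<and> \<kappa> x *\<^sub>R u1 x + u2 x = 0"
  shows "beam_dom u u1 u2 (\<lambda>x. \<eta>1 x *\<^sub>R u2 x + \<eta> x *\<^sub>R u3 x)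
    (\<lambda>x. \<eta>2 x *\<^sub>R u2 x + (2 * \<eta>1 x) *\<^sub>R u3 x + \<eta> x *\<^sub>R u4 x)"
  unfolding beam_dom_def
proof (intro conjI ballI)
  fix x assume x: "x \<in> {0..pi}"
  show "((\<lambda>y. \<eta> y *\<^sub>R u2 y) has_vector_derivative \<eta>1 x *\<^sub>R u2 x + \<eta> x *\<^sub>R u3 x) (at x within {0..pi})"
    using has_vector_derivative_scaleR[OF \<eta>1[OF x] assms(3)[OF x]] by (simp add: add.commute)
  have "((\<lambda>x. \<eta>1 x *\<^sub>R u2 x + \<eta> x *\<^sub>R u3 x) has_vector_derivative
      (\<eta>1 x *\<^sub>R u3 x + \<eta>2 x *\<^sub>R u2 x) + (\<eta> x *\<^sub>R u4 x + \<eta>1 x *\<^sub>R u3 x)) (at x within {0..pi})"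
    by (intro has_vector_derivative_add has_vector_derivative_scaleR \<eta>1 \<eta>2 x assms)
  then show "((\<lambda>x. \<eta>1 x *\<^sub>R u2 x + \<eta> x *\<^sub>R u3 x) has_vector_derivative
      \<eta>2 x *\<^sub>R u2 x + (2 * \<eta>1 x) *\<^sub>R u3 x + \<eta> x *\<^sub>R u4 x) (at x within {0..pi})"
    by (rule has_vector_derivative_eq_rhs) (simp add: algebra_simps, simp add: scaleR_2[symmetric] mult.commute)
qed (use assms in auto)

lemma beam_dom_cong:
  "beam_dom u u1 u2 w1 w2 \<Longrightarrow> (\<And>x. x \<in> {0..pi} \<Longrightarrow> w2 x = w2' x) \<Longrightarrow> beam_dom u u1 u2 w1 w2'"
  unfolding beam_dom_def by simp

lemma beam_dom_add_scaled:
  assumes "beam_dom u u1 u2 w1 w2" "beam_dom v v1 v2 z1 z2"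
  shows "beam_dom (\<lambda>x. u x + c *\<^sub>R v x) (\<lambda>x. u1 x + c *\<^sub>R v1 x) (\<lambda>x. u2 x + c *\<^sub>R v2 x)
    (\<lambda>x. w1 x + c *\<^sub>R z1 x) (\<lambda>x. w2 x + c *\<^sub>R z2 x)"
  unfolding beam_dom_def
proof (intro conjI ballI)
  fix x assume x: "x \<in> {0..pi}"
  note d = assms[unfolded beam_dom_def, THEN conjunct1, rule_format, OF x]
  have cv: "((\<lambda>x. f x + c *\<^sub>R g x) has_vector_derivative f' + c *\<^sub>R g') F"
    if "(f has_vector_derivative f') F" "(g has_vector_derivative g') F" for f g :: "real \<Rightarrow> 'a" and f' g' F
    using that by (intro has_vector_derivative_add bounded_linear.has_vector_derivative[OF bounded_linear_scaleR_right])
  show "((\<lambda>x. u x + c *\<^sub>R v x) has_vector_derivative u1 x + c *\<^sub>R v1 x) (at x within {0..pi})"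
    "((\<lambda>x. u1 x + c *\<^sub>R v1 x) has_vector_derivative u2 x + c *\<^sub>R v2 x) (at x within {0..pi})"
    "((\<lambda>x. w1 x + c *\<^sub>R z1 x) has_vector_derivative w2 x + c *\<^sub>R z2 x) (at x within {0..pi})"
    using d by (auto intro!: cv)
  have "((\<lambda>y. \<eta> y *\<^sub>R u2 y + c *\<^sub>R (\<eta> y *\<^sub>R v2 y)) has_vector_derivative w1 x + c *\<^sub>R z1 x) (at x within {0..pi})"
    by (intro cv) (use d in auto)
  then show "((\<lambda>y. \<eta> y *\<^sub>R (u2 y + c *\<^sub>R v2 y)) has_vector_derivative w1 x + c *\<^sub>R z1 x) (at x within {0..pi})"
    by (simp add: scaleR_right_distrib mult.commute)
next
  fix x assume x: "x \<in> {0, pi}"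
  note b = assms[unfolded beam_dom_def, THEN conjunct2, rule_format, OF x]
  show "u x + c *\<^sub>R v x = 0" using b by simp
  have "\<kappa> x *\<^sub>R (u1 x + c *\<^sub>R v1 x) + (u2 x + c *\<^sub>R v2 x) = (\<kappa> x *\<^sub>R u1 x + u2 x) + c *\<^sub>R (\<kappa> x *\<^sub>R v1 x + v2 x)"
    by (simp add: algebra_simps)
  then show "\<kappa> x *\<^sub>R (u1 x + c *\<^sub>R v1 x) + (u2 x + c *\<^sub>R v2 x) = 0" using b by simp
qed

text \<open>The first-order system for \<open>u\<close>, its slope, the moment \<open>w\<close>,
  which is \<open>\<eta>\<close> times the second derivative of \<open>u\<close>, and the slope of
  \<open>w\<close>. With \<open>w\<close> as an unknown no derivative of \<open>\<eta>\<close>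
  enters.\<close>

definition ivp :: "real \<Rightarrow> (real \<Rightarrow> real) \<Rightarrow> (real \<Rightarrow> real) \<Rightarrow> (real \<Rightarrow> real) \<Rightarrow> (real \<Rightarrow> real) \<Rightarrow> (real \<Rightarrow> real) \<Rightarrow> bool" where
  "ivp l h u u1 w w1 \<longleftrightarrow> (\<forall>x\<in>{0..pi}.
     (u has_real_derivative u1 x) (at x within {0..pi}) \<and>
     (u1 has_real_derivative w x / \<eta> x) (at x within {0..pi}) \<and>
     (w has_real_derivative w1 x) (at x within {0..pi}) \<and>
     (w1 has_real_derivative \<rho> x * (l * u x + h x)) (at x within {0..pi}))"

lemma ivp_add_scaled:
  assumes "ivp l h u u1 w w1" "ivp l k v v1 z z1"
  shows "ivp l (\<lambda>x. h x + c * k x) (\<lambda>x. u x + c * v x) (\<lambda>x. u1 x + c * v1 x) (\<lambda>x. w x + c * z x) (\<lambda>x. w1 x + c * z1 x)"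
  unfolding ivp_def
proof (intro ballI conjI)
  fix x assume x: "x \<in> {0..pi}"
  note a = assms(1)[unfolded ivp_def, rule_format, OF x] and b = assms(2)[unfolded ivp_def, rule_format, OF x]
  show "((\<lambda>x. u x + c * v x) has_real_derivative u1 x + c * v1 x) (at x within {0..pi})"
    "((\<lambda>x. w x + c * z x) has_real_derivative w1 x + c * z1 x) (at x within {0..pi})"
    using a b by (auto intro!: DERIV_add DERIV_cmult)
  have "((\<lambda>x. u1 x + c * v1 x) has_real_derivative w x / \<eta> x + c * (z x / \<eta> x)) (at x within {0..pi})"
    "((\<lambda>x. w1 x + c * z1 x) has_real_derivative \<rho> x * (l * u x + h x) + c * (\<rho> x * (l * v x + k x))) (at x within {0..pi})"
    by (intro DERIV_add DERIV_cmult; (use a b in blast))+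
  then show "((\<lambda>x. u1 x + c * v1 x) has_real_derivative (w x + c * z x) / \<eta> x) (at x within {0..pi})"
    "((\<lambda>x. w1 x + c * z1 x) has_real_derivative \<rho> x * (l * (u x + c * v x) + (h x + c * k x))) (at x within {0..pi})"
    by (simp_all add: add_divide_distrib algebra_simps)
qed

lemma coefficient_bounds:
  obtains m r where "m > 0" "r > 0" "\<And>x. x \<in> {0..pi} \<Longrightarrow> 1 / \<eta> x \<le> m" "\<And>x. x \<in> {0..pi} \<Longrightarrow> \<rho> x \<le> r"
    "\<And>x. x \<in> {0..pi} \<Longrightarrow> 1 / \<rho> x \<le> m"
proof -
  have bnd: "\<exists>B. \<forall>x\<in>{0..pi}. f x \<le> B" if "continuous_on {0..pi} f" for f :: "real \<Rightarrow> real"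
    using compact_imp_bounded[OF compact_continuous_image[OF that compact_Icc]]
    unfolding bounded_real by (meson abs_le_D1 imageI)
  have "continuous_on {0..pi} (\<lambda>x. 1 / \<eta> x)"
    by (rule continuous_on_divide[OF continuous_on_const \<eta>_cont]) (simp add: \<eta>_nz)
  then obtain A where A: "\<forall>x\<in>{0..pi}. 1 / \<eta> x \<le> A" using bnd by blast
  have "continuous_on {0..pi} (\<lambda>x. 1 / \<rho> x)"
    by (rule continuous_on_divide[OF continuous_on_const \<rho>_cont]) (simp add: \<rho>_nz)
  then obtain C where C: "\<forall>x\<in>{0..pi}. 1 / \<rho> x \<le> C" using bnd by blast
  obtain B where B: "\<forall>x\<in>{0..pi}. \<rho> x \<le> B" using bnd[OF \<rho>_cont] by blast
  show ?thesis
  proof (rule that[of "\<bar>A\<bar> + (\<bar>C\<bar> + 1)" "\<bar>B\<bar> + 1"])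
    fix x :: real assume x: "x \<in> {0..pi}"
    have "1 / \<eta> x \<le> A" using A x by blast
    then show "1 / \<eta> x \<le> \<bar>A\<bar> + (\<bar>C\<bar> + 1)" by linarith
    have "\<rho> x \<le> B" using B x by blast
    then show "\<rho> x \<le> \<bar>B\<bar> + 1" by linarith
    have "1 / \<rho> x \<le> C" using C x by blast
    then show "1 / \<rho> x \<le> \<bar>A\<bar> + (\<bar>C\<bar> + 1)" by linarith
  qed auto
qed

text \<open>Gronwall's argument: the sum \<open>E\<close> of the four squares satisfies
  \<open>E' \<le> k E + r\<^sup>2 h\<^sup>2\<close>, so the damped energy minus the accumulated
  source, \<open>N\<close>, does not increase.\<close>

lemma ivp_energy:
  obtains C where "C > 0" "\<And>h u u1 w w1 x. continuous_on {0..pi} h \<Longrightarrow> ivp l h u u1 w w1 \<Longrightarrow> x \<in> {0..pi} \<Longrightarrow>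
    (u x)\<^sup>2 + (u1 x)\<^sup>2 + (w x)\<^sup>2 + (w1 x)\<^sup>2
      \<le> C * ((u 0)\<^sup>2 + (u1 0)\<^sup>2 + (w 0)\<^sup>2 + (w1 0)\<^sup>2 + integral {0..pi} (\<lambda>x. (h x)\<^sup>2))"
proof -
  obtain m r where m: "m > 0" "\<And>x. x \<in> {0..pi} \<Longrightarrow> 1 / \<eta> x \<le> m" and r: "r > 0" "\<And>x. x \<in> {0..pi} \<Longrightarrow> \<rho> x \<le> r"
    using coefficient_bounds by metis
  \<comment> \<open>The 3 counts the products \<open>u u1\<close>, \<open>w w1\<close> and
    \<open>w1 \<rho> h\<close>; \<open>m\<close> comes from \<open>u1 w / \<eta>\<close>, and
    \<open>r * \<bar>l\<bar>\<close> from \<open>w1 \<rho> l u\<close>.\<close>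
  define k where "k = 3 + m + r * \<bar>l\<bar>"
  have k: "k > 0" using m r by (simp add: k_def add_pos_nonneg)
  show ?thesis
  proof (rule that[of "exp (k * pi) * (1 + r\<^sup>2)"])
    show "exp (k * pi) * (1 + r\<^sup>2) > 0" by (simp add: add_pos_nonneg)
    fix h u u1 w w1 x
    assume h: "continuous_on {0..pi} h" and sol: "ivp l h u u1 w w1" and x: "x \<in> {0..pi}"
    define E where "E x = (u x)\<^sup>2 + (u1 x)\<^sup>2 + (w x)\<^sup>2 + (w1 x)\<^sup>2" for x
    define E' where "E' x = 2 * u x * u1 x + 2 * u1 x * (w x / \<eta> x) + 2 * w x * w1 x + 2 * w1 x * (\<rho> x * (l * u x + h x))" for x
    define Ih where "Ih x = integral {0..x} (\<lambda>x. (h x)\<^sup>2)" for x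
    have E0: "E y \<ge> 0" for y by (simp add: E_def)
    have dE: "(E has_real_derivative E' y) (at y within {0..pi})" if y: "y \<in> {0..pi}" for y
      unfolding E_def E'_def using sol[unfolded ivp_def, rule_format, OF y]
      by (auto intro!: derivative_eq_intros)
    have dI: "(Ih has_real_derivative (h y)\<^sup>2) (at y within {0..pi})" if y: "y \<in> {0..pi}" for y
      unfolding Ih_def using y by (intro integral_has_real_derivative continuous_intros h)
    have amgm: "2 * a * b \<le> a\<^sup>2 + b\<^sup>2" for a b :: real
      using sum_squares_bound[of a b] by simp
    have E'_le: "E' y \<le> k * E y + r\<^sup>2 * (h y)\<^sup>2" if y: "y \<in> {0..pi}" for y
    proof -
      have 1: "2 * u y * u1 y \<le> E y" using amgm[of "u y" "u1 y"] zero_le_power2[of "w y"] zero_le_power2[of "w1 y"] unfolding E_def by linarith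
      have \<eta>m: "0 \<le> 1 / \<eta> y" "1 / \<eta> y \<le> m" using m \<eta>_pos[OF y] y by (auto intro: less_imp_le)
      have "2 * u1 y * (w y / \<eta> y) = (1 / \<eta> y) * (2 * u1 y * w y)" by simp
      also have "\<dots> \<le> (1 / \<eta> y) * E y"
      proof (rule mult_left_mono[OF _ \<eta>m(1)])
        show "2 * u1 y * w y \<le> E y"
          using amgm[of "u1 y" "w y"] zero_le_power2[of "u y"] zero_le_power2[of "w1 y"] unfolding E_def by linarith
      qed
      also have "\<dots> \<le> m * E y" using \<eta>m E0 by (intro mult_right_mono) auto
      finally have 2: "2 * u1 y * (w y / \<eta> y) \<le> m * E y" .
      have 3: "2 * w y * w1 y \<le> E y" using amgm[of "w y" "w1 y"] zero_le_power2[of "u y"] zero_le_power2[of "u1 y"] unfolding E_def by linarith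
      have \<rho>r: "0 \<le> \<rho> y" "\<rho> y \<le> r" using r \<rho>_pos[OF y] y by (auto intro: less_imp_le)
      have "2 * w1 y * (\<rho> y * (l * u y)) = \<rho> y * l * (2 * w1 y * u y)" by simp
      also have "\<dots> \<le> \<bar>\<rho> y * l\<bar> * \<bar>2 * w1 y * u y\<bar>" by (metis abs_ge_self abs_mult)
      also have "\<dots> \<le> (r * \<bar>l\<bar>) * E y"
      proof (rule mult_mono)
        show "\<bar>\<rho> y * l\<bar> \<le> r * \<bar>l\<bar>" using \<rho>r by (auto simp: abs_mult intro: mult_right_mono)
        have "\<bar>2 * w1 y * u y\<bar> \<le> (w1 y)\<^sup>2 + (u y)\<^sup>2"
          using amgm[of "w1 y" "u y"] amgm[of "w1 y" "- u y"] by (simp add: abs_le_iff)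
        also have "\<dots> \<le> E y" by (simp add: E_def)
        finally show "\<bar>2 * w1 y * u y\<bar> \<le> E y" .
      qed (use r in auto)
      finally have 4: "2 * w1 y * (\<rho> y * (l * u y)) \<le> (r * \<bar>l\<bar>) * E y" .
      have "2 * w1 y * (\<rho> y * h y) \<le> (w1 y)\<^sup>2 + (\<rho> y * h y)\<^sup>2" by (rule amgm)
      also have "(\<rho> y * h y)\<^sup>2 \<le> r\<^sup>2 * (h y)\<^sup>2" using \<rho>r by (auto simp: power_mult_distrib intro!: mult_right_mono power_mono)
      also have "(w1 y)\<^sup>2 \<le> E y" by (simp add: E_def)
      finally have 5: "2 * w1 y * (\<rho> y * h y) \<le> E y + r\<^sup>2 * (h y)\<^sup>2" by simp
      have "E' y = 2 * u y * u1 y + 2 * u1 y * (w y / \<eta> y) + 2 * w y * w1 y + 2 * w1 y * (\<rho> y * (l * u y)) + 2 * w1 y * (\<rho> y * h y)"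
        by (simp add: E'_def algebra_simps)
      then show ?thesis using 1 2 3 4 5 unfolding k_def distrib_right by linarith
    qed
    define N where "N y = E y * exp (- (k * y)) - r\<^sup>2 * Ih y" for y
    have dN: "(N has_real_derivative (E' y - k * E y) * exp (- (k * y)) - r\<^sup>2 * (h y)\<^sup>2) (at y within {0..pi})" if y: "y \<in> {0..pi}" for y
      unfolding N_def by (rule derivative_eq_intros dE[OF y] dI[OF y] refl)+ (simp add: algebra_simps)
    have cN: "continuous_on {0..pi} N" by (rule DERIV_continuous_on[OF dN])
    have "N x \<le> N 0"
    proof (rule DERIV_nonpos_imp_decreasing_open[of 0 x N])
      show "0 \<le> x" using x by simp
    next
      show "continuous_on {0..x} N"
        using x by (intro continuous_on_subset[OF cN]) auto
      fix y assume y: "0 < y" "y < x"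
      then have y': "y \<in> {0..pi}" "y \<in> interior {0..pi}" using x by auto
      have "(N has_real_derivative (E' y - k * E y) * exp (- (k * y)) - r\<^sup>2 * (h y)\<^sup>2) (at y)"
        using dN[OF y'(1)] at_within_interior[OF y'(2)] by simp
      moreover have "(E' y - k * E y) * exp (- (k * y)) \<le> (r\<^sup>2 * (h y)\<^sup>2) * exp (- (k * y))"
        using E'_le[OF y'(1)] by (intro mult_right_mono) auto
      moreover have "(r\<^sup>2 * (h y)\<^sup>2) * exp (- (k * y)) \<le> (r\<^sup>2 * (h y)\<^sup>2) * 1"
        using k y by (intro mult_left_mono) auto
      ultimately show "\<exists>d. (N has_real_derivative d) (at y) \<and> d \<le> 0" by - (rule exI, rule conjI, assumption, linarith)
    qed
    then have le: "E x * exp (- (k * x)) \<le> E 0 + r\<^sup>2 * Ih x" by (simp add: N_def Ih_def)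
    have Ih: "0 \<le> Ih x" "Ih x \<le> Ih pi"
    proof -
      have i: "(\<lambda>x. (h x)\<^sup>2) integrable_on {0..y}" if "y \<in> {0..pi}" for y
        using that by (intro integrable_continuous_interval continuous_intros continuous_on_subset[OF h]) auto
      show "0 \<le> Ih x" unfolding Ih_def using i[OF x] by (intro integral_nonneg) auto
      show "Ih x \<le> Ih pi" unfolding Ih_def using x i by (intro integral_subset_le) auto
    qed
    have "E x = (E x * exp (- (k * x))) * exp (k * x)" by (simp add: mult.assoc exp_add[symmetric])
    also have "\<dots> \<le> ((1 + r\<^sup>2) * (E 0 + Ih pi)) * exp (k * pi)"
    proof (rule mult_mono)
      have "r\<^sup>2 * Ih x \<le> r\<^sup>2 * Ih pi" using Ih by (intro mult_left_mono) auto
      then have "E 0 + r\<^sup>2 * Ih x \<le> (1 + r\<^sup>2) * (E 0 + Ih pi)" using E0[of 0] Ih mult_nonneg_nonneg[OF zero_le_power2[of r] E0[of 0]]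
        unfolding distrib_right distrib_left by linarith
      then show "E x * exp (- (k * x)) \<le> (1 + r\<^sup>2) * (E 0 + Ih pi)" using le by linarith
      show "exp (k * x) \<le> exp (k * pi)" using k x by simp
      show "0 \<le> (1 + r\<^sup>2) * (E 0 + Ih pi)" using E0[of 0] Ih by simp
    qed simp
    finally show "(u x)\<^sup>2 + (u1 x)\<^sup>2 + (w x)\<^sup>2 + (w1 x)\<^sup>2
      \<le> exp (k * pi) * (1 + r\<^sup>2) * ((u 0)\<^sup>2 + (u1 0)\<^sup>2 + (w 0)\<^sup>2 + (w1 0)\<^sup>2 + integral {0..pi} (\<lambda>x. (h x)\<^sup>2))"
      by (simp add: E_def Ih_def mult_ac)
  qed
qed

lemma ivp_unique:
  assumes "ivp l (\<lambda>_. 0) u u1 w w1" "u 0 = 0" "u1 0 = 0" "w 0 = 0" "w1 0 = 0" "x \<in> {0..pi}"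
  shows "u x = 0"
proof -
  have "(u x)\<^sup>2 + (u1 x)\<^sup>2 + (w x)\<^sup>2 + (w1 x)\<^sup>2 \<le> 0"
  proof (rule ivp_energy[of l])
    fix C :: real assume "\<And>h u u1 w w1 x. continuous_on {0..pi} h \<Longrightarrow> ivp l h u u1 w w1 \<Longrightarrow> x \<in> {0..pi} \<Longrightarrow>
      (u x)\<^sup>2 + (u1 x)\<^sup>2 + (w x)\<^sup>2 + (w1 x)\<^sup>2
        \<le> C * ((u 0)\<^sup>2 + (u1 0)\<^sup>2 + (w 0)\<^sup>2 + (w1 0)\<^sup>2 + integral {0..pi} (\<lambda>x. (h x)\<^sup>2))"
    from this[OF continuous_on_const assms(1,6)] show ?thesis using assms by simp
  qed
  then have "(u x)\<^sup>2 \<le> 0" using zero_le_power2[of "u1 x"] zero_le_power2[of "w x"] zero_le_power2[of "w1 x"] by linarith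
  then show ?thesis by simp
qed

text \<open>A contraction for small \<open>l\<close> is enough: the resolvent is only needed at one point outside the
  countable set of eigenvalues.\<close>

lemma ivp_exists:
  obtains l0 where "l0 > 0" "\<And>l h a A B. \<bar>l\<bar> \<le> l0 \<Longrightarrow> continuous_on {0..pi} h \<Longrightarrow>
    \<exists>u u1 w w1. ivp l h u u1 w w1 \<and> u 0 = 0 \<and> u1 0 = a \<and> w 0 = A \<and> w1 0 = B"
proof -
  obtain m r where m: "m > 0" "\<And>x. x \<in> {0..pi} \<Longrightarrow> 1 / \<eta> x \<le> m" and r: "r > 0" "\<And>x. x \<in> {0..pi} \<Longrightarrow> \<rho> x \<le> r"
    using coefficient_bounds by metis
  define I where "I f x = integral {0..x} f" for f :: "real \<Rightarrow> real" and x
  have dI: "(I f has_real_derivative f x) (at x within {0..pi})" if "continuous_on {0..pi} f" "x \<in> {0..pi}" for f x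
    unfolding I_def using that by (intro integral_has_real_derivative)
  have cI: "continuous_on {0..pi} (I f)" if "continuous_on {0..pi} f" for f
    using dI[OF that] by (intro DERIV_continuous_on)
  have bI: "\<bar>I f x - I g x\<bar> \<le> pi * b"
    if f: "continuous_on {0..pi} f" and g: "continuous_on {0..pi} g" and b: "\<And>y. y \<in> {0..pi} \<Longrightarrow> \<bar>f y - g y\<bar> \<le> b" and x: "x \<in> {0..pi}" for f g b x
  proof -
    have b0: "b \<ge> 0" using b[of 0] by (auto intro: order_trans[OF abs_ge_zero])
    have int: "f integrable_on {0..x}" "g integrable_on {0..x}"
      using x by (auto intro!: integrable_continuous_interval continuous_on_subset[OF f] continuous_on_subset[OF g])
    have "I f x - I g x = integral {0..x} (\<lambda>y. f y - g y)"
      unfolding I_def by (rule Henstock_Kurzweil_Integration.integral_diff[OF int, symmetric])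
    also have "norm \<dots> \<le> b * (x - 0)"
      using x b f g by (intro integral_bound continuous_on_diff continuous_on_subset[OF f] continuous_on_subset[OF g]) auto
    also have "\<dots> \<le> pi * b" using x b0 by (subst mult.commute) (intro mult_right_mono, auto)
    finally show ?thesis by simp
  qed
  \<comment> \<open>Four integrations cost a factor \<open>pi\<close> each,
    \<open>1 / \<eta>\<close> costs \<open>m\<close> and \<open>\<rho>\<close> costs
    \<open>r\<close>; this value makes the Lipschitz constant 1/2.\<close>
  define l0 where "l0 = 1 / (2 * (pi * (pi * (r * (pi * (pi * m))))))"
  have l0: "l0 > 0" using m r by (simp add: l0_def)
  show ?thesis
  proof (rule that[OF l0])
    fix l a A B :: real and h :: "real \<Rightarrow> real"
    assume l: "\<bar>l\<bar> \<le> l0" and h: "continuous_on {0..pi} h"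
    \<comment> \<open>\<open>U v\<close> recovers the displacement from the moment \<open>v\<close>,
      and \<open>T\<close> integrates the equation for the moment twice; so a fixed point of
      \<open>T\<close> is the unknown \<open>w\<close>.\<close>
    define U where "U v x = a * x + I (I (\<lambda>y. v y / \<eta> y)) x" for v x
    define T where "T v x = A + B * x + I (I (\<lambda>y. \<rho> y * (l * U v y + h y))) x" for v x
    \<comment> \<open>Clamping the argument extends functions on the interval to bounded continuous
      functions on the line, a complete space.\<close>
    define cl :: "real \<Rightarrow> real" where "cl x = max 0 (min pi x)" for x
    have cl: "cl x \<in> {0..pi}" for x by (auto simp: cl_def)
    have cl_id: "x \<in> {0..pi} \<Longrightarrow> cl x = x" for x by (auto simp: cl_def)
    have cq: "continuous_on {0..pi} (\<lambda>y. v y / \<eta> y)" if "continuous_on {0..pi} v" for v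
      by (intro continuous_on_divide that \<eta>_cont ballI \<eta>_nz)
    have cU: "continuous_on {0..pi} (U v)" if "continuous_on {0..pi} v" for v
      unfolding U_def by (intro continuous_intros cI cq that)
    have cR: "continuous_on {0..pi} (\<lambda>y. \<rho> y * (l * U v y + h y))" if "continuous_on {0..pi} v" for v
      by (intro continuous_intros cU that h \<rho>_cont)
    have cT: "continuous_on {0..pi} (T v)" if "continuous_on {0..pi} v" for v
      unfolding T_def by (intro continuous_intros cI cR that)
    define \<T> :: "(real \<Rightarrow>\<^sub>C real) \<Rightarrow> real \<Rightarrow>\<^sub>C real" where "\<T> v = Bcontfun (\<lambda>x. T (apply_bcontfun v) (cl x))" for v
    have cv: "continuous_on {0..pi} (apply_bcontfun v)" for v :: "real \<Rightarrow>\<^sub>C real"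
      by (rule continuous_on_subset[of UNIV]) (use apply_bcontfun[of v] in \<open>auto simp: bcontfun_def\<close>)
    have \<T>: "apply_bcontfun (\<T> v) x = T (apply_bcontfun v) (cl x)" for v x
    proof -
      have "(\<lambda>x. T (apply_bcontfun v) (cl x)) \<in> bcontfun"
        unfolding bcontfun_def
      proof (intro CollectI conjI)
        have "continuous_on UNIV cl" unfolding cl_def by (intro continuous_intros)
        then show "continuous_on UNIV (\<lambda>x. T (apply_bcontfun v) (cl x))"
          using cl by (intro continuous_on_compose2[OF cT[OF cv]]) auto
        have "bounded (T (apply_bcontfun v) ` {0..pi})"
          by (intro compact_imp_bounded compact_continuous_image cT cv) simp
        then show "bounded (range (\<lambda>x. T (apply_bcontfun v) (cl x)))"
          by (rule bounded_subset) (use cl in auto)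
      qed
      then show ?thesis by (simp add: \<T>_def Bcontfun_inverse)
    qed
    have contr: "dist (\<T> v) (\<T> v') \<le> 1/2 * dist v v'" for v v'
    proof (rule dist_bound)
      fix x
      define d where "d = dist v v'"
      have d: "\<bar>apply_bcontfun v y - apply_bcontfun v' y\<bar> \<le> d" for y
        using dist_bounded[of v y v'] by (simp add: d_def dist_real_def)
      have d0: "d \<ge> 0" by (simp add: d_def)
      have 1: "\<bar>apply_bcontfun v y / \<eta> y - apply_bcontfun v' y / \<eta> y\<bar> \<le> m * d" if y: "y \<in> {0..pi}" for y
      proof -
        have "\<bar>apply_bcontfun v y / \<eta> y - apply_bcontfun v' y / \<eta> y\<bar> = (1 / \<eta> y) * \<bar>apply_bcontfun v y - apply_bcontfun v' y\<bar>"
          using \<eta>_pos[OF y] by (simp add: diff_divide_distrib[symmetric] abs_divide)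
        also have "\<dots> \<le> m * d" using m y d d0 \<eta>_pos[OF y] by (intro mult_mono) auto
        finally show ?thesis .
      qed
      have 2: "\<bar>U v y - U v' y\<bar> \<le> pi * (pi * (m * d))" if y: "y \<in> {0..pi}" for y
        unfolding U_def using bI[OF cI[OF cq[OF cv]] cI[OF cq[OF cv]] bI[OF cq[OF cv] cq[OF cv] 1] y] by simp
      have 3: "\<bar>\<rho> y * (l * U v y + h y) - \<rho> y * (l * U v' y + h y)\<bar> \<le> r * (l0 * (pi * (pi * (m * d))))" if y: "y \<in> {0..pi}" for y
      proof -
        have "\<rho> y * (l * U v y + h y) - \<rho> y * (l * U v' y + h y) = \<rho> y * (l * (U v y - U v' y))" by (simp add: algebra_simps)
        also have "\<bar>\<dots>\<bar> = \<rho> y * (\<bar>l\<bar> * \<bar>U v y - U v' y\<bar>)" using \<rho>_pos[OF y] by (simp add: abs_mult)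
        also have "\<dots> \<le> r * (l0 * (pi * (pi * (m * d))))"
          using r y 2[OF y] l l0 \<rho>_pos[OF y] by (intro mult_mono) auto
        finally show ?thesis .
      qed
      have "\<bar>T v (cl x) - T v' (cl x)\<bar> \<le> pi * (pi * (r * (l0 * (pi * (pi * (m * d))))))"
        unfolding T_def using bI[OF cI[OF cR[OF cv]] cI[OF cR[OF cv]] bI[OF cR[OF cv] cR[OF cv] 3] cl[of x]] by simp
      also have "\<dots> = 1/2 * d" using m r by (simp add: l0_def)
      finally show "dist (apply_bcontfun (\<T> v) x) (apply_bcontfun (\<T> v') x) \<le> 1/2 * dist v v'"
        by (simp add: \<T> dist_real_def d_def)
    qed
    have "\<exists>!v. \<T> v = v" by (rule banach_fix_type[of "1/2"]) (use contr in auto)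
    then obtain v where v: "\<T> v = v" by blast
    have fix_eq: "T v x = v x" if "x \<in> {0..pi}" for x using \<T>[of v x] v cl_id[OF that] by simp
    show "\<exists>u u1 w w1. ivp l h u u1 w w1 \<and> u 0 = 0 \<and> u1 0 = a \<and> w 0 = A \<and> w1 0 = B"
    proof (intro exI conjI)
      define u1 where "u1 x = a + I (\<lambda>y. v y / \<eta> y) x" for x
      define w1 where "w1 x = B + I (\<lambda>y. \<rho> y * (l * U v y + h y)) x" for x
      show "ivp l h (U v) u1 (T v) w1" unfolding ivp_def
      proof (intro ballI conjI)
        fix x assume x: "x \<in> {0..pi}"
        show "(U v has_real_derivative u1 x) (at x within {0..pi})"
          unfolding U_def u1_def by (auto intro!: derivative_eq_intros dI cI cq cv x)
        show "(u1 has_real_derivative T v x / \<eta> x) (at x within {0..pi})"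
          unfolding u1_def fix_eq[OF x] by (auto intro!: derivative_eq_intros dI cI cq cv x)
        show "(T v has_real_derivative w1 x) (at x within {0..pi})"
          unfolding T_def w1_def by (auto intro!: derivative_eq_intros dI cI cR cv x)
        show "(w1 has_real_derivative \<rho> x * (l * U v x + h x)) (at x within {0..pi})"
          unfolding w1_def by (auto intro!: derivative_eq_intros dI cR cv x)
      qed
      show "U v 0 = 0" "u1 0 = a" "T v 0 = A" "w1 0 = B" by (simp_all add: U_def u1_def T_def w1_def I_def)
    qed
  qed
qed

section \<open>From the initial to the boundary value problem\<close>

lemma ivp_zero: "ivp l (\<lambda>_. 0) (\<lambda>_. 0) (\<lambda>_. 0) (\<lambda>_. 0) (\<lambda>_. 0)"
  by (simp add: ivp_def)

lemma ivp_imp_beam_dom: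
  assumes sol: "ivp l h u u1 w w1" and bc: "\<And>x. x \<in> {0, pi} \<Longrightarrow> u x = 0 \<and> \<kappa> x * u1 x + w x / \<eta> x = 0"
  shows "beam_dom u u1 (\<lambda>x. w x / \<eta> x) w1 (\<lambda>x. \<rho> x * (l * u x + h x))"
  unfolding beam_dom_def
proof (intro conjI ballI)
  fix x assume x: "x \<in> {0..pi}"
  note d = sol[unfolded ivp_def, rule_format, OF x]
  show "(u has_vector_derivative u1 x) (at x within {0..pi})"
    "(u1 has_vector_derivative w x / \<eta> x) (at x within {0..pi})"
    "(w1 has_vector_derivative \<rho> x * (l * u x + h x)) (at x within {0..pi})"
    using d by (auto simp: has_real_derivative_iff_has_vector_derivative)
  have "(w has_vector_derivative w1 x) (at x within {0..pi})"
    using d by (auto simp: has_real_derivative_iff_has_vector_derivative)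
  then show "((\<lambda>y. \<eta> y *\<^sub>R (w y / \<eta> y)) has_vector_derivative w1 x) (at x within {0..pi})"
    by (rule has_vector_derivative_transform[OF x, rotated]) (simp add: \<eta>_nz)
qed (use bc in auto)

lemma beam_dom_imp_ivp:
  assumes "beam_dom u u1 u2 w1 w2" "\<And>x. x \<in> {0..pi} \<Longrightarrow> w2 x = \<rho> x * (l * u x + h x)"
  shows "ivp l h u u1 (\<lambda>x. \<eta> x * u2 x) w1"
  using assms \<eta>_nz unfolding beam_dom_def ivp_def
  by (auto simp: has_real_derivative_iff_has_vector_derivative)

lemma derivative_of_zero:
  assumes "\<And>y. y \<in> {0..pi} \<Longrightarrow> f y = (0::real)" "(f has_real_derivative d) (at x within {0..pi})" "x \<in> {0..pi}"
  shows "d = 0"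
proof (rule vector_derivative_unique_within_closed_interval)
  show "(f has_vector_derivative d) (at x within cbox 0 pi)"
    using assms by (simp add: has_real_derivative_iff_has_vector_derivative)
  have "((\<lambda>_. 0) has_vector_derivative 0) (at x within {0..pi})" by simp
  then show "(f has_vector_derivative 0) (at x within cbox 0 pi)"
    using has_vector_derivative_transform[OF assms(3) assms(1)] by simp
qed (use assms in auto)

lemma linear_2x2:
  fixes a b c d :: real
  shows "(\<exists>x y. (x \<noteq> 0 \<or> y \<noteq> 0) \<and> x * a + y * b = 0 \<and> x * c + y * d = 0) \<or> a * d - b * c \<noteq> 0"
proof (cases "a * d - b * c = 0")
  case True
  consider "a \<noteq> 0 \<or> b \<noteq> 0" | "c \<noteq> 0 \<or> d \<noteq> 0" | "a = 0" "b = 0" "c = 0" "d = 0" by blast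
  then show ?thesis
  proof cases
    case 1
    then show ?thesis using True by (intro disjI1 exI[of _ b] exI[of _ "- a"]) (auto simp: algebra_simps)
  next
    case 2
    then show ?thesis using True by (intro disjI1 exI[of _ d] exI[of _ "- c"]) (auto simp: algebra_simps)
  next
    case 3
    then show ?thesis by (intro disjI1 exI[of _ 1]) auto
  qed
qed simp

text \<open>Shooting: \<open>U\<close> and \<open>V\<close> span the homogeneous solutions that satisfy the conditions at \<open>0\<close>, and \<open>D\<close> is
  the determinant of the conditions at \<open>\<pi>\<close>.\<close>

lemma bvp_exists:
  assumes ex: "\<And>h a A B. continuous_on {0..pi} h \<Longrightarrow>
      \<exists>u u1 w w1. ivp l h u u1 w w1 \<and> u 0 = 0 \<and> u1 0 = a \<and> w 0 = A \<and> w1 0 = B"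
    and inj: "\<And>u u1 u2 w1 x. beam_dom u u1 u2 w1 (\<lambda>x. \<rho> x * (l * u x)) \<Longrightarrow> x \<in> {0..pi} \<Longrightarrow> u x = 0"
  obtains C where "C > 0" "\<And>h. continuous_on {0..pi} h \<Longrightarrow>
      \<exists>u u1 u2 w1. beam_dom u u1 u2 w1 (\<lambda>x. \<rho> x * (l * u x + h x)) \<and>
        (\<forall>x\<in>{0..pi}. (u x)\<^sup>2 + (u1 x)\<^sup>2 \<le> C * integral {0..pi} (\<lambda>x. (h x)\<^sup>2))"
proof -
  \<comment> \<open>The initial moment \<open>- \<kappa> 0 * \<eta> 0\<close> is the boundary
    condition at 0 for slope 1.\<close>
  obtain U U1 UW UW1 where U: "ivp l (\<lambda>_. 0) U U1 UW UW1" "U 0 = 0" "U1 0 = 1" "UW 0 = - \<kappa> 0 * \<eta> 0" "UW1 0 = 0"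
    using ex[of "\<lambda>_. 0" 1 "- \<kappa> 0 * \<eta> 0" 0] by auto
  obtain V V1 VW VW1 where V: "ivp l (\<lambda>_. 0) V V1 VW VW1" "V 0 = 0" "V1 0 = 0" "VW 0 = 0" "VW1 0 = 1"
    using ex[of "\<lambda>_. 0" 0 0 1] by auto
  define Lb where "Lb u1 w = \<kappa> pi * u1 pi + w pi / \<eta> pi" for u1 w :: "real \<Rightarrow> real"
  define D where "D = U pi * Lb V1 VW - V pi * Lb U1 UW"
  have dom: "beam_dom u u1 (\<lambda>x. w x / \<eta> x) w1 (\<lambda>x. \<rho> x * (l * u x + h x))"
    if "ivp l h u u1 w w1" "u 0 = 0" "w 0 = - \<kappa> 0 * \<eta> 0 * u1 0" "u pi = 0" "Lb u1 w = 0" for h u u1 w w1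
    by (rule ivp_imp_beam_dom) (use that \<eta>_nz[of 0] in \<open>auto simp: Lb_def\<close>)
  \<comment> \<open>A zero determinant would give a combination of \<open>U\<close> and
    \<open>V\<close> that meets all boundary conditions. By \<open>inj\<close> it vanishes, and so
    do its initial slope and \<open>w1 0\<close>, which are the coefficients of the
    combination.\<close>
  have D: "D \<noteq> 0"
  proof (rule ccontr)
    assume "\<not> D \<noteq> 0"
    then obtain a b where ab: "a \<noteq> 0 \<or> b \<noteq> 0" "a * U pi + b * V pi = 0" "a * Lb U1 UW + b * Lb V1 VW = 0"
      using linear_2x2[of "U pi" "V pi" "Lb U1 UW" "Lb V1 VW"] by (auto simp: D_def)
    define u u1 w w1 where "u x = a * U x + b * V x" and "u1 x = a * U1 x + b * V1 x"
      and "w x = a * UW x + b * VW x" and "w1 x = a * UW1 x + b * VW1 x" for x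
    have sol: "ivp l (\<lambda>_. 0) u u1 w w1"
      using ivp_add_scaled[OF ivp_add_scaled[OF ivp_zero U(1), of a] V(1), of b]
      by (simp add: u_def[abs_def] u1_def[abs_def] w_def[abs_def] w1_def[abs_def])
    have "beam_dom u u1 (\<lambda>x. w x / \<eta> x) w1 (\<lambda>x. \<rho> x * (l * u x + 0))"
      by (rule dom[OF sol]) (use U V ab in \<open>auto simp: u_def u1_def w_def Lb_def algebra_simps add_divide_distrib\<close>)
    then have u0: "u x = 0" if "x \<in> {0..pi}" for x using inj that by simp
    note d = sol[unfolded ivp_def, rule_format]
    have u10: "u1 x = 0" if "x \<in> {0..pi}" for x using derivative_of_zero[of u, OF u0 _ that] d[OF that] by blast
    have "w x / \<eta> x = 0" if "x \<in> {0..pi}" for x using derivative_of_zero[of u1, OF u10 _ that] d[OF that] by blast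
    then have w0: "w x = 0" if "x \<in> {0..pi}" for x using \<eta>_nz that by fastforce
    have "w1 x = 0" if "x \<in> {0..pi}" for x using derivative_of_zero[of w, OF w0 _ that] d[OF that] by blast
    then have "w1 0 = 0" "u1 0 = 0" using u10 by auto
    then show False using ab(1) U V by (simp add: u1_def w1_def)
  qed
  show ?thesis
  proof (rule ivp_energy[of l])
    fix C :: real assume C: "C > 0" and en: "\<And>h u u1 w w1 x. continuous_on {0..pi} h \<Longrightarrow> ivp l h u u1 w w1 \<Longrightarrow> x \<in> {0..pi} \<Longrightarrow>
      (u x)\<^sup>2 + (u1 x)\<^sup>2 + (w x)\<^sup>2 + (w1 x)\<^sup>2
        \<le> C * ((u 0)\<^sup>2 + (u1 0)\<^sup>2 + (w 0)\<^sup>2 + (w1 0)\<^sup>2 + integral {0..pi} (\<lambda>x. (h x)\<^sup>2))"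
    define c2 where "c2 = \<bar>\<kappa> pi\<bar> + 1 / \<eta> pi"
    have c2: "c2 \<ge> 0" using \<eta>_pos[of pi] by (simp add: c2_def add_nonneg_nonneg less_imp_le)
    \<comment> \<open>Bounds on the coefficients from Cramer's rule, relative to the bound
      \<open>s\<close> for the particular solution at the right end.\<close>
    define ka kb where "ka = (\<bar>Lb V1 VW\<bar> + c2 * \<bar>V pi\<bar>) / \<bar>D\<bar>" and "kb = (c2 * \<bar>U pi\<bar> + \<bar>Lb U1 UW\<bar>) / \<bar>D\<bar>"
    define k where "k = (1 + (\<kappa> 0 * \<eta> 0)\<^sup>2) * ka\<^sup>2 + kb\<^sup>2"
    have k: "k \<ge> 0" by (simp add: k_def)
    show ?thesis
    proof (rule that[of "C * (k * C + 1)"])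
      show "C * (k * C + 1) > 0" using C k by (simp add: add_nonneg_pos)
      fix h :: "real \<Rightarrow> real" assume h: "continuous_on {0..pi} h"
      define I where "I = integral {0..pi} (\<lambda>x. (h x)\<^sup>2)"
      have I: "I \<ge> 0" unfolding I_def by (intro integral_nonneg integrable_continuous_interval continuous_intros h) auto
      obtain P P1 PW PW1 where P: "ivp l h P P1 PW PW1" "P 0 = 0" "P1 0 = 0" "PW 0 = 0" "PW1 0 = 0"
        using ex[OF h, of 0 0 0] by auto
      define s where "s = sqrt (C * I)"
      have s: "s \<ge> 0" "s\<^sup>2 = C * I" using C I by (simp_all add: s_def)
      have eP: "(P pi)\<^sup>2 + (P1 pi)\<^sup>2 + (PW pi)\<^sup>2 + (PW1 pi)\<^sup>2 \<le> s\<^sup>2"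
        using en[OF h P(1), of pi] P(2-5) by (simp add: s I_def)
      have "\<bar>y\<bar> \<le> s" if "y\<^sup>2 \<le> s\<^sup>2" for y using that s(1) abs_le_square_iff[of y s] by simp
      moreover have "(P pi)\<^sup>2 \<le> s\<^sup>2" "(P1 pi)\<^sup>2 \<le> s\<^sup>2" "(PW pi)\<^sup>2 \<le> s\<^sup>2"
        using eP zero_le_power2[of "P pi"] zero_le_power2[of "P1 pi"] zero_le_power2[of "PW pi"] zero_le_power2[of "PW1 pi"] by linarith+
      ultimately have Ps: "\<bar>P pi\<bar> \<le> s" "\<bar>P1 pi\<bar> \<le> s" "\<bar>PW pi\<bar> \<le> s" by auto
      have LbP: "\<bar>Lb P1 PW\<bar> \<le> c2 * s"
      proof -
        have "\<bar>Lb P1 PW\<bar> \<le> \<bar>\<kappa> pi * P1 pi\<bar> + \<bar>PW pi / \<eta> pi\<bar>" unfolding Lb_def by (rule abs_triangle_ineq)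
        also have "\<dots> \<le> \<bar>\<kappa> pi\<bar> * s + s / \<eta> pi"
          using Ps \<eta>_pos[of pi] by (intro add_mono) (auto simp: abs_mult abs_divide intro!: mult_left_mono divide_right_mono)
        finally show ?thesis by (simp add: c2_def distrib_right)
      qed
      \<comment> \<open>Cramer's rule: \<open>a U + b V\<close> cancels the boundary defect of the
        particular solution \<open>P\<close> at \<open>pi\<close>.\<close>
      define a b where "a = - (P pi * Lb V1 VW - Lb P1 PW * V pi) / D" and "b = - (U pi * Lb P1 PW - Lb U1 UW * P pi) / D"
      have absa: "\<bar>a\<bar> \<le> ka * s"
      proof -
        have "\<bar>P pi * Lb V1 VW - Lb P1 PW * V pi\<bar> \<le> \<bar>P pi\<bar> * \<bar>Lb V1 VW\<bar> + \<bar>Lb P1 PW\<bar> * \<bar>V pi\<bar>"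
          by (metis abs_mult abs_triangle_ineq4)
        also have "\<dots> \<le> s * \<bar>Lb V1 VW\<bar> + c2 * s * \<bar>V pi\<bar>" using Ps LbP by (intro add_mono mult_right_mono) auto
        finally have "\<bar>a\<bar> \<le> (s * \<bar>Lb V1 VW\<bar> + c2 * s * \<bar>V pi\<bar>) / \<bar>D\<bar>"
          unfolding a_def abs_divide abs_minus_cancel by (intro divide_right_mono) auto
        then show ?thesis by (simp add: ka_def algebra_simps)
      qed
      have absb: "\<bar>b\<bar> \<le> kb * s"
      proof -
        have "\<bar>U pi * Lb P1 PW - Lb U1 UW * P pi\<bar> \<le> \<bar>U pi\<bar> * \<bar>Lb P1 PW\<bar> + \<bar>Lb U1 UW\<bar> * \<bar>P pi\<bar>"
          by (metis abs_mult abs_triangle_ineq4)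
        also have "\<dots> \<le> \<bar>U pi\<bar> * (c2 * s) + \<bar>Lb U1 UW\<bar> * s" using Ps LbP by (intro add_mono mult_left_mono) auto
        finally have "\<bar>b\<bar> \<le> (\<bar>U pi\<bar> * (c2 * s) + \<bar>Lb U1 UW\<bar> * s) / \<bar>D\<bar>"
          unfolding b_def abs_divide abs_minus_cancel by (intro divide_right_mono) auto
        then show ?thesis by (simp add: kb_def algebra_simps)
      qed
      define u u1 w w1 where "u x = P x + a * U x + b * V x" and "u1 x = P1 x + a * U1 x + b * V1 x"
        and "w x = PW x + a * UW x + b * VW x" and "w1 x = PW1 x + a * UW1 x + b * VW1 x" for x
      have sol: "ivp l h u u1 w w1"
        using ivp_add_scaled[OF ivp_add_scaled[OF P(1) U(1), of a] V(1), of b]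
        by (simp add: u_def[abs_def] u1_def[abs_def] w_def[abs_def] w1_def[abs_def])
      have "u pi = 0 \<and> Lb u1 w = 0"
      proof
        have "D * u pi = D * P pi + (D * a) * U pi + (D * b) * V pi" by (simp add: u_def algebra_simps)
        also have "\<dots> = 0" using D by (simp add: a_def b_def) (simp add: D_def algebra_simps)
        finally show "u pi = 0" using D by simp
        have "Lb u1 w = Lb P1 PW + a * Lb U1 UW + b * Lb V1 VW"
          by (simp add: Lb_def u1_def w_def algebra_simps add_divide_distrib)
        then have "D * Lb u1 w = D * Lb P1 PW + (D * a) * Lb U1 UW + (D * b) * Lb V1 VW" by (simp add: algebra_simps)
        also have "\<dots> = 0" using D by (simp add: a_def b_def) (simp add: D_def algebra_simps)
        finally show "Lb u1 w = 0" using D by simp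
      qed
      then have bd: "beam_dom u u1 (\<lambda>x. w x / \<eta> x) w1 (\<lambda>x. \<rho> x * (l * u x + h x))"
        by (intro dom[OF sol]) (use P U V in \<open>auto simp: u_def u1_def w_def\<close>)
      have bound: "(u x)\<^sup>2 + (u1 x)\<^sup>2 \<le> C * (k * C + 1) * I" if x: "x \<in> {0..pi}" for x
      proof -
        have init: "(u 0)\<^sup>2 + (u1 0)\<^sup>2 + (w 0)\<^sup>2 + (w1 0)\<^sup>2 = (1 + (\<kappa> 0 * \<eta> 0)\<^sup>2) * a\<^sup>2 + b\<^sup>2"
          using P U V by (simp add: u_def u1_def w_def w1_def power_mult_distrib algebra_simps)
        have "a\<^sup>2 \<le> ka\<^sup>2 * s\<^sup>2" "b\<^sup>2 \<le> kb\<^sup>2 * s\<^sup>2"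
          using power_mono[OF absa, of 2] power_mono[OF absb, of 2] by (simp_all add: power_mult_distrib)
        then have "(1 + (\<kappa> 0 * \<eta> 0)\<^sup>2) * a\<^sup>2 + b\<^sup>2 \<le> (1 + (\<kappa> 0 * \<eta> 0)\<^sup>2) * (ka\<^sup>2 * s\<^sup>2) + kb\<^sup>2 * s\<^sup>2"
          by (intro add_mono mult_left_mono) auto
        also have "\<dots> = k * (C * I)" by (simp add: k_def s(2) algebra_simps)
        finally have i: "(1 + (\<kappa> 0 * \<eta> 0)\<^sup>2) * a\<^sup>2 + b\<^sup>2 \<le> k * (C * I)" .
        have "(u x)\<^sup>2 + (u1 x)\<^sup>2 \<le> (u x)\<^sup>2 + (u1 x)\<^sup>2 + (w x)\<^sup>2 + (w1 x)\<^sup>2" by simp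
        also have "\<dots> \<le> C * ((1 + (\<kappa> 0 * \<eta> 0)\<^sup>2) * a\<^sup>2 + b\<^sup>2 + I)"
          using en[OF h sol x] unfolding init I_def .
        also have "\<dots> \<le> C * (k * (C * I) + I)" using i C by (intro mult_left_mono) auto
        finally show ?thesis by (simp add: algebra_simps)
      qed
      show "\<exists>u u1 u2 w1. beam_dom u u1 u2 w1 (\<lambda>x. \<rho> x * (l * u x + h x)) \<and>
        (\<forall>x\<in>{0..pi}. (u x)\<^sup>2 + (u1 x)\<^sup>2 \<le> C * (k * C + 1) * integral {0..pi} (\<lambda>x. (h x)\<^sup>2))"
        using bd bound unfolding I_def by blast
    qed
  qed
qed

end

section \<open>Eigenfunction expansion\<close>

context beam
begin

definition eigen :: "real \<Rightarrow> (real \<Rightarrow> real) \<Rightarrow> bool" where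
  "eigen \<nu> u \<longleftrightarrow> (\<exists>u1 u2 w1. beam_dom u u1 u2 w1 (\<lambda>x. \<nu> * (\<rho> x * u x)))"

lemma beam_dom_scale:
  assumes "beam_dom u u1 u2 w1 w2"
  shows "beam_dom (\<lambda>x. c *\<^sub>R u x) (\<lambda>x. c *\<^sub>R u1 x) (\<lambda>x. c *\<^sub>R u2 x) (\<lambda>x. c *\<^sub>R w1 x) (\<lambda>x. c *\<^sub>R w2 x)"
proof -
  have "beam_dom (\<lambda>_. 0) (\<lambda>_. 0) (\<lambda>_. 0) (\<lambda>_. 0) (\<lambda>_. 0 :: 'a)" by (simp add: beam_dom_def)
  from beam_dom_add_scaled[OF this assms, of c] show ?thesis by simp
qed

lemma sqrt_\<rho>: "x \<in> {0..pi} \<Longrightarrow> sqrt (\<rho> x) > 0" "x \<in> {0..pi} \<Longrightarrow> sqrt (\<rho> x) * sqrt (\<rho> x) = \<rho> x"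
    "continuous_on {0..pi} (\<lambda>x. sqrt (\<rho> x))"
  using \<rho>_pos[of x] by (auto intro!: continuous_intros \<rho>_cont)

text \<open>Conjugation with \<open>sqrt \<rho>\<close> turns the solution operator, which is symmetric for the weight \<open>\<rho>\<close>, into
  an operator \<open>K\<close> that is symmetric without weight.\<close>

lemma eigenfunction_expansion_aux:
  assumes bound: "C > 0" "\<And>h. continuous_on {0..pi} h \<Longrightarrow>
      \<exists>u u1 u2 w1. beam_dom u u1 u2 w1 (\<lambda>x. \<rho> x * (l * u x + h x)) \<and>
        (\<forall>x\<in>{0..pi}. (u x)\<^sup>2 + (u1 x)\<^sup>2 \<le> C * integral {0..pi} (\<lambda>x. (h x)\<^sup>2))"
    and inj: "\<And>u u1 u2 w1 x. beam_dom u u1 u2 w1 (\<lambda>x. \<rho> x * (l * u x)) \<Longrightarrow> x \<in> {0..pi} \<Longrightarrow> u x = 0"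
  obtains \<B> :: "cpi set" and e \<nu> where
    "\<And>b. b \<in> \<B> \<Longrightarrow> eigen (\<nu> b) (e b)" 
    "\<And>b c. b \<in> \<B> \<Longrightarrow> c \<in> \<B> \<Longrightarrow> integral {0..pi} (\<lambda>x. \<rho> x * (e b x * e c x)) = (if b = c then 1 else 0)"
    "\<And>r. finite {b \<in> \<B>. \<bar>\<nu> b\<bar> \<le> r}"
    "\<And>u u1 u2 w1 w2 \<delta>. beam_dom u u1 u2 w1 w2 \<Longrightarrow> continuous_on {0..pi} w2 \<Longrightarrow> \<delta> > 0 \<Longrightarrow>
      \<exists>F c. finite F \<and> F \<subseteq> \<B> \<and> integral {0..pi} (\<lambda>x. \<rho> x * (u x - (\<Sum>b\<in>F. c b * e b x))\<^sup>2) < \<delta>"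
proof -
  obtain m r where m: "m > 0" and r: "r > 0" "\<And>x. x \<in> {0..pi} \<Longrightarrow> \<rho> x \<le> r" "\<And>x. x \<in> {0..pi} \<Longrightarrow> 1 / \<rho> x \<le> m"
    using coefficient_bounds by metis
  \<comment> \<open>The unweighted inner product of \<open>X\<close> is the weighted inner product
    of \<open>h X\<close>.\<close>
  define h where "h X x = fun_of X x / sqrt (\<rho> x)" for X x
  have hc: "continuous_on {0..pi} (h X)" for X
    unfolding h_def using sqrt_\<rho>(1) by (intro continuous_on_divide continuous_fun_of sqrt_\<rho>(3) ballI) force
  have fun_h: "fun_of X x = sqrt (\<rho> x) * h X x" if "x \<in> {0..pi}" for X x
    using sqrt_\<rho>(1)[OF that] by (simp add: h_def)
  define Q where "Q X u \<longleftrightarrow> (\<exists>u1 u2 w1. beam_dom u u1 u2 w1 (\<lambda>x. \<rho> x * (l * u x + h X x)) \<and>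
        (\<forall>x\<in>{0..pi}. (u x)\<^sup>2 + (u1 x)\<^sup>2 \<le> C * integral {0..pi} (\<lambda>x. (h X x)\<^sup>2)))" for X u
  define S where "S X = (SOME u. Q X u)" for X
  have QS: "Q X (S X)" for X
  proof -
    have "\<exists>u. Q X u" using bound(2)[OF hc[of X]] unfolding Q_def .
    then show ?thesis unfolding S_def by (rule someI_ex)
  qed
  have dom: "\<exists>u1 u2 w1. beam_dom (S X) u1 u2 w1 (\<lambda>x. \<rho> x * (l * S X x + h X x))" for X
    using QS[of X] unfolding Q_def by blast
  have Sc: "continuous_on {0..pi} (S X)" for X using dom[of X] beam_dom_continuous(1) by blast
  have uniq: "u x = S X x" if u: "beam_dom u u1 u2 w1 w2" "\<And>x. x \<in> {0..pi} \<Longrightarrow> w2 x = \<rho> x * (l * u x + h X x)"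
    and x: "x \<in> {0..pi}" for u u1 u2 w1 w2 X x
  proof -
    obtain v1 v2 z1 where v: "beam_dom (S X) v1 v2 z1 (\<lambda>x. \<rho> x * (l * S X x + h X x))" using dom by blast
    have "beam_dom (\<lambda>x. u x + (-1) *\<^sub>R S X x) (\<lambda>x. u1 x + (-1) *\<^sub>R v1 x) (\<lambda>x. u2 x + (-1) *\<^sub>R v2 x) (\<lambda>x. w1 x + (-1) *\<^sub>R z1 x)
        (\<lambda>x. \<rho> x * (l * (u x + (-1) *\<^sub>R S X x)))"
      by (rule beam_dom_cong[OF beam_dom_add_scaled[OF u(1) v]]) (simp add: u(2) algebra_simps)
    from inj[OF this x] show ?thesis by simp
  qed
  have Klin: "S (X + c *\<^sub>R Y) x = S X x + c * S Y x" if x: "x \<in> {0..pi}" for X Y c x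
  proof -
    obtain u1 u2 w1 where u: "beam_dom (S X) u1 u2 w1 (\<lambda>x. \<rho> x * (l * S X x + h X x))" using dom by blast
    obtain v1 v2 z1 where v: "beam_dom (S Y) v1 v2 z1 (\<lambda>x. \<rho> x * (l * S Y x + h Y x))" using dom by blast
    have "S X x + c *\<^sub>R S Y x = S (X + c *\<^sub>R Y) x"
      by (rule uniq[OF beam_dom_add_scaled[OF u v] _ x])
        (simp add: h_def plus_cpi.rep_eq scaleR_cpi.rep_eq algebra_simps add_divide_distrib)
    then show ?thesis by simp
  qed
  define K where "K X = cpi_of (\<lambda>x. sqrt (\<rho> x) * S X x)" for X
  have Kf: "fun_of (K X) x = sqrt (\<rho> x) * S X x" if "x \<in> {0..pi}" for X x
  proof -
    have "continuous_on {0..pi} (\<lambda>x. sqrt (\<rho> x) * S X x)" by (rule continuous_on_mult[OF sqrt_\<rho>(3) Sc])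
    from fun_of_cpi_of[OF this that] show ?thesis by (simp only: K_def)
  qed
  have inner_K: "inner (K X) Y = integral {0..pi} (\<lambda>x. S X x * (\<rho> x * h Y x))" for X Y
  proof -
    have "fun_of (K X) x * fun_of Y x = S X x * (\<rho> x * h Y x)" if x: "x \<in> {0..pi}" for x
    proof -
      have "fun_of (K X) x * fun_of Y x = (sqrt (\<rho> x) * sqrt (\<rho> x)) * (S X x * h Y x)"
        unfolding Kf[OF x] fun_h[OF x, of Y] by (simp only: mult_ac)
      then show ?thesis unfolding sqrt_\<rho>(2)[OF x] by (simp only: mult_ac)
    qed
    then show ?thesis unfolding inner_cpi_def by (rule integral_cong)
  qed
  have Klinear: "linear K"
  proof (rule linearI)
    show "K (X + Y) = K X + K Y" for X Y
      by (rule cpi_eqI) (use Klin[of _ X 1 Y] in \<open>simp add: Kf plus_cpi.rep_eq algebra_simps\<close>)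
    have S0: "S 0 x = 0" if "x \<in> {0..pi}" for x using Klin[of x 0 1 0] that by simp
    show "K (c *\<^sub>R X) = c *\<^sub>R K X" for c X
      by (rule cpi_eqI) (use Klin[of _ 0 c X] S0 in \<open>simp add: Kf scaleR_cpi.rep_eq algebra_simps\<close>)
  qed
  \<comment> \<open>In Lagrange's identity the terms with \<open>l\<close> are symmetric in the two
    solutions and cancel; what is left is the symmetry of the solution operator.\<close>
  have Ksym: "inner (K X) Y = inner X (K Y)" for X Y
  proof -
    obtain u1 u2 w1 where u: "beam_dom (S X) u1 u2 w1 (\<lambda>x. \<rho> x * (l * S X x + h X x))" using dom by blast
    obtain v1 v2 z1 where v: "beam_dom (S Y) v1 v2 z1 (\<lambda>x. \<rho> x * (l * S Y x + h Y x))" using dom by blast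
    have c: "continuous_on {0..pi} (\<lambda>x. \<rho> x * (l * S X x + h X x))" for X
      by (intro continuous_intros \<rho>_cont Sc hc)
    have i: "(\<lambda>x. S X x * (\<rho> x * h Y x)) integrable_on {0..pi}" "(\<lambda>x. l * (\<rho> x * (S X x * S Y x))) integrable_on {0..pi}" for X Y
      by (intro integrable_continuous_interval continuous_intros \<rho>_cont Sc hc)+
    have "integral {0..pi} (\<lambda>x. S X x * (\<rho> x * h Y x) + l * (\<rho> x * (S X x * S Y x)))
        = integral {0..pi} (\<lambda>x. S Y x * (\<rho> x * h X x) + l * (\<rho> x * (S Y x * S X x)))"
      using beam_dom_symmetric[OF u v c c] by (simp add: algebra_simps)
    then have "integral {0..pi} (\<lambda>x. S X x * (\<rho> x * h Y x)) + integral {0..pi} (\<lambda>x. l * (\<rho> x * (S X x * S Y x)))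
        = integral {0..pi} (\<lambda>x. S Y x * (\<rho> x * h X x)) + integral {0..pi} (\<lambda>x. l * (\<rho> x * (S Y x * S X x)))"
      by (simp only: Henstock_Kurzweil_Integration.integral_add[OF i])
    then have "integral {0..pi} (\<lambda>x. S X x * (\<rho> x * h Y x)) = integral {0..pi} (\<lambda>x. S Y x * (\<rho> x * h X x))"
      by (simp add: mult.commute[of "S Y _" "S X _"])
    then show ?thesis using inner_K[of X Y] inner_K[of Y X] by (simp add: inner_commute)
  qed
  \<comment> \<open>The bound on solutions and their slopes makes them uniformly bounded and
    equi-Lipschitz. Arzela-Ascoli gives uniform convergence, which implies convergence in the norm
    of the space.\<close>
  have Kcpt: "\<exists>k y. strict_mono (k :: nat \<Rightarrow> nat) \<and> (\<lambda>n. K (X (k n))) \<longlonglongrightarrow> y" if X: "\<And>n. norm (X n) \<le> 1" for X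
  proof -
    define B where "B = sqrt (C * m)"
    have B: "B > 0" "B\<^sup>2 = C * m" using bound(1) m by (simp_all add: B_def)
    have hI: "integral {0..pi} (\<lambda>x. (h (X n) x)\<^sup>2) \<le> m" for n
    proof -
      have "integral {0..pi} (\<lambda>x. (h (X n) x)\<^sup>2) \<le> integral {0..pi} (\<lambda>x. m * (fun_of (X n) x * fun_of (X n) x))"
      proof (rule integral_le)
        fix x assume x: "x \<in> {0..pi}"
        have "(h (X n) x)\<^sup>2 = (1 / \<rho> x) * (fun_of (X n) x * fun_of (X n) x)"
          using \<rho>_pos[OF x] by (simp add: h_def power_divide power2_eq_square)
        also have "\<dots> \<le> m * (fun_of (X n) x * fun_of (X n) x)" using r(3)[OF x] by (intro mult_right_mono) auto
        finally show "(h (X n) x)\<^sup>2 \<le> m * (fun_of (X n) x * fun_of (X n) x)" .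
      qed (intro integrable_continuous_interval continuous_intros hc)+
      also have "\<dots> = m * (norm (X n))\<^sup>2" by (simp add: power2_norm_eq_inner inner_cpi_def)
      also have "\<dots> \<le> m * 1" using m X[of n] by (intro mult_left_mono power_le_one) auto
      finally show ?thesis by simp
    qed
    have bnd: "\<exists>u1 u2 w1. beam_dom (S (X n)) u1 u2 w1 (\<lambda>x. \<rho> x * (l * S (X n) x + h (X n) x)) \<and>
      (\<forall>x\<in>{0..pi}. \<bar>S (X n) x\<bar> \<le> B \<and> \<bar>u1 x\<bar> \<le> B)" for n
    proof -
      obtain u1 u2 w1 where u: "beam_dom (S (X n)) u1 u2 w1 (\<lambda>x. \<rho> x * (l * S (X n) x + h (X n) x))"
        and le: "\<And>x. x \<in> {0..pi} \<Longrightarrow> (S (X n) x)\<^sup>2 + (u1 x)\<^sup>2 \<le> C * integral {0..pi} (\<lambda>x. (h (X n) x)\<^sup>2)"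
        using QS[of "X n"] unfolding Q_def by blast
      have "\<bar>S (X n) x\<bar> \<le> B \<and> \<bar>u1 x\<bar> \<le> B" if x: "x \<in> {0..pi}" for x
      proof -
        have "(S (X n) x)\<^sup>2 + (u1 x)\<^sup>2 \<le> B\<^sup>2"
          using le[OF x] mult_left_mono[OF hI[of n], of C] bound(1) B(2) by linarith
        then have "(S (X n) x)\<^sup>2 \<le> B\<^sup>2" "(u1 x)\<^sup>2 \<le> B\<^sup>2"
          using zero_le_power2[of "S (X n) x"] zero_le_power2[of "u1 x"] by linarith+
        then show ?thesis using B(1) abs_le_square_iff[of _ B] by (metis abs_of_pos)
      qed
      then show ?thesis using u by blast
    qed
    have lip: "\<bar>S (X n) x - S (X n) y\<bar> \<le> B * \<bar>x - y\<bar>" if "x \<in> {0..pi}" "y \<in> {0..pi}" for n x y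
    proof -
      obtain u1 u2 w1 where u: "beam_dom (S (X n)) u1 u2 w1 (\<lambda>x. \<rho> x * (l * S (X n) x + h (X n) x))"
        and le: "\<And>x. x \<in> {0..pi} \<Longrightarrow> \<bar>u1 x\<bar> \<le> B" using bnd[of n] by blast
      have "norm (S (X n) x - S (X n) y) \<le> B * norm (x - y)"
      proof (rule field_differentiable_bound[of "{0..pi}" _ u1])
        show "(S (X n) has_field_derivative u1 z) (at z within {0..pi})" if "z \<in> {0..pi}" for z
          using u that unfolding beam_dom_def has_real_derivative_iff_has_vector_derivative by blast
      qed (use that le in auto)
      then show ?thesis by simp
    qed
    have Bn: "norm (S (X n) x) \<le> B" if "x \<in> {0..pi}" for n x using bnd[of n] that by auto
    have eq: "\<exists>d. 0 < d \<and> (\<forall>n y. y \<in> {0..pi} \<and> norm (x - y) < d \<longrightarrow> norm (S (X n) x - S (X n) y) < \<epsilon>)"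
      if x: "x \<in> {0..pi}" and \<epsilon>: "0 < \<epsilon>" for x \<epsilon>
    proof (intro exI[of _ "\<epsilon> / B"] conjI allI impI)
      show "0 < \<epsilon> / B" using \<epsilon> B by simp
      fix n y assume y: "y \<in> {0..pi} \<and> norm (x - y) < \<epsilon> / B"
      have "\<bar>S (X n) x - S (X n) y\<bar> \<le> B * \<bar>x - y\<bar>" using lip x y by blast
      also have "\<dots> < \<epsilon>" using y B by (simp add: field_simps)
      finally show "norm (S (X n) x - S (X n) y) < \<epsilon>" by simp
    qed
    obtain g k where g: "continuous_on {0..pi} g" and k: "strict_mono (k :: nat \<Rightarrow> nat)"
      and lim: "\<And>e. 0 < e \<Longrightarrow> \<exists>N. \<forall>n x. n \<ge> N \<and> x \<in> {0..pi} \<longrightarrow> norm (S (X (k n)) x - g x) < e"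
      using Arzela_Ascoli[of "{0..pi}" "\<lambda>n. S (X n)" B, OF compact_Icc Bn eq] by blast
    define Y where "Y = cpi_of (\<lambda>x. sqrt (\<rho> x) * g x)"
    have Yf: "fun_of Y x = sqrt (\<rho> x) * g x" if "x \<in> {0..pi}" for x
      unfolding Y_def by (rule fun_of_cpi_of[OF continuous_on_mult[OF sqrt_\<rho>(3) g] that])
    have "(\<lambda>n. K (X (k n))) \<longlonglongrightarrow> Y"
    proof (rule LIMSEQ_I)
      fix \<epsilon> :: real assume \<epsilon>: "\<epsilon> > 0"
      \<comment> \<open>The weight is at most \<open>r\<close> and the interval has length
        \<open>pi\<close>, so the squared norm is at most
        \<open>r * pi * \<epsilon>'\<^sup>2\<close>, the square of half of
        \<open>\<epsilon>\<close>.\<close>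
      define \<epsilon>' where "\<epsilon>' = \<epsilon> / (2 * sqrt (r * pi))"
      have \<epsilon>': "\<epsilon>' > 0" using \<epsilon> r by (simp add: \<epsilon>'_def)
      obtain N where N: "\<And>n x. n \<ge> N \<Longrightarrow> x \<in> {0..pi} \<Longrightarrow> norm (S (X (k n)) x - g x) < \<epsilon>'" using lim[OF \<epsilon>'] by blast
      show "\<exists>N. \<forall>n\<ge>N. norm (K (X (k n)) - Y) < \<epsilon>"
      proof (intro exI[of _ N] allI impI)
        fix n assume n: "n \<ge> N"
        have "(norm (K (X (k n)) - Y))\<^sup>2 = integral {0..pi} (\<lambda>x. fun_of (K (X (k n)) - Y) x * fun_of (K (X (k n)) - Y) x)"
          by (simp add: power2_norm_eq_inner inner_cpi_def)
        also have "\<dots> \<le> integral {0..pi} (\<lambda>x. r * \<epsilon>'\<^sup>2)"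
        proof (rule integral_le)
          show "(\<lambda>x. fun_of (K (X (k n)) - Y) x * fun_of (K (X (k n)) - Y) x) integrable_on {0..pi}"
            by (intro integrable_continuous_interval continuous_intros)
          fix x assume x: "x \<in> {0..pi}"
          have "fun_of (K (X (k n)) - Y) x * fun_of (K (X (k n)) - Y) x = (sqrt (\<rho> x) * sqrt (\<rho> x)) * (S (X (k n)) x - g x)\<^sup>2"
          proof -
            have "fun_of (K (X (k n)) - Y) x = sqrt (\<rho> x) * (S (X (k n)) x - g x)"
              using Kf[OF x] Yf[OF x] by (simp add: minus_cpi.rep_eq right_diff_distrib)
            then show ?thesis unfolding power2_eq_square by (simp only: mult_ac)
          qed
          also have "\<dots> = \<rho> x * (S (X (k n)) x - g x)\<^sup>2" by (simp only: sqrt_\<rho>(2)[OF x])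
          also have "\<dots> \<le> r * \<epsilon>'\<^sup>2"
          proof (rule mult_mono)
            have "\<bar>S (X (k n)) x - g x\<bar> \<le> \<epsilon>'" using N[OF n x] by simp
            then show "(S (X (k n)) x - g x)\<^sup>2 \<le> \<epsilon>'\<^sup>2" using power_mono[of "\<bar>S (X (k n)) x - g x\<bar>" \<epsilon>' 2] by simp
          qed (use r x \<rho>_pos[OF x] in auto)
          finally show "fun_of (K (X (k n)) - Y) x * fun_of (K (X (k n)) - Y) x \<le> r * \<epsilon>'\<^sup>2" .
        qed (intro integrable_continuous_interval continuous_on_const)
        also have "\<dots> = (r * pi) * \<epsilon>'\<^sup>2" by simp
        also have "\<dots> = (\<epsilon> / 2)\<^sup>2" using r by (simp add: \<epsilon>'_def power_divide power_mult_distrib)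
        finally have "norm (K (X (k n)) - Y) \<le> \<epsilon> / 2" by (rule power2_le_imp_le) (use \<epsilon> in simp)
        then show "norm (K (X (k n)) - Y) < \<epsilon>" using \<epsilon> by simp
      qed
    qed
    then show ?thesis using k by blast
  qed
  interpret compact_symmetric K by (rule compact_symmetric.intro[OF Klinear Ksym Kcpt])
  obtain \<B> where \<B>: "orthonormal_eigenvectors \<B>" and fin: "\<And>\<delta>. \<delta> > 0 \<Longrightarrow> finite {b \<in> \<B>. \<delta> \<le> \<bar>K b \<bullet> b\<bar>}"
    and appr: "\<And>h \<delta>. \<delta> > 0 \<Longrightarrow> \<exists>F c. finite F \<and> F \<subseteq> \<B> \<and> norm (K h - (\<Sum>b\<in>F. c b *\<^sub>R b)) < \<delta>"
    by (rule spectral_theorem) (rule that)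
  define \<kappa>' where "\<kappa>' b = K b \<bullet> b" for b
  have Kb: "K b = \<kappa>' b *\<^sub>R b" and nb: "norm b = 1" if "b \<in> \<B>" for b
    using \<B> that unfolding orthonormal_eigenvectors_def \<kappa>'_def by blast+
  have Sb: "S b x = \<kappa>' b * h b x" if b: "b \<in> \<B>" and x: "x \<in> {0..pi}" for b x
  proof -
    have "sqrt (\<rho> x) * S b x = \<kappa>' b * (sqrt (\<rho> x) * h b x)"
      by (simp only: Kf[OF x, symmetric] Kb[OF b] scaleR_cpi.rep_eq fun_h[OF x, symmetric])
    then show ?thesis using sqrt_\<rho>(1)[OF x] by simp
  qed
  \<comment> \<open>\<open>K\<close> is injective: when the solution vanishes, differentiating it
    four times shows that its source vanishes too.\<close>
  have \<kappa>0: "\<kappa>' b \<noteq> 0" if b: "b \<in> \<B>" for b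
  proof
    assume 0: "\<kappa>' b = 0"
    obtain u1 u2 w1 where u: "beam_dom (S b) u1 u2 w1 (\<lambda>x. \<rho> x * (l * S b x + h b x))" using dom by blast
    have S0: "S b x = 0" if "x \<in> {0..pi}" for x using Sb[OF b that] 0 by simp
    note d = u[unfolded beam_dom_def, THEN conjunct1, rule_format, folded has_real_derivative_iff_has_vector_derivative]
    have u10: "u1 x = 0" if "x \<in> {0..pi}" for x using derivative_of_zero[of "S b", OF S0 _ that] d[OF that] by blast
    have u20: "u2 x = 0" if "x \<in> {0..pi}" for x using derivative_of_zero[of u1, OF u10 _ that] d[OF that] by blast
    then have e0: "\<eta> x *\<^sub>R u2 x = 0" if "x \<in> {0..pi}" for x using that by simp
    have w10: "w1 x = 0" if "x \<in> {0..pi}" for x using derivative_of_zero[of "\<lambda>y. \<eta> y *\<^sub>R u2 y", OF e0 _ that] d[OF that] by blast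
    have "\<rho> x * (l * S b x + h b x) = 0" if "x \<in> {0..pi}" for x using derivative_of_zero[of w1, OF w10 _ that] d[OF that] by blast
    then have "h b x = 0" if "x \<in> {0..pi}" for x using S0[OF that] \<rho>_nz[OF that] that by fastforce
    then have "b = 0" by (intro cpi_eqI) (simp add: fun_h zero_cpi.rep_eq)
    then show False using nb[OF b] by simp
  qed
  \<comment> \<open>The source \<open>h b\<close> is \<open>S b / \<kappa>' b\<close>, so the
    equation for \<open>S b\<close> has right-hand side
    \<open>\<rho> (l + 1 / \<kappa>' b) S b\<close>.\<close>
  define \<nu> where "\<nu> b = l + 1 / \<kappa>' b" for b
  show ?thesis
  proof (rule that[of \<B> \<nu> h])
    fix b assume b: "b \<in> \<B>"
    obtain u1 u2 w1 where u: "beam_dom (S b) u1 u2 w1 (\<lambda>x. \<rho> x * (l * S b x + h b x))" using dom by blast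
    note s = beam_dom_scale[OF u, of "1 / \<kappa>' b"]
    have hs: "h b x = (1 / \<kappa>' b) *\<^sub>R S b x" if "x \<in> {0..pi}" for x using Sb[OF b that] \<kappa>0[OF b] by simp
    have "beam_dom (h b) (\<lambda>x. (1 / \<kappa>' b) *\<^sub>R u1 x) (\<lambda>x. (1 / \<kappa>' b) *\<^sub>R u2 x) (\<lambda>x. (1 / \<kappa>' b) *\<^sub>R w1 x)
        (\<lambda>x. (1 / \<kappa>' b) *\<^sub>R (\<rho> x * (l * S b x + h b x)))"
      unfolding beam_dom_def
    proof (intro conjI ballI)
      fix x assume x: "x \<in> {0..pi}"
      have "((\<lambda>x. (1 / \<kappa>' b) *\<^sub>R S b x) has_vector_derivative (1 / \<kappa>' b) *\<^sub>R u1 x) (at x within {0..pi})"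
        using s x unfolding beam_dom_def by blast
      then show "(h b has_vector_derivative (1 / \<kappa>' b) *\<^sub>R u1 x) (at x within {0..pi})"
        by (rule has_vector_derivative_transform[OF x, rotated]) (simp add: hs)
    next
      fix x assume x: "x \<in> {0, pi}"
      then have "x \<in> {0..pi}" by auto
      then show "h b x = 0" using s x hs unfolding beam_dom_def by auto
    qed (use s in \<open>unfold beam_dom_def, blast+\<close>)
    moreover have "(1 / \<kappa>' b) *\<^sub>R (\<rho> x * (l * S b x + h b x)) = \<nu> b * (\<rho> x * h b x)" if x: "x \<in> {0..pi}" for x
    proof -
      have "l * S b x + h b x = \<kappa>' b * (\<nu> b * h b x)"
        unfolding Sb[OF b x] \<nu>_def using \<kappa>0[OF b] by (simp add: algebra_simps)
      then show ?thesis using \<kappa>0[OF b] by (simp add: mult_ac)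
    qed
    ultimately have "beam_dom (h b) (\<lambda>x. (1 / \<kappa>' b) *\<^sub>R u1 x) (\<lambda>x. (1 / \<kappa>' b) *\<^sub>R u2 x) (\<lambda>x. (1 / \<kappa>' b) *\<^sub>R w1 x)
        (\<lambda>x. \<nu> b * (\<rho> x * h b x))"
      by (rule beam_dom_cong)
    then show "eigen (\<nu> b) (h b)" unfolding eigen_def by (intro exI)
  next
    fix b c assume b: "b \<in> \<B>" and c: "c \<in> \<B>"
    have "integral {0..pi} (\<lambda>x. \<rho> x * (h b x * h c x)) = b \<bullet> c"
    proof -
      have "\<rho> x * (h b x * h c x) = fun_of b x * fun_of c x" if x: "x \<in> {0..pi}" for x
      proof -
        have "fun_of b x * fun_of c x = (sqrt (\<rho> x) * sqrt (\<rho> x)) * (h b x * h c x)"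
          unfolding fun_h[OF x] by (simp only: mult_ac)
        then show ?thesis unfolding sqrt_\<rho>(2)[OF x] by simp
      qed
      then show ?thesis unfolding inner_cpi_def by (rule integral_cong)
    qed
    also have "\<dots> = (if b = c then 1 else 0)"
      using \<B> b c nb[OF b] unfolding orthonormal_eigenvectors_def by (auto simp: power2_norm_eq_inner[symmetric])
    finally show "integral {0..pi} (\<lambda>x. \<rho> x * (h b x * h c x)) = (if b = c then 1 else 0)" .
  next
    fix R :: real
    \<comment> \<open>A bound on \<open>\<nu> b\<close> bounds \<open>1 / \<kappa>' b\<close> and so
      keeps \<open>\<kappa>' b\<close> away from zero.\<close>
    define \<delta> where "\<delta> = 1 / (\<bar>R\<bar> + \<bar>l\<bar> + 1)"
    have \<delta>: "\<delta> > 0" by (simp add: \<delta>_def add_nonneg_pos)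
    have "{b \<in> \<B>. \<bar>\<nu> b\<bar> \<le> R} \<subseteq> {b \<in> \<B>. \<delta> \<le> \<bar>K b \<bullet> b\<bar>}"
    proof (intro subsetI CollectI conjI; clarify)
      fix b assume b: "b \<in> \<B>" "\<bar>\<nu> b\<bar> \<le> R"
      then have "\<bar>1 / \<kappa>' b\<bar> \<le> \<bar>R\<bar> + \<bar>l\<bar> + 1" unfolding \<nu>_def by linarith
      then have "1 / (\<bar>R\<bar> + \<bar>l\<bar> + 1) \<le> \<bar>\<kappa>' b\<bar>" using \<kappa>0[OF b(1)] by (simp add: field_simps abs_divide add_nonneg_pos)
      then show "\<delta> \<le> \<bar>K b \<bullet> b\<bar>" by (simp add: \<delta>_def \<kappa>'_def)
    qed
    then show "finite {b \<in> \<B>. \<bar>\<nu> b\<bar> \<le> R}" using fin[OF \<delta>] finite_subset by blast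
  next
    fix u u1 u2 w1 w2 :: "real \<Rightarrow> real" and \<delta> :: real
    assume u: "beam_dom u u1 u2 w1 w2" and w2: "continuous_on {0..pi} w2" and \<delta>: "\<delta> > 0"
    \<comment> \<open>The source, conjugated with \<open>sqrt \<rho>\<close>, for which the solution
      operator returns \<open>u\<close>. Thus \<open>sqrt \<rho> * u\<close> is a value of
      \<open>K\<close>, which the spectral theorem approximates.\<close>
    define f where "f x = sqrt (\<rho> x) * (w2 x / \<rho> x - l * u x)" for x
    have fc: "continuous_on {0..pi} f"
      unfolding f_def using \<rho>_nz by (intro continuous_intros sqrt_\<rho>(3) w2 \<rho>_cont beam_dom_continuous(1)[OF u]) auto
    define X where "X = cpi_of f"
    have hX: "h X x = w2 x / \<rho> x - l * u x" if "x \<in> {0..pi}" for x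
      using fun_of_cpi_of[OF fc that] sqrt_\<rho>(1)[OF that] by (simp add: h_def X_def f_def)
    have SX: "S X x = u x" if x: "x \<in> {0..pi}" for x
      by (rule uniq[OF u _ x, symmetric]) (simp add: hX \<rho>_nz)
    obtain F c where F: "finite F" "F \<subseteq> \<B>" "norm (K X - (\<Sum>b\<in>F. c b *\<^sub>R b)) < sqrt \<delta>"
      using appr[of "sqrt \<delta>" X] \<delta> by auto
    define Z where "Z = K X - (\<Sum>b\<in>F. c b *\<^sub>R b)"
    have Z: "fun_of Z x = sqrt (\<rho> x) * (u x - (\<Sum>b\<in>F. c b * h b x))" if x: "x \<in> {0..pi}" for x
    proof -
      have "(\<Sum>b\<in>F. c b * fun_of b x) = sqrt (\<rho> x) * (\<Sum>b\<in>F. c b * h b x)"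
        unfolding sum_distrib_left by (intro sum.cong refl) (simp add: fun_h[OF x])
      then show ?thesis
        by (simp add: Z_def minus_cpi.rep_eq fun_of_sum scaleR_cpi.rep_eq Kf[OF x] SX[OF x] right_diff_distrib)
    qed
    have "integral {0..pi} (\<lambda>x. \<rho> x * (u x - (\<Sum>b\<in>F. c b * h b x))\<^sup>2) = Z \<bullet> Z"
    proof -
      have "\<rho> x * (u x - (\<Sum>b\<in>F. c b * h b x))\<^sup>2 = fun_of Z x * fun_of Z x" if x: "x \<in> {0..pi}" for x
      proof -
        have "fun_of Z x * fun_of Z x = (sqrt (\<rho> x) * sqrt (\<rho> x)) * (u x - (\<Sum>b\<in>F. c b * h b x))\<^sup>2"
          unfolding Z[OF x] power2_eq_square by (simp only: mult_ac)
        then show ?thesis unfolding sqrt_\<rho>(2)[OF x] by simp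
      qed
      then show ?thesis unfolding inner_cpi_def by (rule integral_cong)
    qed
    also have "\<dots> = (norm Z)\<^sup>2" by (simp add: power2_norm_eq_inner)
    also have "\<dots> < (sqrt \<delta>)\<^sup>2" using F(3) unfolding Z_def by (intro power_strict_mono) auto
    also have "\<dots> = \<delta>" using \<delta> by simp
    finally show "\<exists>F c. finite F \<and> F \<subseteq> \<B> \<and> integral {0..pi} (\<lambda>x. \<rho> x * (u x - (\<Sum>b\<in>F. c b * h b x))\<^sup>2) < \<delta>"
      using F by blast
  qed
qed

text \<open>Countably many eigenvalues cannot fill the interval below \<open>l0\<close>. At some
  \<open>l\<close> there, solvability of the initial value problem and injectivity of the boundary
  value problem hold together, and the compact solution operator for this \<open>l\<close> yields
  the system.\<close>

theorem eigenfunction_expansion: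
  assumes cnt: "countable {\<nu>. \<exists>u x. eigen \<nu> u \<and> x \<in> {0..pi} \<and> u x \<noteq> 0}"
  obtains \<B> :: "cpi set" and e \<nu> where
    "\<And>b. b \<in> \<B> \<Longrightarrow> eigen (\<nu> b) (e b)" 
    "\<And>b c. b \<in> \<B> \<Longrightarrow> c \<in> \<B> \<Longrightarrow> integral {0..pi} (\<lambda>x. \<rho> x * (e b x * e c x)) = (if b = c then 1 else 0)"
    "\<And>r. finite {b \<in> \<B>. \<bar>\<nu> b\<bar> \<le> r}"
    "\<And>u u1 u2 w1 w2 \<delta>. beam_dom u u1 u2 w1 w2 \<Longrightarrow> continuous_on {0..pi} w2 \<Longrightarrow> \<delta> > 0 \<Longrightarrow>
      \<exists>F c. finite F \<and> F \<subseteq> \<B> \<and> integral {0..pi} (\<lambda>x. \<rho> x * (u x - (\<Sum>b\<in>F. c b * e b x))\<^sup>2) < \<delta>"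
proof (rule ivp_exists)
  fix l0 :: real
  assume l0: "l0 > 0" and ex: "\<And>l h a A B. \<bar>l\<bar> \<le> l0 \<Longrightarrow> continuous_on {0..pi} h \<Longrightarrow>
    \<exists>u u1 w w1. ivp l h u u1 w w1 \<and> u 0 = 0 \<and> u1 0 = a \<and> w 0 = A \<and> w1 0 = B"
  define E where "E = {\<nu>. \<exists>u x. eigen \<nu> u \<and> x \<in> {0..pi} \<and> u x \<noteq> 0}"
  have "uncountable ({0<..<l0} - E)"
    using uncountable_minus_countable[OF _ cnt, of "{0<..<l0}"] uncountable_open_interval[of 0 l0] l0
    unfolding E_def by blast
  then obtain l where l: "l \<in> {0<..<l0}" "l \<notin> E" by (metis DiffE countable_empty ex_in_conv)
  have inj: "u x = 0" if d: "beam_dom u u1 u2 w1 (\<lambda>x. \<rho> x * (l * u x))" and x: "x \<in> {0..pi}" for u u1 u2 w1 x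
  proof (rule ccontr)
    assume "u x \<noteq> 0"
    moreover have "eigen l u" unfolding eigen_def using d by (intro exI) (simp add: mult.left_commute)
    ultimately show False using l(2) x unfolding E_def by blast
  qed
  have exl: "\<exists>u u1 w w1. ivp l h u u1 w w1 \<and> u 0 = 0 \<and> u1 0 = a \<and> w 0 = A \<and> w1 0 = B"
    if "continuous_on {0..pi} h" for h a A B
    by (rule ex) (use l that in auto)
  show thesis
  proof (rule bvp_exists[of l])
    show "\<exists>u u1 w w1. ivp l h u u1 w w1 \<and> u 0 = 0 \<and> u1 0 = a \<and> w 0 = A \<and> w1 0 = B"
      if "continuous_on {0..pi} h" for h a A B using exl[OF that] .
    show "u x = 0" if "beam_dom u u1 u2 w1 (\<lambda>x. \<rho> x * (l * u x))" "x \<in> {0..pi}" for u u1 u2 w1 x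
      using inj[OF that] .
    fix C :: real
    assume C: "C > 0" "\<And>h. continuous_on {0..pi} h \<Longrightarrow>
      \<exists>u u1 u2 w1. beam_dom u u1 u2 w1 (\<lambda>x. \<rho> x * (l * u x + h x)) \<and>
        (\<forall>x\<in>{0..pi}. (u x)\<^sup>2 + (u1 x)\<^sup>2 \<le> C * integral {0..pi} (\<lambda>x. (h x)\<^sup>2))"
    show thesis
    proof (rule eigenfunction_expansion_aux[of C l])
      show "C > 0" by (rule C(1))
      show "\<exists>u u1 u2 w1. beam_dom u u1 u2 w1 (\<lambda>x. \<rho> x * (l * u x + h x)) \<and>
        (\<forall>x\<in>{0..pi}. (u x)\<^sup>2 + (u1 x)\<^sup>2 \<le> C * integral {0..pi} (\<lambda>x. (h x)\<^sup>2))"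
        if "continuous_on {0..pi} h" for h using C(2)[OF that] .
      show "u x = 0" if "beam_dom u u1 u2 w1 (\<lambda>x. \<rho> x * (l * u x))" "x \<in> {0..pi}" for u u1 u2 w1 x
        using inj[OF that] .
    qed (rule that)
  qed
qed

end

section \<open>Listed eigenvalues\<close>

context beam
begin

lemma beam_dom_bounded_linear:
  assumes T: "bounded_linear T" and u: "beam_dom u u1 u2 w1 w2"
  shows "beam_dom (\<lambda>x. T (u x)) (\<lambda>x. T (u1 x)) (\<lambda>x. T (u2 x)) (\<lambda>x. T (w1 x)) (\<lambda>x. T (w2 x))"
  unfolding beam_dom_def
proof (intro conjI ballI)
  interpret bounded_linear T by (rule T)
  note hvd = bounded_linear.has_vector_derivative[OF T]
  fix x assume x: "x \<in> {0..pi}"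
  note d = u[unfolded beam_dom_def, THEN conjunct1, rule_format, OF x]
  show "((\<lambda>x. T (u x)) has_vector_derivative T (u1 x)) (at x within {0..pi})"
    "((\<lambda>x. T (u1 x)) has_vector_derivative T (u2 x)) (at x within {0..pi})"
    "((\<lambda>x. T (w1 x)) has_vector_derivative T (w2 x)) (at x within {0..pi})"
    using d by (auto intro: hvd)
  have "((\<lambda>x. T (\<eta> x *\<^sub>R u2 x)) has_vector_derivative T (w1 x)) (at x within {0..pi})"
    by (rule hvd) (use d in auto)
  then show "((\<lambda>y. \<eta> y *\<^sub>R T (u2 y)) has_vector_derivative T (w1 x)) (at x within {0..pi})"
    by (simp add: scaleR)
next
  interpret bounded_linear T by (rule T)
  fix x assume x: "x \<in> {0, pi}"
  note b = u[unfolded beam_dom_def, THEN conjunct2, rule_format, OF x]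
  show "T (u x) = 0" using b by (simp add: zero)
  have "\<kappa> x *\<^sub>R T (u1 x) + T (u2 x) = T (\<kappa> x *\<^sub>R u1 x + u2 x)" by (simp add: add scaleR)
  then show "\<kappa> x *\<^sub>R T (u1 x) + T (u2 x) = 0" using b by (simp add: zero)
qed

text \<open>The values \<open>a\<close> of \<open>\<phi>'\<close> and \<open>b\<close> of \<open>(\<eta> \<phi>'')'\<close> at \<open>0\<close> determine an eigenfunction. Hence eigenspaces are finite
  dimensional, and \<open>dim\<close> does not take its junk value \<open>0\<close> on them.\<close>

definition eigendata :: "real \<Rightarrow> (real \<Rightarrow> complex) \<Rightarrow> complex \<Rightarrow> complex \<Rightarrow> bool" where
  "eigendata \<nu> \<phi> a b \<longleftrightarrow> (\<forall>x. x \<notin> {0..pi} \<longrightarrow> \<phi> x = 0) \<and>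
    (\<exists>\<phi>1 \<phi>2 w1 w2. beam_dom \<phi> \<phi>1 \<phi>2 w1 w2 \<and>
      (\<forall>x\<in>{0..pi}. w2 x = \<rho> x *\<^sub>R (\<nu> *\<^sub>R \<phi> x)) \<and> \<phi>1 0 = a \<and> w1 0 = b)"

lemma beam_eigenspace_eigendata:
  "beam_eigenspace \<alpha> \<beta> \<rho> \<eta> (complex_of_real \<nu>) = {\<phi>. \<exists>a b. eigendata \<nu> \<phi> a b}"
proof -
  have eq: "(1 / \<rho> x) *\<^sub>R w = complex_of_real \<nu> * z \<longleftrightarrow> w = \<rho> x *\<^sub>R (\<nu> *\<^sub>R z)" if "x \<in> {0..pi}" for x w z
  proof -
    have "(1 / \<rho> x) *\<^sub>R w = \<nu> *\<^sub>R z \<longleftrightarrow> \<rho> x *\<^sub>R ((1 / \<rho> x) *\<^sub>R w) = \<rho> x *\<^sub>R (\<nu> *\<^sub>R z)"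
      using \<rho>_nz[OF that] by (subst scaleR_cancel_left) auto
    then show ?thesis using \<rho>_nz[OF that] by (simp add: scaleR_conv_of_real[of \<nu>])
  qed
  show ?thesis
  proof (intro set_eqI iffI)
    fix \<phi> assume "\<phi> \<in> beam_eigenspace \<alpha> \<beta> \<rho> \<eta> (complex_of_real \<nu>)"
    then obtain \<phi>1 \<phi>2 w1 w2 where 0: "\<forall>x. x \<notin> {0..pi} \<longrightarrow> \<phi> x = 0" and 1: "\<forall>x\<in>{0..pi}.
           (\<phi> has_vector_derivative \<phi>1 x) (at x within {0..pi}) \<and>
           (\<phi>1 has_vector_derivative \<phi>2 x) (at x within {0..pi}) \<and>
           ((\<lambda>y. \<eta> y *\<^sub>R \<phi>2 y) has_vector_derivative w1 x) (at x within {0..pi}) \<and>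
           (w1 has_vector_derivative w2 x) (at x within {0..pi}) \<and>
           (1 / \<rho> x) *\<^sub>R w2 x = complex_of_real \<nu> * \<phi> x"
      and 2: "\<forall>x\<in>{0, pi}. \<phi> x = 0 \<and> (2 * (\<alpha> x + \<beta> x)) *\<^sub>R \<phi>1 x + \<phi>2 x = 0"
      unfolding beam_eigenspace_def by blast
    have "beam_dom \<phi> \<phi>1 \<phi>2 w1 w2" unfolding beam_dom_def \<kappa>_def using 1 2 by blast
    moreover have "\<forall>x\<in>{0..pi}. w2 x = \<rho> x *\<^sub>R (\<nu> *\<^sub>R \<phi> x)" using 1 eq by blast
    ultimately have "eigendata \<nu> \<phi> (\<phi>1 0) (w1 0)" unfolding eigendata_def using 0 by blast
    then show "\<phi> \<in> {\<phi>. \<exists>a b. eigendata \<nu> \<phi> a b}" by blast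
  next
    fix \<phi> assume "\<phi> \<in> {\<phi>. \<exists>a b. eigendata \<nu> \<phi> a b}"
    then obtain \<phi>1 \<phi>2 w1 w2 where 0: "\<forall>x. x \<notin> {0..pi} \<longrightarrow> \<phi> x = 0" and 1: "beam_dom \<phi> \<phi>1 \<phi>2 w1 w2"
      and 2: "\<forall>x\<in>{0..pi}. w2 x = \<rho> x *\<^sub>R (\<nu> *\<^sub>R \<phi> x)"
      unfolding eigendata_def by blast
    have "\<forall>x\<in>{0..pi}. (1 / \<rho> x) *\<^sub>R w2 x = complex_of_real \<nu> * \<phi> x" using 2 eq by blast
    then show "\<phi> \<in> beam_eigenspace \<alpha> \<beta> \<rho> \<eta> (complex_of_real \<nu>)"
      unfolding beam_eigenspace_def using 0 1[unfolded beam_dom_def \<kappa>_def]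
      by (intro CollectI conjI exI[of _ \<phi>1] exI[of _ \<phi>2] exI[of _ w1] exI[of _ w2]) blast+
  qed
qed

lemma eigendata_combination:
  assumes "eigendata \<nu> \<phi> a b" "eigendata \<nu> \<psi> c d"
  shows "eigendata \<nu> (\<lambda>x. \<phi> x + k * \<psi> x) (a + k * c) (b + k * d)"
proof -
  obtain \<phi>1 \<phi>2 w1 w2 where p: "\<forall>x. x \<notin> {0..pi} \<longrightarrow> \<phi> x = 0" "beam_dom \<phi> \<phi>1 \<phi>2 w1 w2"
    "\<forall>x\<in>{0..pi}. w2 x = \<rho> x *\<^sub>R (\<nu> *\<^sub>R \<phi> x)" "\<phi>1 0 = a" "w1 0 = b" using assms(1) unfolding eigendata_def by blast
  obtain \<psi>1 \<psi>2 z1 z2 where q: "\<forall>x. x \<notin> {0..pi} \<longrightarrow> \<psi> x = 0" "beam_dom \<psi> \<psi>1 \<psi>2 z1 z2"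
    "\<forall>x\<in>{0..pi}. z2 x = \<rho> x *\<^sub>R (\<nu> *\<^sub>R \<psi> x)" "\<psi>1 0 = c" "z1 0 = d" using assms(2) unfolding eigendata_def by blast
  note s = beam_dom_add_scaled[OF p(2) beam_dom_bounded_linear[OF bounded_linear_mult_right[of k] q(2)], of 1]
  show ?thesis unfolding eigendata_def
  proof (intro conjI allI impI exI)
    show "beam_dom (\<lambda>x. \<phi> x + k * \<psi> x) (\<lambda>x. \<phi>1 x + k * \<psi>1 x) (\<lambda>x. \<phi>2 x + k * \<psi>2 x) (\<lambda>x. w1 x + k * z1 x) (\<lambda>x. w2 x + k * z2 x)"
      using s by simp
  qed (use p q in \<open>auto simp: algebra_simps\<close>)
qed

text \<open>The boundary conditions at 0 supply the two missing initial values, and uniqueness of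
  the initial value problem applies to the real and the imaginary part.\<close>

lemma eigendata_zero:
  assumes "eigendata \<nu> \<phi> 0 0"
  shows "\<phi> = (\<lambda>_. 0)"
proof -
  obtain \<phi>1 \<phi>2 w1 w2 where p: "\<forall>x. x \<notin> {0..pi} \<longrightarrow> \<phi> x = 0" "beam_dom \<phi> \<phi>1 \<phi>2 w1 w2"
    "\<forall>x\<in>{0..pi}. w2 x = \<rho> x *\<^sub>R (\<nu> *\<^sub>R \<phi> x)" "\<phi>1 0 = 0" "w1 0 = 0" using assms unfolding eigendata_def by blast
  have bc: "\<phi> 0 = 0" "\<phi>2 0 = 0" using p(2,4) unfolding beam_dom_def by auto
  have T0: "T (\<phi> x) = 0" if T: "bounded_linear T" and x: "x \<in> {0..pi}" for T :: "complex \<Rightarrow> real" and x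
  proof -
    interpret T: bounded_linear T by (rule T)
    have "ivp \<nu> (\<lambda>_. 0) (\<lambda>x. T (\<phi> x)) (\<lambda>x. T (\<phi>1 x)) (\<lambda>x. \<eta> x * T (\<phi>2 x)) (\<lambda>x. T (w1 x))"
      by (rule beam_dom_imp_ivp[OF beam_dom_bounded_linear[OF T p(2)]]) (simp add: p(3) T.scaleR)
    then show ?thesis by (rule ivp_unique) (use p bc x in \<open>auto simp: T.zero\<close>)
  qed
  have "\<phi> x = 0" for x
  proof (cases "x \<in> {0..pi}")
    case True
    then show ?thesis using T0[OF bounded_linear_Re] T0[OF bounded_linear_Im] by (simp add: complex_eq_iff)
  qed (use p(1) in simp)
  then show ?thesis by blast
qed

text \<open>Eliminating the two initial data in turn shows that \<open>{\<phi>a, \<phi>b}\<close>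
  spans the eigenspace. A basis is then finite, and \<open>u\<close> makes it non-empty, so its
  cardinality is positive.\<close>

lemma eigen_imp_multiplicity_pos:
  assumes e: "eigen \<nu> u" and x: "x \<in> {0..pi}" "u x \<noteq> 0"
  shows "beam_multiplicity \<alpha> \<beta> \<rho> \<eta> (complex_of_real \<nu>) > 0"
proof -
  interpret vs: vector_space "\<lambda>(c::complex) (\<phi>::real \<Rightarrow> complex) x. c * \<phi> x"
    by unfold_locales (auto simp: fun_eq_iff algebra_simps)
  define V where "V = beam_eigenspace \<alpha> \<beta> \<rho> \<eta> (complex_of_real \<nu>)"
  have V: "\<phi> \<in> V \<longleftrightarrow> (\<exists>a b. eigendata \<nu> \<phi> a b)" for \<phi> by (simp add: V_def beam_eigenspace_eigendata)
  \<comment> \<open>If every eigenfunction has first datum zero, the zero function serves as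
    \<open>\<phi>a\<close>. The quotient by \<open>a0 = 0\<close> formed below is harmless, since
    the datum to be eliminated is zero as well.\<close>
  have ex: "\<exists>\<phi>a a0 b0. eigendata \<nu> \<phi>a a0 b0 \<and> (a0 \<noteq> 0 \<or> (\<forall>\<phi> a b. eigendata \<nu> \<phi> a b \<longrightarrow> a = 0))"
  proof (cases "\<exists>\<phi> a b. eigendata \<nu> \<phi> a b \<and> a \<noteq> 0")
    case False
    have "eigendata \<nu> (\<lambda>_. 0) 0 0" unfolding eigendata_def
      by (intro conjI exI[of _ "\<lambda>_. 0"]) (auto simp: beam_dom_def)
    then show ?thesis using False by blast
  qed blast
  then obtain \<phi>a a0 b0 where a: "eigendata \<nu> \<phi>a a0 b0" "a0 \<noteq> 0 \<or> (\<forall>\<phi> a b. eigendata \<nu> \<phi> a b \<longrightarrow> a = 0)" by blast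
  have ex: "\<exists>\<phi>b b1. eigendata \<nu> \<phi>b 0 b1 \<and> (b1 \<noteq> 0 \<or> (\<forall>\<phi> b. eigendata \<nu> \<phi> 0 b \<longrightarrow> b = 0))"
  proof (cases "\<exists>\<phi> b. eigendata \<nu> \<phi> 0 b \<and> b \<noteq> 0")
    case False
    have "eigendata \<nu> (\<lambda>_. 0) 0 0" unfolding eigendata_def
      by (intro conjI exI[of _ "\<lambda>_. 0"]) (auto simp: beam_dom_def)
    then show ?thesis using False by blast
  qed blast
  then obtain \<phi>b b1 where b: "eigendata \<nu> \<phi>b 0 b1" "b1 \<noteq> 0 \<or> (\<forall>\<phi> b. eigendata \<nu> \<phi> 0 b \<longrightarrow> b = 0)" by blast
  have span: "V \<subseteq> vs.span {\<phi>a, \<phi>b}"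
  proof
    fix \<phi> assume "\<phi> \<in> V"
    then obtain c d where cd: "eigendata \<nu> \<phi> c d" by (auto simp: V)
    define k where "k = - c / a0"
    have "eigendata \<nu> (\<lambda>x. \<phi> x + k * \<phi>a x) (c + k * a0) (d + k * b0)" by (rule eigendata_combination[OF cd a(1)])
    moreover have "c + k * a0 = 0" using a(2) cd by (auto simp: k_def)
    ultimately have 1: "eigendata \<nu> (\<lambda>x. \<phi> x + k * \<phi>a x) 0 (d + k * b0)" by simp
    define m where "m = - (d + k * b0) / b1"
    have "eigendata \<nu> (\<lambda>x. (\<phi> x + k * \<phi>a x) + m * \<phi>b x) (0 + m * 0) (d + k * b0 + m * b1)"
      by (rule eigendata_combination[OF 1 b(1)])
    moreover have "d + k * b0 + m * b1 = 0"
    proof (cases "b1 = 0")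
      case True
      then have "d + k * b0 = 0" using b(2) 1 by blast
      then show ?thesis using True by simp
    qed (simp add: m_def)
    ultimately have "(\<lambda>x. (\<phi> x + k * \<phi>a x) + m * \<phi>b x) = (\<lambda>_. 0)" using eigendata_zero by simp
    then have "\<phi> x = (- k) * \<phi>a x + (- m) * \<phi>b x" for x
      by (drule_tac x = x in fun_cong) (simp add: eq_neg_iff_add_eq_0 algebra_simps)
    then have "\<phi> = (\<lambda>x. (- k) * \<phi>a x) + (\<lambda>x. (- m) * \<phi>b x)" by (auto simp: fun_eq_iff)
    then show "\<phi> \<in> vs.span {\<phi>a, \<phi>b}"
      by (metis insertI1 insertI2 singletonI vs.span_add vs.span_base vs.span_scale)
  qed
  obtain B where B: "B \<subseteq> V" "vs.independent B" "V \<subseteq> vs.span B" "card B = vs.dim V"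
    using vs.basis_exists[of V] by blast
  have "finite B"
    using vs.independent_span_bound[of "{\<phi>a, \<phi>b}" B] B span by auto
  moreover have "B \<noteq> {}"
  proof
    assume "B = {}"
    then have sub: "V \<subseteq> {0}" using B(3) by simp
    \<comment> \<open>Extended by zero, because members of the eigenspace vanish outside the
      interval.\<close>
    define \<phi> where "\<phi> y = (if y \<in> {0..pi} then complex_of_real (u y) else 0)" for y
    obtain u1 u2 w1 where u: "beam_dom u u1 u2 w1 (\<lambda>x. \<nu> * (\<rho> x * u x))" using e unfolding eigen_def by blast
    note c = beam_dom_bounded_linear[OF bounded_linear_of_real[where 'a = complex] u]
    have "beam_dom \<phi> (\<lambda>x. of_real (u1 x)) (\<lambda>x. of_real (u2 x)) (\<lambda>x. of_real (w1 x)) (\<lambda>x. of_real (\<nu> * (\<rho> x * u x)))"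
      unfolding beam_dom_def
    proof (intro conjI ballI)
      fix x assume x: "x \<in> {0..pi}"
      have "((\<lambda>x. complex_of_real (u x)) has_vector_derivative complex_of_real (u1 x)) (at x within {0..pi})"
        using c x unfolding beam_dom_def by blast
      then show "(\<phi> has_vector_derivative complex_of_real (u1 x)) (at x within {0..pi})"
        by (rule has_vector_derivative_transform[OF x, rotated]) (simp add: \<phi>_def)
    next
      fix x assume "x \<in> {0, pi}"
      then show "\<phi> x = 0" using c unfolding beam_dom_def \<phi>_def by auto
    qed (use c in \<open>unfold beam_dom_def, blast+\<close>)
    then have "eigendata \<nu> \<phi> (of_real (u1 0)) (of_real (w1 0))"
      unfolding eigendata_def
      by (intro conjI exI; (assumption | simp add: \<phi>_def scaleR_conv_of_real mult_ac)?) (auto simp: \<phi>_def scaleR_conv_of_real)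
    then have "\<phi> \<in> V" by (auto simp: V)
    then have "\<phi> x = 0" using sub by auto
    then show False using x by (simp add: \<phi>_def)
  qed
  ultimately have "card B > 0" by (simp add: card_gt_0_iff)
  then show ?thesis using B(4) unfolding beam_multiplicity_def V_def by simp
qed

lemma eigen_imp_listed:
  assumes mu: "beam_eigenvalues \<alpha> \<beta> \<rho> \<eta> \<mu>" and "eigen \<nu> u" "x \<in> {0..pi}" "u x \<noteq> 0"
  shows "\<nu> \<in> \<mu> ` {1..}"
proof -
  have "card {n \<in> {1..}. complex_of_real (\<mu> n) = complex_of_real \<nu>} > 0"
    using mu eigen_imp_multiplicity_pos[OF assms(2-)] unfolding beam_eigenvalues_def by metis
  then obtain n where "n \<in> {1..}" "complex_of_real (\<mu> n) = complex_of_real \<nu>"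
    by (metis (mono_tags, lifting) card.empty ex_in_conv less_irrefl mem_Collect_eq)
  then show ?thesis by auto
qed

lemma countable_eigen:
  assumes "beam_eigenvalues \<alpha> \<beta> \<rho> \<eta> \<mu>"
  shows "countable {\<nu>. \<exists>u x. eigen \<nu> u \<and> x \<in> {0..pi} \<and> u x \<noteq> 0}"
proof (rule countable_subset)
  show "{\<nu>. \<exists>u x. eigen \<nu> u \<and> x \<in> {0..pi} \<and> u x \<noteq> 0} \<subseteq> \<mu> ` {1..}"
    using eigen_imp_listed[OF assms] by blast
qed simp

end

section \<open>Polynomial approximation of the domain\<close>

lemma poly_antiderivative: "\<exists>Q :: real poly. pderiv Q = P \<and> poly Q 0 = c"
proof -
  have sum: "pderiv (\<Sum>i\<in>A. f i) = (\<Sum>i\<in>A. pderiv (f i))" for f :: "nat \<Rightarrow> real poly" and A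
    by (induction A rule: infinite_finite_induct) (simp_all add: pderiv_add)
  have "pderiv (\<Sum>i\<le>degree P. monom (coeff P i / real (Suc i)) (Suc i)) = P"
    unfolding sum by (simp add: pderiv_monom poly_as_sum_of_monoms del: of_nat_Suc)
  then have "\<exists>Q :: real poly. pderiv Q = P" by blast
  then obtain Q where Q: "pderiv Q = P" by blast
  then show ?thesis by (intro exI[of _ "Q + [:c - poly Q 0:]"]) (simp add: pderiv_add pderiv_pCons)
qed

lemma real_polynomial_function_poly:
  "real_polynomial_function f \<Longrightarrow> \<exists>P :: real poly. f = poly P"
proof -
  assume "real_polynomial_function f"
  then obtain a n where "f = (\<lambda>x. \<Sum>i\<le>n. a i * x ^ i)" using real_polynomial_function_iff_sum by blast
  then have "f = poly (\<Sum>i\<le>n. monom (a i) i)" by (simp add: fun_eq_iff poly_sum poly_monom)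
  then show ?thesis by blast
qed

text \<open>The difference vanishes at 0 and has slope at most \<open>\<delta>\<close>, so each
  integration enlarges a uniform error by at most the length of the interval.\<close>

lemma close_antiderivative:
  assumes f: "\<And>x. x \<in> {0..pi} \<Longrightarrow> (f has_real_derivative f' x) (at x within {0..pi})"
    and Q: "pderiv Q = P" "poly Q 0 = f 0"
    and close: "\<And>x. x \<in> {0..pi} \<Longrightarrow> \<bar>poly P x - f' x\<bar> \<le> \<delta>" and x: "x \<in> {0..pi}"
  shows "\<bar>poly Q x - f x\<bar> \<le> pi * \<delta>"
proof -
  have \<delta>: "\<delta> \<ge> 0" using close[of 0] by (auto intro: order_trans[OF abs_ge_zero])
  have "norm ((poly Q x - f x) - (poly Q 0 - f 0)) \<le> \<delta> * norm (x - 0)"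
  proof (rule field_differentiable_bound[of "{0..pi}" "\<lambda>x. poly Q x - f x" "\<lambda>x. poly P x - f' x"])
    show "((\<lambda>x. poly Q x - f x) has_field_derivative poly P z - f' z) (at z within {0..pi})" if "z \<in> {0..pi}" for z
      using f[OF that] has_field_derivative_at_within[OF poly_DERIV[of Q z]] Q by (auto intro: DERIV_diff)
  qed (use x close in auto)
  also have "\<dots> \<le> \<delta> * pi" using x \<delta> by (intro mult_left_mono) auto
  finally show ?thesis using Q by (simp add: mult.commute)
qed

context beam
begin

lemma beam_dom_poly:
  assumes "\<And>x. x \<in> {0, pi} \<Longrightarrow> poly P x = 0 \<and> \<kappa> x * poly (pderiv P) x + poly (pderiv (pderiv P)) x = 0"
  shows "beam_dom (poly P) (poly (pderiv P)) (poly (pderiv (pderiv P)))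
    (\<lambda>x. \<eta>1 x * poly (pderiv (pderiv P)) x + \<eta> x * poly (pderiv (pderiv (pderiv P))) x)
    (\<lambda>x. \<eta>2 x * poly (pderiv (pderiv P)) x + (2 * \<eta>1 x) * poly (pderiv (pderiv (pderiv P))) x
      + \<eta> x * poly (pderiv (pderiv (pderiv (pderiv P)))) x)"
proof -
  have d: "(poly R has_vector_derivative poly (pderiv R) x) (at x within {0..pi})" for R :: "real poly" and x
    using has_field_derivative_at_within[OF poly_DERIV[of R x]] by (simp add: has_real_derivative_iff_has_vector_derivative)
  show ?thesis
    using beam_dom_C4[OF d d d d, of P] assms by simp
qed

text \<open>\<open>u2\<close> is the quotient of a twice differentiable function and
  \<open>\<eta>\<close>, so the two derivatives of \<open>\<eta>\<close> let the quotient rule be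
  applied twice.\<close>

lemma C4_representation:
  assumes "beam_dom (u :: real \<Rightarrow> real) u1 u2 w1 w2" and w2: "continuous_on {0..pi} w2"
  obtains u3 u4 where "\<And>x. x \<in> {0..pi} \<Longrightarrow> (u2 has_real_derivative u3 x) (at x within {0..pi})"
    "\<And>x. x \<in> {0..pi} \<Longrightarrow> (u3 has_real_derivative u4 x) (at x within {0..pi})"
    "continuous_on {0..pi} u4"
    "\<And>x. x \<in> {0..pi} \<Longrightarrow> w2 x = \<eta>2 x * u2 x + (2 * \<eta>1 x) * u3 x + \<eta> x * u4 x"
proof -
  note d = assms(1)[unfolded beam_dom_def, THEN conjunct1, rule_format, folded has_real_derivative_iff_has_vector_derivative]
  define w where "w x = \<eta> x * u2 x" for x
  have dw: "(w has_real_derivative w1 x) (at x within {0..pi})" "(w1 has_real_derivative w2 x) (at x within {0..pi})"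
    if "x \<in> {0..pi}" for x
    using d[OF that] unfolding w_def by auto
  define u3 where "u3 x = (w1 x - \<eta>1 x * w x / \<eta> x) / \<eta> x" for x
  define u4 where "u4 x = (w2 x - \<eta>2 x * u2 x - 2 * \<eta>1 x * u3 x) / \<eta> x" for x
  have u2w: "u2 x = w x / \<eta> x" if "x \<in> {0..pi}" for x using \<eta>_nz[OF that] by (simp add: w_def)
  have d2: "(u2 has_real_derivative u3 x) (at x within {0..pi})" if x: "x \<in> {0..pi}" for x
  proof -
    have "((\<lambda>x. w x / \<eta> x) has_real_derivative u3 x) (at x within {0..pi})"
      using DERIV_divide[OF dw(1)[OF x] \<eta>1[OF x] \<eta>_nz[OF x]] \<eta>_nz[OF x]
      by (simp add: u3_def field_simps)
    then show ?thesis
      by (rule has_field_derivative_transform_within[OF _ zero_less_one x]) (simp add: u2w)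
  qed
  have d3: "(u3 has_real_derivative u4 x) (at x within {0..pi})" if x: "x \<in> {0..pi}" for x
  proof -
    have "((\<lambda>x. (w1 x - \<eta>1 x * u2 x) / \<eta> x) has_real_derivative
       ((w2 x - (\<eta>2 x * u2 x + u3 x * \<eta>1 x)) * \<eta> x - (w1 x - \<eta>1 x * u2 x) * \<eta>1 x) / (\<eta> x * \<eta> x)) (at x within {0..pi})"
      by (intro DERIV_divide DERIV_diff DERIV_mult dw \<eta>1 \<eta>2 d2 x \<eta>_nz)
    moreover have "w1 x - \<eta>1 x * u2 x = u3 x * \<eta> x" using \<eta>_nz[OF x] by (simp add: u3_def u2w[OF x])
    then have "((w2 x - (\<eta>2 x * u2 x + u3 x * \<eta>1 x)) * \<eta> x - (w1 x - \<eta>1 x * u2 x) * \<eta>1 x) / (\<eta> x * \<eta> x) = u4 x"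
      using \<eta>_nz[OF x] by (simp add: u4_def field_simps)
    ultimately have "((\<lambda>x. (w1 x - \<eta>1 x * u2 x) / \<eta> x) has_real_derivative u4 x) (at x within {0..pi})" by simp
    then show ?thesis
      by (rule has_field_derivative_transform_within[OF _ zero_less_one x]) (simp add: u3_def u2w)
  qed
  show ?thesis
  proof (rule that[OF d2 d3])
    have "continuous_on {0..pi} u2" "continuous_on {0..pi} u3"
      by (rule DERIV_continuous_on[OF d2], assumption) (rule DERIV_continuous_on[OF d3], assumption)
    then show "continuous_on {0..pi} u4"
      unfolding u4_def by (intro continuous_on_divide continuous_on_diff continuous_on_mult continuous_on_const
        w2 \<eta>2_cont \<eta>1_cont \<eta>_cont ballI \<eta>_nz)
  next
    fix x assume "x \<in> {0..pi}"
    then show "w2 x = \<eta>2 x * u2 x + (2 * \<eta>1 x) * u3 x + \<eta> x * u4 x" using \<eta>_nz by (simp add: u4_def)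
  qed
qed

lemma bounded_on_interval:
  fixes f :: "real \<Rightarrow> real"
  assumes "continuous_on {0..pi} f"
  shows "\<exists>B>0. \<forall>x\<in>{0..pi}. \<bar>f x\<bar> \<le> B"
proof -
  have "bounded (f ` {0..pi})" by (intro compact_imp_bounded compact_continuous_image assms) simp
  then obtain B where "B > 0" "\<forall>y\<in>f ` {0..pi}. norm y \<le> B" unfolding bounded_pos by blast
  then show ?thesis by auto
qed

text \<open>The correction \<open>s x\<^sup>3 + t x\<^sup>3 (x - \<pi>)\<^sup>2\<close> restores the boundary conditions at \<open>\<pi>\<close> without
  disturbing those at \<open>0\<close>.\<close>

lemma beam_dom_poly_approximation:
  assumes dom: "beam_dom (u :: real \<Rightarrow> real) u1 u2 w1 w2" and w2: "continuous_on {0..pi} w2" and \<epsilon>: "\<epsilon> > 0"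
  obtains P where "\<And>x. x \<in> {0, pi} \<Longrightarrow> poly P x = 0 \<and> \<kappa> x * poly (pderiv P) x + poly (pderiv (pderiv P)) x = 0"
    "\<And>x. x \<in> {0..pi} \<Longrightarrow> \<bar>poly P x - u x\<bar> \<le> \<epsilon>"
    "\<And>x. x \<in> {0..pi} \<Longrightarrow> \<bar>\<eta>2 x * poly (pderiv (pderiv P)) x + (2 * \<eta>1 x) * poly (pderiv (pderiv (pderiv P))) x
      + \<eta> x * poly (pderiv (pderiv (pderiv (pderiv P)))) x - w2 x\<bar> \<le> \<epsilon>"
proof -
  obtain u3 u4 where d2: "\<And>x. x \<in> {0..pi} \<Longrightarrow> (u2 has_real_derivative u3 x) (at x within {0..pi})"
    and d3: "\<And>x. x \<in> {0..pi} \<Longrightarrow> (u3 has_real_derivative u4 x) (at x within {0..pi})"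
    and c4: "continuous_on {0..pi} u4"
    and w2eq: "\<And>x. x \<in> {0..pi} \<Longrightarrow> w2 x = \<eta>2 x * u2 x + (2 * \<eta>1 x) * u3 x + \<eta> x * u4 x"
    using C4_representation[OF dom w2] by metis
  have d0: "(u has_real_derivative u1 x) (at x within {0..pi})" and d1: "(u1 has_real_derivative u2 x) (at x within {0..pi})"
    if "x \<in> {0..pi}" for x
    using dom that unfolding beam_dom_def has_real_derivative_iff_has_vector_derivative by blast+
  have bc: "u x = 0 \<and> \<kappa> x * u1 x + u2 x = 0" if "x \<in> {0, pi}" for x using dom that unfolding beam_dom_def by auto
  define X3 Y :: "real poly" where "X3 = [:0, 1:] ^ 3" and "Y = X3 * [:- pi, 1:]\<^sup>2"
  define D where "D k P = (pderiv ^^ k) P" for k and P :: "real poly"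
  have "\<exists>B>0. \<forall>k\<le>4. \<forall>x\<in>{0..pi}. \<bar>poly (D k P) x\<bar> \<le> B" for P
  proof -
    have "\<exists>B>0. \<forall>x\<in>{0..pi}. \<bar>poly (D k P) x\<bar> \<le> B" for k
      by (rule bounded_on_interval) (intro continuous_intros)
    then obtain B where B: "\<And>k. B k > 0" "\<And>k x. x \<in> {0..pi} \<Longrightarrow> \<bar>poly (D k P) x\<bar> \<le> B k" by metis
    show ?thesis
    proof (intro exI[of _ "\<Sum>k\<le>4. B k"] conjI allI impI ballI)
      show "(\<Sum>k\<le>4. B k) > 0" using B(1) by (intro sum_pos) auto
      fix k :: nat and x :: real assume k: "k \<le> 4" and x: "x \<in> {0..pi}"
      have "B k \<le> (\<Sum>k\<le>4. B k)" using k B(1) by (intro member_le_sum) (auto intro: less_imp_le)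
      then show "\<bar>poly (D k P) x\<bar> \<le> (\<Sum>k\<le>4. B k)" using B(2)[OF x, of k] by linarith
    qed
  qed note bndD = this
  obtain BX where BX: "BX > 0" "\<And>k x. k \<le> 4 \<Longrightarrow> x \<in> {0..pi} \<Longrightarrow> \<bar>poly (D k X3) x\<bar> \<le> BX" using bndD[of X3] by blast
  obtain BY where BY: "BY > 0" "\<And>k x. k \<le> 4 \<Longrightarrow> x \<in> {0..pi} \<Longrightarrow> \<bar>poly (D k Y) x\<bar> \<le> BY" using bndD[of Y] by blast
  obtain E where E: "E > 0" "\<And>x. x \<in> {0..pi} \<Longrightarrow> \<bar>\<eta> x\<bar> \<le> E" "\<And>x. x \<in> {0..pi} \<Longrightarrow> \<bar>\<eta>1 x\<bar> \<le> E" "\<And>x. x \<in> {0..pi} \<Longrightarrow> \<bar>\<eta>2 x\<bar> \<le> E"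
  proof -
    obtain A where A: "A > 0" "\<forall>x\<in>{0..pi}. \<bar>\<eta> x\<bar> \<le> A" using bounded_on_interval[OF \<eta>_cont] by blast
    obtain B where B: "B > 0" "\<forall>x\<in>{0..pi}. \<bar>\<eta>1 x\<bar> \<le> B" using bounded_on_interval[OF \<eta>1_cont] by blast
    obtain C where C: "C > 0" "\<forall>x\<in>{0..pi}. \<bar>\<eta>2 x\<bar> \<le> C" using bounded_on_interval[OF \<eta>2_cont] by blast
    show thesis by (rule that[of "A + B + C"]) (use A B C in force)+
  qed
  define c1 where "c1 = \<bar>\<kappa> pi\<bar> + 1"
  \<comment> \<open>The bound for \<open>\<bar>t\<bar> / \<delta>0\<close>: \<open>c1\<close>
    accounts for the errors of \<open>Q1\<close> and \<open>Q2\<close> in the boundary condition,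
    the other summands for the cubic correction.\<close>
  define kt where "kt = (c1 + \<bar>\<kappa> pi\<bar> * 3 / pi + 6 / pi\<^sup>2) / (2 * pi ^ 3)"
  have kt: "kt \<ge> 0" by (simp add: kt_def c1_def)
  define M where "M = 1 + BX + kt * BY"
  have M: "M > 0" using BX BY kt by (simp add: M_def add_pos_nonneg)
  \<comment> \<open>The coefficients \<open>\<eta>2\<close>, \<open>2 \<eta>1\<close> and
    \<open>\<eta>\<close> contribute at most \<open>4 E\<close> together, and \<open>M\<close> is
    the factor by which the corrections enlarge the error.\<close>
  define \<delta>0 where "\<delta>0 = \<epsilon> / (M * (4 * E + 1))"
  have \<delta>0: "\<delta>0 > 0" using \<epsilon> M E by (simp add: \<delta>0_def)
  have "M * \<delta>0 = \<epsilon> / (4 * E + 1)" using M by (simp add: \<delta>0_def)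
  moreover have "\<epsilon> / (4 * E + 1) \<le> \<epsilon>" "4 * E * (\<epsilon> / (4 * E + 1)) \<le> \<epsilon>"
    using \<epsilon> E(1) by (auto simp: pos_divide_le_eq algebra_simps)
  ultimately have ME: "M * \<delta>0 \<le> \<epsilon>" "4 * E * (M * \<delta>0) \<le> \<epsilon>" by simp_all
  \<comment> \<open>Four integrations multiply the error by at most \<open>pi\<close> each.\<close>
  define \<delta> where "\<delta> = \<delta>0 / pi ^ 4"
  have \<delta>: "\<delta> > 0" using \<delta>0 by (simp add: \<delta>_def)
  have pi1: "pi \<ge> 1" using pi_gt3 by linarith
  obtain f where "real_polynomial_function f" "\<And>x. x \<in> {0..pi} \<Longrightarrow> \<bar>u4 x - f x\<bar> < \<delta>"
    using Stone_Weierstrass_real_polynomial_function[OF compact_Icc c4 \<delta>] by blast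
  then obtain Q4 where Q4: "\<And>x. x \<in> {0..pi} \<Longrightarrow> \<bar>poly Q4 x - u4 x\<bar> \<le> \<delta>"
    using real_polynomial_function_poly by (metis abs_minus_commute less_imp_le)
  obtain Q3 where Q3: "pderiv Q3 = Q4" "poly Q3 0 = u3 0" using poly_antiderivative by blast
  obtain Q2 where Q2: "pderiv Q2 = Q3" "poly Q2 0 = u2 0" using poly_antiderivative by blast
  obtain Q1 where Q1: "pderiv Q1 = Q2" "poly Q1 0 = u1 0" using poly_antiderivative by blast
  obtain Q0 where Q0: "pderiv Q0 = Q1" "poly Q0 0 = u 0" using poly_antiderivative by blast
  have e3: "\<bar>poly Q3 x - u3 x\<bar> \<le> pi * \<delta>" if "x \<in> {0..pi}" for x by (rule close_antiderivative[OF d3 Q3 Q4 that])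
  have e2: "\<bar>poly Q2 x - u2 x\<bar> \<le> pi * (pi * \<delta>)" if "x \<in> {0..pi}" for x by (rule close_antiderivative[OF d2 Q2 e3 that])
  have e1: "\<bar>poly Q1 x - u1 x\<bar> \<le> pi * (pi * (pi * \<delta>))" if "x \<in> {0..pi}" for x by (rule close_antiderivative[OF d1 Q1 e2 that])
  have e0: "\<bar>poly Q0 x - u x\<bar> \<le> pi * (pi * (pi * (pi * \<delta>)))" if "x \<in> {0..pi}" for x by (rule close_antiderivative[OF d0 Q0 e1 that])
  have step: "y \<le> pi * y" if "y \<ge> 0" for y :: real using mult_right_mono[OF pi1 that] by simp
  have p4: "pi * (pi * (pi * (pi * \<delta>))) = \<delta>0" by (simp add: \<delta>_def power4_eq_xxxx)
  have le: "\<delta> \<le> \<delta>0" "pi * \<delta> \<le> \<delta>0" "pi * (pi * \<delta>) \<le> \<delta>0" "pi * (pi * (pi * \<delta>)) \<le> \<delta>0"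
  proof -
    have 0: "0 \<le> \<delta>" "0 \<le> pi * \<delta>" "0 \<le> pi * (pi * \<delta>)" "0 \<le> pi * (pi * (pi * \<delta>))" using \<delta> by simp_all
    note 1 = step[OF 0(1)] and 2 = step[OF 0(2)] and 3 = step[OF 0(3)] and 4 = step[OF 0(4), unfolded p4]
    show "\<delta> \<le> \<delta>0" "pi * \<delta> \<le> \<delta>0" "pi * (pi * \<delta>) \<le> \<delta>0" "pi * (pi * (pi * \<delta>)) \<le> \<delta>0"
      using 1 2 3 4 by linarith+
  qed
  \<comment> \<open>At \<open>pi\<close> the polynomial \<open>Y\<close> has zero value, zero slope
    and second derivative \<open>2 pi\<^sup>3\<close>. So the value is repaired by \<open>s\<close>
    alone, and the remaining condition then by \<open>t\<close>.\<close>
  define s where "s = - poly Q0 pi / pi ^ 3"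
  define t where "t = - (\<kappa> pi * poly Q1 pi + poly Q2 pi + \<kappa> pi * (3 * s * pi\<^sup>2) + 6 * s * pi) / (2 * pi ^ 3)"
  define P where "P = Q0 + smult s X3 + smult t Y"
  have bs: "\<bar>s\<bar> \<le> \<delta>0 / pi ^ 3"
    using e0[of pi] bc[of pi] unfolding p4 by (simp add: s_def abs_divide divide_right_mono)
  then have bs1: "\<bar>s\<bar> \<le> \<delta>0" using \<delta>0 one_le_power[OF pi1, of 3] by (auto intro: order_trans simp: divide_le_eq mult_le_cancel_left1)
  have bt: "\<bar>t\<bar> \<le> kt * \<delta>0"
  proof -
    have 1: "\<bar>\<kappa> pi * poly Q1 pi + poly Q2 pi\<bar> \<le> c1 * \<delta>0"
    proof -
      have "\<kappa> pi * poly Q1 pi + poly Q2 pi = \<kappa> pi * (poly Q1 pi - u1 pi) + (poly Q2 pi - u2 pi)"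
        using bc[of pi] by (simp add: algebra_simps)
      also have "\<bar>\<dots>\<bar> \<le> \<bar>\<kappa> pi\<bar> * \<bar>poly Q1 pi - u1 pi\<bar> + \<bar>poly Q2 pi - u2 pi\<bar>"
        by (metis abs_mult abs_triangle_ineq)
      also have "\<dots> \<le> \<bar>\<kappa> pi\<bar> * \<delta>0 + \<delta>0" using e1[of pi] e2[of pi] le by (intro add_mono mult_left_mono) auto
      finally show ?thesis by (simp add: c1_def algebra_simps)
    qed
    have 2: "\<bar>\<kappa> pi * (3 * s * pi\<^sup>2)\<bar> \<le> \<bar>\<kappa> pi\<bar> * 3 / pi * \<delta>0"
    proof -
      have "\<bar>\<kappa> pi * (3 * s * pi\<^sup>2)\<bar> = \<bar>\<kappa> pi\<bar> * 3 * pi\<^sup>2 * \<bar>s\<bar>" by (simp add: abs_mult)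
      also have "\<dots> \<le> \<bar>\<kappa> pi\<bar> * 3 * pi\<^sup>2 * (\<delta>0 / pi ^ 3)" using bs by (intro mult_left_mono) auto
      finally show ?thesis by (simp add: field_simps power2_eq_square power3_eq_cube)
    qed
    have 3: "\<bar>6 * s * pi\<bar> \<le> 6 / pi\<^sup>2 * \<delta>0"
    proof -
      have "\<bar>6 * s * pi\<bar> = 6 * pi * \<bar>s\<bar>" by (simp add: abs_mult)
      also have "\<dots> \<le> 6 * pi * (\<delta>0 / pi ^ 3)" using bs by (intro mult_left_mono) auto
      finally show ?thesis by (simp add: field_simps power2_eq_square power3_eq_cube)
    qed
    have "\<bar>\<kappa> pi * poly Q1 pi + poly Q2 pi + \<kappa> pi * (3 * s * pi\<^sup>2) + 6 * s * pi\<bar> \<le> (c1 + \<bar>\<kappa> pi\<bar> * 3 / pi + 6 / pi\<^sup>2) * \<delta>0"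
      using 1 2 3 unfolding distrib_right by linarith
    then have "\<bar>\<kappa> pi * poly Q1 pi + poly Q2 pi + \<kappa> pi * (3 * s * pi\<^sup>2) + 6 * s * pi\<bar> / (2 * pi ^ 3)
        \<le> (c1 + \<bar>\<kappa> pi\<bar> * 3 / pi + 6 / pi\<^sup>2) * \<delta>0 / (2 * pi ^ 3)" by (intro divide_right_mono) auto
    moreover have "\<bar>t\<bar> = \<bar>\<kappa> pi * poly Q1 pi + poly Q2 pi + \<kappa> pi * (3 * s * pi\<^sup>2) + 6 * s * pi\<bar> / (2 * pi ^ 3)"
      unfolding t_def abs_divide abs_minus_cancel by simp
    ultimately show ?thesis by (simp add: kt_def)
  qed
  have DP: "D k P = D k Q0 + smult s (D k X3) + smult t (D k Y)" for k
    unfolding D_def P_def by (induction k) (simp_all add: pderiv_add pderiv_smult)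
  have corr: "\<bar>poly (D k P) x - v\<bar> \<le> M * \<delta>0" if "k \<le> 4" "x \<in> {0..pi}" "\<bar>poly (D k Q0) x - v\<bar> \<le> \<delta>0" for k x v
  proof -
    have "\<bar>poly (D k P) x - v\<bar> \<le> \<bar>poly (D k Q0) x - v\<bar> + \<bar>s\<bar> * \<bar>poly (D k X3) x\<bar> + \<bar>t\<bar> * \<bar>poly (D k Y) x\<bar>"
      unfolding DP abs_mult[symmetric] by simp
    also have "\<dots> \<le> \<delta>0 + \<delta>0 * BX + (kt * \<delta>0) * BY"
      using that BX BY bs1 bt kt \<delta>0 by (intro add_mono mult_mono) auto
    finally show ?thesis by (simp add: M_def algebra_simps)
  qed
  have DQ: "D 0 Q0 = Q0" "D 1 Q0 = Q1" "D 2 Q0 = Q2" "D 3 Q0 = Q3" "D 4 Q0 = Q4"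
    by (simp_all add: D_def numeral_2_eq_2 numeral_3_eq_3 numeral_eq_Suc Q0 Q1 Q2 Q3)
  have Dn: "D 1 P = pderiv P" "D 2 P = pderiv (pderiv P)" "D 3 P = pderiv (pderiv (pderiv P))" "D 4 P = pderiv (pderiv (pderiv (pderiv P)))"
    by (simp_all add: D_def numeral_eq_Suc)
  have D0: "D 0 P = P" by (simp add: D_def)
  have X3v: "poly (D 0 X3) x = x ^ 3" "poly (D 1 X3) x = 3 * x\<^sup>2" "poly (D 2 X3) x = 6 * x" for x
    by (simp_all add: D_def X3_def power3_eq_cube power2_eq_square numeral_2_eq_2 pderiv_mult pderiv_pCons algebra_simps)
  have Yv: "poly (D 0 Y) 0 = 0" "poly (D 1 Y) 0 = 0" "poly (D 2 Y) 0 = 0" "poly (D 0 Y) pi = 0" "poly (D 1 Y) pi = 0" "poly (D 2 Y) pi = 2 * pi ^ 3"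
    by (simp_all add: D_def Y_def X3_def power3_eq_cube power2_eq_square numeral_2_eq_2 pderiv_mult pderiv_pCons algebra_simps)
  show ?thesis
  proof (rule that[of P])
    fix x :: real assume "x \<in> {0, pi}"
    then consider "x = 0" | "x = pi" by blast
    then show "poly P x = 0 \<and> \<kappa> x * poly (pderiv P) x + poly (pderiv (pderiv P)) x = 0"
    proof cases
      case 1
      have "poly (D 0 P) 0 = 0" "poly (D 1 P) 0 = u1 0" "poly (D 2 P) 0 = u2 0"
        using bc[of 0] Q0(2) Q1(2) Q2(2) unfolding DP DQ by (simp_all add: X3v Yv del: One_nat_def)
      then show ?thesis using 1 bc[of 0] by (simp add: D0 Dn del: One_nat_def)
    next
      case 2
      have "poly (D 0 P) pi = 0" unfolding DP DQ by (simp add: X3v Yv s_def)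
      moreover have "\<kappa> pi * poly (D 1 P) pi + poly (D 2 P) pi
          = \<kappa> pi * poly Q1 pi + poly Q2 pi + \<kappa> pi * (3 * s * pi\<^sup>2) + 6 * s * pi + t * (2 * pi ^ 3)"
        unfolding DP DQ by (simp add: X3v Yv algebra_simps del: One_nat_def)
      moreover have "\<dots> = 0" by (simp add: t_def)
      ultimately show ?thesis using 2 by (simp add: D0 Dn del: One_nat_def)
    qed
  next
    fix x assume x: "x \<in> {0..pi}"
    have "\<bar>poly (D 0 P) x - u x\<bar> \<le> M * \<delta>0" by (rule corr) (use x e0 p4 DQ in auto)
    then show "\<bar>poly P x - u x\<bar> \<le> \<epsilon>" using ME by (simp add: D_def)
    have c2: "\<bar>poly (D 2 P) x - u2 x\<bar> \<le> M * \<delta>0" by (rule corr) (use x order_trans[OF e2[OF x] le(3)] in \<open>simp_all add: DQ\<close>)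
    have c3: "\<bar>poly (D 3 P) x - u3 x\<bar> \<le> M * \<delta>0" by (rule corr) (use x order_trans[OF e3[OF x] le(2)] in \<open>simp_all add: DQ\<close>)
    have c4: "\<bar>poly (D 4 P) x - u4 x\<bar> \<le> M * \<delta>0" by (rule corr) (use x order_trans[OF Q4[OF x] le(1)] in \<open>simp_all add: DQ\<close>)
    have "\<eta>2 x * poly (D 2 P) x + (2 * \<eta>1 x) * poly (D 3 P) x + \<eta> x * poly (D 4 P) x - w2 x
      = \<eta>2 x * (poly (D 2 P) x - u2 x) + (2 * \<eta>1 x) * (poly (D 3 P) x - u3 x) + \<eta> x * (poly (D 4 P) x - u4 x)"
      unfolding w2eq[OF x] by (simp add: algebra_simps)
    also have "\<bar>\<dots>\<bar> \<le> \<bar>\<eta>2 x\<bar> * \<bar>poly (D 2 P) x - u2 x\<bar> + \<bar>2 * \<eta>1 x\<bar> * \<bar>poly (D 3 P) x - u3 x\<bar> + \<bar>\<eta> x\<bar> * \<bar>poly (D 4 P) x - u4 x\<bar>"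
      unfolding abs_mult[symmetric] by linarith
    also have "\<dots> \<le> E * (M * \<delta>0) + (2 * E) * (M * \<delta>0) + E * (M * \<delta>0)"
    proof -
      have "\<bar>2 * \<eta>1 x\<bar> \<le> 2 * E" using E(3)[OF x] by (simp add: abs_mult)
      then show ?thesis using c2 c3 c4 E x by (intro add_mono mult_mono) auto
    qed
    also have "\<dots> \<le> \<epsilon>" using ME(2) by (simp add: algebra_simps)
    finally show "\<bar>\<eta>2 x * poly (pderiv (pderiv P)) x + (2 * \<eta>1 x) * poly (pderiv (pderiv (pderiv P))) x
      + \<eta> x * poly (pderiv (pderiv (pderiv (pderiv P)))) x - w2 x\<bar> \<le> \<epsilon>" unfolding Dn .
  qed
qed

end

section \<open>The abstract Landesman--Lazer problem\<close>

text \<open>The Riesz-Fischer argument: along a fast subsequence the increments have summable L1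
  norms, so the telescoping series converges absolutely almost everywhere, and the sum of the
  absolute increments serves as the dominating function.\<close>

lemma L1_Cauchy_limit:
  fixes u :: "nat \<Rightarrow> 'a \<Rightarrow> real"
  assumes int: "\<And>n. integrable M (u n)"
    and Cauchy: "\<And>e. e > 0 \<Longrightarrow> \<exists>N. \<forall>m\<ge>N. \<forall>n\<ge>N. (\<integral>x. \<bar>u m x - u n x\<bar> \<partial>M) < e"
  obtains v r where "integrable M v" "strict_mono (r :: nat \<Rightarrow> nat)" "AE x in M. (\<lambda>n. u (r n) x) \<longlonglongrightarrow> v x"
    "(\<lambda>n. \<integral>x. \<bar>u (r n) x - v x\<bar> \<partial>M) \<longlonglongrightarrow> 0"
proof -
  have "\<exists>N. \<forall>m\<ge>N. \<forall>n\<ge>N. (\<integral>x. \<bar>u m x - u n x\<bar> \<partial>M) < (1/2) ^ k" for k :: nat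
    by (rule Cauchy) simp
  then obtain N where N: "\<And>k m n. m \<ge> N k \<Longrightarrow> n \<ge> N k \<Longrightarrow> (\<integral>x. \<bar>u m x - u n x\<bar> \<partial>M) < (1/2) ^ k" by metis
  \<comment> \<open>The sum makes \<open>r k\<close> at least \<open>N k\<close>; the added
    \<open>k\<close> makes the sequence strictly increasing.\<close>
  define r where "r k = (\<Sum>i\<le>k. N i) + k" for k
  have r: "strict_mono r" by (intro strict_monoI_Suc) (simp add: r_def)
  have rN: "r m \<ge> N k" if "m \<ge> k" for m k
  proof -
    have "N k \<le> (\<Sum>i\<le>m. N i)" using that by (intro member_le_sum) auto
    then show ?thesis by (simp add: r_def)
  qed
  define d where "d k x = u (r (Suc k)) x - u (r k) x" for k x
  have dint: "integrable M (d k)" for k unfolding d_def by (intro Bochner_Integration.integrable_diff int)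
  have dle: "(\<integral>x. \<bar>d k x\<bar> \<partial>M) \<le> (1/2) ^ k" for k
    unfolding d_def by (rule less_imp_le, rule N) (auto intro: rN)
  have meas [measurable]: "d k \<in> borel_measurable M" "u k \<in> borel_measurable M" for k
    using dint int by auto
  have "(\<integral>\<^sup>+x. (\<Sum>k. ennreal \<bar>d k x\<bar>) \<partial>M) = (\<Sum>k. \<integral>\<^sup>+x. ennreal \<bar>d k x\<bar> \<partial>M)"
    by (intro nn_integral_suminf) measurable
  also have "\<dots> = (\<Sum>k. ennreal (\<integral>x. \<bar>d k x\<bar> \<partial>M))"
    using dint by (intro suminf_cong nn_integral_eq_integral) auto
  also have "\<dots> \<le> (\<Sum>k. ennreal ((1/2) ^ k))"
    using dle by (intro suminf_le ennreal_leI) auto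
  also have "\<dots> = ennreal (\<Sum>k. (1/2) ^ k)"
    by (intro suminf_ennreal2) (auto intro: summable_geometric)
  also have "\<dots> < \<infinity>" by simp
  finally have fin: "(\<integral>\<^sup>+x. (\<Sum>k. ennreal \<bar>d k x\<bar>) \<partial>M) < \<infinity>" .
  have "AE x in M. (\<Sum>k. ennreal \<bar>d k x\<bar>) \<noteq> \<infinity>"
    using fin by (intro nn_integral_noteq_infinite) auto
  then have AEs: "AE x in M. summable (\<lambda>k. \<bar>d k x\<bar>)"
    by (elim AE_mp) (intro AE_I2 impI summable_suminf_not_top, auto)
  have summ: "summable (\<lambda>k. \<integral>x. \<bar>d k x\<bar> \<partial>M)"
    by (rule summable_comparison_test'[of "\<lambda>k. (1/2)^k" 0]) (use dle in \<open>auto intro: summable_geometric\<close>)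
  have gint: "integrable M (\<lambda>x. \<Sum>k. \<bar>d k x\<bar>)"
    using AEs summ dint by (intro integrable_suminf) auto
  define v where "v x = u (r 0) x + (\<Sum>k. d k x)" for x
  have vint: "integrable M v"
    unfolding v_def using AEs summ dint int by (intro Bochner_Integration.integrable_add integrable_suminf) auto
  have tele: "u (r n) x = u (r 0) x + (\<Sum>k<n. d k x)" for n x
    by (induction n) (auto simp: d_def)
  have lim: "AE x in M. (\<lambda>n. u (r n) x) \<longlonglongrightarrow> v x"
    using AEs
  proof eventually_elim
    case (elim x)
    then have "summable (\<lambda>k. d k x)" by (rule summable_rabs_cancel)
    then have "(\<lambda>n. \<Sum>k<n. d k x) \<longlonglongrightarrow> (\<Sum>k. d k x)" by (rule summable_LIMSEQ)
    then have "(\<lambda>n. u (r 0) x + (\<Sum>k<n. d k x)) \<longlonglongrightarrow> v x" unfolding v_def by (intro tendsto_intros)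
    then show ?case by (simp only: tele[symmetric])
  qed
  have "(\<lambda>n. \<integral>x. \<bar>u (r n) x - v x\<bar> \<partial>M) \<longlonglongrightarrow> (\<integral>x. 0 \<partial>M)"
  proof (rule integral_dominated_convergence[where w = "\<lambda>x. 2 * (\<Sum>k. \<bar>d k x\<bar>)"])
    show "AE x in M. (\<lambda>n. \<bar>u (r n) x - v x\<bar>) \<longlonglongrightarrow> 0"
      using lim by eventually_elim (auto intro: tendsto_rabs_zero LIM_zero)
    show "AE x in M. norm \<bar>u (r n) x - v x\<bar> \<le> 2 * (\<Sum>k. \<bar>d k x\<bar>)" for n
      using AEs
    proof eventually_elim
      case (elim x)
      have "\<bar>\<Sum>k. d k x\<bar> \<le> (\<Sum>k. \<bar>d k x\<bar>)" by (rule summable_rabs[OF elim])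
      moreover have "\<bar>\<Sum>k<n. d k x\<bar> \<le> (\<Sum>k. \<bar>d k x\<bar>)"
        by (rule order_trans[OF sum_abs sum_le_suminf[OF elim]]) auto
      ultimately show ?case unfolding tele[of n x] v_def by simp
    qed
  qed (use gint vint in auto)
  then show ?thesis using that[OF vint r lim] by simp
qed

text \<open>\<open>M\<close> will be the measure with density \<open>\<rho>\<close>, and
  \<open>e\<close>, \<open>lam\<close> the modes and their eigenvalues up to a common sign.
  \<open>F\<close> and \<open>f2\<close> represent the data f/\<rho> and f**; the part f* enters as
  their difference, through \<open>F_kernel\<close>. Bounds hold at every point, so that the bounded
  functions form an algebra.\<close>

locale landesman_lazer = finite_measure M for M :: "'a measure" +
  fixes J :: "'j set" and e :: "'j \<Rightarrow> 'a \<Rightarrow> real" and lam :: "'j \<Rightarrow> real"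
    and g :: "real \<Rightarrow> real" and F f2 :: "'a \<Rightarrow> real" and K gm gp \<epsilon> :: real
  assumes e_meas: "j \<in> J \<Longrightarrow> e j \<in> borel_measurable M"
    and e_bdd: "j \<in> J \<Longrightarrow> \<exists>B. \<forall>x\<in>space M. \<bar>e j x\<bar> \<le> B"
    and orth: "i \<in> J \<Longrightarrow> j \<in> J \<Longrightarrow> (\<integral>x. e i x * e j x \<partial>M) = (if i = j then 1 else 0)"
    and fin: "finite {j \<in> J. \<bar>lam j\<bar> \<le> R}"
    and mono: "mono g" and cont_g: "continuous_on UNIV g" and g_bdd: "\<bar>g s\<bar> < K"
    and gm: "(g \<longlongrightarrow> gm) at_bot" and gp: "(g \<longlongrightarrow> gp) at_top"
    and F_meas: "F \<in> borel_measurable M" and f2_meas: "f2 \<in> borel_measurable M"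
    and F_bdd: "\<exists>B. \<forall>x\<in>space M. \<bar>F x\<bar> \<le> B"
    and \<epsilon>: "\<epsilon> > 0" and f2_bdd: "x \<in> space M \<Longrightarrow> gm + \<epsilon> \<le> f2 x \<and> f2 x \<le> gp - \<epsilon>"
    and F_kernel: "j \<in> J \<Longrightarrow> lam j = 0 \<Longrightarrow> (\<integral>x. (F x - f2 x) * e j x \<partial>M) = 0"
begin

text \<open>Bounded measurable functions on a finite measure space are integrable and closed under
  products, which settles the integrability of every term of the Galerkin equations.\<close>

definition Bd :: "('a \<Rightarrow> real) \<Rightarrow> bool" where
  "Bd f \<longleftrightarrow> f \<in> borel_measurable M \<and> (\<exists>B. \<forall>x\<in>space M. \<bar>f x\<bar> \<le> B)"

lemma BdI: "f \<in> borel_measurable M \<Longrightarrow> (\<And>x. x \<in> space M \<Longrightarrow> \<bar>f x\<bar> \<le> B) \<Longrightarrow> Bd f"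
  unfolding Bd_def by blast

lemma Bd_meas [measurable_dest]: "Bd f \<Longrightarrow> f \<in> borel_measurable M" by (simp add: Bd_def)

lemma Bd_const [simp, intro!]: "Bd (\<lambda>_. c)" by (rule BdI[of _ "\<bar>c\<bar>"]) auto

lemma Bd_add [intro!]: assumes "Bd u" "Bd v" shows "Bd (\<lambda>x. u x + v x)"
proof -
  obtain A B where "\<And>x. x \<in> space M \<Longrightarrow> \<bar>u x\<bar> \<le> A" "\<And>x. x \<in> space M \<Longrightarrow> \<bar>v x\<bar> \<le> B"
    using assms by (auto simp: Bd_def)
  then have "\<bar>u x + v x\<bar> \<le> A + B" if "x \<in> space M" for x using that abs_triangle_ineq[of "u x" "v x"] add_mono by fastforce
  then show ?thesis using assms by (intro BdI[of _ "A + B"]) (auto simp: Bd_def)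
qed

lemma Bd_mult [intro!]: assumes "Bd u" "Bd v" shows "Bd (\<lambda>x. u x * v x)"
proof -
  obtain A B where "\<And>x. x \<in> space M \<Longrightarrow> \<bar>u x\<bar> \<le> A" "\<And>x. x \<in> space M \<Longrightarrow> \<bar>v x\<bar> \<le> B"
    using assms by (auto simp: Bd_def)
  then have "\<bar>u x * v x\<bar> \<le> A * B" if "x \<in> space M" for x
    using that unfolding abs_mult by (metis abs_ge_zero mult_mono order_trans)
  then show ?thesis using assms by (intro BdI[of _ "A * B"]) (auto simp: Bd_def)
qed

lemma Bd_minus [intro!]: "Bd u \<Longrightarrow> Bd (\<lambda>x. - u x)"
  using Bd_mult[of "\<lambda>_. -1" u] by simp
lemma Bd_diff [intro!]: "Bd u \<Longrightarrow> Bd v \<Longrightarrow> Bd (\<lambda>x. u x - v x)"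
  using Bd_add[of u "\<lambda>x. - v x"] by auto
lemma Bd_abs [intro!]: "Bd u \<Longrightarrow> Bd (\<lambda>x. \<bar>u x\<bar>)"
  by (auto simp: Bd_def)
lemma Bd_power2 [intro!]: "Bd u \<Longrightarrow> Bd (\<lambda>x. (u x)\<^sup>2)"
  unfolding power2_eq_square by auto
lemma Bd_divide [intro!]: "Bd u \<Longrightarrow> Bd (\<lambda>x. u x / c)"
  using Bd_mult[of u "\<lambda>_. 1 / c"] by simp
lemma Bd_sum [intro!]: "(\<And>i. i \<in> I \<Longrightarrow> Bd (u i)) \<Longrightarrow> Bd (\<lambda>x. \<Sum>i\<in>I. u i x)"
  by (induction I rule: infinite_finite_induct) auto

lemma Bd_integrable [intro!]: "Bd u \<Longrightarrow> integrable M u"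
  unfolding Bd_def by (auto intro!: integrable_const_bound AE_I2)

lemma Bd_e [intro!]: "j \<in> J \<Longrightarrow> Bd (e j)" using e_meas e_bdd by (auto simp: Bd_def)
lemma Bd_F [intro!]: "Bd F" using F_meas F_bdd by (auto simp: Bd_def)

lemma g_measurable: "g \<in> borel_measurable borel"
  using cont_g by (rule borel_measurable_continuous_onI)

lemma Bd_g: "u \<in> borel_measurable M \<Longrightarrow> Bd (\<lambda>x. g (u x))"
  using measurable_compose[OF _ g_measurable] g_bdd by (intro BdI[of _ K]) (auto intro: less_imp_le)

lemma gm_ge: "- K \<le> gm" and gp_le: "gp \<le> K"
proof -
  have K: "- K \<le> g s" "g s \<le> K" for s using g_bdd[of s] by linarith+
  show "- K \<le> gm" by (intro tendsto_lowerbound[OF gm] always_eventually) (auto simp: K)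
  show "gp \<le> K" by (intro tendsto_upperbound[OF gp] always_eventually) (auto simp: K)
qed

lemma f2_abs_le: "x \<in> space M \<Longrightarrow> \<bar>f2 x\<bar> \<le> K"
  using f2_bdd[of x] gm_ge gp_le \<epsilon> by linarith

lemma Bd_f2 [intro!]: "Bd f2"
  using f2_meas f2_abs_le by (rule BdI)

section \<open>Finite orthonormal expansions\<close>

definition ip :: "('a \<Rightarrow> real) \<Rightarrow> ('a \<Rightarrow> real) \<Rightarrow> real" where
  "ip u v = (\<integral>x. u x * v x \<partial>M)"

definition comb :: "'j set \<Rightarrow> ('j \<Rightarrow> real) \<Rightarrow> 'a \<Rightarrow> real" where
  "comb I c x = (\<Sum>j\<in>I. c j * e j x)"

lemma Bd_comb [intro!]: "I \<subseteq> J \<Longrightarrow> Bd (comb I c)"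
  unfolding comb_def by (intro Bd_sum Bd_mult) auto

lemma ip_comb: "finite I \<Longrightarrow> I \<subseteq> J \<Longrightarrow> Bd v \<Longrightarrow> ip v (comb I c) = (\<Sum>j\<in>I. c j * ip v (e j))"
proof -
  assume I: "finite I" "I \<subseteq> J" "Bd v"
  have "ip v (comb I c) = (\<integral>x. (\<Sum>j\<in>I. c j * (v x * e j x)) \<partial>M)"
    unfolding ip_def comb_def by (simp add: sum_distrib_left mult.left_commute)
  also have "\<dots> = (\<Sum>j\<in>I. \<integral>x. c j * (v x * e j x) \<partial>M)"
    using I by (intro Bochner_Integration.integral_sum) auto
  finally show ?thesis by (simp add: ip_def)
qed

lemma ip_comb_e: "finite I \<Longrightarrow> I \<subseteq> J \<Longrightarrow> j \<in> J \<Longrightarrow> ip (comb I c) (e j) = (if j \<in> I then c j else 0)"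
proof -
  assume I: "finite I" "I \<subseteq> J" "j \<in> J"
  have "ip (comb I c) (e j) = ip (e j) (comb I c)" by (simp add: ip_def mult.commute)
  also have "\<dots> = (\<Sum>i\<in>I. c i * ip (e j) (e i))" using I by (intro ip_comb) auto
  also have "\<dots> = (\<Sum>i\<in>I. if i = j then c i else 0)"
    using I orth[of j] by (intro sum.cong refl) (auto simp: ip_def)
  finally show ?thesis using I by simp
qed

lemma ip_comb_comb: "finite I \<Longrightarrow> I \<subseteq> J \<Longrightarrow> ip (comb I c) (comb I d) = (\<Sum>j\<in>I. c j * d j)"
  by (subst ip_comb) (auto simp: ip_comb_e subset_iff mult.commute intro!: sum.cong)

text \<open>Completing the square in each coefficient. The last sum vanishes for the coefficients
  \<open>ip v (e j)\<close>, which gives both Bessel's inequality and the best approximation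
  property.\<close>

lemma ip_diff_comb:
  assumes "finite I" "I \<subseteq> J" "Bd v"
  shows "(\<integral>x. (v x - comb I c x)\<^sup>2 \<partial>M) = ip v v - (\<Sum>j\<in>I. (ip v (e j))\<^sup>2) + (\<Sum>j\<in>I. (c j - ip v (e j))\<^sup>2)"
proof -
  have "(\<integral>x. (v x - comb I c x)\<^sup>2 \<partial>M) = (\<integral>x. v x * v x - 2 * (v x * comb I c x) + comb I c x * comb I c x \<partial>M)"
    by (simp add: power2_eq_square algebra_simps)
  also have "\<dots> = ip v v - 2 * ip v (comb I c) + ip (comb I c) (comb I c)"
  proof -
    have Bc: "Bd (comb I c)" using assms(2) by (rule Bd_comb)
    have "integrable M (\<lambda>x. v x * v x)" by (intro Bd_integrable Bd_mult assms(3))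
    moreover have "integrable M (\<lambda>x. v x * comb I c x)" by (intro Bd_integrable Bd_mult assms(3) Bc)
    moreover have "integrable M (\<lambda>x. comb I c x * comb I c x)" by (intro Bd_integrable Bd_mult Bc)
    ultimately show ?thesis by (simp add: ip_def)
  qed
  finally show ?thesis using assms
    by (simp add: ip_comb ip_comb_comb power2_eq_square algebra_simps sum.distrib sum_subtractf sum_distrib_left)
qed

lemma bessel:
  assumes "finite I" "I \<subseteq> J" "Bd v"
  shows "(\<Sum>j\<in>I. (ip v (e j))\<^sup>2) \<le> ip v v"
proof -
  have "0 \<le> (\<integral>x. (v x - comb I (\<lambda>j. ip v (e j)) x)\<^sup>2 \<partial>M)" by simp
  then show ?thesis unfolding ip_diff_comb[OF assms] by simp
qed

text \<open>Any bound for \<open>F\<close> increased by \<open>K\<close>, so that the residual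
  \<open>F - g u\<close> is bounded independently of \<open>u\<close>.\<close>

definition H :: real where "H = (SOME B. \<forall>x\<in>space M. \<bar>F x\<bar> \<le> B) + K"

lemma resid_le: "x \<in> space M \<Longrightarrow> \<bar>F x - g s\<bar> \<le> H"
  using someI_ex[OF F_bdd] g_bdd[of s] unfolding H_def by fastforce

lemma Bd_resid: "u \<in> borel_measurable M \<Longrightarrow> Bd (\<lambda>x. F x - g (u x))"
  by (intro Bd_diff Bd_F Bd_g)

text \<open>The kernel of the linear part is shifted by \<open>\<delta>\<close>, which makes the finite-dimensional problem
  a fixed-point problem for a map with bounded range.\<close>

lemma galerkin:
  assumes I: "finite I" "I \<subseteq> J" and \<delta>: "\<delta> > 0"
  obtains c where "\<And>j. j \<in> I \<Longrightarrow>
    (if lam j = 0 then \<delta> else lam j) * c j = ip (\<lambda>x. F x - g (comb I c x)) (e j)"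
proof -
  define L where "L j = (if lam j = 0 then \<delta> else lam j)" for j
  have L: "L j \<noteq> 0" for j using \<delta> by (auto simp: L_def)
  define n where "n = card I"
  \<comment> \<open>Numbers the modes, since the fixed point lemma indexes coordinates by an initial
    segment of the naturals.\<close>
  obtain h where h: "bij_betw h {..<n} I"
    using ex_bij_betw_nat_finite[OF I(1)] by (auto simp: n_def atLeast0LessThan)
  define N where "N y x = (\<Sum>i<n. y i * e (h i) x)" for y :: "nat \<Rightarrow> real" and x
  have hJ: "h i \<in> J" if "i < n" for i using h that I(2) by (auto simp: bij_betw_def)
  have BdN: "Bd (N y)" for y unfolding N_def using hJ by (intro Bd_sum Bd_mult) auto
  define f where "f y i = ip (\<lambda>x. F x - g (N y x)) (e (h i)) / L (h i)" for y i
  \<comment> \<open>One coordinate of \<open>f\<close> is dominated by the sum over all of them; the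
    1 keeps the box from degenerating.\<close>
  define C where "C = (\<Sum>i<n. H * (\<integral>x. \<bar>e (h i) x\<bar> \<partial>M) / \<bar>L (h i)\<bar>) + 1"
  have H0: "H * (\<integral>x. \<bar>w x\<bar> \<partial>M) \<ge> 0" for w :: "'a \<Rightarrow> real"
  proof (cases "space M = {}")
    case True
    then show ?thesis by (simp add: Bochner_Integration.integral_empty)
  next
    case False
    then obtain x where "x \<in> space M" by blast
    then have "H \<ge> 0" using resid_le[of x 0] by linarith
    then show ?thesis by simp
  qed
  have "\<exists>y. \<forall>i<n. \<bar>y i\<bar> \<le> C \<and> f y i = y i"
  proof (rule brouwer_nat_box)
    show "C > 0" unfolding C_def using H0 by (intro add_nonneg_pos sum_nonneg divide_nonneg_nonneg) auto
    fix y :: "nat \<Rightarrow> real" and i assume i: "i < n"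
    have "\<bar>ip (\<lambda>x. F x - g (N y x)) (e (h i))\<bar> \<le> (\<integral>x. \<bar>(F x - g (N y x)) * e (h i) x\<bar> \<partial>M)"
      unfolding ip_def by (rule integral_abs_bound)
    also have "\<dots> \<le> (\<integral>x. H * \<bar>e (h i) x\<bar> \<partial>M)"
      using hJ[OF i] BdN resid_le
      by (intro integral_mono Bd_integrable Bd_abs Bd_mult Bd_resid) (auto simp: abs_mult intro!: mult_right_mono dest: Bd_meas)
    finally have "\<bar>f y i\<bar> \<le> H * (\<integral>x. \<bar>e (h i) x\<bar> \<partial>M) / \<bar>L (h i)\<bar>"
      unfolding f_def abs_divide by (intro divide_right_mono) auto
    also have "\<dots> \<le> C"
    proof -
      have "H * (\<integral>x. \<bar>e (h i) x\<bar> \<partial>M) / \<bar>L (h i)\<bar> \<le> (\<Sum>i<n. H * (\<integral>x. \<bar>e (h i) x\<bar> \<partial>M) / \<bar>L (h i)\<bar>)"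
        using i H0 by (intro member_le_sum divide_nonneg_nonneg) auto
      then show ?thesis by (simp add: C_def)
    qed
    finally show "\<bar>f y i\<bar> \<le> C" .
  next
    fix X :: "nat \<Rightarrow> nat \<Rightarrow> real" and y i
    assume X: "\<And>j. j < n \<Longrightarrow> (\<lambda>k. X k j) \<longlonglongrightarrow> y j" and i: "i < n"
    have "(\<lambda>k. ip (\<lambda>x. F x - g (N (X k) x)) (e (h i))) \<longlonglongrightarrow> ip (\<lambda>x. F x - g (N y x)) (e (h i))"
      unfolding ip_def
    proof (rule integral_dominated_convergence[where w = "\<lambda>x. H * \<bar>e (h i) x\<bar>"])
      show "AE x in M. (\<lambda>k. (F x - g (N (X k) x)) * e (h i) x) \<longlonglongrightarrow> (F x - g (N y x)) * e (h i) x"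
      proof (intro AE_I2 tendsto_intros)
        fix x
        have "(\<lambda>k. N (X k) x) \<longlonglongrightarrow> N y x" unfolding N_def using X by (intro tendsto_intros) auto
        then show "(\<lambda>k. g (N (X k) x)) \<longlonglongrightarrow> g (N y x)"
          using cont_g by (auto intro: continuous_on_tendsto_compose[of UNIV g])
      qed
      show "AE x in M. norm ((F x - g (N (X k) x)) * e (h i) x) \<le> H * \<bar>e (h i) x\<bar>" for k
        using resid_le by (intro AE_I2) (auto simp: abs_mult intro!: mult_right_mono)
    qed (use hJ[OF i] BdN in \<open>auto intro!: Bd_meas Bd_resid Bd_mult Bd_abs Bd_integrable\<close>)
    then show "(\<lambda>k. f (X k) i) \<longlonglongrightarrow> f y i" unfolding f_def using L by (intro tendsto_intros) auto
  qed
  then obtain y where y: "\<And>i. i < n \<Longrightarrow> f y i = y i" by blast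
  define c where "c j = y (the_inv_into {..<n} h j)" for j
  have ch: "c (h i) = y i" if "i < n" for i
    using h that by (simp add: c_def bij_betw_def the_inv_into_f_f)
  have "comb I c = N y"
  proof
    fix x
    have "comb I c x = (\<Sum>i<n. c (h i) * e (h i) x)"
      unfolding comb_def using sum.reindex_bij_betw[OF h, of "\<lambda>j. c j * e j x"] by simp
    then show "comb I c x = N y x" using ch by (simp add: N_def)
  qed
  moreover have "L j * c j = ip (\<lambda>x. F x - g (N y x)) (e j)" if j: "j \<in> I" for j
  proof -
    obtain i where i: "i < n" "j = h i" using h j by (auto simp: bij_betw_def)
    then show ?thesis using y[OF i(1)] ch[OF i(1)] L[of j] by (auto simp: f_def field_simps)
  qed
  ultimately show ?thesis using that[of c] by (auto simp: L_def)
qed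

text \<open>The pointwise inequality \<open>\<bar>y\<bar> \<le> (t + y\<^sup>2 / t) / 2\<close>,
  integrated. The free parameter \<open>t\<close> balances the measure of the space against the L2
  norm.\<close>

lemma L1_le_L2:
  assumes "Bd w" "t > 0"
  shows "(\<integral>x. \<bar>w x\<bar> \<partial>M) \<le> (t * measure M (space M) + (\<integral>x. (w x)\<^sup>2 \<partial>M) / t) / 2"
proof -
  have "\<bar>y\<bar> \<le> (t + y\<^sup>2 / t) / 2" for y
  proof -
    have "0 \<le> (t - \<bar>y\<bar>)\<^sup>2" by simp
    then have "2 * t * \<bar>y\<bar> \<le> t * t + y\<^sup>2" by (simp add: power2_diff) (simp add: power2_eq_square algebra_simps)
    then show ?thesis using assms(2) by (simp add: field_simps)
  qed
  then have "(\<integral>x. \<bar>w x\<bar> \<partial>M) \<le> (\<integral>x. (t + (w x)\<^sup>2 / t) / 2 \<partial>M)"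
    using assms(1) by (intro integral_mono Bd_integrable Bd_divide Bd_add Bd_const Bd_power2 Bd_abs) auto
  also have "\<dots> = (t * measure M (space M) + (\<integral>x. (w x)\<^sup>2 \<partial>M) / t) / 2"
    using Bd_integrable[OF Bd_power2[OF assms(1)]] by simp
  finally show ?thesis .
qed

lemma L2_small_imp_L1_small:
  assumes "\<epsilon>' > 0"
  shows "\<exists>\<eta>>0. \<forall>w. Bd w \<longrightarrow> (\<integral>x. (w x)\<^sup>2 \<partial>M) < \<eta> \<longrightarrow> (\<integral>x. \<bar>w x\<bar> \<partial>M) < \<epsilon>'"
proof (intro exI conjI allI impI)
  define V where "V = measure M (space M)"
  have V: "V \<ge> 0" by (simp add: V_def)
  define t where "t = \<epsilon>' / (V + 1)"
  have t: "t > 0" using assms V by (simp add: t_def)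
  show "\<epsilon>' * t > 0" using t assms by simp
  fix w assume w: "Bd w" "(\<integral>x. (w x)\<^sup>2 \<partial>M) < \<epsilon>' * t"
  have "t * V \<le> \<epsilon>'" using V assms by (simp add: t_def field_simps)
  moreover have "(\<integral>x. (w x)\<^sup>2 \<partial>M) / t < \<epsilon>'" using w(2) t by (simp add: field_simps)
  ultimately show "(\<integral>x. \<bar>w x\<bar> \<partial>M) < \<epsilon>'" using L1_le_L2[OF w(1) t] by (simp add: V_def)
qed

text \<open>\<open>\<phi>\<close> plays the role of L applied to \<open>\<psi>\<close> and is tied
  to it by mode coefficients alone; the last clause puts \<open>\<psi>\<close> into the closed span
  of the modes.\<close>

definition test_pair :: "('a \<Rightarrow> real) \<Rightarrow> ('a \<Rightarrow> real) \<Rightarrow> bool" where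
  "test_pair \<psi> \<phi> \<longleftrightarrow> Bd \<psi> \<and> Bd \<phi> \<and> (\<forall>j\<in>J. ip \<phi> (e j) = lam j * ip \<psi> (e j)) \<and>
     (\<forall>\<eta>>0. \<exists>I c. finite I \<and> I \<subseteq> J \<and> (\<integral>x. (\<psi> x - comb I c x)\<^sup>2 \<partial>M) < \<eta>)"

text \<open>\<open>f2\<close> stays at distance \<open>\<epsilon>\<close> from both limits. Once
  \<open>g\<close> is within \<open>\<epsilon> / 2\<close> of a limit, \<open>g s - f2 x\<close> has
  the sign of \<open>s\<close> and modulus at least \<open>\<epsilon> / 2\<close>.\<close>

lemma coercive:
  obtains C0 where "C0 \<ge> 0"
    "\<And>x s. x \<in> space M \<Longrightarrow> \<epsilon> / 2 * \<bar>s\<bar> - C0 \<le> (g s - f2 x) * s"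
proof -
  have "eventually (\<lambda>s. gp - \<epsilon> / 2 < g s) at_top" using gp \<epsilon> by (intro order_tendstoD) auto
  then obtain S1 where S1: "\<And>s. s \<ge> S1 \<Longrightarrow> gp - \<epsilon> / 2 < g s" by (auto simp: eventually_at_top_linorder)
  have "eventually (\<lambda>s. g s < gm + \<epsilon> / 2) at_bot" using gm \<epsilon> by (intro order_tendstoD) auto
  then obtain S2 where S2: "\<And>s. s \<le> S2 \<Longrightarrow> g s < gm + \<epsilon> / 2" by (auto simp: eventually_at_bot_linorder)
  \<comment> \<open>Beyond \<open>S\<close> the sign is decided. On the middle range the product is
    at most \<open>2 K S\<close> in modulus, and the linear term is at most
    \<open>\<epsilon> S\<close>; this gives the constant
    \<open>(2 * K + \<epsilon>) * S\<close>.\<close>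
  define S where "S = max \<bar>S1\<bar> \<bar>S2\<bar>"
  have S: "S \<ge> 0" "S \<ge> S1" "- S \<le> S2" by (auto simp: S_def)
  have K: "K > 0" using g_bdd[of 0] by linarith
  show ?thesis
  proof (rule that[of "(2 * K + \<epsilon>) * S"])
    show "(2 * K + \<epsilon>) * S \<ge> 0" using S K \<epsilon> by simp
    fix x s assume x: "x \<in> space M"
    have SK: "(2 * K + \<epsilon>) * S \<ge> 0" using S K \<epsilon> by simp
    consider "s \<ge> S" | "s \<le> - S" | "\<bar>s\<bar> \<le> S" by linarith
    then show "\<epsilon> / 2 * \<bar>s\<bar> - (2 * K + \<epsilon>) * S \<le> (g s - f2 x) * s"
    proof cases
      case 1
      then have "\<epsilon> / 2 \<le> g s - f2 x" using S1[of s] S f2_bdd[OF x] by linarith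
      then have "\<epsilon> / 2 * s \<le> (g s - f2 x) * s" using 1 S by (intro mult_right_mono) auto
      then show ?thesis using 1 S SK by simp
    next
      case 2
      then have "\<epsilon> / 2 \<le> - (g s - f2 x)" using S2[of s] S f2_bdd[OF x] by linarith
      then have "\<epsilon> / 2 * (- s) \<le> - (g s - f2 x) * (- s)" using 2 S by (intro mult_right_mono) auto
      then have "\<epsilon> / 2 * (- s) \<le> (g s - f2 x) * s" by (simp only: mult_minus_left mult_minus_right minus_minus)
      moreover have "\<bar>s\<bar> = - s" using 2 S by simp
      ultimately show ?thesis using SK by simp
    next
      case 3
      have "\<bar>g s - f2 x\<bar> \<le> 2 * K" using g_bdd[of s] f2_abs_le[OF x] by linarith
      then have "\<bar>(g s - f2 x) * s\<bar> \<le> 2 * K * \<bar>s\<bar>" unfolding abs_mult by (intro mult_right_mono) auto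
      moreover have "(2 * K + \<epsilon> / 2) * \<bar>s\<bar> \<le> (2 * K + \<epsilon>) * S" using 3 K \<epsilon> by (intro mult_mono) auto
      ultimately show ?thesis by (simp add: distrib_right)
    qed
  qed
qed

text \<open>All estimates rest on the residual \<open>h N\<close> being bounded uniformly in
  \<open>N\<close>. Dividing its coefficients by the eigenvalues bounds \<open>v N\<close> and makes
  the tails uniformly small; multiplying the equation by \<open>u N\<close> bounds the kernel part.
  The resulting strong convergence lets the bounded continuous \<open>g\<close> pass to the
  limit.\<close>

theorem solution_exists:
  obtains u where "u \<in> borel_measurable M" "integrable M (\<lambda>x. (u x)\<^sup>2)"
    "\<And>\<psi> \<phi>. test_pair \<psi> \<phi> \<Longrightarrow> ip u \<phi> + ip (\<lambda>x. g (u x)) \<psi> = ip F \<psi>"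
proof -
  define V where "V = measure M (space M)"
  have V: "V \<ge> 0" by (simp add: V_def)
  define I where "I N = {j \<in> J. \<bar>lam j\<bar> \<le> real N}" for N :: nat
  have I: "finite (I N)" "I N \<subseteq> J" for N using fin by (auto simp: I_def)
  have Imono: "I m \<subseteq> I n" if "m \<le> n" for m n using that by (auto simp: I_def)
  define \<delta> where "\<delta> N = 1 / real (Suc N)" for N
  have \<delta>: "\<delta> N > 0" for N by (simp add: \<delta>_def)
  have "\<forall>N. \<exists>c. \<forall>j\<in>I N. (if lam j = 0 then \<delta> N else lam j) * c j = ip (\<lambda>x. F x - g (comb (I N) c x)) (e j)"
    using galerkin[OF I \<delta>] by metis
  then obtain c where c: "\<And>N j. j \<in> I N \<Longrightarrow>
      (if lam j = 0 then \<delta> N else lam j) * c N j = ip (\<lambda>x. F x - g (comb (I N) (c N) x)) (e j)" by metis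
  define u where "u N = comb (I N) (c N)" for N
  define h where "h N x = F x - g (u N x)" for N x
  have Bu: "Bd (u N)" for N unfolding u_def by (intro Bd_comb I)
  have Bh: "Bd (h N)" for N unfolding h_def using Bu by (intro Bd_resid Bd_meas)
  have c0: "ip (h N) (e j) = \<delta> N * c N j" if "j \<in> I N" "lam j = 0" for N j
    using c[OF that(1)] that(2) by (simp add: h_def[abs_def] u_def)
  have c1: "ip (h N) (e j) = lam j * c N j" if "j \<in> I N" "lam j \<noteq> 0" for N j
    using c[OF that(1)] that(2) by (simp add: h_def[abs_def] u_def)
  define A where "A = H\<^sup>2 * V"
  have A: "A \<ge> 0" using V by (simp add: A_def)
  have hh: "ip (h N) (h N) \<le> A" for N
  proof -
    have "ip (h N) (h N) \<le> (\<integral>x. H\<^sup>2 \<partial>M)" unfolding ip_def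
    proof (rule integral_mono)
      show "integrable M (\<lambda>x. h N x * h N x)" using Bh by auto
      fix x assume "x \<in> space M"
      then have "\<bar>h N x\<bar> \<le> H" using resid_le by (simp add: h_def)
      then have "\<bar>h N x\<bar>\<^sup>2 \<le> H\<^sup>2" by (intro power_mono) auto
      then show "h N x * h N x \<le> H\<^sup>2" by (simp add: power2_eq_square)
    qed simp
    then show ?thesis by (simp add: A_def V_def mult.commute)
  qed
  have bes: "(\<Sum>j\<in>I N. (ip (h N) (e j))\<^sup>2) \<le> A" for N
    using bessel[OF I Bh, of N N] hh[of N] by linarith
  \<comment> \<open>A lower bound for the non-zero eigenvalues in modulus. It is positive because
    only finitely many lie in [-1, 1].\<close>
  define m0 where "m0 = Min (insert 1 ((\<lambda>j. \<bar>lam j\<bar>) ` {j \<in> {j \<in> J. \<bar>lam j\<bar> \<le> 1}. lam j \<noteq> 0}))"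
  have m0fin: "finite ((\<lambda>j. \<bar>lam j\<bar>) ` {j \<in> {j \<in> J. \<bar>lam j\<bar> \<le> 1}. lam j \<noteq> 0})"
    by (intro finite_imageI finite_subset[OF _ fin[of 1]]) auto
  have m0: "m0 > 0" unfolding m0_def using m0fin by (subst Min_gr_iff) auto
  have m0_le: "m0 \<le> \<bar>lam j\<bar>" if j: "j \<in> J" "lam j \<noteq> 0" for j
  proof (cases "\<bar>lam j\<bar> \<le> 1")
    case True
    then show ?thesis unfolding m0_def using m0fin j by (intro Min_le) auto
  next
    case False
    have "m0 \<le> 1" unfolding m0_def using m0fin by (intro Min_le) auto
    then show ?thesis using False by linarith
  qed
  \<comment> \<open>Away from the kernel each coefficient of the solution is that of
    \<open>h N\<close> divided by the eigenvalue; Bessel's inequality bounds the sum of the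
    squares.\<close>
  have tail: "(\<Sum>j\<in>I'. (c N j)\<^sup>2) \<le> A / t\<^sup>2"
    if I': "I' \<subseteq> I N" "\<And>j. j \<in> I' \<Longrightarrow> lam j \<noteq> 0 \<and> t \<le> \<bar>lam j\<bar>" and t: "t > 0" for I' N t
  proof -
    have "t\<^sup>2 * (c N j)\<^sup>2 \<le> (ip (h N) (e j))\<^sup>2" if j: "j \<in> I'" for j
    proof -
      have "t\<^sup>2 \<le> \<bar>lam j\<bar>\<^sup>2" using I'(2)[OF j] t by (intro power_mono) auto
      then have "t\<^sup>2 * (c N j)\<^sup>2 \<le> (lam j)\<^sup>2 * (c N j)\<^sup>2" by (intro mult_right_mono) auto
      then show ?thesis using c1[of j N] I' j by (auto simp: power_mult_distrib)
    qed
    then have "t\<^sup>2 * (\<Sum>j\<in>I'. (c N j)\<^sup>2) \<le> (\<Sum>j\<in>I'. (ip (h N) (e j))\<^sup>2)"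
      unfolding sum_distrib_left by (rule sum_mono)
    also have "\<dots> \<le> (\<Sum>j\<in>I N. (ip (h N) (e j))\<^sup>2)" using I' I by (intro sum_mono2) auto
    also note bes
    finally show ?thesis using t by (simp add: field_simps)
  qed
  define ker where "ker = {j \<in> J. lam j = 0}"
  have ker: "finite ker" "ker \<subseteq> J" using fin[of 0] by (auto simp: ker_def)
  have kerI: "ker \<subseteq> I N" for N by (auto simp: ker_def I_def)
  \<comment> \<open>The equation bounds \<open>v\<close>, the part outside the kernel; the kernel part \<open>z\<close> is bounded through \<open>coercive\<close>.\<close>
  define v z where "v N = comb (I N - ker) (c N)" and "z N = comb ker (c N)" for N
  have uvz: "u N x = v N x + z N x" for N x
    unfolding u_def v_def z_def comb_def by (rule sum.subset_diff[OF kerI I(1)])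
  have Ik: "finite (I N - ker)" "I N - ker \<subseteq> J" for N using I by auto
  have Bv: "Bd (v N)" and Bz: "Bd (z N)" for N unfolding v_def z_def by (intro Bd_comb Ik ker)+
  have vv: "(\<Sum>j\<in>I N - ker. (c N j)\<^sup>2) \<le> A / m0\<^sup>2" for N
    using I(2) m0_le by (intro tail m0) (auto simp: ker_def)
  define W where "W = (V + A / m0\<^sup>2) / 2"
  have v1: "(\<integral>x. \<bar>v N x\<bar> \<partial>M) \<le> W" for N
  proof -
    have "(\<integral>x. (v N x)\<^sup>2 \<partial>M) = ip (v N) (v N)" by (simp add: ip_def power2_eq_square)
    also have "\<dots> = (\<Sum>j\<in>I N - ker. (c N j)\<^sup>2)"
      unfolding v_def using ip_comb_comb[OF Ik, of N "c N" "c N"] by (simp add: power2_eq_square)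
    finally show ?thesis using L1_le_L2[OF Bv, of 1 N] vv[of N] by (simp add: W_def V_def)
  qed
  obtain C0 where C0: "C0 \<ge> 0" "\<And>x s. x \<in> space M \<Longrightarrow> \<epsilon> / 2 * \<bar>s\<bar> - C0 \<le> (g s - f2 x) * s"
    using coercive by blast
  have K: "K > 0" using g_bdd[of 0] by linarith
  define U where "U = (C0 * V + 2 * K * W) / (\<epsilon> / 2)"
  have u1: "(\<integral>x. \<bar>u N x\<bar> \<partial>M) \<le> U" for N
  proof -
    have Bgf: "Bd (\<lambda>x. g (u N x) - f2 x)" using Bu by (intro Bd_diff Bd_g Bd_f2 Bd_meas)
    have "\<epsilon> / 2 * (\<integral>x. \<bar>u N x\<bar> \<partial>M) - C0 * V = (\<integral>x. \<epsilon> / 2 * \<bar>u N x\<bar> - C0 \<partial>M)"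
      using Bd_integrable[OF Bd_abs[OF Bu[of N]]] by (simp add: V_def mult.commute)
    also have "\<dots> \<le> (\<integral>x. (g (u N x) - f2 x) * u N x \<partial>M)"
      using C0(2) by (intro integral_mono Bd_integrable Bd_mult[OF Bgf Bu] Bd_diff Bd_mult[OF Bd_const Bd_abs[OF Bu]] Bd_const)
    \<comment> \<open>On the kernel part \<open>g u - f2\<close> is written as
      \<open>(F - f2) - h\<close>. The first term integrates to zero by \<open>F_kernel\<close>, the
      second contributes minus \<open>\<delta>\<close> times a sum of squares. What survives
      involves \<open>v\<close> only, which is already bounded.\<close>
    also have "\<dots> = (\<integral>x. (g (u N x) - f2 x) * v N x \<partial>M) + (\<integral>x. (F x - f2 x) * z N x \<partial>M) - (\<integral>x. h N x * z N x \<partial>M)"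
    proof -
      have "(\<integral>x. (g (u N x) - f2 x) * u N x \<partial>M)
        = (\<integral>x. (g (u N x) - f2 x) * v N x + (F x - f2 x) * z N x - h N x * z N x \<partial>M)"
        by (intro Bochner_Integration.integral_cong refl) (simp add: uvz h_def algebra_simps)
      moreover have "integrable M (\<lambda>x. (g (u N x) - f2 x) * v N x)" "integrable M (\<lambda>x. (F x - f2 x) * z N x)"
        "integrable M (\<lambda>x. h N x * z N x)"
        using Bgf Bv Bz Bh by (auto intro!: Bd_integrable)
      ultimately show ?thesis by simp
    qed
    also have "(\<integral>x. (F x - f2 x) * z N x \<partial>M) = 0"
    proof -
      have "ip (\<lambda>x. F x - f2 x) (z N) = (\<Sum>j\<in>ker. c N j * ip (\<lambda>x. F x - f2 x) (e j))"
        unfolding z_def by (intro ip_comb ker) auto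
      also have "\<dots> = 0" using F_kernel by (intro sum.neutral) (auto simp: ker_def ip_def)
      finally show ?thesis by (simp add: ip_def)
    qed
    also have "(\<integral>x. h N x * z N x \<partial>M) \<ge> 0"
    proof -
      have "ip (h N) (z N) = (\<Sum>j\<in>ker. c N j * ip (h N) (e j))"
        unfolding z_def by (intro ip_comb ker Bh)
      also have "\<dots> = (\<Sum>j\<in>ker. \<delta> N * (c N j)\<^sup>2)"
      proof (rule sum.cong[OF refl])
        fix j assume j: "j \<in> ker"
        then have "j \<in> I N" "lam j = 0" using kerI[of N] by (auto simp: ker_def)
        then show "c N j * ip (h N) (e j) = \<delta> N * (c N j)\<^sup>2" using c0 by (simp add: power2_eq_square)
      qed
      also have "\<dots> \<ge> 0" using \<delta>[of N] by (intro sum_nonneg) auto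
      finally show ?thesis by (simp add: ip_def)
    qed
    then have "(\<integral>x. (g (u N x) - f2 x) * v N x \<partial>M) + 0 - (\<integral>x. h N x * z N x \<partial>M)
        \<le> (\<integral>x. (g (u N x) - f2 x) * v N x \<partial>M)" by simp
    also have "\<dots> \<le> (\<integral>x. 2 * K * \<bar>v N x\<bar> \<partial>M)"
    proof (rule integral_mono)
      fix x assume x: "x \<in> space M"
      have "(g (u N x) - f2 x) * v N x \<le> \<bar>g (u N x) - f2 x\<bar> * \<bar>v N x\<bar>" by (metis abs_ge_self abs_mult)
      also have "\<dots> \<le> 2 * K * \<bar>v N x\<bar>"
        using g_bdd[of "u N x"] f2_abs_le[OF x] by (intro mult_right_mono) auto
      finally show "(g (u N x) - f2 x) * v N x \<le> 2 * K * \<bar>v N x\<bar>" .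
    qed (use Bgf Bv in \<open>auto intro!: Bd_integrable\<close>)
    also have "\<dots> \<le> 2 * K * W" using v1[of N] K by simp
    finally show ?thesis using \<epsilon> unfolding U_def by (subst pos_le_divide_eq) (auto simp: algebra_simps)
  qed
  have "\<forall>j\<in>ker. \<exists>B. \<forall>x\<in>space M. \<bar>e j x\<bar> \<le> B" using e_bdd ker by auto
  then obtain B where B: "\<And>j x. j \<in> ker \<Longrightarrow> x \<in> space M \<Longrightarrow> \<bar>e j x\<bar> \<le> B j" by metis
  have U: "U \<ge> 0" by (rule order_trans[OF _ u1[of 0]]) simp
  \<comment> \<open>The finitely many kernel modes are bounded functions, so the L1 bound on
    \<open>u N\<close> controls the kernel coefficients.\<close>
  define Ck where "Ck = (\<Sum>j\<in>ker. \<bar>B j\<bar> * U)"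
  have ckb: "\<bar>c N j\<bar> \<le> Ck" if j: "j \<in> ker" for N j
  proof -
    have "c N j = ip (u N) (e j)" using ip_comb_e[OF I, of j N "c N"] j ker kerI[of N] by (simp add: u_def subset_iff)
    then have "\<bar>c N j\<bar> \<le> (\<integral>x. \<bar>u N x * e j x\<bar> \<partial>M)" unfolding ip_def by (simp add: integral_abs_bound)
    also have "\<dots> \<le> (\<integral>x. \<bar>B j\<bar> * \<bar>u N x\<bar> \<partial>M)"
    proof (rule integral_mono)
      show "\<bar>u N x * e j x\<bar> \<le> \<bar>B j\<bar> * \<bar>u N x\<bar>" if x: "x \<in> space M" for x
      proof -
        have "\<bar>e j x\<bar> \<le> \<bar>B j\<bar>" using B[OF j x] by linarith
        then show ?thesis unfolding abs_mult by (subst mult.commute) (intro mult_right_mono, auto)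
      qed
    qed (use Bu j ker in \<open>auto intro!: Bd_integrable\<close>)
    also have "\<dots> \<le> \<bar>B j\<bar> * U" using u1[of N] by (simp add: mult_left_mono)
    also have "\<dots> \<le> Ck" unfolding Ck_def using j ker U by (intro member_le_sum) auto
    finally show ?thesis .
  qed
  \<comment> \<open>Extension by zero puts the coefficients for all \<open>N\<close> on the common
    index set \<open>J\<close>, as the diagonal argument requires.\<close>
  define c' where "c' N j = (if j \<in> I N then c N j else 0)" for N j
  define Cm where "Cm = \<bar>Ck\<bar> + sqrt (A / m0\<^sup>2)"
  have Cm: "norm (c' N j) \<le> Cm" if j: "j \<in> J" for N j
  proof (cases "j \<in> I N")
    case jI: True
    show ?thesis
    proof (cases "j \<in> ker")
      case True
      have "sqrt (A / m0\<^sup>2) \<ge> 0" using A by simp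
      then have "Ck \<le> Cm" unfolding Cm_def by linarith
      moreover have "norm (c' N j) \<le> Ck" using ckb[OF True, of N] jI by (simp add: c'_def)
      ultimately show ?thesis by linarith
    next
      case False
      have "(c N j)\<^sup>2 \<le> (\<Sum>j\<in>I N - ker. (c N j)\<^sup>2)" using jI False I by (intro member_le_sum) auto
      then have "(c N j)\<^sup>2 \<le> A / m0\<^sup>2" using vv[of N] by linarith
      then have "\<bar>c N j\<bar> \<le> sqrt (A / m0\<^sup>2)" using real_le_rsqrt by fastforce
      then show ?thesis using jI by (simp add: c'_def Cm_def)
    qed
  next
    case False
    then show ?thesis using A by (simp add: c'_def Cm_def)
  qed
  have "J = (\<Union>N. I N)"
  proof
    show "J \<subseteq> (\<Union>N. I N)"
    proof
      fix j assume j: "j \<in> J"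
      obtain N :: nat where "\<bar>lam j\<bar> \<le> real N" using real_arch_simple by blast
      then show "j \<in> (\<Union>N. I N)" using j by (auto simp: I_def)
    qed
  qed (auto simp: I_def)
  moreover have "countable (\<Union>N. I N)" by (rule countable_UN) (simp_all add: countable_finite I(1))
  ultimately have cntJ: "countable J" by simp
  obtain r where r: "strict_mono (r :: nat \<Rightarrow> nat)" "\<And>j. j \<in> J \<Longrightarrow> \<exists>l. (\<lambda>k. c' (r k) j) \<longlonglongrightarrow> l"
    by (rule function_convergent_subsequence[where S = J and f = c' and M = Cm, OF cntJ Cm], assumption, rule that)
  define d where "d j = lim (\<lambda>k. c' (r k) j)" for j
  have d: "(\<lambda>k. c' (r k) j) \<longlonglongrightarrow> d j" if "j \<in> J" for j
    using r(2)[OF that] unfolding d_def by (simp add: convergent_def convergent_LIMSEQ_iff[symmetric])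
  have u_ext: "u N = comb I' (c' N)" if I': "I N \<subseteq> I'" "finite I'" for N I'
  proof
    fix x
    have "comb (I N) (c N) x = (\<Sum>j\<in>I N. c' N j * e j x)" by (simp add: comb_def c'_def)
    also have "\<dots> = (\<Sum>j\<in>I'. c' N j * e j x)" using I' by (intro sum.mono_neutral_left) (auto simp: c'_def)
    finally show "u N x = comb I' (c' N) x" by (simp add: u_def comb_def)
  qed
  have tail': "(\<Sum>j\<in>I' - I R. (c' N j)\<^sup>2) \<le> A / (real R)\<^sup>2" if I': "finite I'" and R: "R > 0" for I' N R
  proof -
    have "(\<Sum>j\<in>I' - I R. (c' N j)\<^sup>2) = (\<Sum>j\<in>(I' - I R) \<inter> I N. (c N j)\<^sup>2)"
      using I' by (intro sum.mono_neutral_cong_right) (auto simp: c'_def)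
    also have "\<dots> \<le> A / (real R)\<^sup>2" using R by (intro tail) (auto simp: I_def)
    finally show ?thesis .
  qed
  \<comment> \<open>The head over \<open>I R\<close> is finite and converges, while the tails are
    small for all \<open>N\<close> at once. The choice of \<open>R\<close> makes the tails cost at
    most half of \<open>\<eta>\<close>; the heads are kept below the other half.\<close>
  have CauchyL2: "\<exists>k0. \<forall>k\<ge>k0. \<forall>l\<ge>k0. (\<integral>x. (u (r k) x - u (r l) x)\<^sup>2 \<partial>M) < \<eta>" if \<eta>: "\<eta> > 0" for \<eta>
  proof -
    obtain R :: nat where R: "real R > 8 * A / \<eta>" "R > 0"
    proof -
      obtain R :: nat where "real R > 8 * A / \<eta>" using reals_Archimedean2 by blast
      then show ?thesis using that[of "Suc R"] by simp
    qed
    have "4 * (A / (real R)\<^sup>2) \<le> \<eta> / 2"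
    proof -
      have "8 * A < \<eta> * real R" using R \<eta> by (simp add: field_simps)
      also have "\<dots> \<le> \<eta> * (real R)\<^sup>2" using R(2) \<eta> by (simp add: power2_eq_square)
      finally show ?thesis using R(2) by (simp add: field_simps)
    qed
    have "(\<lambda>k. \<Sum>j\<in>I R. (c' (r k) j - d j)\<^sup>2) \<longlonglongrightarrow> (\<Sum>j\<in>I R. (d j - d j)\<^sup>2)"
      using I d by (intro tendsto_intros) auto
    then have "eventually (\<lambda>k. (\<Sum>j\<in>I R. (c' (r k) j - d j)\<^sup>2) < \<eta> / 8) sequentially"
      using \<eta> by (intro order_tendstoD(2)) auto
    then obtain k0 where k0: "\<And>k. k \<ge> k0 \<Longrightarrow> (\<Sum>j\<in>I R. (c' (r k) j - d j)\<^sup>2) < \<eta> / 8"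
      by (auto simp: eventually_sequentially)
    show ?thesis
    proof (intro exI[of _ k0] allI impI)
      fix k l assume kl: "k \<ge> k0" "l \<ge> k0"
      define I' where "I' = I R \<union> I (r k) \<union> I (r l)"
      have I': "finite I'" "I' \<subseteq> J" using I by (auto simp: I'_def)
      have sq: "(a - b)\<^sup>2 \<le> 2 * (a - y)\<^sup>2 + 2 * (b - y)\<^sup>2" for a b y :: real
      proof -
        have "0 \<le> ((a - y) + (b - y))\<^sup>2" by simp
        then show ?thesis by (simp add: power2_eq_square algebra_simps)
      qed
      have ext: "u (r k) = comb I' (c' (r k))" "u (r l) = comb I' (c' (r l))"
        using I'(1) by (auto intro!: u_ext simp: I'_def)
      have "u (r k) x - u (r l) x = comb I' (\<lambda>j. c' (r k) j - c' (r l) j) x" for x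
        unfolding ext by (simp add: comb_def left_diff_distrib sum_subtractf)
      then have "(\<integral>x. (u (r k) x - u (r l) x)\<^sup>2 \<partial>M) = ip (comb I' (\<lambda>j. c' (r k) j - c' (r l) j)) (comb I' (\<lambda>j. c' (r k) j - c' (r l) j))"
        by (simp add: ip_def power2_eq_square)
      also have "\<dots> = (\<Sum>j\<in>I'. (c' (r k) j - c' (r l) j)\<^sup>2)" using I' by (simp add: ip_comb_comb power2_eq_square)
      also have "\<dots> = (\<Sum>j\<in>I R. (c' (r k) j - c' (r l) j)\<^sup>2) + (\<Sum>j\<in>I' - I R. (c' (r k) j - c' (r l) j)\<^sup>2)"
        using I' by (subst sum.subset_diff[of "I R" I']) (auto simp: I'_def)
      also have "(\<Sum>j\<in>I R. (c' (r k) j - c' (r l) j)\<^sup>2)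
          \<le> 2 * (\<Sum>j\<in>I R. (c' (r k) j - d j)\<^sup>2) + 2 * (\<Sum>j\<in>I R. (c' (r l) j - d j)\<^sup>2)"
        unfolding sum_distrib_left sum.distrib[symmetric] by (intro sum_mono sq)
      also have "(\<Sum>j\<in>I' - I R. (c' (r k) j - c' (r l) j)\<^sup>2)
          \<le> 2 * (\<Sum>j\<in>I' - I R. (c' (r k) j)\<^sup>2) + 2 * (\<Sum>j\<in>I' - I R. (c' (r l) j)\<^sup>2)"
        unfolding sum_distrib_left sum.distrib[symmetric] using sq[of _ _ 0] by (intro sum_mono) simp
      finally show "(\<integral>x. (u (r k) x - u (r l) x)\<^sup>2 \<partial>M) < \<eta>"
        using k0[OF kl(1)] k0[OF kl(2)] tail'[OF I'(1) R(2), of "r k"] tail'[OF I'(1) R(2), of "r l"]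
          \<open>4 * (A / (real R)\<^sup>2) \<le> \<eta> / 2\<close> by linarith
    qed
  qed
  have CauchyL1: "\<exists>k0. \<forall>k\<ge>k0. \<forall>l\<ge>k0. (\<integral>x. \<bar>u (r k) x - u (r l) x\<bar> \<partial>M) < \<eta>" if \<eta>: "\<eta> > 0" for \<eta>
  proof -
    obtain \<eta>' where \<eta>': "\<eta>' > 0" "\<And>w. Bd w \<Longrightarrow> (\<integral>x. (w x)\<^sup>2 \<partial>M) < \<eta>' \<Longrightarrow> (\<integral>x. \<bar>w x\<bar> \<partial>M) < \<eta>"
      using L2_small_imp_L1_small[OF \<eta>] by blast
    obtain k0 where "\<forall>k\<ge>k0. \<forall>l\<ge>k0. (\<integral>x. (u (r k) x - u (r l) x)\<^sup>2 \<partial>M) < \<eta>'"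
      using CauchyL2[OF \<eta>'(1)] by blast
    then show ?thesis using \<eta>'(2) Bu by (intro exI[of _ k0] allI impI \<eta>'(2) Bd_diff) auto
  qed
  obtain w s where w: "integrable M w" and s: "strict_mono (s :: nat \<Rightarrow> nat)"
    and wlim: "AE x in M. (\<lambda>n. u (r (s n)) x) \<longlonglongrightarrow> w x"
    and wL1: "(\<lambda>n. \<integral>x. \<bar>u (r (s n)) x - w x\<bar> \<partial>M) \<longlonglongrightarrow> 0"
    using L1_Cauchy_limit[of M "\<lambda>k. u (r k)", OF Bd_integrable[OF Bu] CauchyL1] by blast
  have wm [measurable]: "w \<in> borel_measurable M" using w by auto
  have um [measurable]: "u N \<in> borel_measurable M" for N using Bu by (rule Bd_meas)
  define N where "N n = r (s n)" for n
  have Nn: "N n \<ge> n" for n unfolding N_def using seq_suble[OF r(1)] seq_suble[OF s] order_trans by blast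
  \<comment> \<open>A common bound for the squared L2 norms; Fatou's lemma passes it on to the limit
    \<open>w\<close>.\<close>
  define Q where "Q = A / m0\<^sup>2 + real (card ker) * Ck\<^sup>2"
  have uQ: "(\<integral>x. (u n x)\<^sup>2 \<partial>M) \<le> Q" for n
  proof -
    have "(\<integral>x. (u n x)\<^sup>2 \<partial>M) = (\<Sum>j\<in>I n. (c n j)\<^sup>2)"
      using ip_comb_comb[OF I, of n "c n" "c n"] by (simp add: u_def ip_def power2_eq_square)
    also have "\<dots> = (\<Sum>j\<in>I n - ker. (c n j)\<^sup>2) + (\<Sum>j\<in>ker. (c n j)\<^sup>2)"
      by (rule sum.subset_diff[OF kerI I(1)])
    also have "(\<Sum>j\<in>ker. (c n j)\<^sup>2) \<le> (\<Sum>j\<in>ker. Ck\<^sup>2)"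
      using ckb by (intro sum_mono) (metis abs_ge_zero power2_abs power_mono)
    finally show ?thesis using vv[of n] by (simp add: Q_def)
  qed
  have "(\<integral>\<^sup>+x. ennreal ((w x)\<^sup>2) \<partial>M) = (\<integral>\<^sup>+x. liminf (\<lambda>n. ennreal ((u (N n) x)\<^sup>2)) \<partial>M)"
  proof (rule nn_integral_cong_AE)
    show "AE x in M. ennreal ((w x)\<^sup>2) = liminf (\<lambda>n. ennreal ((u (N n) x)\<^sup>2))"
      using wlim
    proof eventually_elim
      case (elim x)
      then have lim: "(\<lambda>n. ennreal ((u (N n) x)\<^sup>2)) \<longlonglongrightarrow> ennreal ((w x)\<^sup>2)"
        unfolding N_def by (intro tendsto_ennrealI tendsto_intros)
      show ?case by (rule sym, rule lim_imp_Liminf[OF _ lim]) simp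
    qed
  qed
  also have "\<dots> \<le> liminf (\<lambda>n. \<integral>\<^sup>+x. ennreal ((u (N n) x)\<^sup>2) \<partial>M)" by (rule nn_integral_liminf) measurable
  also have "\<dots> \<le> ennreal Q"
  proof (rule Liminf_le)
    show "\<forall>\<^sub>F n in sequentially. (\<integral>\<^sup>+x. ennreal ((u (N n) x)\<^sup>2) \<partial>M) \<le> ennreal Q"
    proof (intro always_eventually allI)
      fix n
      have "(\<integral>\<^sup>+x. ennreal ((u (N n) x)\<^sup>2) \<partial>M) = ennreal (\<integral>x. (u (N n) x)\<^sup>2 \<partial>M)"
        using Bu by (intro nn_integral_eq_integral) auto
      then show "(\<integral>\<^sup>+x. ennreal ((u (N n) x)\<^sup>2) \<partial>M) \<le> ennreal Q" using uQ by (simp add: ennreal_leI)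
    qed
  qed simp
  also have "\<dots> < \<infinity>" by simp
  finally have w2: "integrable M (\<lambda>x. (w x)\<^sup>2)" by (intro integrableI_nonneg) auto
  have main: "ip w \<phi> + ip (\<lambda>x. g (w x)) \<psi> = ip F \<psi>" if tp: "test_pair \<psi> \<phi>" for \<psi> \<phi>
  proof -
    have B\<psi>: "Bd \<psi>" and B\<phi>: "Bd \<phi>" and \<psi>\<phi>: "\<And>j. j \<in> J \<Longrightarrow> ip \<phi> (e j) = lam j * ip \<psi> (e j)"
      and clos: "\<And>\<eta>. \<eta> > 0 \<Longrightarrow> \<exists>I c. finite I \<and> I \<subseteq> J \<and> (\<integral>x. (\<psi> x - comb I c x)\<^sup>2 \<partial>M) < \<eta>"
      using tp unfolding test_pair_def by blast+
    obtain C\<psi> where C\<psi>: "\<And>x. x \<in> space M \<Longrightarrow> \<bar>\<psi> x\<bar> \<le> C\<psi>" using B\<psi> by (auto simp: Bd_def)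
    obtain C\<phi> where C\<phi>: "\<And>x. x \<in> space M \<Longrightarrow> \<bar>\<phi> x\<bar> \<le> C\<phi>" using B\<phi> by (auto simp: Bd_def)
    have pm [measurable]: "\<psi> \<in> borel_measurable M" "\<phi> \<in> borel_measurable M" using B\<psi> B\<phi> by (auto dest: Bd_meas)
    have w\<phi>: "integrable M (\<lambda>x. w x * \<phi> x)"
    proof (rule Bochner_Integration.integrable_bound)
      show "integrable M (\<lambda>x. C\<phi> * w x)" using w by simp
      show "AE x in M. norm (w x * \<phi> x) \<le> norm (C\<phi> * w x)"
      proof (rule AE_I2)
        fix x assume "x \<in> space M"
        then have "\<bar>\<phi> x\<bar> \<le> \<bar>C\<phi>\<bar>" using C\<phi> by fastforce
        then show "norm (w x * \<phi> x) \<le> norm (C\<phi> * w x)"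
          by (simp add: abs_mult mult.commute mult_right_mono)
      qed
    qed simp
    have t1: "(\<lambda>n. ip (u (N n)) \<phi>) \<longlonglongrightarrow> ip w \<phi>"
    proof (rule LIM_zero_cancel, rule Lim_null_comparison)
      show "(\<lambda>n. \<bar>C\<phi>\<bar> * (\<integral>x. \<bar>u (N n) x - w x\<bar> \<partial>M)) \<longlonglongrightarrow> 0"
        using tendsto_mult[OF tendsto_const wL1, of "\<bar>C\<phi>\<bar>"] by (simp add: N_def)
      show "\<forall>\<^sub>F n in sequentially. norm (ip (u (N n)) \<phi> - ip w \<phi>) \<le> \<bar>C\<phi>\<bar> * (\<integral>x. \<bar>u (N n) x - w x\<bar> \<partial>M)"
      proof (intro always_eventually allI)
        fix n
        have i1: "integrable M (\<lambda>x. u (N n) x * \<phi> x)" using Bu B\<phi> by auto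
        have "ip (u (N n)) \<phi> - ip w \<phi> = (\<integral>x. (u (N n) x - w x) * \<phi> x \<partial>M)"
          using i1 w\<phi> by (simp add: ip_def left_diff_distrib)
        also have "\<bar>\<dots>\<bar> \<le> (\<integral>x. \<bar>(u (N n) x - w x) * \<phi> x\<bar> \<partial>M)" by (rule integral_abs_bound)
        also have "\<dots> \<le> (\<integral>x. \<bar>C\<phi>\<bar> * \<bar>u (N n) x - w x\<bar> \<partial>M)"
        proof (rule integral_mono)
          show "integrable M (\<lambda>x. \<bar>(u (N n) x - w x) * \<phi> x\<bar>)" using i1 w\<phi> by (simp add: left_diff_distrib)
          show "integrable M (\<lambda>x. \<bar>C\<phi>\<bar> * \<bar>u (N n) x - w x\<bar>)"
            by (intro integrable_mult_right integrable_abs Bochner_Integration.integrable_diff Bd_integrable Bu w)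
          fix x assume "x \<in> space M"
          then have "\<bar>\<phi> x\<bar> \<le> \<bar>C\<phi>\<bar>" using C\<phi> by fastforce
          then show "\<bar>(u (N n) x - w x) * \<phi> x\<bar> \<le> \<bar>C\<phi>\<bar> * \<bar>u (N n) x - w x\<bar>"
            unfolding abs_mult by (subst mult.commute) (intro mult_right_mono, auto)
        qed
        finally show "norm (ip (u (N n)) \<phi> - ip w \<phi>) \<le> \<bar>C\<phi>\<bar> * (\<integral>x. \<bar>u (N n) x - w x\<bar> \<partial>M)" by simp
      qed
    qed
    define hw where "hw x = F x - g (w x)" for x
    have Bhw: "Bd hw" unfolding hw_def by (intro Bd_resid wm)
    have t2: "(\<lambda>n. ip (h (N n)) \<psi>) \<longlonglongrightarrow> ip hw \<psi>"
      unfolding ip_def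
    proof (rule integral_dominated_convergence[where w = "\<lambda>x. H * \<bar>C\<psi>\<bar>"])
      show "AE x in M. (\<lambda>n. h (N n) x * \<psi> x) \<longlonglongrightarrow> hw x * \<psi> x"
        using wlim
      proof eventually_elim
        case (elim x)
        have "(\<lambda>n. g (u (N n) x)) \<longlonglongrightarrow> g (w x)"
          using cont_g elim by (auto intro: continuous_on_tendsto_compose[of UNIV g] simp: N_def)
        then show ?case unfolding h_def hw_def by (intro tendsto_intros)
      qed
      show "AE x in M. norm (h (N n) x * \<psi> x) \<le> H * \<bar>C\<psi>\<bar>" for n
      proof (rule AE_I2)
        fix x assume x: "x \<in> space M"
        have "\<bar>h (N n) x\<bar> \<le> H" using resid_le[OF x] by (simp add: h_def)
        moreover have "\<bar>\<psi> x\<bar> \<le> \<bar>C\<psi>\<bar>" using C\<psi>[OF x] by linarith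
        ultimately show "norm (h (N n) x * \<psi> x) \<le> H * \<bar>C\<psi>\<bar>"
          unfolding real_norm_def abs_mult by (intro mult_mono) (auto intro: order_trans[OF abs_ge_zero])
      qed
    qed (use Bh Bhw B\<psi> in \<open>auto intro!: Bd_meas\<close>)
    \<comment> \<open>The projection of \<open>\<psi>\<close> onto the Galerkin space, since the
      equations hold only against its members. The sum over \<open>ker\<close> in \<open>id\<close>
      is the trace of the shift: there the coefficients of \<open>\<phi>\<close> vanish while those
      of the residual do not.\<close>
    define P where "P n = comb (I n) (\<lambda>j. ip \<psi> (e j))" for n
    have BP: "Bd (P n)" for n unfolding P_def by (intro Bd_comb I)
    have id: "ip (u n) \<phi> = ip (h n) (P n) - \<delta> n * (\<Sum>j\<in>ker. c n j * ip \<psi> (e j))" for n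
    proof -
      have "ip (u n) \<phi> = ip \<phi> (comb (I n) (c n))" by (simp add: ip_def u_def mult.commute)
      also have "\<dots> = (\<Sum>j\<in>I n. c n j * ip \<phi> (e j))" by (intro ip_comb I B\<phi>)
      also have "\<dots> = (\<Sum>j\<in>I n. ip \<psi> (e j) * ip (h n) (e j) - (if j \<in> ker then \<delta> n * (c n j * ip \<psi> (e j)) else 0))"
      proof (rule sum.cong[OF refl])
        fix j assume j: "j \<in> I n"
        then have jJ: "j \<in> J" using I by blast
        show "c n j * ip \<phi> (e j) = ip \<psi> (e j) * ip (h n) (e j) - (if j \<in> ker then \<delta> n * (c n j * ip \<psi> (e j)) else 0)"
          using c0[OF j] c1[OF j] \<psi>\<phi>[OF jJ] jJ by (cases "lam j = 0") (auto simp: ker_def)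
      qed
      also have "\<dots> = (\<Sum>j\<in>I n. ip \<psi> (e j) * ip (h n) (e j)) - (\<Sum>j\<in>I n. if j \<in> ker then \<delta> n * (c n j * ip \<psi> (e j)) else 0)"
        by (rule sum_subtractf)
      also have "(\<Sum>j\<in>I n. ip \<psi> (e j) * ip (h n) (e j)) = ip (h n) (P n)"
        unfolding P_def by (intro ip_comb[symmetric] I Bh)
      also have "(\<Sum>j\<in>I n. if j \<in> ker then \<delta> n * (c n j * ip \<psi> (e j)) else 0) = (\<Sum>j\<in>ker. \<delta> n * (c n j * ip \<psi> (e j)))"
        using kerI I by (intro sum.mono_neutral_cong_right) auto
      finally show ?thesis by (simp add: sum_distrib_left)
    qed
    have H0: "\<bar>h n x\<bar> \<le> \<bar>H\<bar>" if "x \<in> space M" for n x using resid_le[OF that, of "u n x"] by (simp add: h_def)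
    \<comment> \<open>\<open>P n\<close> is the best approximation from spans that eventually
      contain any given finite combination.\<close>
    have P0: "(\<lambda>n. \<integral>x. \<bar>P n x - \<psi> x\<bar> \<partial>M) \<longlonglongrightarrow> 0"
    proof (rule LIMSEQ_I)
      fix \<eta> :: real assume \<eta>: "\<eta> > 0"
      obtain \<eta>' where \<eta>': "\<eta>' > 0" "\<And>w. Bd w \<Longrightarrow> (\<integral>x. (w x)\<^sup>2 \<partial>M) < \<eta>' \<Longrightarrow> (\<integral>x. \<bar>w x\<bar> \<partial>M) < \<eta>"
        using L2_small_imp_L1_small[OF \<eta>] by blast
      obtain I' a where I': "finite I'" "I' \<subseteq> J" "(\<integral>x. (\<psi> x - comb I' a x)\<^sup>2 \<partial>M) < \<eta>'"
        using clos[OF \<eta>'(1)] by blast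
      obtain n0 :: nat where n0: "real n0 \<ge> (\<Sum>j\<in>I'. \<bar>lam j\<bar>)" using real_arch_simple by blast
      have I'n: "I' \<subseteq> I n" if n: "n \<ge> n0" for n
      proof
        fix j assume j: "j \<in> I'"
        then have "\<bar>lam j\<bar> \<le> (\<Sum>j\<in>I'. \<bar>lam j\<bar>)" using I' by (intro member_le_sum) auto
        then show "j \<in> I n" using n n0 j I' by (auto simp: I_def)
      qed
      have "(\<integral>x. \<bar>P n x - \<psi> x\<bar> \<partial>M) < \<eta>" if n: "n \<ge> n0" for n
      proof -
        define a' where "a' j = (if j \<in> I' then a j else 0)" for j
        have "comb (I n) a' = comb I' a"
        proof
          fix x
          show "comb (I n) a' x = comb I' a x"
            unfolding comb_def using I'n[OF n] I by (intro sum.mono_neutral_cong_right) (auto simp: a'_def)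
        qed
        then have "(\<integral>x. (\<psi> x - P n x)\<^sup>2 \<partial>M) \<le> (\<integral>x. (\<psi> x - comb I' a x)\<^sup>2 \<partial>M)"
          using ip_diff_comb[OF I B\<psi>, of n a'] ip_diff_comb[OF I B\<psi>, of n "\<lambda>j. ip \<psi> (e j)"]
          by (simp add: P_def sum_nonneg)
        then have "(\<integral>x. (\<psi> x - P n x)\<^sup>2 \<partial>M) < \<eta>'" using I'(3) by linarith
        then have "(\<integral>x. \<bar>\<psi> x - P n x\<bar> \<partial>M) < \<eta>" using B\<psi> BP by (intro \<eta>'(2)) auto
        then show ?thesis by (simp add: abs_minus_commute)
      qed
      then show "\<exists>n0. \<forall>n\<ge>n0. norm ((\<integral>x. \<bar>P n x - \<psi> x\<bar> \<partial>M) - 0) < \<eta>"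
        by (intro exI[of _ n0]) simp
    qed
    have t3: "(\<lambda>n. ip (h (N n)) (P (N n)) - ip (h (N n)) \<psi>) \<longlonglongrightarrow> 0"
    proof (rule Lim_null_comparison)
      have "filterlim N at_top sequentially" 
        by (rule filterlim_at_top_mono[OF filterlim_ident]) (intro always_eventually allI Nn)
      then have "(\<lambda>n. \<integral>x. \<bar>P (N n) x - \<psi> x\<bar> \<partial>M) \<longlonglongrightarrow> 0"
        by (rule filterlim_compose[OF P0])
      then show "(\<lambda>n. \<bar>H\<bar> * (\<integral>x. \<bar>P (N n) x - \<psi> x\<bar> \<partial>M)) \<longlonglongrightarrow> 0"
        by (rule tendsto_mult_right_zero)
      show "\<forall>\<^sub>F n in sequentially. norm (ip (h (N n)) (P (N n)) - ip (h (N n)) \<psi>) \<le> \<bar>H\<bar> * (\<integral>x. \<bar>P (N n) x - \<psi> x\<bar> \<partial>M)"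
      proof (intro always_eventually allI)
        fix n
        have i: "integrable M (\<lambda>x. h (N n) x * P (N n) x)" "integrable M (\<lambda>x. h (N n) x * \<psi> x)"
          using Bh BP B\<psi> by auto
        have "ip (h (N n)) (P (N n)) - ip (h (N n)) \<psi> = (\<integral>x. h (N n) x * (P (N n) x - \<psi> x) \<partial>M)"
          using i by (simp add: ip_def right_diff_distrib)
        also have "\<bar>\<dots>\<bar> \<le> (\<integral>x. \<bar>h (N n) x * (P (N n) x - \<psi> x)\<bar> \<partial>M)" by (rule integral_abs_bound)
        also have "\<dots> \<le> (\<integral>x. \<bar>H\<bar> * \<bar>P (N n) x - \<psi> x\<bar> \<partial>M)"
          using Bh BP B\<psi> H0 by (intro integral_mono) (auto simp: abs_mult intro!: mult_right_mono Bd_integrable)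
        finally show "norm (ip (h (N n)) (P (N n)) - ip (h (N n)) \<psi>) \<le> \<bar>H\<bar> * (\<integral>x. \<bar>P (N n) x - \<psi> x\<bar> \<partial>M)" by simp
      qed
    qed
    \<comment> \<open>The kernel coefficients stay below \<open>Ck\<close> while the shift tends to
      zero.\<close>
    have t4: "(\<lambda>n. \<delta> (N n) * (\<Sum>j\<in>ker. c (N n) j * ip \<psi> (e j))) \<longlonglongrightarrow> 0"
    proof (rule Lim_null_comparison)
      show "(\<lambda>n. 1 / real (Suc n) * (\<Sum>j\<in>ker. Ck * \<bar>ip \<psi> (e j)\<bar>)) \<longlonglongrightarrow> 0"
        using LIMSEQ_inverse_real_of_nat by (intro tendsto_mult_left_zero) (simp add: field_simps)
      show "\<forall>\<^sub>F n in sequentially. norm (\<delta> (N n) * (\<Sum>j\<in>ker. c (N n) j * ip \<psi> (e j))) \<le> 1 / real (Suc n) * (\<Sum>j\<in>ker. Ck * \<bar>ip \<psi> (e j)\<bar>)"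
      proof (intro always_eventually allI)
        fix n
        have "\<bar>\<Sum>j\<in>ker. c (N n) j * ip \<psi> (e j)\<bar> \<le> (\<Sum>j\<in>ker. Ck * \<bar>ip \<psi> (e j)\<bar>)"
          by (rule order_trans[OF sum_abs]) (auto simp: abs_mult intro!: sum_mono mult_right_mono ckb)
        moreover have "\<delta> (N n) \<le> 1 / real (Suc n)" unfolding \<delta>_def using Nn[of n] by (intro divide_left_mono) auto
        ultimately show "norm (\<delta> (N n) * (\<Sum>j\<in>ker. c (N n) j * ip \<psi> (e j))) \<le> 1 / real (Suc n) * (\<Sum>j\<in>ker. Ck * \<bar>ip \<psi> (e j)\<bar>)"
          using \<delta>[of "N n"] unfolding real_norm_def abs_mult by (intro mult_mono) auto
      qed
    qed
    have "(\<lambda>n. ip (h (N n)) \<psi> + (ip (h (N n)) (P (N n)) - ip (h (N n)) \<psi>) - \<delta> (N n) * (\<Sum>j\<in>ker. c (N n) j * ip \<psi> (e j)))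
        \<longlonglongrightarrow> ip hw \<psi> + 0 - 0"
      by (intro tendsto_add tendsto_diff t2 t3 t4)
    then have "(\<lambda>n. ip (u (N n)) \<phi>) \<longlonglongrightarrow> ip hw \<psi>" by (simp add: id)
    then have "ip w \<phi> = ip hw \<psi>" using t1 LIMSEQ_unique by blast
    moreover have "ip hw \<psi> = ip F \<psi> - ip (\<lambda>x. g (w x)) \<psi>"
    proof -
      have "integrable M (\<lambda>x. F x * \<psi> x)" "integrable M (\<lambda>x. g (w x) * \<psi> x)"
        using B\<psi> Bd_g[OF wm] by (auto intro!: Bd_integrable)
      then show ?thesis by (simp add: ip_def hw_def left_diff_distrib)
    qed
    ultimately show ?thesis by simp
  qed
  show ?thesis using that[OF wm w2 main] .
qed

end

section \<open>Test functions\<close>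

abbreviation rect :: "real \<Rightarrow> (real \<times> real) set" where
  "rect T \<equiv> {0..T} \<times> {0..pi}"

text \<open>The derivative is taken within the closed interval, so values off the rectangle have no
  influence.\<close>

lemma Dt_cong:
  assumes "\<And>z. z \<in> rect T \<Longrightarrow> \<psi> z = \<psi>' z" "z \<in> rect T"
  shows "Dt T \<psi> z = Dt T \<psi>' z"
proof -
  obtain t x where z: "z = (t, x)" "t \<in> {0..T}" "x \<in> {0..pi}" using assms(2) by auto
  have "((\<lambda>s. \<psi> (s, x)) has_vector_derivative d) (at t within {0..T}) \<longleftrightarrow> ((\<lambda>s. \<psi>' (s, x)) has_vector_derivative d) (at t within {0..T})" for d
    using has_vector_derivative_transform[OF z(2), of "\<lambda>s. \<psi> (s, x)" "\<lambda>s. \<psi>' (s, x)" d]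
      has_vector_derivative_transform[OF z(2), of "\<lambda>s. \<psi>' (s, x)" "\<lambda>s. \<psi> (s, x)" d] assms(1) z(3) by auto
  then show ?thesis by (simp add: Dt_def z vector_derivative_def)
qed

lemma Dx_cong:
  assumes "\<And>z. z \<in> rect T \<Longrightarrow> \<psi> z = \<psi>' z" "z \<in> rect T"
  shows "Dx \<psi> z = Dx \<psi>' z"
proof -
  obtain t x where z: "z = (t, x)" "t \<in> {0..T}" "x \<in> {0..pi}" using assms(2) by auto
  have "((\<lambda>s. \<psi> (t, s)) has_vector_derivative d) (at x within {0..pi}) \<longleftrightarrow> ((\<lambda>s. \<psi>' (t, s)) has_vector_derivative d) (at x within {0..pi})" for d
    using has_vector_derivative_transform[OF z(3), of "\<lambda>s. \<psi> (t, s)" "\<lambda>s. \<psi>' (t, s)" d]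
      has_vector_derivative_transform[OF z(3), of "\<lambda>s. \<psi>' (t, s)" "\<lambda>s. \<psi> (t, s)" d] assms(1) z(2) by auto
  then show ?thesis by (simp add: Dx_def z vector_derivative_def)
qed

lemma smooth_closedD:
  assumes "smooth_closed T \<psi>"
  shows "continuous_on (rect T) \<psi>" "smooth_closed T (Dx \<psi>)" "smooth_closed T (Dt T \<psi>)"
    and "t \<in> {0..T} \<Longrightarrow> x \<in> {0..pi} \<Longrightarrow> ((\<lambda>y. \<psi> (t, y)) has_vector_derivative Dx \<psi> (t, x)) (at x within {0..pi})"
    and "t \<in> {0..T} \<Longrightarrow> x \<in> {0..pi} \<Longrightarrow> ((\<lambda>s. \<psi> (s, x)) has_vector_derivative Dt T \<psi> (t, x)) (at t within {0..T})"
proof -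
  have S: "Ck_closed T (Suc k) \<psi>" for k using assms unfolding smooth_closed_def by blast
  show "continuous_on (rect T) \<psi>" "smooth_closed T (Dx \<psi>)" "smooth_closed T (Dt T \<psi>)"
    using S unfolding smooth_closed_def by auto
  assume "t \<in> {0..T}" "x \<in> {0..pi}"
  then have "(\<lambda>s. \<psi> (s, x)) differentiable (at t within {0..T})" "(\<lambda>y. \<psi> (t, y)) differentiable (at x within {0..pi})"
    using S[of 0] by auto
  then show "((\<lambda>y. \<psi> (t, y)) has_vector_derivative Dx \<psi> (t, x)) (at x within {0..pi})"
    "((\<lambda>s. \<psi> (s, x)) has_vector_derivative Dt T \<psi> (t, x)) (at t within {0..T})"
    by (simp_all add: Dx_def Dt_def vector_derivative_works[symmetric])
qed

text \<open>A family closed under both partial derivatives suffices. The induction covers all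
  functions that agree with a member on the rectangle, because the operators \<open>Dt\<close> and
  \<open>Dx\<close> return a member of the family only up to values off the rectangle.\<close>

lemma smooth_closedI:
  assumes F: "\<psi> \<in> F" and T: "T > 0"
    and cont: "\<And>f. f \<in> F \<Longrightarrow> continuous_on (rect T) f"
    and dt: "\<And>f. f \<in> F \<Longrightarrow> \<exists>g\<in>F. \<forall>t\<in>{0..T}. \<forall>x\<in>{0..pi}. ((\<lambda>s. f (s, x)) has_vector_derivative g (t, x)) (at t within {0..T})"
    and dx: "\<And>f. f \<in> F \<Longrightarrow> \<exists>g\<in>F. \<forall>t\<in>{0..T}. \<forall>x\<in>{0..pi}. ((\<lambda>y. f (t, y)) has_vector_derivative g (t, x)) (at x within {0..pi})"
  shows "smooth_closed T \<psi>"
proof -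
  have "Ck_closed T k h" if "f \<in> F" "\<And>z. z \<in> rect T \<Longrightarrow> h z = f z" for k f h
    using that
  proof (induction k arbitrary: f h)
    case 0
    then show ?case using cont by (simp cong: continuous_on_cong)
  next
    case (Suc k)
    obtain g where g: "g \<in> F" "\<And>t x. t \<in> {0..T} \<Longrightarrow> x \<in> {0..pi} \<Longrightarrow> ((\<lambda>s. f (s, x)) has_vector_derivative g (t, x)) (at t within {0..T})"
      using dt[OF Suc.prems(1)] by blast
    obtain k' where k': "k' \<in> F" "\<And>t x. t \<in> {0..T} \<Longrightarrow> x \<in> {0..pi} \<Longrightarrow> ((\<lambda>y. f (t, y)) has_vector_derivative k' (t, x)) (at x within {0..pi})"
      using dx[OF Suc.prems(1)] by blast
    have ht: "((\<lambda>s. h (s, x)) has_vector_derivative g (t, x)) (at t within {0..T})"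
      and hx: "((\<lambda>y. h (t, y)) has_vector_derivative k' (t, x)) (at x within {0..pi})" if "t \<in> {0..T}" "x \<in> {0..pi}" for t x
      using has_vector_derivative_transform[OF that(1) _ g(2)[OF that], of "\<lambda>s. h (s, x)"]
        has_vector_derivative_transform[OF that(2) _ k'(2)[OF that], of "\<lambda>y. h (t, y)"] Suc.prems(2) that by auto
    have "Dt T h z = g z" "Dx h z = k' z" if zr: "z \<in> rect T" for z
    proof -
      obtain t x where z: "z = (t, x)" "t \<in> {0..T}" "x \<in> {0..pi}" using zr by auto
      have "vector_derivative (\<lambda>s. h (s, x)) (at t within cbox 0 T) = g (t, x)"
        by (rule vector_derivative_within_cbox) (use T ht[OF z(2,3)] z in auto)
      moreover have "vector_derivative (\<lambda>y. h (t, y)) (at x within cbox 0 pi) = k' (t, x)"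
        by (rule vector_derivative_within_cbox) (use hx[OF z(2,3)] z in auto)
      ultimately show "Dt T h z = g z" "Dx h z = k' z" by (simp_all add: Dt_def Dx_def z)
    qed
    then have "Ck_closed T k (Dt T h)" "Ck_closed T k (Dx h)" using Suc.IH g(1) k'(1) by blast+
    moreover have "continuous_on (rect T) h" using cont[OF Suc.prems(1)] Suc.prems(2) by (simp cong: continuous_on_cong)
    ultimately show ?case using ht hx unfolding Ck_closed.simps differentiable_def has_vector_derivative_def by blast
  qed
  then show ?thesis using F unfolding smooth_closed_def by blast
qed

locale beam_rect = beam +
  fixes T :: real
  assumes T: "T > 0"
begin

abbreviation II :: "(real \<times> real \<Rightarrow> 'a::banach) \<Rightarrow> 'a" where
  "II f \<equiv> integral (cbox (0, 0) (T, pi)) f"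

section \<open>Integration over the rectangle\<close>

lemma cbox_rect: "cbox (0, 0) (T, pi) = rect T"
  by (simp add: cbox_Pair_eq)

lemma Omega_box: "Omega T = box (0, 0) (T, pi)"
  by (simp add: Omega_def box_prod)

lemma Omega_lebesgue [measurable, simp]: "Omega T \<in> sets lebesgue"
  by (simp add: Omega_box lmeasurable_box fmeasurableD)

lemma II_iterated:
  fixes f :: "real \<times> real \<Rightarrow> 'a::banach"
  assumes "continuous_on (rect T) f"
  shows "II f = integral {0..T} (\<lambda>t. integral {0..pi} (\<lambda>x. f (t, x)))"
    and "II f = integral {0..pi} (\<lambda>x. integral {0..T} (\<lambda>t. f (t, x)))"
proof -
  have c: "continuous_on (cbox (0, 0) (T, pi)) f" using assms by (simp add: cbox_rect)
  show 1: "II f = integral {0..T} (\<lambda>t. integral {0..pi} (\<lambda>x. f (t, x)))"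
    using integral_prod_continuous[OF c] by simp
  have "continuous_on (cbox (0, 0) (T, pi)) (\<lambda>(x, y). f (x, y))" using c by simp
  from integral_swap_continuous[OF this] show "II f = integral {0..pi} (\<lambda>x. integral {0..T} (\<lambda>t. f (t, x)))"
    using 1 by simp
qed

text \<open>The boundary is a null set, so for continuous integrands the Lebesgue integral over the
  open rectangle may be exchanged for \<open>II\<close>, where iterated integrals are at
  hand.\<close>

lemma LINT_Omega:
  fixes f :: "real \<times> real \<Rightarrow> 'a::euclidean_space"
  assumes "continuous_on (rect T) f"
  shows "integrable (lebesgue_on (Omega T)) f" "(LINT z|lebesgue_on (Omega T). f z) = II f"
proof -
  have "f absolutely_integrable_on cbox (0, 0) (T, pi)"
    using assms by (intro absolutely_integrable_continuous) (simp add: cbox_rect)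
  then have "f absolutely_integrable_on Omega T"
    by (rule set_integrable_subset) (use box_subset_cbox in \<open>auto simp: Omega_box lmeasurable_box fmeasurableD\<close>)
  then show i: "integrable (lebesgue_on (Omega T)) f"
    by (simp add: absolutely_integrable_imp_integrable)
  show "(LINT z|lebesgue_on (Omega T). f z) = II f"
    using lebesgue_integral_eq_integral[OF i] by (simp add: Omega_box integral_open_interval)
qed

lemma continuous_on_fst_snd:
  assumes "continuous_on {0..T} f" "continuous_on {0..pi} g"
  shows "continuous_on (rect T) (\<lambda>z. f (fst z))" "continuous_on (rect T) (\<lambda>z. g (snd z))"
  by (auto intro!: continuous_on_compose2[OF assms(1)] continuous_on_compose2[OF assms(2)] continuous_intros)

lemma continuous_on_section:
  assumes "continuous_on (rect T) f"
  shows "t \<in> {0..T} \<Longrightarrow> continuous_on {0..pi} (\<lambda>x. f (t, x))" "x \<in> {0..pi} \<Longrightarrow> continuous_on {0..T} (\<lambda>t. f (t, x))"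
  by (auto intro!: continuous_on_compose2[OF assms] continuous_intros)

text \<open>The spatial part of the operator with the product rule carried out.\<close>

definition W2 :: "(real \<times> real \<Rightarrow> complex) \<Rightarrow> real \<times> real \<Rightarrow> complex" where
  "W2 \<psi> z = \<eta>2 (snd z) *\<^sub>R Dx (Dx \<psi>) z + (2 * \<eta>1 (snd z)) *\<^sub>R Dx (Dx (Dx \<psi>)) z + \<eta> (snd z) *\<^sub>R Dx (Dx (Dx (Dx \<psi>))) z"

lemma test_function_section:
  assumes "\<psi> \<in> test_functions T \<alpha> \<beta>" and t: "t \<in> {0..T}"
  shows "beam_dom (\<lambda>x. \<psi> (t, x)) (\<lambda>x. Dx \<psi> (t, x)) (\<lambda>x. Dx (Dx \<psi>) (t, x))
    (\<lambda>x. \<eta>1 x *\<^sub>R Dx (Dx \<psi>) (t, x) + \<eta> x *\<^sub>R Dx (Dx (Dx \<psi>)) (t, x)) (\<lambda>x. W2 \<psi> (t, x))"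
proof -
  have s: "smooth_closed T \<psi>" and bc: "\<forall>x\<in>{0, pi}. \<psi> (t, x) = 0 \<and> \<kappa> x *\<^sub>R Dx \<psi> (t, x) + Dx (Dx \<psi>) (t, x) = 0"
    using assms unfolding test_functions_def \<kappa>_def by auto
  note s1 = smooth_closedD(2)[OF s] note s2 = smooth_closedD(2)[OF s1] note s3 = smooth_closedD(2)[OF s2]
  show ?thesis unfolding W2_def snd_conv
    by (rule beam_dom_C4) (use smooth_closedD(4)[OF s t] smooth_closedD(4)[OF s1 t] smooth_closedD(4)[OF s2 t]
      smooth_closedD(4)[OF s3 t] bc in blast)+
qed

lemma beam_expr_eq:
  assumes \<psi>: "\<psi> \<in> test_functions T \<alpha> \<beta>" and z: "z \<in> rect T"
  shows "beam_expr T \<rho> \<eta> \<psi> z = \<rho> (snd z) *\<^sub>R Dt T (Dt T \<psi>) z + W2 \<psi> z"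
proof -
  obtain t x where tx: "z = (t, x)" "t \<in> {0..T}" "x \<in> {0..pi}" using z by auto
  define W1 where "W1 z = \<eta>1 (snd z) *\<^sub>R Dx (Dx \<psi>) z + \<eta> (snd z) *\<^sub>R Dx (Dx (Dx \<psi>)) z" for z
  have vd: "vector_derivative f (at y within {0..pi}) = d"
    if "(f has_vector_derivative d) (at y within {0..pi})" "y \<in> {0..pi}" for f :: "real \<Rightarrow> complex" and d y
  proof -
    have "vector_derivative f (at y within cbox 0 pi) = d"
      by (rule vector_derivative_within_cbox) (use that in auto)
    then show ?thesis by simp
  qed
  have 1: "Dx (\<lambda>w. \<eta> (snd w) *\<^sub>R Dx (Dx \<psi>) w) z' = W1 z'" if "z' \<in> rect T" for z'
  proof -
    obtain s y where sy: "z' = (s, y)" "s \<in> {0..T}" "y \<in> {0..pi}" using \<open>z' \<in> rect T\<close> by auto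
    show ?thesis unfolding sy(1) Dx_def[of "\<lambda>w. \<eta> (snd w) *\<^sub>R Dx (Dx \<psi>) w"] W1_def
      using test_function_section[OF \<psi> sy(2)] sy(3) unfolding beam_dom_def by (auto intro!: vd)
  qed
  have "Dx (Dx (\<lambda>w. \<eta> (snd w) *\<^sub>R Dx (Dx \<psi>) w)) z = Dx W1 z" by (rule Dx_cong[OF 1 z])
  also have "\<dots> = W2 \<psi> z"
    unfolding tx(1) Dx_def[of W1] W1_def
    using test_function_section[OF \<psi> tx(2)] tx(3) unfolding beam_dom_def by (auto intro!: vd)
  finally show ?thesis by (simp add: beam_expr_def)
qed

lemma test_function_continuous:
  assumes \<psi>: "\<psi> \<in> test_functions T \<alpha> \<beta>"
  shows "continuous_on (rect T) \<psi>" "continuous_on (rect T) (Dt T (Dt T \<psi>))" "continuous_on (rect T) (W2 \<psi>)"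
    "continuous_on (rect T) (beam_expr T \<rho> \<eta> \<psi>)"
proof -
  have s: "smooth_closed T \<psi>" using \<psi> by (simp add: test_functions_def)
  note s1 = smooth_closedD(2)[OF s] note s2 = smooth_closedD(2)[OF s1] note s3 = smooth_closedD(2)[OF s2] note s4 = smooth_closedD(2)[OF s3]
  show 1: "continuous_on (rect T) \<psi>" by (rule smooth_closedD(1)[OF s])
  show 2: "continuous_on (rect T) (Dt T (Dt T \<psi>))" by (rule smooth_closedD(1)[OF smooth_closedD(3)[OF smooth_closedD(3)[OF s]]])
  note c = continuous_on_fst_snd(2)[OF continuous_on_const]
  show 3: "continuous_on (rect T) (W2 \<psi>)"
    unfolding W2_def[abs_def]
    by (intro continuous_on_add continuous_on_scaleR continuous_on_mult continuous_on_const c \<eta>_cont \<eta>1_cont \<eta>2_cont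
      smooth_closedD(1)[OF s2] smooth_closedD(1)[OF s3] smooth_closedD(1)[OF s4])
  have "continuous_on (rect T) (\<lambda>z. \<rho> (snd z) *\<^sub>R Dt T (Dt T \<psi>) z + W2 \<psi> z)"
    by (intro continuous_on_add continuous_on_scaleR c \<rho>_cont 2 3)
  then show "continuous_on (rect T) (beam_expr T \<rho> \<eta> \<psi>)"
    by (rule continuous_on_eq) (simp add: beam_expr_eq[OF \<psi>])
qed

text \<open>Two integrations by parts leave the boundary form \<open>G\<close>, whose values at both
  ends agree by periodicity.\<close>

lemma periodic_by_parts:
  fixes f :: "real \<Rightarrow> complex"
  assumes \<tau>: "\<And>t. (\<tau> has_real_derivative \<tau>1 t) (at t)" "\<And>t. (\<tau>1 has_real_derivative \<tau>2 t) (at t)" "continuous_on {0..T} \<tau>2"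
    and p\<tau>: "\<tau> 0 = \<tau> T" "\<tau>1 0 = \<tau>1 T"
    and f: "\<And>t. t \<in> {0..T} \<Longrightarrow> (f has_vector_derivative f1 t) (at t within {0..T})"
      "\<And>t. t \<in> {0..T} \<Longrightarrow> (f1 has_vector_derivative f2 t) (at t within {0..T})" "continuous_on {0..T} f2"
    and pf: "f 0 = f T" "f1 0 = f1 T"
  shows "integral {0..T} (\<lambda>t. \<tau> t *\<^sub>R f2 t) = integral {0..T} (\<lambda>t. \<tau>2 t *\<^sub>R f t)"
proof -
  define G where "G t = \<tau> t *\<^sub>R f1 t - \<tau>1 t *\<^sub>R f t" for t
  have "((\<lambda>t. \<tau> t *\<^sub>R f2 t - \<tau>2 t *\<^sub>R f t) has_integral G T - G 0) {0..T}"
  proof (rule fundamental_theorem_of_calculus)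
    fix t assume t: "t \<in> {0..T}"
    have "(G has_vector_derivative (\<tau> t *\<^sub>R f2 t + \<tau>1 t *\<^sub>R f1 t) - (\<tau>1 t *\<^sub>R f1 t + \<tau>2 t *\<^sub>R f t)) (at t within {0..T})"
      unfolding G_def using \<tau> f t
      by (intro has_vector_derivative_diff has_vector_derivative_scaleR) (auto intro: has_field_derivative_at_within)
    then show "(G has_vector_derivative \<tau> t *\<^sub>R f2 t - \<tau>2 t *\<^sub>R f t) (at t within {0..T})" by simp
  qed (use T in simp)
  then have "((\<lambda>t. \<tau> t *\<^sub>R f2 t - \<tau>2 t *\<^sub>R f t) has_integral 0) {0..T}" using p\<tau> pf by (simp add: G_def)
  moreover have "continuous_on {0..T} \<tau>" using \<tau>(1) by (meson DERIV_isCont continuous_at_imp_continuous_on)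
  then have "(\<lambda>t. \<tau> t *\<^sub>R f2 t) integrable_on {0..T}"
    by (intro integrable_continuous_interval continuous_on_scaleR f(3))
  moreover have "continuous_on {0..T} f" by (rule vector_derivative_continuous_on[OF f(1)])
  then have "(\<lambda>t. \<tau>2 t *\<^sub>R f t) integrable_on {0..T}"
    by (intro integrable_continuous_interval continuous_on_scaleR \<tau>(3))
  ultimately show ?thesis by (simp add: has_integral_iff Henstock_Kurzweil_Integration.integral_diff)
qed

text \<open>The operator is moved from \<open>\<psi>\<close> onto the product of
  \<open>\<tau>\<close> and \<open>b\<close>: periodicity in time produces the factor
  \<open>- k\<close>, Lagrange's identity in space the factor \<open>\<nu>\<close>. This is the
  eigenvalue equation in weak form.\<close>

lemma beam_expr_eigen:
  assumes \<psi>: "\<psi> \<in> test_functions T \<alpha> \<beta>" and b: "eigen \<nu> b"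
    and \<tau>: "\<And>t. (\<tau> has_real_derivative \<tau>1 t) (at t)" "\<And>t. (\<tau>1 has_real_derivative - k * \<tau> t) (at t)"
    and p\<tau>: "\<tau> 0 = \<tau> T" "\<tau>1 0 = \<tau>1 T"
  shows "II (\<lambda>z. (\<tau> (fst z) * b (snd z)) *\<^sub>R beam_expr T \<rho> \<eta> \<psi> z)
    = (\<nu> - k) *\<^sub>R II (\<lambda>z. (\<rho> (snd z) * (\<tau> (fst z) * b (snd z))) *\<^sub>R \<psi> z)"
proof -
  have s: "smooth_closed T \<psi>" and per: "\<And>x. x \<in> {0..pi} \<Longrightarrow> \<psi> (0, x) = \<psi> (T, x) \<and> Dt T \<psi> (0, x) = Dt T \<psi> (T, x)"
    using \<psi> by (auto simp: test_functions_def)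
  note c = test_function_continuous[OF \<psi>]
  obtain b1 b2 w1 where bd: "beam_dom b b1 b2 w1 (\<lambda>x. \<nu> * (\<rho> x * b x))" using b unfolding eigen_def by blast
  have bc: "continuous_on {0..pi} b" by (rule beam_dom_continuous(1)[OF bd])
  have \<tau>c: "continuous_on {0..T} \<tau>" using \<tau>(1) by (meson DERIV_isCont continuous_at_imp_continuous_on)
  note cc = continuous_on_fst_snd(1)[OF \<tau>c continuous_on_const] continuous_on_fst_snd(2)[OF continuous_on_const bc]
    continuous_on_fst_snd(2)[OF continuous_on_const \<rho>_cont]
  have c1: "continuous_on (rect T) (\<lambda>z. (\<tau> (fst z) * (\<rho> (snd z) * b (snd z))) *\<^sub>R Dt T (Dt T \<psi>) z)"
    and c2: "continuous_on (rect T) (\<lambda>z. (\<tau> (fst z) * b (snd z)) *\<^sub>R W2 \<psi> z)"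
    and c3: "continuous_on (rect T) (\<lambda>z. (\<rho> (snd z) * (\<tau> (fst z) * b (snd z))) *\<^sub>R \<psi> z)"
    by (intro continuous_on_scaleR continuous_on_mult cc c)+
  have "II (\<lambda>z. (\<tau> (fst z) * b (snd z)) *\<^sub>R beam_expr T \<rho> \<eta> \<psi> z)
     = II (\<lambda>z. (\<tau> (fst z) * (\<rho> (snd z) * b (snd z))) *\<^sub>R Dt T (Dt T \<psi>) z + (\<tau> (fst z) * b (snd z)) *\<^sub>R W2 \<psi> z)"
    by (rule integral_cong) (simp add: cbox_rect beam_expr_eq[OF \<psi>] scaleR_right_distrib mult_ac)
  also have "\<dots> = II (\<lambda>z. (\<tau> (fst z) * (\<rho> (snd z) * b (snd z))) *\<^sub>R Dt T (Dt T \<psi>) z) + II (\<lambda>z. (\<tau> (fst z) * b (snd z)) *\<^sub>R W2 \<psi> z)"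
    by (rule Henstock_Kurzweil_Integration.integral_add) (rule integrable_continuous, simp only: cbox_rect c1 c2)+
  also have "II (\<lambda>z. (\<tau> (fst z) * (\<rho> (snd z) * b (snd z))) *\<^sub>R Dt T (Dt T \<psi>) z)
      = (- k) *\<^sub>R II (\<lambda>z. (\<rho> (snd z) * (\<tau> (fst z) * b (snd z))) *\<^sub>R \<psi> z)"
  proof -
    have inner: "integral {0..T} (\<lambda>t. (\<tau> t * (\<rho> x * b x)) *\<^sub>R Dt T (Dt T \<psi>) (t, x))
        = (- k) *\<^sub>R integral {0..T} (\<lambda>t. (\<rho> x * (\<tau> t * b x)) *\<^sub>R \<psi> (t, x))" if x: "x \<in> {0..pi}" for x
    proof -
      have "integral {0..T} (\<lambda>t. \<tau> t *\<^sub>R Dt T (Dt T \<psi>) (t, x)) = integral {0..T} (\<lambda>t. (- k * \<tau> t) *\<^sub>R \<psi> (t, x))"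
      proof (rule periodic_by_parts[OF \<tau>])
        show "continuous_on {0..T} (\<lambda>t. - k * \<tau> t)" by (intro continuous_on_mult continuous_on_const \<tau>c)
        show "((\<lambda>t. \<psi> (t, x)) has_vector_derivative Dt T \<psi> (t, x)) (at t within {0..T})" if "t \<in> {0..T}" for t
          using smooth_closedD(5)[OF s that x] .
        show "((\<lambda>t. Dt T \<psi> (t, x)) has_vector_derivative Dt T (Dt T \<psi>) (t, x)) (at t within {0..T})" if "t \<in> {0..T}" for t
          using smooth_closedD(5)[OF smooth_closedD(3)[OF s] that x] .
        show "continuous_on {0..T} (\<lambda>t. Dt T (Dt T \<psi>) (t, x))" by (rule continuous_on_section(2)[OF c(2) x])
      qed (use p\<tau> per[OF x] in auto)
      then have "(\<rho> x * b x) *\<^sub>R integral {0..T} (\<lambda>t. \<tau> t *\<^sub>R Dt T (Dt T \<psi>) (t, x))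
          = (\<rho> x * b x) *\<^sub>R integral {0..T} (\<lambda>t. (- k * \<tau> t) *\<^sub>R \<psi> (t, x))" by simp
      then show ?thesis by (simp only: integral_cmul[symmetric] scaleR_scaleR mult_ac)
    qed
    show ?thesis
    proof -
      have "integral {0..pi} (\<lambda>x. integral {0..T} (\<lambda>t. (\<tau> t * (\<rho> x * b x)) *\<^sub>R Dt T (Dt T \<psi>) (t, x)))
          = integral {0..pi} (\<lambda>x. (- k) *\<^sub>R integral {0..T} (\<lambda>t. (\<rho> x * (\<tau> t * b x)) *\<^sub>R \<psi> (t, x)))"
        by (rule integral_cong) (rule inner)
      also have "\<dots> = (- k) *\<^sub>R integral {0..pi} (\<lambda>x. integral {0..T} (\<lambda>t. (\<rho> x * (\<tau> t * b x)) *\<^sub>R \<psi> (t, x)))"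
        by (rule integral_cmul)
      finally show ?thesis unfolding II_iterated(2)[OF c1] II_iterated(2)[OF c3] fst_conv snd_conv .
    qed
  qed
  also have "II (\<lambda>z. (\<tau> (fst z) * b (snd z)) *\<^sub>R W2 \<psi> z) = \<nu> *\<^sub>R II (\<lambda>z. (\<rho> (snd z) * (\<tau> (fst z) * b (snd z))) *\<^sub>R \<psi> z)"
  proof -
    have inner: "integral {0..pi} (\<lambda>x. (\<tau> t * b x) *\<^sub>R W2 \<psi> (t, x))
        = \<nu> *\<^sub>R integral {0..pi} (\<lambda>x. (\<rho> x * (\<tau> t * b x)) *\<^sub>R \<psi> (t, x))" if t: "t \<in> {0..T}" for t
    proof -
      have "integral {0..pi} (\<lambda>x. (\<nu> * (\<rho> x * b x)) *\<^sub>R \<psi> (t, x)) = integral {0..pi} (\<lambda>x. b x *\<^sub>R W2 \<psi> (t, x))"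
        by (rule beam_dom_symmetric[OF bd test_function_section[OF \<psi> t]])
          (intro continuous_on_mult continuous_on_const \<rho>_cont bc, rule continuous_on_section(1)[OF c(3) t])
      then have "\<tau> t *\<^sub>R integral {0..pi} (\<lambda>x. b x *\<^sub>R W2 \<psi> (t, x)) = \<tau> t *\<^sub>R integral {0..pi} (\<lambda>x. (\<nu> * (\<rho> x * b x)) *\<^sub>R \<psi> (t, x))" by simp
      then show ?thesis by (simp only: integral_cmul[symmetric] scaleR_scaleR mult_ac)
    qed
    show ?thesis
    proof -
      have "integral {0..T} (\<lambda>t. integral {0..pi} (\<lambda>x. (\<tau> t * b x) *\<^sub>R W2 \<psi> (t, x)))
          = integral {0..T} (\<lambda>t. \<nu> *\<^sub>R integral {0..pi} (\<lambda>x. (\<rho> x * (\<tau> t * b x)) *\<^sub>R \<psi> (t, x)))"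
        by (rule integral_cong) (rule inner)
      also have "\<dots> = \<nu> *\<^sub>R integral {0..T} (\<lambda>t. integral {0..pi} (\<lambda>x. (\<rho> x * (\<tau> t * b x)) *\<^sub>R \<psi> (t, x)))"
        by (rule integral_cmul)
      finally show ?thesis unfolding II_iterated(1)[OF c2] II_iterated(1)[OF c3] fst_conv snd_conv .
    qed
  qed
  finally show ?thesis by (simp add: scaleR_left_diff_distrib)
qed

end

section \<open>Trigonometric polynomials in time\<close>

lemma finite_sum_extend:
  fixes e :: "'j \<Rightarrow> real"
  assumes "finite I" "I \<subseteq> I'" "finite I'"
  shows "(\<Sum>j\<in>I. c j * e j) = (\<Sum>j\<in>I'. (if j \<in> I then c j else 0) * e j)"
  using assms by (intro sum.mono_neutral_cong_left) auto

context beam_rect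
begin

section \<open>The real Fourier basis in time\<close>

definition \<omega> :: real where "\<omega> = 2 * pi / T"

lemma \<omega>_T: "\<omega> * T = 2 * pi" using T by (simp add: \<omega>_def)

text \<open>A single integer index for the real Fourier basis of period \<open>T\<close>;
  \<open>trig 0\<close> is the constant 1.\<close>

definition trig :: "int \<Rightarrow> real \<Rightarrow> real" where
  "trig m t = (if m \<ge> 0 then cos (\<omega> * real_of_int m * t) else sin (\<omega> * real_of_int m * t))"

definition trig1 :: "int \<Rightarrow> real \<Rightarrow> real" where
  "trig1 m t = (\<omega> * real_of_int m) * (if m \<ge> 0 then - sin (\<omega> * real_of_int m * t) else cos (\<omega> * real_of_int m * t))"

lemma trig_deriv: "(trig m has_real_derivative trig1 m t) (at t)"
proof (cases "m \<ge> 0")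
  case True
  have "((\<lambda>t. cos (\<omega> * real_of_int m * t)) has_real_derivative trig1 m t) (at t)"
    using True by (auto intro!: derivative_eq_intros simp: trig1_def)
  then show ?thesis using True by (simp add: trig_def[abs_def])
next
  case False
  have "((\<lambda>t. sin (\<omega> * real_of_int m * t)) has_real_derivative trig1 m t) (at t)"
    using False by (auto intro!: derivative_eq_intros simp: trig1_def)
  then show ?thesis using False by (simp add: trig_def[abs_def])
qed

lemma trig1_deriv: "(trig1 m has_real_derivative - (\<omega> * real_of_int m)\<^sup>2 * trig m t) (at t)"
proof (cases "m \<ge> 0")
  case True
  have "((\<lambda>t. (\<omega> * real_of_int m) * - sin (\<omega> * real_of_int m * t)) has_real_derivative - (\<omega> * real_of_int m)\<^sup>2 * trig m t) (at t)"
    using True by (auto intro!: derivative_eq_intros simp: trig_def power2_eq_square)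
  then show ?thesis using True by (simp add: trig1_def[abs_def])
next
  case False
  have "((\<lambda>t. (\<omega> * real_of_int m) * cos (\<omega> * real_of_int m * t)) has_real_derivative - (\<omega> * real_of_int m)\<^sup>2 * trig m t) (at t)"
    using False by (auto intro!: derivative_eq_intros simp: trig_def power2_eq_square)
  then show ?thesis using False by (simp add: trig1_def[abs_def])
qed

lemma \<omega>_int_T: "\<omega> * real_of_int k * T = (2 * pi) * real_of_int k"
  using \<omega>_T by (metis mult.assoc mult.commute)

lemma trig_periodic: "trig m 0 = trig m T" "trig1 m 0 = trig1 m T"
  by (simp_all add: trig_def trig1_def \<omega>_int_T cos_int_2pin sin_int_2pin)

lemma trig_continuous: "continuous_on S (trig m)"
  using trig_deriv by (meson DERIV_isCont continuous_at_imp_continuous_on)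

lemma abs_trig_le: "\<bar>trig m t\<bar> \<le> 1" by (simp add: trig_def)

lemma integral_cos_sin:
  "integral {0..T} (\<lambda>t. cos (\<omega> * real_of_int k * t)) = (if k = 0 then T else 0)"
  "integral {0..T} (\<lambda>t. sin (\<omega> * real_of_int k * t)) = 0"
proof -
  have \<omega>: "\<omega> > 0" using T by (simp add: \<omega>_def)
  have c: "((\<lambda>t. cos (\<omega> * real_of_int k * t)) has_integral 0) {0..T}"
    and s: "((\<lambda>t. sin (\<omega> * real_of_int k * t)) has_integral 0) {0..T}" if k: "k \<noteq> 0"
  proof -
    define w where "w = \<omega> * real_of_int k"
    have "w * T = (2 * pi) * real_of_int k" by (simp only: w_def \<omega>_int_T)
    then have w2: "sin (w * T) = 0" "cos (w * T) = 1" by (simp_all only: sin_int_2pin cos_int_2pin)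
    have "w \<noteq> 0" using k \<omega> by (simp add: w_def)
    note w = this w2
    have "((\<lambda>t. cos (w * t)) has_integral sin (w * T) / w - sin (w * 0) / w) {0..T}"
      using T w(1) by (intro fundamental_theorem_of_calculus)
        (auto intro!: derivative_eq_intros simp: has_real_derivative_iff_has_vector_derivative[symmetric])
    then show "((\<lambda>t. cos (\<omega> * real_of_int k * t)) has_integral 0) {0..T}" using w(2) by (simp add: w_def[symmetric])
    have "((\<lambda>t. sin (w * t)) has_integral - cos (w * T) / w - - cos (w * 0) / w) {0..T}"
      using T w(1) by (intro fundamental_theorem_of_calculus)
        (auto intro!: derivative_eq_intros simp: has_real_derivative_iff_has_vector_derivative[symmetric])
    then show "((\<lambda>t. sin (\<omega> * real_of_int k * t)) has_integral 0) {0..T}" using w(3) by (simp add: w_def[symmetric])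
  qed
  show "integral {0..T} (\<lambda>t. cos (\<omega> * real_of_int k * t)) = (if k = 0 then T else 0)"
    using c T by (cases "k = 0") (auto intro: integral_unique)
  show "integral {0..T} (\<lambda>t. sin (\<omega> * real_of_int k * t)) = 0"
    using s by (cases "k = 0") (auto intro: integral_unique)
qed

lemma trig_mult_cases:
  shows "m \<ge> 0 \<Longrightarrow> n \<ge> 0 \<Longrightarrow> trig m t * trig n t = (cos (\<omega> * real_of_int (m - n) * t) + cos (\<omega> * real_of_int (m + n) * t)) / 2"
    "m < 0 \<Longrightarrow> n < 0 \<Longrightarrow> trig m t * trig n t = (cos (\<omega> * real_of_int (m - n) * t) - cos (\<omega> * real_of_int (m + n) * t)) / 2"
    "m < 0 \<Longrightarrow> n \<ge> 0 \<Longrightarrow> trig m t * trig n t = (sin (\<omega> * real_of_int (m + n) * t) + sin (\<omega> * real_of_int (m - n) * t)) / 2"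
proof -
  have *: "\<omega> * real_of_int (m - n) * t = \<omega> * real_of_int m * t - \<omega> * real_of_int n * t"
    "\<omega> * real_of_int (m + n) * t = \<omega> * real_of_int m * t + \<omega> * real_of_int n * t" by (simp_all add: algebra_simps)
  show "m \<ge> 0 \<Longrightarrow> n \<ge> 0 \<Longrightarrow> trig m t * trig n t = (cos (\<omega> * real_of_int (m - n) * t) + cos (\<omega> * real_of_int (m + n) * t)) / 2"
    "m < 0 \<Longrightarrow> n < 0 \<Longrightarrow> trig m t * trig n t = (cos (\<omega> * real_of_int (m - n) * t) - cos (\<omega> * real_of_int (m + n) * t)) / 2"
    "m < 0 \<Longrightarrow> n \<ge> 0 \<Longrightarrow> trig m t * trig n t = (sin (\<omega> * real_of_int (m + n) * t) + sin (\<omega> * real_of_int (m - n) * t)) / 2"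
    unfolding * by (simp_all add: trig_def cos_times_cos sin_times_sin sin_times_cos)
qed

text \<open>The squared norm of \<open>trig m\<close> in L2(0,T), by whose root the modes are
  normalised.\<close>

definition N :: "int \<Rightarrow> real" where "N m = (if m = 0 then T else T / 2)"

lemma N_pos: "N m > 0" using T by (simp add: N_def)

text \<open>Product formulas reduce the integrand to single cosines and sines, whose integrals over
  a period vanish except for the constant. The one sign pattern without a formula follows by
  exchanging the factors.\<close>

lemma trig_orthogonal: "integral {0..T} (\<lambda>t. trig m t * trig n t) = (if m = n then N m else 0)"
proof -
  have i: "(\<lambda>t. cos (\<omega> * real_of_int k * t)) integrable_on {0..T}" "(\<lambda>t. sin (\<omega> * real_of_int k * t)) integrable_on {0..T}" for k
    by (intro integrable_continuous_interval continuous_intros)+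
  have "integral {0..T} (\<lambda>t. trig m t * trig n t) = (if m = n then N m else 0)" if mn: "n \<ge> 0 \<or> m < 0" for m n
  proof -
    consider "m \<ge> 0" "n \<ge> 0" | "m < 0" "n < 0" | "m < 0" "n \<ge> 0" using mn by linarith
    then show ?thesis
    proof cases
      case 1
      have "integral {0..T} (\<lambda>t. trig m t * trig n t)
        = (integral {0..T} (\<lambda>t. cos (\<omega> * real_of_int (m - n) * t)) + integral {0..T} (\<lambda>t. cos (\<omega> * real_of_int (m + n) * t))) / 2"
        unfolding trig_mult_cases(1)[OF 1] by (simp add: Henstock_Kurzweil_Integration.integral_add[OF i(1) i(1)] del: of_int_diff of_int_add)
      then show ?thesis unfolding integral_cos_sin using 1 by (auto simp: N_def)
    next
      case 2
      have "integral {0..T} (\<lambda>t. trig m t * trig n t)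
        = (integral {0..T} (\<lambda>t. cos (\<omega> * real_of_int (m - n) * t)) - integral {0..T} (\<lambda>t. cos (\<omega> * real_of_int (m + n) * t))) / 2"
        unfolding trig_mult_cases(2)[OF 2] by (simp add: Henstock_Kurzweil_Integration.integral_diff[OF i(1) i(1)] del: of_int_diff of_int_add)
      then show ?thesis unfolding integral_cos_sin using 2 by (auto simp: N_def)
    next
      case 3
      have "integral {0..T} (\<lambda>t. trig m t * trig n t)
        = (integral {0..T} (\<lambda>t. sin (\<omega> * real_of_int (m + n) * t)) + integral {0..T} (\<lambda>t. sin (\<omega> * real_of_int (m - n) * t))) / 2"
        unfolding trig_mult_cases(3)[OF 3] by (simp add: Henstock_Kurzweil_Integration.integral_add[OF i(2) i(2)] del: of_int_diff of_int_add)
      then show ?thesis unfolding integral_cos_sin using 3 by auto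
    qed
  qed note main = this
  show ?thesis
  proof (cases "n \<ge> 0 \<or> m < 0")
    case False
    then show ?thesis using main[of m n] by (simp add: mult.commute)
  qed (rule main)
qed

section \<open>Approximation by trigonometric polynomials\<close>

lemma cos_sin_trig: "\<exists>a k. \<forall>t. cos (\<omega> * real_of_int m * t) = a * trig k t" "\<exists>a k. \<forall>t. sin (\<omega> * real_of_int m * t) = a * trig k t"
proof -
  have "cos (\<omega> * real_of_int m * t) = 1 * trig \<bar>m\<bar> t" for t
    by (cases "m \<ge> 0") (auto simp: trig_def)
  then show "\<exists>a k. \<forall>t. cos (\<omega> * real_of_int m * t) = a * trig k t" by blast
  consider "m < 0" | "m = 0" | "m > 0" by linarith
  then show "\<exists>a k. \<forall>t. sin (\<omega> * real_of_int m * t) = a * trig k t"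
  proof cases
    case 1
    then have "\<forall>t. sin (\<omega> * real_of_int m * t) = 1 * trig m t" by (simp add: trig_def)
    then show ?thesis by blast
  next
    case 2
    then have "\<forall>t. sin (\<omega> * real_of_int m * t) = 0 * trig 0 t" by simp
    then show ?thesis by blast
  next
    case 3
    then have "\<forall>t. sin (\<omega> * real_of_int m * t) = (-1) * trig (- m) t" by (simp add: trig_def)
    then show ?thesis by blast
  qed
qed

text \<open>Scalars are absorbed by the polynomial factor, so addition alone generates the
  span.\<close>

inductive trig_poly :: "(real \<times> real \<Rightarrow> real) \<Rightarrow> bool" where
  base: "trig_poly (\<lambda>z. trig m (fst z) * poly p (snd z))"
| add: "trig_poly f \<Longrightarrow> trig_poly g \<Longrightarrow> trig_poly (\<lambda>z. f z + g z)"

lemma trig_poly_cos: "trig_poly (\<lambda>z. cos (\<omega> * real_of_int m * fst z) * poly p (snd z))"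
  and trig_poly_sin: "trig_poly (\<lambda>z. sin (\<omega> * real_of_int m * fst z) * poly p (snd z))"
proof -
  have *: "trig_poly (\<lambda>z. F (fst z) * poly p (snd z))" if "\<forall>t. F t = a * trig k t" for F a k
  proof -
    have "(\<lambda>z. F (fst z) * poly p (snd z)) = (\<lambda>z. trig k (fst z) * poly (smult a p) (snd z))" using that by (simp add: fun_eq_iff)
    then show ?thesis using base[of k "smult a p"] by simp
  qed
  show "trig_poly (\<lambda>z. cos (\<omega> * real_of_int m * fst z) * poly p (snd z))"
  proof -
    obtain a k where "\<forall>t. cos (\<omega> * real_of_int m * t) = a * trig k t" using cos_sin_trig(1)[of m] by blast
    from *[of "\<lambda>t. cos (\<omega> * real_of_int m * t)", OF this] show ?thesis .
  qed
  show "trig_poly (\<lambda>z. sin (\<omega> * real_of_int m * fst z) * poly p (snd z))"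
  proof -
    obtain a k where "\<forall>t. sin (\<omega> * real_of_int m * t) = a * trig k t" using cos_sin_trig(2)[of m] by blast
    from *[of "\<lambda>t. sin (\<omega> * real_of_int m * t)", OF this] show ?thesis .
  qed
qed

lemma trig_poly_mult:
  assumes "trig_poly f" "trig_poly g"
  shows "trig_poly (\<lambda>z. f z * g z)"
  using assms(1)
proof induction
  case (base m p)
  show ?case using assms(2)
  proof induction
    case (base n q)
    have "trig_poly (\<lambda>z. (trig m (fst z) * trig n (fst z)) * poly (p * q) (snd z))" if mn: "n \<ge> 0 \<or> m < 0" for m n
    proof -
      consider "m \<ge> 0" "n \<ge> 0" | "m < 0" "n < 0" | "m < 0" "n \<ge> 0" using mn by linarith
      then show ?thesis
      proof cases
        case 1
        then show ?thesis
          using trig_poly.add[OF trig_poly_cos[of "m - n" "smult (1/2) (p * q)"] trig_poly_cos[of "m + n" "smult (1/2) (p * q)"]]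
          unfolding trig_mult_cases(1)[OF 1] by (simp add: algebra_simps add_divide_distrib diff_divide_distrib del: of_int_diff of_int_add)
      next
        case 2
        then show ?thesis
          using trig_poly.add[OF trig_poly_cos[of "m - n" "smult (1/2) (p * q)"] trig_poly_cos[of "m + n" "smult (-1/2) (p * q)"]]
          unfolding trig_mult_cases(2)[OF 2] by (simp add: algebra_simps add_divide_distrib diff_divide_distrib del: of_int_diff of_int_add)
      next
        case 3
        then show ?thesis
          using trig_poly.add[OF trig_poly_sin[of "m + n" "smult (1/2) (p * q)"] trig_poly_sin[of "m - n" "smult (1/2) (p * q)"]]
          unfolding trig_mult_cases(3)[OF 3] by (simp add: algebra_simps add_divide_distrib diff_divide_distrib del: of_int_diff of_int_add)
      qed
    qed note main = this
    have "trig_poly (\<lambda>z. (trig m (fst z) * trig n (fst z)) * poly (p * q) (snd z))"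
    proof (cases "n \<ge> 0 \<or> m < 0")
      case False
      then show ?thesis using main[of m n] by (simp add: mult.commute)
    qed (rule main)
    moreover have "(\<lambda>z. (trig m (fst z) * trig n (fst z)) * poly (p * q) (snd z)) = (\<lambda>z. trig m (fst z) * poly p (snd z) * (trig n (fst z) * poly q (snd z)))"
      by (simp add: fun_eq_iff mult_ac)
    ultimately show ?case by simp
  next
    case (add f g)
    then show ?case using trig_poly.add[OF add.IH] by (simp add: distrib_left)
  qed
next
  case (add f g)
  then show ?case using trig_poly.add[OF add.IH] by (simp add: distrib_right)
qed

text \<open>Wraps time around the circle: the times \<open>0\<close> and \<open>T\<close> are glued,
  and periodic functions become functions on a compact set to which Stone-Weierstrass
  applies.\<close>

definition circ :: "real \<times> real \<Rightarrow> complex \<times> real" where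
  "circ z = (cis (\<omega> * fst z), snd z)"

lemma real_polynomial_function_trig_poly:
  assumes "real_polynomial_function P"
  shows "trig_poly (\<lambda>z. P (circ z))"
  using assms
proof induction
  case (linear f)
  interpret bounded_linear f by (rule linear)
  have "f (circ z) = (cos (\<omega> * real_of_int 1 * fst z) * poly [:f (1, 0):] (snd z) + sin (\<omega> * real_of_int 1 * fst z) * poly [:f (\<i>, 0):] (snd z))
      + cos (\<omega> * real_of_int 0 * fst z) * poly [:0, f (0, 1):] (snd z)" for z
  proof -
    have "circ z = cos (\<omega> * fst z) *\<^sub>R (1, 0) + sin (\<omega> * fst z) *\<^sub>R (\<i>, 0) + snd z *\<^sub>R (0, 1)"
      by (simp add: circ_def complex_eq_iff)
    then have "f (circ z) = cos (\<omega> * fst z) * f (1, 0) + sin (\<omega> * fst z) * f (\<i>, 0) + snd z * f (0, 1)"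
      by (simp only: add scaleR real_scaleR_def)
    then show ?thesis by simp
  qed
  then show ?case by (simp only:) (intro trig_poly.add trig_poly_cos trig_poly_sin)
next
  case (const c)
  have "trig_poly (\<lambda>z. trig 0 (fst z) * poly [:c:] (snd z))" by (rule base)
  then show ?case by (simp add: trig_def)
next
  case (add f g)
  then show ?case by (intro trig_poly.add)
next
  case (mult f g)
  then show ?case by (intro trig_poly_mult)
qed

lemma circ_eq:
  assumes "circ (t, x) = circ (t', x')" "t \<in> {0..T}" "t' \<in> {0..T}"
  shows "x = x'" "t = t' \<or> (t = 0 \<and> t' = T) \<or> (t = T \<and> t' = 0)"
proof -
  show "x = x'" using assms(1) by (simp add: circ_def)
  have "cis (\<omega> * t) = cis (\<omega> * t')" using assms(1) by (simp add: circ_def)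
  then have "cos (\<omega> * t - \<omega> * t') = 1"
    by (simp add: cos_diff cis.ctr)
  then obtain k :: int where k: "\<omega> * t - \<omega> * t' = real_of_int k * 2 * pi" using cos_one_2pi_int by blast
  moreover have "\<omega> * (T * real_of_int k) = real_of_int k * 2 * pi" using \<omega>_int_T[of k] by (simp only: mult_ac)
  ultimately have "\<omega> * (t - t') = \<omega> * (T * real_of_int k)" by (simp only: right_diff_distrib)
  moreover have "\<omega> \<noteq> 0" using T by (simp add: \<omega>_def)
  ultimately have e: "t - t' = T * real_of_int k" using mult_left_cancel by blast
  have "\<bar>t - t'\<bar> \<le> T" using assms by auto
  then have "T * \<bar>real_of_int k\<bar> \<le> T * 1" using e T by (simp add: abs_mult)
  then have "\<bar>real_of_int k\<bar> \<le> 1" using T mult_le_cancel_left_pos by blast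
  then have "\<bar>k\<bar> \<le> 1" by linarith
  then consider "k = 0" | "k = 1" | "k = -1" by linarith
  then show "t = t' \<or> (t = 0 \<and> t' = T) \<or> (t = T \<and> t' = 0)"
    using e assms by cases auto
qed

text \<open>By periodicity \<open>\<psi>\<close> factors through \<open>circ\<close>. The factor is
  continuous since \<open>circ\<close> maps closed subsets of the compact rectangle to closed sets,
  and polynomials on the image pull back to trigonometric polynomials.\<close>

lemma trig_poly_dense:
  assumes \<psi>: "continuous_on (rect T) \<psi>" and per: "\<And>x. x \<in> {0..pi} \<Longrightarrow> \<psi> (0, x) = \<psi> (T, x)" and \<epsilon>: "\<epsilon> > (0::real)"
  obtains A where "trig_poly A" "\<And>z. z \<in> rect T \<Longrightarrow> \<bar>\<psi> z - A z\<bar> < \<epsilon>"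
proof -
  define S where "S = circ ` rect T"
  have circ_cont: "continuous_on (rect T) circ" unfolding circ_def by (intro continuous_intros)
  have cR: "compact (rect T)" by (intro compact_Times) auto
  have S: "compact S" unfolding S_def by (rule compact_continuous_image[OF circ_cont cR])
  \<comment> \<open>Any preimage will do: two of them differ at most by exchanging the times
    \<open>0\<close> and \<open>T\<close>.\<close>
  define f where "f s = \<psi> (SOME z. z \<in> rect T \<and> circ z = s)" for s
  have f: "f (circ z) = \<psi> z" if z: "z \<in> rect T" for z
  proof -
    define y where "y = (SOME y. y \<in> rect T \<and> circ y = circ z)"
    have y: "y \<in> rect T" "circ y = circ z"
      using someI[of "\<lambda>y. y \<in> rect T \<and> circ y = circ z" z] z unfolding y_def by auto
    obtain t x t' x' where tx: "z = (t, x)" "y = (t', x')" by (cases z, cases y)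
    have "\<psi> y = \<psi> z"
      using circ_eq[of t' x' t x] y z per[of x] unfolding tx by auto
    then show ?thesis by (simp add: f_def y_def)
  qed
  have "continuous_on S f"
    unfolding continuous_on_closed_vimage[OF compact_imp_closed[OF S]]
  proof (intro allI impI)
    fix B :: "real set" assume B: "closed B"
    have "closed (\<psi> -` B \<inter> rect T)"
      using \<psi> B continuous_on_closed_vimage[OF compact_imp_closed[OF cR]] by blast
    then have "compact (\<psi> -` B \<inter> rect T)" using cR by (metis Int_commute compact_Int_closed inf.right_idem)
    then have "compact (circ ` (\<psi> -` B \<inter> rect T))"
      by (rule compact_continuous_image[OF continuous_on_subset[OF circ_cont], rotated]) auto
    moreover have "circ ` (\<psi> -` B \<inter> rect T) = f -` B \<inter> S"
      unfolding S_def using f by auto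
    ultimately show "closed (f -` B \<inter> S)" by (simp add: compact_imp_closed)
  qed
  then obtain P where P: "real_polynomial_function P" "\<And>s. s \<in> S \<Longrightarrow> \<bar>f s - P s\<bar> < \<epsilon>"
    using Stone_Weierstrass_real_polynomial_function[OF S _ \<epsilon>] by blast
  show ?thesis
  proof (rule that[OF real_polynomial_function_trig_poly[OF P(1)]])
    fix z assume z: "z \<in> rect T"
    then show "\<bar>\<psi> z - P (circ z)\<bar> < \<epsilon>" using P(2)[of "circ z"] f[OF z] by (simp add: S_def)
  qed
qed

end

section \<open>The kernel of the beam operator\<close>

context beam_rect
begin

text \<open>Carrying both \<open>trig m\<close> and its derivative closes the family under
  differentiation in time, which sends \<open>(c, d)\<close> to
  \<open>(- (\<omega> m)\<^sup>2 d, c)\<close>; differentiation in space acts on \<open>Q\<close>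
  alone.\<close>

definition mode_poly :: "int \<Rightarrow> real poly \<Rightarrow> real \<Rightarrow> real \<Rightarrow> real \<times> real \<Rightarrow> complex" where
  "mode_poly m Q c d z = complex_of_real (poly Q (snd z) * (c * trig m (fst z) + d * trig1 m (fst z)))"

lemma mode_poly_deriv:
  "((\<lambda>s. mode_poly m Q c d (s, x)) has_vector_derivative mode_poly m Q (- (\<omega> * real_of_int m)\<^sup>2 * d) c (t, x)) (at t within S)"
  "((\<lambda>y. mode_poly m Q c d (t, y)) has_vector_derivative mode_poly m (pderiv Q) c d (t, x)) (at x within S)"
proof -
  have t: "((\<lambda>s. poly Q x * (c * trig m s + d * trig1 m s)) has_real_derivative
      poly Q x * (c * trig1 m t + d * (- (\<omega> * real_of_int m)\<^sup>2 * trig m t))) (at t within S)"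
    by (intro DERIV_cmult DERIV_add trig_deriv[THEN has_field_derivative_at_within] trig1_deriv[THEN has_field_derivative_at_within])
  have x: "((\<lambda>y. poly Q y * (c * trig m t + d * trig1 m t)) has_real_derivative
      poly (pderiv Q) x * (c * trig m t + d * trig1 m t)) (at x within S)"
    by (intro DERIV_cmult_right has_field_derivative_at_within[OF poly_DERIV])
  show "((\<lambda>s. mode_poly m Q c d (s, x)) has_vector_derivative mode_poly m Q (- (\<omega> * real_of_int m)\<^sup>2 * d) c (t, x)) (at t within S)"
    using has_vector_derivative_of_real[OF t, where 'a = complex]
    by (simp add: mode_poly_def algebra_simps)
  show "((\<lambda>y. mode_poly m Q c d (t, y)) has_vector_derivative mode_poly m (pderiv Q) c d (t, x)) (at x within S)"
    using has_vector_derivative_of_real[OF x, where 'a = complex]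
    by (simp add: mode_poly_def)
qed

lemma trig1_continuous: "continuous_on S (trig1 m)"
  using trig1_deriv by (meson DERIV_isCont continuous_at_imp_continuous_on)

lemma continuous_on_poly_real: "continuous_on S (poly (P :: real poly))"
  by (intro continuous_on_poly continuous_on_id)

lemma smooth_mode_poly: "smooth_closed T (mode_poly m Q c d)"
proof (rule smooth_closedI[where F = "{mode_poly m Q c d | Q c d. True}"])
  show "mode_poly m Q c d \<in> {mode_poly m Q c d | Q c d. True}" by blast
  show "T > 0" by (rule T)
next
  fix f assume "f \<in> {mode_poly m Q c d | Q c d. True}"
  then obtain Q c d where f: "f = mode_poly m Q c d" by blast
  show "continuous_on (rect T) f"
    unfolding f mode_poly_def
    by (intro continuous_on_of_real continuous_on_mult continuous_on_add continuous_on_const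
      continuous_on_fst_snd[OF trig_continuous continuous_on_poly_real] continuous_on_fst_snd[OF trig1_continuous continuous_on_poly_real])
  show "\<exists>g\<in>{mode_poly m Q c d | Q c d. True}. \<forall>t\<in>{0..T}. \<forall>x\<in>{0..pi}. ((\<lambda>s. f (s, x)) has_vector_derivative g (t, x)) (at t within {0..T})"
    unfolding f by (rule bexI[where x = "mode_poly m Q (- (\<omega> * real_of_int m)\<^sup>2 * d) c"]) (use mode_poly_deriv in blast)+
  show "\<exists>g\<in>{mode_poly m Q c d | Q c d. True}. \<forall>t\<in>{0..T}. \<forall>x\<in>{0..pi}. ((\<lambda>y. f (t, y)) has_vector_derivative g (t, x)) (at x within {0..pi})"
    unfolding f by (rule bexI[where x = "mode_poly m (pderiv Q) c d"]) (use mode_poly_deriv in blast)+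
qed

lemma Dt_mode_poly: "z \<in> rect T \<Longrightarrow> Dt T (mode_poly m Q c d) z = mode_poly m Q (- (\<omega> * real_of_int m)\<^sup>2 * d) c z"
  and Dx_mode_poly: "z \<in> rect T \<Longrightarrow> Dx (mode_poly m Q c d) z = mode_poly m (pderiv Q) c d z"
proof -
  assume zr: "z \<in> rect T"
  obtain t x where z: "z = (t, x)" "t \<in> {0..T}" "x \<in> {0..pi}" using zr by auto
  have "vector_derivative (\<lambda>s. mode_poly m Q c d (s, x)) (at t within cbox 0 T) = mode_poly m Q (- (\<omega> * real_of_int m)\<^sup>2 * d) c (t, x)"
    by (rule vector_derivative_within_cbox) (use T mode_poly_deriv z in auto)
  then show "Dt T (mode_poly m Q c d) z = mode_poly m Q (- (\<omega> * real_of_int m)\<^sup>2 * d) c z" by (simp add: Dt_def z)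
  have "vector_derivative (\<lambda>y. mode_poly m Q c d (t, y)) (at x within cbox 0 pi) = mode_poly m (pderiv Q) c d (t, x)"
    by (rule vector_derivative_within_cbox) (use T mode_poly_deriv z in auto)
  then show "Dx (mode_poly m Q c d) z = mode_poly m (pderiv Q) c d z" by (simp add: Dx_def z)
qed

lemma Dx_mode_poly2: "z \<in> rect T \<Longrightarrow> Dx (Dx (mode_poly m Q c d)) z = mode_poly m (pderiv (pderiv Q)) c d z"
  using Dx_cong[of T "Dx (mode_poly m Q c d)" "mode_poly m (pderiv Q) c d"] by (simp add: Dx_mode_poly)

lemma Dx_mode_poly3: "z \<in> rect T \<Longrightarrow> Dx (Dx (Dx (mode_poly m Q c d))) z = mode_poly m (pderiv (pderiv (pderiv Q))) c d z"
  using Dx_cong[of T "Dx (Dx (mode_poly m Q c d))" "mode_poly m (pderiv (pderiv Q)) c d"] by (simp add: Dx_mode_poly2 Dx_mode_poly)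

lemma Dx_mode_poly4: "z \<in> rect T \<Longrightarrow> Dx (Dx (Dx (Dx (mode_poly m Q c d)))) z = mode_poly m (pderiv (pderiv (pderiv (pderiv Q)))) c d z"
  using Dx_cong[of T "Dx (Dx (Dx (mode_poly m Q c d)))" "mode_poly m (pderiv (pderiv (pderiv Q))) c d"] by (simp add: Dx_mode_poly3 Dx_mode_poly)

lemma Dt_mode_poly2: "z \<in> rect T \<Longrightarrow> Dt T (Dt T (mode_poly m Q c d)) z
    = mode_poly m Q (- (\<omega> * real_of_int m)\<^sup>2 * c) (- (\<omega> * real_of_int m)\<^sup>2 * d) z"
  using Dt_cong[of T "Dt T (mode_poly m Q c d)" "mode_poly m Q (- (\<omega> * real_of_int m)\<^sup>2 * d) c"] by (simp add: Dt_mode_poly)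

lemma mode_poly_test_function:
  assumes P: "\<And>x. x \<in> {0, pi} \<Longrightarrow> poly P x = 0 \<and> \<kappa> x * poly (pderiv P) x + poly (pderiv (pderiv P)) x = 0"
  shows "mode_poly m P 1 0 \<in> test_functions T \<alpha> \<beta>"
proof -
  have r: "(t, x) \<in> rect T" if "t \<in> {0..T}" "x \<in> {0, pi}" for t x using that by auto
  have r0: "(0, x) \<in> rect T" "(T, x) \<in> rect T" if "x \<in> {0..pi}" for x using that T by auto
  have b: "mode_poly m P 1 0 (t, x) = 0 \<and> (2 * (\<alpha> x + \<beta> x)) *\<^sub>R Dx (mode_poly m P 1 0) (t, x) + Dx (Dx (mode_poly m P 1 0)) (t, x) = 0"
    if tx: "t \<in> {0..T}" "x \<in> {0, pi}" for t x
  proof -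
    have "\<kappa> x *\<^sub>R Dx (mode_poly m P 1 0) (t, x) + Dx (Dx (mode_poly m P 1 0)) (t, x)
      = complex_of_real ((\<kappa> x * poly (pderiv P) x + poly (pderiv (pderiv P)) x) * trig m t)"
      unfolding Dx_mode_poly[OF r[OF tx]] Dx_mode_poly2[OF r[OF tx]] mode_poly_def by (simp add: scaleR_conv_of_real algebra_simps)
    also have "\<dots> = 0" using P[OF tx(2)] by (simp only:) simp
    finally show ?thesis using P[OF tx(2)] by (simp add: mode_poly_def \<kappa>_def)
  qed
  have p: "mode_poly m P 1 0 (0, x) = mode_poly m P 1 0 (T, x) \<and> Dt T (mode_poly m P 1 0) (0, x) = Dt T (mode_poly m P 1 0) (T, x)"
    if x: "x \<in> {0..pi}" for x
    unfolding Dt_mode_poly[OF r0(1)[OF x]] Dt_mode_poly[OF r0(2)[OF x]] by (simp add: mode_poly_def trig_periodic[symmetric])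
  show ?thesis unfolding test_functions_def using smooth_mode_poly b p by blast
qed

lemma beam_expr_mode_poly:
  assumes P: "\<And>x. x \<in> {0, pi} \<Longrightarrow> poly P x = 0 \<and> \<kappa> x * poly (pderiv P) x + poly (pderiv (pderiv P)) x = 0"
    and z: "z \<in> rect T"
  shows "beam_expr T \<rho> \<eta> (mode_poly m P 1 0) z = complex_of_real (trig m (fst z) *
    ((\<eta>2 (snd z) * poly (pderiv (pderiv P)) (snd z) + (2 * \<eta>1 (snd z)) * poly (pderiv (pderiv (pderiv P))) (snd z)
      + \<eta> (snd z) * poly (pderiv (pderiv (pderiv (pderiv P)))) (snd z)) - (\<omega> * real_of_int m)\<^sup>2 * (\<rho> (snd z) * poly P (snd z))))"
proof -
  have \<psi>: "mode_poly m P 1 0 \<in> test_functions T \<alpha> \<beta>" using P by (rule mode_poly_test_function)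
  have "beam_expr T \<rho> \<eta> (mode_poly m P 1 0) z = \<rho> (snd z) *\<^sub>R mode_poly m P (- (\<omega> * real_of_int m)\<^sup>2 * 1) (- (\<omega> * real_of_int m)\<^sup>2 * 0) z
    + (\<eta>2 (snd z) *\<^sub>R mode_poly m (pderiv (pderiv P)) 1 0 z + (2 * \<eta>1 (snd z)) *\<^sub>R mode_poly m (pderiv (pderiv (pderiv P))) 1 0 z
      + \<eta> (snd z) *\<^sub>R mode_poly m (pderiv (pderiv (pderiv (pderiv P)))) 1 0 z)"
    by (simp only: beam_expr_eq[OF \<psi> z] W2_def Dt_mode_poly2[OF z] Dx_mode_poly2[OF z] Dx_mode_poly3[OF z] Dx_mode_poly4[OF z])
  then show ?thesis by (simp add: mode_poly_def scaleR_conv_of_real algebra_simps)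
qed

text \<open>\<open>\<rho>\<close> is bounded away from zero on the interval, the domain has finite
  measure, and \<open>norm w \<le> 1 + (norm w)\<^sup>2\<close>.\<close>

lemma L2_integrable:
  fixes w :: "real \<times> real \<Rightarrow> 'a::euclidean_space"
  assumes w: "w \<in> L2 T \<rho>"
  shows "integrable (lebesgue_on (Omega T)) w"
proof -
  obtain m r where m: "m > 0" "\<And>x. x \<in> {0..pi} \<Longrightarrow> 1 / \<rho> x \<le> m" using coefficient_bounds by metis
  have wm: "w \<in> borel_measurable (lebesgue_on (Omega T))" and wi: "integrable (lebesgue_on (Omega T)) (\<lambda>z. (norm (w z))\<^sup>2 * \<rho> (snd z))"
    using w by (auto simp: L2_def)
  have i1: "integrable (lebesgue_on (Omega T)) (\<lambda>z. 1 :: real)" by (rule LINT_Omega(1)) simp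
  show ?thesis
  proof (rule Bochner_Integration.integrable_bound[OF Bochner_Integration.integrable_add[OF i1 Bochner_Integration.integrable_mult_right[OF wi, of m]] wm])
    show "AE z in lebesgue_on (Omega T). norm (w z) \<le> norm (1 + m * ((norm (w z))\<^sup>2 * \<rho> (snd z)))"
    proof (rule AE_I2)
      fix z assume "z \<in> space (lebesgue_on (Omega T))"
      then have z: "snd z \<in> {0..pi}" by (auto simp: Omega_def)
      have "1 \<le> m * \<rho> (snd z)" using m(2)[OF z] \<rho>_pos[OF z] by (simp add: field_simps)
      then have "(norm (w z))\<^sup>2 * 1 \<le> (norm (w z))\<^sup>2 * (m * \<rho> (snd z))" by (intro mult_left_mono) auto
      moreover have "norm (w z) \<le> 1 + (norm (w z))\<^sup>2"
        using zero_le_power2[of "norm (w z) - 1/2"] by (simp add: power2_eq_square algebra_simps)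
      ultimately show "norm (w z) \<le> norm (1 + m * ((norm (w z))\<^sup>2 * \<rho> (snd z)))" by (simp add: mult_ac)
    qed
  qed
qed

text \<open>Formally the product of \<open>trig m\<close> and \<open>b\<close> is annihilated by the
  operator, but it need not be smooth enough to be a test function. Polynomials close to
  \<open>b\<close> with close images give test functions whose image is of size
  \<open>\<delta>\<close>, and the weak equation for \<open>(w, h)\<close> then bounds the integral
  by a multiple of \<open>\<delta>\<close>.\<close>

lemma kernel_orthogonal:
  assumes b: "eigen \<nu> b" and \<nu>: "\<nu> = (\<omega> * real_of_int m)\<^sup>2" and wh: "(w, h) \<in> beam_graph T \<alpha> \<beta> \<rho> \<eta>"
  shows "(LINT z|lebesgue_on (Omega T). \<rho> (snd z) *\<^sub>R (h z * complex_of_real (trig m (fst z) * b (snd z)))) = 0"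
proof -
  let ?M = "lebesgue_on (Omega T)"
  obtain R where R: "R > 0" "\<And>x. x \<in> {0..pi} \<Longrightarrow> \<bar>\<rho> x\<bar> \<le> R" using bounded_on_interval[OF \<rho>_cont] by blast
  obtain b1 b2 w1 where bd: "beam_dom b b1 b2 w1 (\<lambda>x. \<nu> * (\<rho> x * b x))" using b unfolding eigen_def by blast
  have bc: "continuous_on {0..pi} b" by (rule beam_dom_continuous(1)[OF bd])
  have w: "integrable ?M w" and h: "integrable ?M h" using wh L2_integrable by (auto simp: beam_graph_def)
  have graph: "(LINT z|?M. w z * beam_expr T \<rho> \<eta> \<psi> z) = (LINT z|?M. \<rho> (snd z) *\<^sub>R (h z * \<psi> z))"
    if "\<psi> \<in> test_functions T \<alpha> \<beta>" for \<psi> using wh that by (auto simp: beam_graph_def)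
  have zr: "z \<in> rect T" "snd z \<in> {0..pi}" if "z \<in> space ?M" for z using that by (auto simp: Omega_def)
  have hb: "integrable ?M (\<lambda>z. h z * k z)" and wb: "integrable ?M (\<lambda>z. w z * k z)" if k: "continuous_on (rect T) k" for k
  proof -
    have "compact (rect T)" by (intro compact_Times) auto
    then obtain B where B: "\<And>z. z \<in> rect T \<Longrightarrow> norm (k z) \<le> B"
      using compact_imp_bounded[OF compact_continuous_image[OF k]] by (auto simp: bounded_iff)
    have km: "k \<in> borel_measurable ?M" using LINT_Omega(1)[OF k] by simp
    have *: "integrable ?M (\<lambda>z. v z * k z)" if v: "integrable ?M v" for v
    proof (rule Bochner_Integration.integrable_bound[OF Bochner_Integration.integrable_mult_right[OF integrable_norm[OF v], of B]])
      show "(\<lambda>z. v z * k z) \<in> borel_measurable ?M" using km borel_measurable_integrable[OF v] by measurable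
      show "AE z in ?M. norm (v z * k z) \<le> norm (B * norm (v z))"
      proof (rule AE_I2)
        fix z assume "z \<in> space ?M"
        then have "norm (v z) * norm (k z) \<le> norm (v z) * B" using zr B by (intro mult_left_mono) auto
        then show "norm (v z * k z) \<le> norm (B * norm (v z))" by (simp add: norm_mult mult.commute)
      qed
    qed
    show "integrable ?M (\<lambda>z. h z * k z)" "integrable ?M (\<lambda>z. w z * k z)" by (intro * h w)+
  qed
  define X where "X = (LINT z|?M. \<rho> (snd z) *\<^sub>R (h z * complex_of_real (trig m (fst z) * b (snd z))))"
  \<comment> \<open>The first summand bounds the pairing of \<open>w\<close> with the image of the
    test function, the second the error of replacing \<open>b\<close> by a polynomial.\<close>
  define C where "C = (1 + \<nu> * R) * (LINT z|?M. norm (w z)) + R * (LINT z|?M. norm (h z))"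
  have \<nu>0: "\<nu> \<ge> 0" by (simp add: \<nu>)
  have C: "C \<ge> 0" unfolding C_def using R \<nu>0 by (intro add_nonneg_nonneg mult_nonneg_nonneg integral_nonneg_AE AE_I2) auto
  have bound: "norm X \<le> \<delta> * C" if \<delta>: "\<delta> > 0" for \<delta>
  proof -
    have w2c: "continuous_on {0..pi} (\<lambda>x. \<nu> * (\<rho> x * b x))" by (intro continuous_intros \<rho>_cont bc)
    obtain P where P: "\<And>x. x \<in> {0, pi} \<Longrightarrow> poly P x = 0 \<and> \<kappa> x * poly (pderiv P) x + poly (pderiv (pderiv P)) x = 0"
      and P1: "\<And>x. x \<in> {0..pi} \<Longrightarrow> \<bar>poly P x - b x\<bar> \<le> \<delta>"
      and P2: "\<And>x. x \<in> {0..pi} \<Longrightarrow> \<bar>\<eta>2 x * poly (pderiv (pderiv P)) x + (2 * \<eta>1 x) * poly (pderiv (pderiv (pderiv P))) x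
        + \<eta> x * poly (pderiv (pderiv (pderiv (pderiv P)))) x - \<nu> * (\<rho> x * b x)\<bar> \<le> \<delta>"
      using beam_dom_poly_approximation[OF bd w2c \<delta>] by metis
    define \<psi> where "\<psi> = mode_poly m P 1 0"
    have \<psi>: "\<psi> \<in> test_functions T \<alpha> \<beta>" unfolding \<psi>_def by (rule mode_poly_test_function[OF P])
    \<comment> \<open>For \<open>b\<close> itself the two contributions to the operator cancel, as
      \<open>\<nu>\<close> equals the squared time frequency; only approximation errors
      remain.\<close>
    have be: "norm (beam_expr T \<rho> \<eta> \<psi> z) \<le> \<delta> * (1 + \<nu> * R)" if z: "z \<in> space ?M" for z
    proof -
      define x where "x = snd z"
      have x: "x \<in> {0..pi}" using zr[OF z] by (simp add: x_def)
      define Y where "Y = \<eta>2 x * poly (pderiv (pderiv P)) x + (2 * \<eta>1 x) * poly (pderiv (pderiv (pderiv P))) x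
        + \<eta> x * poly (pderiv (pderiv (pderiv (pderiv P)))) x"
      have "\<bar>Y - \<nu> * (\<rho> x * poly P x)\<bar> \<le> \<bar>Y - \<nu> * (\<rho> x * b x)\<bar> + \<nu> * (\<bar>\<rho> x\<bar> * \<bar>poly P x - b x\<bar>)"
      proof -
        have "Y - \<nu> * (\<rho> x * poly P x) = (Y - \<nu> * (\<rho> x * b x)) - \<nu> * (\<rho> x * (poly P x - b x))" by (simp add: algebra_simps)
        then show ?thesis using abs_triangle_ineq4[of "Y - \<nu> * (\<rho> x * b x)" "\<nu> * (\<rho> x * (poly P x - b x))"] \<nu>0 by (simp add: abs_mult)
      qed
      also have "\<dots> \<le> \<delta> + \<nu> * (R * \<delta>)"
        using P2[OF x] R(1) R(2)[OF x] P1[OF x] \<nu>0 unfolding Y_def by (intro add_mono mult_left_mono mult_mono) auto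
      finally have y: "\<bar>Y - \<nu> * (\<rho> x * poly P x)\<bar> \<le> \<delta> * (1 + \<nu> * R)" by (simp add: algebra_simps)
      have "beam_expr T \<rho> \<eta> \<psi> z = complex_of_real (trig m (fst z) * (Y - \<nu> * (\<rho> x * poly P x)))"
        unfolding \<psi>_def Y_def x_def \<nu> using P zr(1)[OF z] by (rule beam_expr_mode_poly)
      then have "norm (beam_expr T \<rho> \<eta> \<psi> z) = \<bar>trig m (fst z)\<bar> * \<bar>Y - \<nu> * (\<rho> x * poly P x)\<bar>"
        by (simp only: norm_of_real abs_mult)
      also have "\<dots> \<le> 1 * (\<delta> * (1 + \<nu> * R))" using y abs_trig_le by (intro mult_mono) auto
      finally show ?thesis by simp
    qed
    note cb = test_function_continuous[OF \<psi>]
    have A: "norm (LINT z|?M. w z * beam_expr T \<rho> \<eta> \<psi> z) \<le> (LINT z|?M. \<delta> * (1 + \<nu> * R) * norm (w z))"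
    proof (rule order_trans[OF integral_norm_bound integral_mono])
      show "integrable ?M (\<lambda>z. norm (w z * beam_expr T \<rho> \<eta> \<psi> z))" by (intro integrable_norm wb cb)
      show "integrable ?M (\<lambda>z. \<delta> * (1 + \<nu> * R) * norm (w z))" by (intro Bochner_Integration.integrable_mult_right integrable_norm w)
      show "norm (w z * beam_expr T \<rho> \<eta> \<psi> z) \<le> \<delta> * (1 + \<nu> * R) * norm (w z)" if "z \<in> space ?M" for z
        unfolding norm_mult using mult_right_mono[OF be[OF that], of "norm (w z)"] by (simp add: mult.commute)
    qed
    have cX: "continuous_on (rect T) (\<lambda>z. complex_of_real (\<rho> (snd z) * (trig m (fst z) * b (snd z))))"
      and c\<psi>: "continuous_on (rect T) (\<lambda>z. complex_of_real (\<rho> (snd z)) * \<psi> z)"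
      by (intro continuous_on_of_real continuous_on_mult continuous_on_fst_snd[OF trig_continuous bc] continuous_on_fst_snd[OF trig_continuous \<rho>_cont] cb)+
    have iX: "integrable ?M (\<lambda>z. \<rho> (snd z) *\<^sub>R (h z * complex_of_real (trig m (fst z) * b (snd z))))"
      using hb[OF cX] by (simp add: scaleR_conv_of_real mult_ac)
    have i\<psi>: "integrable ?M (\<lambda>z. \<rho> (snd z) *\<^sub>R (h z * \<psi> z))"
      using hb[OF c\<psi>] by (simp add: scaleR_conv_of_real mult_ac)
    have "norm (X - (LINT z|?M. \<rho> (snd z) *\<^sub>R (h z * \<psi> z)))
        = norm (LINT z|?M. \<rho> (snd z) *\<^sub>R (h z * complex_of_real (trig m (fst z) * b (snd z))) - \<rho> (snd z) *\<^sub>R (h z * \<psi> z))"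
      unfolding X_def by (simp only: Bochner_Integration.integral_diff[OF iX i\<psi>])
    also have "\<dots> \<le> (LINT z|?M. R * \<delta> * norm (h z))"
    proof (rule order_trans[OF integral_norm_bound integral_mono])
      show "integrable ?M (\<lambda>z. norm (\<rho> (snd z) *\<^sub>R (h z * complex_of_real (trig m (fst z) * b (snd z))) - \<rho> (snd z) *\<^sub>R (h z * \<psi> z)))"
        by (intro integrable_norm Bochner_Integration.integrable_diff iX i\<psi>)
      show "integrable ?M (\<lambda>z. R * \<delta> * norm (h z))" by (intro Bochner_Integration.integrable_mult_right integrable_norm h)
      fix z assume z: "z \<in> space ?M"
      have "\<rho> (snd z) *\<^sub>R (h z * complex_of_real (trig m (fst z) * b (snd z))) - \<rho> (snd z) *\<^sub>R (h z * \<psi> z)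
        = h z * complex_of_real (\<rho> (snd z) * (trig m (fst z) * (b (snd z) - poly P (snd z))))"
        by (simp add: \<psi>_def mode_poly_def scaleR_conv_of_real algebra_simps)
      then have "norm (\<rho> (snd z) *\<^sub>R (h z * complex_of_real (trig m (fst z) * b (snd z))) - \<rho> (snd z) *\<^sub>R (h z * \<psi> z))
        = norm (h z) * (\<bar>\<rho> (snd z)\<bar> * (\<bar>trig m (fst z)\<bar> * \<bar>b (snd z) - poly P (snd z)\<bar>))" by (simp add: norm_mult abs_mult del: of_real_mult of_real_diff)
      also have "\<dots> \<le> norm (h z) * (R * (1 * \<delta>))"
        using R P1[OF zr(2)[OF z]] abs_trig_le zr(2)[OF z] by (intro mult_left_mono mult_mono) (auto simp: abs_minus_commute)
      finally show "norm (\<rho> (snd z) *\<^sub>R (h z * complex_of_real (trig m (fst z) * b (snd z))) - \<rho> (snd z) *\<^sub>R (h z * \<psi> z)) \<le> R * \<delta> * norm (h z)"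
        by (simp add: mult_ac)
    qed
    finally have B: "norm (X - (LINT z|?M. w z * beam_expr T \<rho> \<eta> \<psi> z)) \<le> (LINT z|?M. R * \<delta> * norm (h z))" by (simp only: graph[OF \<psi>])
    have "norm X \<le> norm (X - (LINT z|?M. w z * beam_expr T \<rho> \<eta> \<psi> z)) + norm (LINT z|?M. w z * beam_expr T \<rho> \<eta> \<psi> z)"
      using norm_triangle_ineq[of "X - (LINT z|?M. w z * beam_expr T \<rho> \<eta> \<psi> z)" "LINT z|?M. w z * beam_expr T \<rho> \<eta> \<psi> z"] by simp
    also have "\<dots> \<le> \<delta> * C" using A B unfolding C_def Bochner_Integration.integral_mult_right_zero by (simp add: algebra_simps)
    finally show ?thesis .
  qed
  have "norm X \<le> \<delta>" if "\<delta> > 0" for \<delta>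
  proof -
    have "norm X \<le> \<delta> / (C + 1) * C" using C that by (intro bound) auto
    also have "\<dots> \<le> \<delta>" using C that by (simp add: field_simps)
    finally show ?thesis .
  qed
  then have "norm X = 0" using field_le_epsilon[of "norm X" 0] by auto
  then show ?thesis by (simp add: X_def)
qed

end

section \<open>Completeness of the modes\<close>

context beam_rect
begin

lemma weighted_continuous:
  assumes "continuous_on (rect T) f"
  shows "continuous_on (rect T) (\<lambda>z. \<rho> (snd z) * (f z)\<^sup>2)"
  by (intro continuous_intros assms continuous_on_fst_snd(2)[OF continuous_on_const \<rho>_cont])

lemma II_mono:
  assumes "continuous_on (rect T) f" "continuous_on (rect T) g" "\<And>z. z \<in> rect T \<Longrightarrow> f z \<le> (g z :: real)"
  shows "II f \<le> II g"
  by (intro integral_le integrable_continuous) (use assms in \<open>auto simp: cbox_rect\<close>)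

lemma II_weighted_add:
  assumes f: "continuous_on (rect T) f" and g: "continuous_on (rect T) g"
  shows "II (\<lambda>z. \<rho> (snd z) * (f z + g z)\<^sup>2) \<le> 2 * II (\<lambda>z. \<rho> (snd z) * (f z)\<^sup>2) + 2 * II (\<lambda>z. \<rho> (snd z) * (g z)\<^sup>2)"
proof -
  have i: "(\<lambda>z. 2 * (\<rho> (snd z) * (h z)\<^sup>2)) integrable_on cbox (0, 0) (T, pi)" if "continuous_on (rect T) h" for h
    by (intro integrable_continuous) (auto intro!: continuous_intros weighted_continuous that simp: cbox_rect)
  have "II (\<lambda>z. \<rho> (snd z) * (f z + g z)\<^sup>2) \<le> II (\<lambda>z. 2 * (\<rho> (snd z) * (f z)\<^sup>2) + 2 * (\<rho> (snd z) * (g z)\<^sup>2))"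
  proof (rule II_mono)
    show "continuous_on (rect T) (\<lambda>z. \<rho> (snd z) * (f z + g z)\<^sup>2)" by (intro weighted_continuous continuous_on_add f g)
    show "continuous_on (rect T) (\<lambda>z. 2 * (\<rho> (snd z) * (f z)\<^sup>2) + 2 * (\<rho> (snd z) * (g z)\<^sup>2))"
      by (intro continuous_on_add continuous_on_mult continuous_on_const weighted_continuous f g)
    fix z assume "z \<in> rect T"
    then have r: "\<rho> (snd z) \<ge> 0" using \<rho>_pos[of "snd z"] by auto
    have "(f z + g z)\<^sup>2 \<le> 2 * (f z)\<^sup>2 + 2 * (g z)\<^sup>2"
      using zero_le_power2[of "f z - g z"] by (simp add: power2_eq_square algebra_simps)
    from mult_left_mono[OF this r] show "\<rho> (snd z) * (f z + g z)\<^sup>2 \<le> 2 * (\<rho> (snd z) * (f z)\<^sup>2) + 2 * (\<rho> (snd z) * (g z)\<^sup>2)"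
      by (simp add: algebra_simps)
  qed
  then show ?thesis by (simp add: Henstock_Kurzweil_Integration.integral_add[OF i[OF f] i[OF g]])
qed

text \<open>Dividing by \<open>d\<^sup>3 + 1/n\<close> instead of \<open>d\<^sup>3\<close> cuts \<open>\<psi>\<close> off near the ends of the beam: polynomial multiples
  of \<open>d\<^sup>3\<close> satisfy the boundary conditions.\<close>

lemma cutoff_converges:
  assumes \<psi>: "continuous_on (rect T) \<psi>" and \<epsilon>: "\<epsilon> > 0"
  obtains n :: nat where "n > 0" "II (\<lambda>z. \<rho> (snd z) * (\<psi> z - (snd z * (pi - snd z)) ^ 3 * (\<psi> z / ((snd z * (pi - snd z)) ^ 3 + 1 / real n)))\<^sup>2) < \<epsilon>"
proof -
  define D where "D z = (snd z * (pi - snd z)) ^ 3" for z :: "real \<times> real"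
  have D0: "D z \<ge> 0" if "z \<in> rect T" for z using that by (auto simp: D_def)
  have Dpos: "D z > 0" if "z \<in> box (0, 0) (T, pi)" for z
    using that unfolding Omega_box[symmetric] by (auto simp: D_def Omega_def)
  have Dc: "continuous_on S D" for S unfolding D_def by (intro continuous_intros)
  define f where "f n z = \<rho> (snd z) * (\<psi> z - D z * (\<psi> z / (D z + 1 / real (Suc n))))\<^sup>2" for n z
  \<comment> \<open>The cut-off error is \<open>\<psi>\<close> times a factor between 0 and 1 that
    tends to zero wherever \<open>D\<close> is positive, which prepares dominated
    convergence.\<close>
  have eq: "\<psi> z - D z * (\<psi> z / (D z + 1 / real (Suc n))) = \<psi> z * (1 / (real (Suc n) * D z + 1))" if "D z \<ge> 0" for n z
  proof -
    have "real (Suc n) * D z + 1 > 0" using that by (simp add: add_nonneg_pos)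
    moreover have "D z + 1 / real (Suc n) = (real (Suc n) * D z + 1) / real (Suc n)" by (simp add: field_simps)
    ultimately show ?thesis by (simp add: field_simps)
  qed
  have fc: "continuous_on (rect T) (f n)" for n
  proof -
    have "D z + 1 / real (Suc n) \<noteq> 0" if "z \<in> rect T" for z using D0[OF that] by (metis add_nonneg_pos less_irrefl of_nat_0_less_iff zero_less_Suc zero_less_divide_1_iff)
    then show ?thesis unfolding f_def
      by (intro weighted_continuous continuous_on_diff continuous_on_mult continuous_on_divide continuous_on_add continuous_on_const \<psi> Dc) auto
  qed
  have gc: "continuous_on (rect T) (\<lambda>z. \<rho> (snd z) * (\<psi> z)\<^sup>2)" by (rule weighted_continuous[OF \<psi>])
  have box: "box (0, 0) (T, pi) \<subseteq> rect T" unfolding Omega_box[symmetric] by (auto simp: Omega_def)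
  have r0: "\<rho> (snd z) \<ge> 0" if "z \<in> rect T" for z using that \<rho>_pos[of "snd z"] by auto
  have "(\<lambda>n. integral (box (0, 0) (T, pi)) (f n)) \<longlonglongrightarrow> integral (box (0, 0) (T, pi)) (\<lambda>z. 0)"
  proof (rule dominated_convergence(2))
    show "f n integrable_on box (0, 0) (T, pi)" for n
      unfolding integrable_on_open_interval by (intro integrable_continuous) (use fc in \<open>simp add: cbox_rect\<close>)
    show "(\<lambda>z. \<rho> (snd z) * (\<psi> z)\<^sup>2) integrable_on box (0, 0) (T, pi)"
      unfolding integrable_on_open_interval by (intro integrable_continuous) (use gc in \<open>simp add: cbox_rect\<close>)
    show "norm (f n z) \<le> \<rho> (snd z) * (\<psi> z)\<^sup>2" if "z \<in> box (0, 0) (T, pi)" for n z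
    proof -
      have z: "z \<in> rect T" using that box by blast
      have "real (Suc n) * D z \<ge> 0" using D0[OF z] by simp
      then have "0 \<le> 1 / (real (Suc n) * D z + 1)" "1 / (real (Suc n) * D z + 1) \<le> 1" by (simp_all only: divide_le_eq_1 zero_le_divide_1_iff) linarith+
      then have "(1 / (real (Suc n) * D z + 1))\<^sup>2 \<le> 1" using power_le_one by blast
      then have "(\<psi> z)\<^sup>2 * (1 / (real (Suc n) * D z + 1))\<^sup>2 \<le> (\<psi> z)\<^sup>2 * 1" by (intro mult_left_mono) auto
      then have "\<rho> (snd z) * (\<psi> z * (1 / (real (Suc n) * D z + 1)))\<^sup>2 \<le> \<rho> (snd z) * (\<psi> z)\<^sup>2"
        unfolding power_mult_distrib using r0[OF z] by (intro mult_left_mono) auto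
      then show ?thesis unfolding f_def eq[OF D0[OF z]] using r0[OF z] by simp
    qed
    show "(\<lambda>n. f n z) \<longlonglongrightarrow> 0" if zb: "z \<in> box (0, 0) (T, pi)" for z
    proof -
      have z: "z \<in> rect T" using zb box by blast
      have "(\<lambda>n. 1 / (real (Suc n) * D z + 1)) \<longlonglongrightarrow> 0"
      proof (rule tendsto_divide_0[OF tendsto_const filterlim_at_top_imp_at_infinity])
        have "filterlim (\<lambda>n. D z * real (Suc n)) at_top sequentially"
          by (intro filterlim_tendsto_pos_mult_at_top[OF tendsto_const Dpos[OF zb]]
            filterlim_compose[OF filterlim_real_sequentially filterlim_Suc])
        then show "filterlim (\<lambda>n. real (Suc n) * D z + 1) at_top sequentially"
          by (rule filterlim_at_top_mono, intro always_eventually allI) (simp only: mult.commute[of "D z"] le_add_same_cancel1 zero_le_one)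
      qed
      then have "(\<lambda>n. \<rho> (snd z) * (\<psi> z * (1 / (real (Suc n) * D z + 1)))\<^sup>2) \<longlonglongrightarrow> \<rho> (snd z) * (\<psi> z * 0)\<^sup>2"
        by (intro tendsto_intros)
      then show ?thesis unfolding f_def eq[OF D0[OF z]] by simp
    qed
  qed
  then have "(\<lambda>n. II (f n)) \<longlonglongrightarrow> 0" by (simp add: integral_open_interval)
  then obtain n where "norm (II (f n) - 0) < \<epsilon>" using LIMSEQ_D[OF _ \<epsilon>] by blast
  then have "II (f n) < \<epsilon>" by simp
  then show ?thesis unfolding f_def D_def by (rule that[rotated]) simp
qed

end

text \<open>The assumptions are the properties that \<open>eigenfunction_expansion\<close>
  provides.\<close>

locale beam_modes = beam_rect +
  fixes \<B> :: "'b set" and eb :: "'b \<Rightarrow> real \<Rightarrow> real" and \<nu> :: "'b \<Rightarrow> real"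
  assumes eb_finite: "finite {b \<in> \<B>. \<bar>\<nu> b\<bar> \<le> r}"
    and eb_eigen: "b \<in> \<B> \<Longrightarrow> eigen (\<nu> b) (eb b)"
    and eb_orthonormal: "b \<in> \<B> \<Longrightarrow> c \<in> \<B> \<Longrightarrow> integral {0..pi} (\<lambda>x. \<rho> x * (eb b x * eb c x)) = (if b = c then 1 else 0)"
    and eb_complete: "beam_dom u u1 u2 w1 w2 \<Longrightarrow> continuous_on {0..pi} w2 \<Longrightarrow> \<delta> > 0 \<Longrightarrow>
      \<exists>F c. finite F \<and> F \<subseteq> \<B> \<and> integral {0..pi} (\<lambda>x. \<rho> x * (u x - (\<Sum>b\<in>F. c b * eb b x))\<^sup>2) < \<delta>"
begin

definition mode :: "'b \<times> int \<Rightarrow> real \<times> real \<Rightarrow> real" where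
  "mode j z = trig (snd j) (fst z) * eb (fst j) (snd z) / sqrt (N (snd j))"

text \<open>The eigenvalue of L on the mode, not a time frequency; it is zero for the modes of the
  kernel.\<close>

definition freq :: "'b \<times> int \<Rightarrow> real" where
  "freq j = \<nu> (fst j) - (\<omega> * real_of_int (snd j))\<^sup>2"

abbreviation JJ :: "('b \<times> int) set" where "JJ \<equiv> \<B> \<times> UNIV"

lemma eb_continuous: "b \<in> \<B> \<Longrightarrow> continuous_on {0..pi} (eb b)"
  using eb_eigen[of b] beam_dom_continuous(1) unfolding eigen_def by blast

lemma mode_continuous: "j \<in> JJ \<Longrightarrow> continuous_on (rect T) (mode j)"
  unfolding mode_def using N_pos[of "snd j"]
  by (intro continuous_on_divide continuous_on_mult continuous_on_const
    continuous_on_fst_snd(1)[OF trig_continuous continuous_on_const] continuous_on_fst_snd(2)[OF continuous_on_const eb_continuous]) auto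

lemma mode_orthonormal:
  assumes "i \<in> JJ" "j \<in> JJ"
  shows "II (\<lambda>z. \<rho> (snd z) * (mode i z * mode j z)) = (if i = j then 1 else 0)"
proof -
  obtain b m c n where ij: "i = (b, m)" "j = (c, n)" "b \<in> \<B>" "c \<in> \<B>" using assms by auto
  have "continuous_on (rect T) (\<lambda>z. \<rho> (snd z) * (mode i z * mode j z))"
    by (intro continuous_on_mult mode_continuous assms continuous_on_fst_snd(2)[OF continuous_on_const \<rho>_cont])
  then have "II (\<lambda>z. \<rho> (snd z) * (mode i z * mode j z))
      = integral {0..T} (\<lambda>t. integral {0..pi} (\<lambda>x. \<rho> x * (mode i (t, x) * mode j (t, x))))"
    by (rule II_iterated(1)[THEN trans]) simp
  also have "\<dots> = integral {0..T} (\<lambda>t. (trig m t * trig n t) * ((if b = c then 1 else 0) / (sqrt (N m) * sqrt (N n))))"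
  proof (intro integral_cong)
    fix t
    have "integral {0..pi} (\<lambda>x. \<rho> x * (mode i (t, x) * mode j (t, x)))
      = integral {0..pi} (\<lambda>x. (trig m t * trig n t / (sqrt (N m) * sqrt (N n))) * (\<rho> x * (eb b x * eb c x)))"
      by (intro integral_cong) (simp add: mode_def ij)
    also have "\<dots> = (trig m t * trig n t / (sqrt (N m) * sqrt (N n))) * (if b = c then 1 else 0)"
      by (subst integral_mult_right) (simp only: eb_orthonormal[OF ij(3,4)])
    finally show "integral {0..pi} (\<lambda>x. \<rho> x * (mode i (t, x) * mode j (t, x)))
      = (trig m t * trig n t) * ((if b = c then 1 else 0) / (sqrt (N m) * sqrt (N n)))" by simp
  qed
  also have "\<dots> = (if m = n then N m else 0) * ((if b = c then 1 else 0) / (sqrt (N m) * sqrt (N n)))"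
    by (subst integral_mult_left) (simp only: trig_orthogonal)
  also have "\<dots> = (if i = j then 1 else 0)" using N_pos[of m] N_pos[of n] by (simp add: ij)
  finally show ?thesis .
qed

text \<open>Membership in the closed span of the modes for the weighted L2 norm. Continuity is
  included so that every integral involved exists.\<close>

definition spanned :: "(real \<times> real \<Rightarrow> real) \<Rightarrow> bool" where
  "spanned \<psi> \<longleftrightarrow> continuous_on (rect T) \<psi> \<and>
    (\<forall>\<epsilon>>0. \<exists>I c. finite I \<and> I \<subseteq> JJ \<and> II (\<lambda>z. \<rho> (snd z) * (\<psi> z - (\<Sum>j\<in>I. c j * mode j z))\<^sup>2) < \<epsilon>)"

lemma sum_mode_continuous: "I \<subseteq> JJ \<Longrightarrow> continuous_on (rect T) (\<lambda>z. \<Sum>j\<in>I. c j * mode j z)"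
  by (intro continuous_on_sum continuous_on_mult continuous_on_const mode_continuous) auto

lemma spanned_add:
  assumes f: "spanned f" and g: "spanned g"
  shows "spanned (\<lambda>z. f z + g z)"
  unfolding spanned_def
proof (intro conjI allI impI)
  note fc = f[unfolded spanned_def, THEN conjunct1] and gc = g[unfolded spanned_def, THEN conjunct1]
  show "continuous_on (rect T) (\<lambda>z. f z + g z)" by (intro continuous_on_add fc gc)
  fix \<epsilon> :: real assume "\<epsilon> > 0"
  then have e: "\<epsilon> / 4 > 0" by simp
  obtain I c where I: "finite I" "I \<subseteq> JJ" "II (\<lambda>z. \<rho> (snd z) * (f z - (\<Sum>j\<in>I. c j * mode j z))\<^sup>2) < \<epsilon> / 4"
    using f[unfolded spanned_def, THEN conjunct2, rule_format, OF e] by blast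
  obtain K d where K: "finite K" "K \<subseteq> JJ" "II (\<lambda>z. \<rho> (snd z) * (g z - (\<Sum>j\<in>K. d j * mode j z))\<^sup>2) < \<epsilon> / 4"
    using g[unfolded spanned_def, THEN conjunct2, rule_format, OF e] by blast
  define cd where "cd j = (if j \<in> I then c j else 0) + (if j \<in> K then d j else 0)" for j
  have sum: "(\<Sum>j\<in>I \<union> K. cd j * mode j z) = (\<Sum>j\<in>I. c j * mode j z) + (\<Sum>j\<in>K. d j * mode j z)" for z
    using finite_sum_extend[OF I(1) _ finite_UnI[OF I(1) K(1)], of c "\<lambda>j. mode j z"] finite_sum_extend[OF K(1) _ finite_UnI[OF I(1) K(1)], of d "\<lambda>j. mode j z"]
    by (simp add: cd_def distrib_right sum.distrib)
  have "II (\<lambda>z. \<rho> (snd z) * ((f z - (\<Sum>j\<in>I. c j * mode j z)) + (g z - (\<Sum>j\<in>K. d j * mode j z)))\<^sup>2) < \<epsilon>"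
    by (rule II_weighted_add[THEN le_less_trans]) (use I K in \<open>auto intro!: continuous_on_diff fc gc sum_mode_continuous\<close>)
  then have "II (\<lambda>z. \<rho> (snd z) * (f z + g z - (\<Sum>j\<in>I \<union> K. cd j * mode j z))\<^sup>2) < \<epsilon>"
    unfolding sum by (simp add: algebra_simps)
  then show "\<exists>I c. finite I \<and> I \<subseteq> JJ \<and> II (\<lambda>z. \<rho> (snd z) * (f z + g z - (\<Sum>j\<in>I. c j * mode j z))\<^sup>2) < \<epsilon>"
    using I K by (intro exI[of _ "I \<union> K"] exI[of _ cd]) auto
qed

lemma spanned_limit:
  assumes c: "continuous_on (rect T) \<psi>"
    and lim: "\<And>\<epsilon>. \<epsilon> > 0 \<Longrightarrow> \<exists>f. spanned f \<and> II (\<lambda>z. \<rho> (snd z) * (\<psi> z - f z)\<^sup>2) < \<epsilon>"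
  shows "spanned \<psi>"
  unfolding spanned_def
proof (intro conjI allI impI c)
  fix \<epsilon> :: real assume "\<epsilon> > 0"
  then have e: "\<epsilon> / 4 > 0" by simp
  obtain f where f: "spanned f" "II (\<lambda>z. \<rho> (snd z) * (\<psi> z - f z)\<^sup>2) < \<epsilon> / 4" using lim[OF e] by blast
  note fc = f(1)[unfolded spanned_def, THEN conjunct1]
  obtain I d where I: "finite I" "I \<subseteq> JJ" "II (\<lambda>z. \<rho> (snd z) * (f z - (\<Sum>j\<in>I. d j * mode j z))\<^sup>2) < \<epsilon> / 4"
    using f(1)[unfolded spanned_def, THEN conjunct2, rule_format, OF e] by blast
  have "II (\<lambda>z. \<rho> (snd z) * ((\<psi> z - f z) + (f z - (\<Sum>j\<in>I. d j * mode j z)))\<^sup>2) < \<epsilon>"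
    by (rule II_weighted_add[THEN le_less_trans]) (use I f(2) in \<open>auto intro!: continuous_on_diff fc c sum_mode_continuous\<close>)
  then show "\<exists>I c. finite I \<and> I \<subseteq> JJ \<and> II (\<lambda>z. \<rho> (snd z) * (\<psi> z - (\<Sum>j\<in>I. c j * mode j z))\<^sup>2) < \<epsilon>"
    using I by (intro exI[of _ I] exI[of _ d]) auto
qed

text \<open>The time factor is already a basis function and bounded by 1, so expanding the spatial
  factor is enough.\<close>

lemma spanned_product:
  assumes u: "beam_dom u u1 u2 w1 w2" "continuous_on {0..pi} w2"
  shows "spanned (\<lambda>z. trig m (fst z) * u (snd z))"
  unfolding spanned_def
proof (intro conjI allI impI)
  have uc: "continuous_on {0..pi} u" by (rule beam_dom_continuous(1)[OF u(1)])
  show "continuous_on (rect T) (\<lambda>z. trig m (fst z) * u (snd z))"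
    by (intro continuous_on_mult continuous_on_fst_snd[OF trig_continuous uc])
  fix \<epsilon> :: real assume "\<epsilon> > 0"
  then have e: "\<epsilon> / T > 0" using T by simp
  obtain F c where F: "finite F" "F \<subseteq> \<B>" "integral {0..pi} (\<lambda>x. \<rho> x * (u x - (\<Sum>b\<in>F. c b * eb b x))\<^sup>2) < \<epsilon> / T"
    using eb_complete[OF u e] by blast
  define I where "I = (\<lambda>b. (b, m)) ` F"
  \<comment> \<open>The root undoes the normalisation inside \<open>mode\<close>.\<close>
  define d where "d j = c (fst j) * sqrt (N m)" for j :: "'b \<times> int"
  define v where "v x = u x - (\<Sum>b\<in>F. c b * eb b x)" for x
  have I: "finite I" "I \<subseteq> JJ" using F by (auto simp: I_def)
  have vc: "continuous_on {0..pi} v" unfolding v_def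
    by (intro continuous_on_diff uc continuous_on_sum continuous_on_mult continuous_on_const eb_continuous) (use F in auto)
  have s: "(\<Sum>j\<in>I. d j * mode j z) = trig m (fst z) * (\<Sum>b\<in>F. c b * eb b (snd z))" for z
    using N_pos[of m] unfolding I_def by (subst sum.reindex) (auto simp: inj_on_def d_def mode_def sum_distrib_left intro!: sum.cong)
  have "II (\<lambda>z. \<rho> (snd z) * (trig m (fst z) * v (snd z))\<^sup>2) \<le> II (\<lambda>z. \<rho> (snd z) * (v (snd z))\<^sup>2)"
  proof (rule II_mono)
    show "continuous_on (rect T) (\<lambda>z. \<rho> (snd z) * (trig m (fst z) * v (snd z))\<^sup>2)"
      "continuous_on (rect T) (\<lambda>z. \<rho> (snd z) * (v (snd z))\<^sup>2)"
      by (intro weighted_continuous continuous_on_mult continuous_on_fst_snd[OF trig_continuous vc])+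
    fix z assume "z \<in> rect T"
    then have r: "\<rho> (snd z) \<ge> 0" using \<rho>_pos[of "snd z"] by auto
    have "(trig m (fst z))\<^sup>2 \<le> 1" using abs_trig_le[of m "fst z"] by (simp add: abs_square_le_1)
    then have "(trig m (fst z))\<^sup>2 * (v (snd z))\<^sup>2 \<le> 1 * (v (snd z))\<^sup>2" by (intro mult_right_mono) auto
    then show "\<rho> (snd z) * (trig m (fst z) * v (snd z))\<^sup>2 \<le> \<rho> (snd z) * (v (snd z))\<^sup>2"
      unfolding power_mult_distrib using r by (intro mult_left_mono) auto
  qed
  also have "\<dots> = integral {0..T} (\<lambda>t. integral {0..pi} (\<lambda>x. \<rho> x * (v x)\<^sup>2))"
    using II_iterated(1)[OF weighted_continuous[OF continuous_on_fst_snd(2)[OF continuous_on_const vc]]] by simp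
  also have "\<dots> = T * integral {0..pi} (\<lambda>x. \<rho> x * (v x)\<^sup>2)" using T by simp
  also have "\<dots> < \<epsilon>" using F(3) T by (simp add: v_def field_simps)
  finally have "II (\<lambda>z. \<rho> (snd z) * (trig m (fst z) * u (snd z) - (\<Sum>j\<in>I. d j * mode j z))\<^sup>2) < \<epsilon>"
    unfolding s v_def by (simp only: right_diff_distrib)
  then show "\<exists>I d. finite I \<and> I \<subseteq> JJ \<and> II (\<lambda>z. \<rho> (snd z) * (trig m (fst z) * u (snd z) - (\<Sum>j\<in>I. d j * mode j z))\<^sup>2) < \<epsilon>"
    using I by (intro exI[of _ I] exI[of _ d]) auto
qed

text \<open>The cube removes the value and the first two derivatives at both ends, so the boundary
  conditions hold whatever \<open>\<kappa>\<close> is.\<close>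

lemma spanned_trig_poly:
  assumes "trig_poly A"
  shows "spanned (\<lambda>z. (snd z * (pi - snd z)) ^ 3 * A z)"
  using assms
proof induction
  case (base m p)
  define D :: "real poly" where "D = [:0, pi, -1:]"
  define P where "P = D * (D * (D * p))"
  have D: "poly D x = x * (pi - x)" for x by (simp add: D_def algebra_simps)
  have bc: "poly P x = 0 \<and> \<kappa> x * poly (pderiv P) x + poly (pderiv (pderiv P)) x = 0" if "x \<in> {0, pi}" for x
  proof -
    have "poly D x = 0" using that by (auto simp: D)
    then show ?thesis by (simp add: P_def pderiv_mult pderiv_add)
  qed
  have "spanned (\<lambda>z. trig m (fst z) * poly P (snd z))"
    by (rule spanned_product[OF beam_dom_poly]) (use bc in \<open>auto intro!: continuous_intros \<eta>_cont \<eta>1_cont \<eta>2_cont\<close>)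
  moreover have "(\<lambda>z. trig m (fst z) * poly P (snd z)) = (\<lambda>z. (snd z * (pi - snd z)) ^ 3 * (trig m (fst z) * poly p (snd z)))"
    by (simp add: fun_eq_iff P_def D power3_eq_cube mult_ac)
  ultimately show ?case by simp
next
  case (add f g)
  then show ?case using spanned_add[OF add.IH] by (simp add: distrib_left)
qed

text \<open>Two approximations are nested: cutting off gives \<open>D k\<close> with
  \<open>k\<close> continuous and periodic in time, and \<open>k\<close> is uniformly close to a
  trigonometric polynomial. The factor \<open>D\<close> supplies the boundary conditions that
  neither \<open>\<psi>\<close> nor this polynomial needs to satisfy.\<close>

theorem spanned_continuous:
  assumes \<psi>: "continuous_on (rect T) \<psi>" and per: "\<And>x. x \<in> {0..pi} \<Longrightarrow> \<psi> (0, x) = \<psi> (T, x)"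
  shows "spanned \<psi>"
proof (rule spanned_limit[OF \<psi>])
  fix \<epsilon> :: real assume \<epsilon>: "\<epsilon> > 0"
  define D where "D z = (snd z * (pi - snd z)) ^ 3" for z :: "real \<times> real"
  have D0: "D z \<ge> 0" if "z \<in> rect T" for z using that by (auto simp: D_def)
  have Dc: "continuous_on S D" for S unfolding D_def by (intro continuous_intros)
  obtain n where n: "n > 0" "II (\<lambda>z. \<rho> (snd z) * (\<psi> z - D z * (\<psi> z / (D z + 1 / real n)))\<^sup>2) < \<epsilon>"
    using cutoff_converges[OF \<psi> \<epsilon>] unfolding D_def by blast
  define k where "k z = \<psi> z / (D z + 1 / real n)" for z
  have nz: "D z + 1 / real n \<noteq> 0" if "z \<in> rect T" for z using D0[OF that] n(1) by (metis add_nonneg_pos less_irrefl of_nat_0_less_iff zero_less_divide_1_iff)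
  have kc: "continuous_on (rect T) k" unfolding k_def
    by (intro continuous_on_divide \<psi> continuous_on_add Dc continuous_on_const) (use nz in auto)
  have "spanned (\<lambda>z. D z * k z)"
  proof (rule spanned_limit)
    show "continuous_on (rect T) (\<lambda>z. D z * k z)" by (intro continuous_on_mult Dc kc)
    fix \<epsilon> :: real assume \<epsilon>: "\<epsilon> > 0"
    define B where "B = II (\<lambda>z. \<rho> (snd z) * (D z)\<^sup>2)"
    have B: "B \<ge> 0" unfolding B_def
    proof (rule integral_nonneg)
      show "(\<lambda>z. \<rho> (snd z) * (D z)\<^sup>2) integrable_on cbox (0, 0) (T, pi)"
        by (intro integrable_continuous) (use weighted_continuous[OF Dc] in \<open>simp add: cbox_rect\<close>)
      show "0 \<le> \<rho> (snd z) * (D z)\<^sup>2" if "z \<in> cbox (0, 0) (T, pi)" for z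
        using that \<rho>_pos[of "snd z"] unfolding cbox_rect by auto
    qed
    \<comment> \<open>The uniform error enters squared and multiplied by \<open>B\<close>; the 1
      makes the final inequality strict and avoids division by zero.\<close>
    define \<delta> where "\<delta> = sqrt (\<epsilon> / (B + 1))"
    have \<delta>: "\<delta> > 0" "\<delta>\<^sup>2 = \<epsilon> / (B + 1)" using \<epsilon> B by (simp_all add: \<delta>_def)
    have "k (0, x) = k (T, x)" if "x \<in> {0..pi}" for x using per[OF that] by (simp add: k_def D_def)
    then obtain A where A: "trig_poly A" "\<And>z. z \<in> rect T \<Longrightarrow> \<bar>k z - A z\<bar> < \<delta>"
      using trig_poly_dense[OF kc _ \<delta>(1)] by blast
    have sA: "spanned (\<lambda>z. D z * A z)" using spanned_trig_poly[OF A(1)] by (simp add: D_def)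
    have "II (\<lambda>z. \<rho> (snd z) * (D z * k z - D z * A z)\<^sup>2) \<le> II (\<lambda>z. \<rho> (snd z) * (D z)\<^sup>2 * \<delta>\<^sup>2)"
    proof (rule II_mono)
      show "continuous_on (rect T) (\<lambda>z. \<rho> (snd z) * (D z * k z - D z * A z)\<^sup>2)"
        by (rule weighted_continuous[OF continuous_on_diff[OF continuous_on_mult[OF Dc kc] sA[unfolded spanned_def, THEN conjunct1]]])
      show "continuous_on (rect T) (\<lambda>z. \<rho> (snd z) * (D z)\<^sup>2 * \<delta>\<^sup>2)"
        by (intro continuous_on_mult[OF weighted_continuous[OF Dc] continuous_on_const])
      fix z assume z: "z \<in> rect T"
      then have r: "\<rho> (snd z) * (D z)\<^sup>2 \<ge> 0" using \<rho>_pos[of "snd z"] by auto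
      have "(k z - A z)\<^sup>2 \<le> \<delta>\<^sup>2" using A(2)[OF z] \<delta>(1) by (intro abs_le_square_iff[THEN iffD1]) auto
      from mult_left_mono[OF this r] show "\<rho> (snd z) * (D z * k z - D z * A z)\<^sup>2 \<le> \<rho> (snd z) * (D z)\<^sup>2 * \<delta>\<^sup>2"
        unfolding right_diff_distrib[symmetric] power_mult_distrib by (simp add: mult_ac)
    qed
    also have "\<dots> = B * \<delta>\<^sup>2" by (simp add: B_def)
    also have "\<dots> < \<epsilon>" using B \<epsilon> by (simp add: \<delta>(2) field_simps)
    finally show "\<exists>f. spanned f \<and> II (\<lambda>z. \<rho> (snd z) * (D z * k z - f z)\<^sup>2) < \<epsilon>" using sA by (intro exI conjI)
  qed
  then show "\<exists>f. spanned f \<and> II (\<lambda>z. \<rho> (snd z) * (\<psi> z - f z)\<^sup>2) < \<epsilon>"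
    using n(2) unfolding k_def by (intro exI conjI)
qed

end

section \<open>Weak solutions\<close>

context beam_rect
begin

text \<open>Its L2 inner product is the weighted one of the problem, so the abstract argument need
  not mention the density.\<close>

definition weighted :: "(real \<times> real) measure" where
  "weighted = density (lebesgue_on (Omega T)) (\<lambda>z. ennreal (\<rho> (snd z)))"

lemma weight_measurable: "(\<lambda>z. \<rho> (snd z)) \<in> borel_measurable (lebesgue_on (Omega T))"
  by (rule borel_measurable_integrable[OF LINT_Omega(1)[OF continuous_on_fst_snd(2)[OF continuous_on_const \<rho>_cont]]])

lemma weight_nonneg: "AE z in lebesgue_on (Omega T). 0 \<le> \<rho> (snd z)"
  by (rule AE_I2) (auto simp: Omega_def intro!: less_imp_le[OF \<rho>_pos])

lemma space_weighted: "space weighted = Omega T"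
  by (simp add: weighted_def)

lemma borel_measurable_weighted: "f \<in> borel_measurable weighted \<longleftrightarrow> f \<in> borel_measurable (lebesgue_on (Omega T))"
  by (simp add: weighted_def)

lemma integral_weighted:
  fixes f :: "real \<times> real \<Rightarrow> real"
  assumes f: "f \<in> borel_measurable (lebesgue_on (Omega T))"
  shows "(LINT z|weighted. f z) = (LINT z|lebesgue_on (Omega T). \<rho> (snd z) * f z)"
    "integrable weighted f \<longleftrightarrow> integrable (lebesgue_on (Omega T)) (\<lambda>z. \<rho> (snd z) * f z)"
  using integral_density[OF f weight_measurable weight_nonneg] integrable_density[OF f weight_measurable weight_nonneg]
  by (simp_all add: weighted_def)

lemma integral_weighted_continuous:
  assumes f: "continuous_on (rect T) f"
  shows "(LINT z|weighted. f z) = II (\<lambda>z. \<rho> (snd z) * f z)"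
  unfolding integral_weighted(1)[OF borel_measurable_integrable[OF LINT_Omega(1)[OF f]]]
  by (intro LINT_Omega(2) continuous_on_mult f continuous_on_fst_snd(2)[OF continuous_on_const \<rho>_cont])

lemma finite_measure_weighted: "finite_measure weighted"
proof
  have "integrable weighted (\<lambda>z. 1 :: real)"
    unfolding integral_weighted(2)[OF borel_measurable_const]
    using LINT_Omega(1)[OF continuous_on_fst_snd(2)[OF continuous_on_const \<rho>_cont]] by simp
  then show "emeasure weighted (space weighted) \<noteq> \<infinity>" by (simp add: integrable_iff_bounded)
qed

lemma continuous_bounded_rect:
  fixes k :: "real \<times> real \<Rightarrow> 'a::euclidean_space"
  assumes k: "continuous_on (rect T) k"
  shows "\<exists>B. \<forall>z\<in>rect T. norm (k z) \<le> B"
proof -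
  have "compact (rect T)" by (intro compact_Times) auto
  then show ?thesis using compact_imp_bounded[OF compact_continuous_image[OF k]] by (auto simp: bounded_iff)
qed

lemma integrable_scaleR_continuous:
  fixes k :: "real \<times> real \<Rightarrow> 'a::euclidean_space"
  assumes v: "integrable (lebesgue_on (Omega T)) v" and k: "continuous_on (rect T) k"
  shows "integrable (lebesgue_on (Omega T)) (\<lambda>z. v z *\<^sub>R k z)"
proof -
  obtain B where B: "\<And>z. z \<in> rect T \<Longrightarrow> norm (k z) \<le> B" using continuous_bounded_rect[OF k] by blast
  show ?thesis
  proof (rule Bochner_Integration.integrable_bound[OF Bochner_Integration.integrable_mult_right[OF integrable_norm[OF v], of B]])
    show "(\<lambda>z. v z *\<^sub>R k z) \<in> borel_measurable (lebesgue_on (Omega T))"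
      using borel_measurable_integrable[OF LINT_Omega(1)[OF k]] borel_measurable_integrable[OF v] by measurable
    show "AE z in lebesgue_on (Omega T). norm (v z *\<^sub>R k z) \<le> norm (B * norm (v z))"
    proof (rule AE_I2)
      fix z assume "z \<in> space (lebesgue_on (Omega T))"
      then have "z \<in> rect T" by (auto simp: Omega_def)
      then have "\<bar>v z\<bar> * norm (k z) \<le> \<bar>v z\<bar> * B" using B by (intro mult_left_mono) auto
      then show "norm (v z *\<^sub>R k z) \<le> norm (B * norm (v z))" by (simp add: mult.commute)
    qed
  qed
qed

lemma integrable_bounded_Omega:
  fixes f :: "real \<times> real \<Rightarrow> real"
  assumes "f \<in> borel_measurable (lebesgue_on (Omega T))" "\<And>z. z \<in> Omega T \<Longrightarrow> \<bar>f z\<bar> \<le> B"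
  shows "integrable (lebesgue_on (Omega T)) f"
proof (rule Bochner_Integration.integrable_bound)
  show "integrable (lebesgue_on (Omega T)) (\<lambda>z. B)" by (intro LINT_Omega(1) continuous_on_const)
  show "AE z in lebesgue_on (Omega T). norm (f z) \<le> norm B" by (rule AE_I2) (use assms(2) in force)
qed (rule assms(1))

end

context beam_modes
begin

text \<open>The constructed system and the list \<open>\<mu>\<close> are matched by value only: each
  \<open>\<nu> b\<close> equals some \<open>\<mu> n\<close>, so a small \<open>freq\<close> comes
  from one of finitely many small divisors, and \<open>eb_finite\<close> limits the number of
  \<open>b\<close> belonging to each.\<close>

lemma finite_freq:
  fixes p q :: nat
  assumes p: "p > 0" and q: "q > 0" and Tpq: "T = 2 * pi * real p / real q"
    and mu: "beam_eigenvalues \<alpha> \<beta> \<rho> \<eta> \<mu>" and a: "a \<notin> \<rat>" and b: "bounded (range c)"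
    and asy: "(\<lambda>n. \<mu> n - (real n ^ 4 + 2 * real n ^ 2 * a + c n)) \<in> o(\<lambda>n. 1 / real n)"
  shows "finite {j \<in> JJ. \<bar>freq j\<bar> \<le> R}"
proof -
  have \<omega>: "\<omega> = real q / real p" 
  proof -
    have "2 * pi / T = real q / real p" using p q by (simp add: Tpq)
    then show ?thesis by (simp only: \<omega>_def)
  qed
  define S where "S = {(n, m::int). 1 \<le> n \<and> \<bar>\<mu> n - (real q / real p)\<^sup>2 * (real_of_int m)\<^sup>2\<bar> \<le> R}"
  have S: "finite S" unfolding S_def by (rule finite_small_divisors[OF p q a b asy])
  have "{j \<in> JJ. \<bar>freq j\<bar> \<le> R} \<subseteq> (\<Union>s\<in>S. {b \<in> \<B>. \<bar>\<nu> b\<bar> \<le> \<bar>\<mu> (fst s)\<bar>} \<times> {snd s})"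
  proof
    fix j assume j: "j \<in> {j \<in> JJ. \<bar>freq j\<bar> \<le> R}"
    obtain b m where bm: "j = (b, m)" "b \<in> \<B>" using j by auto
    have "\<exists>x\<in>{0..pi}. eb b x \<noteq> 0"
    proof (rule ccontr)
      assume "\<not> (\<exists>x\<in>{0..pi}. eb b x \<noteq> 0)"
      then have "integral {0..pi} (\<lambda>x. \<rho> x * (eb b x * eb b x)) = integral {0..pi} (\<lambda>x. 0)"
        by (intro integral_cong) auto
      then show False using eb_orthonormal[OF bm(2) bm(2)] by simp
    qed
    then obtain x where "x \<in> {0..pi}" "eb b x \<noteq> 0" by blast
    then have "\<nu> b \<in> \<mu> ` {1..}" using eigen_imp_listed[OF mu eb_eigen[OF bm(2)]] by blast
    then obtain n where n: "n \<ge> 1" "\<nu> b = \<mu> n" by auto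
    have "freq j = \<mu> n - (real q / real p)\<^sup>2 * (real_of_int m)\<^sup>2" by (simp only: freq_def bm fst_conv snd_conv n \<omega> power_mult_distrib)
    then have "(n, m) \<in> S" using j n(1) by (simp add: S_def)
    then show "j \<in> (\<Union>s\<in>S. {b \<in> \<B>. \<bar>\<nu> b\<bar> \<le> \<bar>\<mu> (fst s)\<bar>} \<times> {snd s})"
      by (rule UN_I) (simp add: bm n)
  qed
  then show ?thesis by (rule finite_subset) (intro finite_UN_I S finite_cartesian_product eb_finite finite.intros)
qed

lemma kernel_orthogonal_mode:
  assumes j: "j \<in> JJ" and z: "freq j = 0" and wh: "(w, h) \<in> beam_graph T \<alpha> \<beta> \<rho> \<eta>"
  shows "(LINT z|lebesgue_on (Omega T). \<rho> (snd z) *\<^sub>R (h z * complex_of_real (mode j z))) = 0"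
proof -
  obtain b m where bm: "j = (b, m)" "b \<in> \<B>" using j by auto
  have "\<rho> (snd z) *\<^sub>R (h z * complex_of_real (mode j z))
    = (\<rho> (snd z) *\<^sub>R (h z * complex_of_real (trig m (fst z) * eb b (snd z)))) * complex_of_real (1 / sqrt (N m))" for z
    by (simp add: mode_def bm scaleR_conv_of_real)
  then have "(LINT z|lebesgue_on (Omega T). \<rho> (snd z) *\<^sub>R (h z * complex_of_real (mode j z)))
    = (LINT z|lebesgue_on (Omega T). \<rho> (snd z) *\<^sub>R (h z * complex_of_real (trig m (fst z) * eb b (snd z)))) * complex_of_real (1 / sqrt (N m))"
    by (simp only: Bochner_Integration.integral_mult_left_zero)
  also have "\<dots> = 0" using kernel_orthogonal[OF eb_eigen[OF bm(2)] _ wh, of m] z by (simp add: freq_def bm)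
  finally show ?thesis .
qed

text \<open>\<open>l\<close> will be the real or the imaginary part: test functions are complex,
  whereas the modes and the abstract problem are real.\<close>

lemma beam_expr_mode:
  fixes l :: "complex \<Rightarrow> real"
  assumes \<psi>: "\<psi> \<in> test_functions T \<alpha> \<beta>" and l: "bounded_linear l" and j: "j \<in> JJ"
  shows "II (\<lambda>z. mode j z * l (beam_expr T \<rho> \<eta> \<psi> z)) = freq j * II (\<lambda>z. \<rho> (snd z) * (mode j z * l (\<psi> z)))"
proof -
  interpret l: bounded_linear l by (rule l)
  note c = test_function_continuous[OF \<psi>]
  obtain b m where bm: "j = (b, m)" "b \<in> \<B>" using j by auto
  note tc = continuous_on_mult[OF continuous_on_fst_snd(1)[OF trig_continuous continuous_on_const] continuous_on_fst_snd(2)[OF continuous_on_const eb_continuous[OF bm(2)]]]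
  note rc = continuous_on_fst_snd(2)[OF continuous_on_const \<rho>_cont]
  have lin: "l (II f) = II (\<lambda>z. l (f z))" if "continuous_on (rect T) f" for f
  proof -
    have "f integrable_on cbox (0, 0) (T, pi)" using that by (intro integrable_continuous) (simp add: cbox_rect)
    from integral_linear[OF this l] show ?thesis by (simp add: o_def)
  qed
  have "II (\<lambda>z. (trig m (fst z) * eb b (snd z)) *\<^sub>R beam_expr T \<rho> \<eta> \<psi> z)
    = (\<nu> b - (\<omega> * real_of_int m)\<^sup>2) *\<^sub>R II (\<lambda>z. (\<rho> (snd z) * (trig m (fst z) * eb b (snd z))) *\<^sub>R \<psi> z)"
    by (rule beam_expr_eigen[OF \<psi> eb_eigen[OF bm(2)] trig_deriv trig1_deriv trig_periodic])
  then have "l (II (\<lambda>z. (trig m (fst z) * eb b (snd z)) *\<^sub>R beam_expr T \<rho> \<eta> \<psi> z))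
    = freq j * l (II (\<lambda>z. (\<rho> (snd z) * (trig m (fst z) * eb b (snd z))) *\<^sub>R \<psi> z))"
    by (simp add: freq_def bm l.scaleR)
  moreover have "l (II (\<lambda>z. (trig m (fst z) * eb b (snd z)) *\<^sub>R beam_expr T \<rho> \<eta> \<psi> z))
    = II (\<lambda>z. (trig m (fst z) * eb b (snd z)) * l (beam_expr T \<rho> \<eta> \<psi> z))"
    by (subst lin) (auto simp: l.scaleR intro!: continuous_on_scaleR tc c)
  moreover have "l (II (\<lambda>z. (\<rho> (snd z) * (trig m (fst z) * eb b (snd z))) *\<^sub>R \<psi> z))
    = II (\<lambda>z. (\<rho> (snd z) * (trig m (fst z) * eb b (snd z))) * l (\<psi> z))"
    by (subst lin) (auto simp: l.scaleR intro!: continuous_on_scaleR continuous_on_mult[OF rc] tc c)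
  moreover have "II (\<lambda>z. mode j z * l (beam_expr T \<rho> \<eta> \<psi> z)) = II (\<lambda>z. (trig m (fst z) * eb b (snd z)) * l (beam_expr T \<rho> \<eta> \<psi> z) / sqrt (N m))"
    by (intro integral_cong) (simp add: mode_def bm)
  moreover have "II (\<lambda>z. \<rho> (snd z) * (mode j z * l (\<psi> z))) = II (\<lambda>z. (\<rho> (snd z) * (trig m (fst z) * eb b (snd z))) * l (\<psi> z) / sqrt (N m))"
    by (intro integral_cong) (simp add: mode_def bm)
  ultimately show ?thesis by simp
qed

text \<open>The sign \<open>s\<close> reduces a nonincreasing \<open>g\<close> to a nondecreasing one: all terms of the equation change sign.\<close>

theorem weak_solution_exists:
  fixes g :: "real \<Rightarrow> real" and F f2 :: "real \<times> real \<Rightarrow> real"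
  assumes fin: "\<And>R. finite {j \<in> JJ. \<bar>freq j\<bar> \<le> R}"
    and s: "s = 1 \<or> s = -1" and mono: "mono (\<lambda>u. s * g u)" and g: "continuous_on UNIV g" "\<And>u. \<bar>g u\<bar> < K"
    and lim: "((\<lambda>u. s * g u) \<longlongrightarrow> gm) at_bot" "((\<lambda>u. s * g u) \<longlongrightarrow> gp) at_top"
    and F: "F \<in> borel_measurable (lebesgue_on (Omega T))" "\<And>z. z \<in> Omega T \<Longrightarrow> \<bar>F z\<bar> \<le> B"
    and f2: "f2 \<in> borel_measurable (lebesgue_on (Omega T))" "\<And>z. z \<in> Omega T \<Longrightarrow> gm + \<epsilon> \<le> s * f2 z \<and> s * f2 z \<le> gp - \<epsilon>"
    and \<epsilon>: "\<epsilon> > 0"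
    and ker: "\<And>j. j \<in> JJ \<Longrightarrow> freq j = 0 \<Longrightarrow> (LINT z|lebesgue_on (Omega T). \<rho> (snd z) * ((F z - f2 z) * mode j z)) = 0"
  obtains u where "u \<in> L2 T \<rho>" "\<And>\<psi>. \<psi> \<in> test_functions T \<alpha> \<beta> \<Longrightarrow>
    (LINT z|lebesgue_on (Omega T). u z *\<^sub>R beam_expr T \<rho> \<eta> \<psi> z)
          + (LINT z|lebesgue_on (Omega T). (g (u z) * \<rho> (snd z)) *\<^sub>R \<psi> z)
          = (LINT z|lebesgue_on (Omega T). (F z * \<rho> (snd z)) *\<^sub>R \<psi> z)"
proof -
  let ?M = "lebesgue_on (Omega T)"
  interpret finite_measure weighted by (rule finite_measure_weighted)
  have ss: "s * s = 1" "\<bar>s\<bar> = 1" using s by auto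
  have sub: "z \<in> rect T" if "z \<in> Omega T" for z using that by (auto simp: Omega_def)
  note meas = borel_measurable_integrable[OF LINT_Omega(1)]
  interpret LL: landesman_lazer weighted JJ mode "\<lambda>j. s * freq j" "\<lambda>u. s * g u" "\<lambda>z. s * F z" "\<lambda>z. s * f2 z" K gm gp \<epsilon>
  proof
    fix i j assume j: "j \<in> JJ"
    show "mode j \<in> borel_measurable weighted" unfolding borel_measurable_weighted by (rule meas[OF mode_continuous[OF j]])
    show "\<exists>B. \<forall>x\<in>space weighted. \<bar>mode j x\<bar> \<le> B"
      using continuous_bounded_rect[OF mode_continuous[OF j]] sub unfolding space_weighted by force
    show "(LINT x|weighted. mode i x * mode j x) = (if i = j then 1 else 0)" if i: "i \<in> JJ"
      using integral_weighted_continuous[OF continuous_on_mult[OF mode_continuous[OF i] mode_continuous[OF j]]] mode_orthonormal[OF i j] by (rule trans)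
    show "(LINT x|weighted. (s * F x - s * f2 x) * mode j x) = 0" if "s * freq j = 0"
    proof -
      have "freq j = 0" using that s by auto
      note k = ker[OF j this]
      have "(LINT x|weighted. (s * F x - s * f2 x) * mode j x) = (LINT x|?M. \<rho> (snd x) * ((s * F x - s * f2 x) * mode j x))"
        by (rule integral_weighted(1)) (use F(1) f2(1) meas[OF mode_continuous[OF j]] in measurable)
      also have "\<dots> = (LINT x|?M. s * (\<rho> (snd x) * ((F x - f2 x) * mode j x)))"
        by (intro Bochner_Integration.integral_cong) (simp_all add: algebra_simps)
      finally show ?thesis using k by simp
    qed
  next
    show "finite {j \<in> JJ. \<bar>s * freq j\<bar> \<le> R}" for R using fin[of R] ss by (simp add: abs_mult)
    show "continuous_on UNIV (\<lambda>u. s * g u)" by (intro continuous_intros g)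
    show "\<bar>s * g u\<bar> < K" for u using g(2) ss by (simp add: abs_mult)
    show "(\<lambda>z. s * F z) \<in> borel_measurable weighted" "(\<lambda>z. s * f2 z) \<in> borel_measurable weighted"
      unfolding borel_measurable_weighted using F(1) f2(1) by measurable
    show "\<exists>B. \<forall>x\<in>space weighted. \<bar>s * F x\<bar> \<le> B"
      using F(2) ss unfolding space_weighted by (intro exI[of _ B]) (simp add: abs_mult)
  qed (use mono lim \<epsilon> f2(2) in \<open>auto simp: space_weighted\<close>)
  obtain u where u: "u \<in> borel_measurable weighted" "integrable weighted (\<lambda>x. (u x)\<^sup>2)"
    and sol: "\<And>\<psi> \<phi>. LL.test_pair \<psi> \<phi> \<Longrightarrow> LL.ip u \<phi> + LL.ip (\<lambda>x. s * g (u x)) \<psi> = LL.ip (\<lambda>z. s * F z) \<psi>"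
    using LL.solution_exists by blast
  have um: "u \<in> borel_measurable ?M" using u(1) by (simp only: borel_measurable_weighted)
  have "integrable ?M (\<lambda>z. \<rho> (snd z) * (u z)\<^sup>2)"
    using u(2) by (subst (asm) integral_weighted(2)) (use um in measurable)
  then have uL: "u \<in> L2 T \<rho>" unfolding L2_def using um by (simp add: mult.commute)
  have ui: "integrable ?M u" by (rule L2_integrable[OF uL])
  have gm: "g \<in> borel_measurable borel" by (rule borel_measurable_continuous_onI[OF g(1)])
  have gum: "(\<lambda>z. g (u z)) \<in> borel_measurable ?M" using gm um by measurable
  have gui: "integrable ?M (\<lambda>z. g (u z))" by (rule integrable_bounded_Omega[OF gum, of K]) (use g(2) in \<open>auto intro: less_imp_le\<close>)
  have Fi: "integrable ?M F" by (rule integrable_bounded_Omega[OF F])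
  note rc = continuous_on_fst_snd(2)[OF continuous_on_const \<rho>_cont]
  have weak: "(LINT z|?M. u z * l (beam_expr T \<rho> \<eta> \<psi> z)) + (LINT z|?M. g (u z) * (\<rho> (snd z) * l (\<psi> z))) = (LINT z|?M. F z * (\<rho> (snd z) * l (\<psi> z)))"
    if \<psi>: "\<psi> \<in> test_functions T \<alpha> \<beta>" and l: "bounded_linear l" for \<psi> and l :: "complex \<Rightarrow> real"
  proof -
    note c = test_function_continuous[OF \<psi>]
    have l\<psi>: "continuous_on (rect T) (\<lambda>z. l (\<psi> z))" and lb: "continuous_on (rect T) (\<lambda>z. l (beam_expr T \<rho> \<eta> \<psi> z))"
      using bounded_linear.continuous_on[OF l] c by blast+
    \<comment> \<open>The image of the real or imaginary part under L, times the sign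
      \<open>s\<close>. Dividing by \<open>\<rho>\<close> compensates for the density of the
      measure.\<close>
    define \<phi> where "\<phi> z = s * (l (beam_expr T \<rho> \<eta> \<psi> z) / \<rho> (snd z))" for z
    have \<phi>c: "continuous_on (rect T) \<phi>" unfolding \<phi>_def
      by (intro continuous_on_mult continuous_on_const continuous_on_divide lb rc) (use \<rho>_nz in auto)
    have Bd: "LL.Bd f" if f: "continuous_on (rect T) f" for f
    proof -
      obtain B where B: "\<And>z. z \<in> rect T \<Longrightarrow> norm (f z) \<le> B" using continuous_bounded_rect[OF f] by blast
      show ?thesis
        by (rule LL.BdI[where B = B]) (use meas[OF f] B sub in \<open>auto simp: borel_measurable_weighted space_weighted simp flip: real_norm_def\<close>)
    qed
    have \<rho>\<phi>: "\<rho> (snd z) * \<phi> z = s * l (beam_expr T \<rho> \<eta> \<psi> z)" if "z \<in> rect T" for z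
      using that \<rho>_nz[of "snd z"] by (auto simp: \<phi>_def)
    have "LL.test_pair (\<lambda>z. l (\<psi> z)) \<phi>"
      unfolding LL.test_pair_def
    proof (intro conjI ballI allI impI Bd l\<psi> \<phi>c)
      fix j assume j: "j \<in> JJ"
      have "LL.ip \<phi> (mode j) = II (\<lambda>z. \<rho> (snd z) * (\<phi> z * mode j z))"
        unfolding LL.ip_def by (intro integral_weighted_continuous continuous_on_mult \<phi>c mode_continuous j)
      also have "\<dots> = II (\<lambda>z. s * (mode j z * l (beam_expr T \<rho> \<eta> \<psi> z)))"
      proof (rule integral_cong)
        fix z assume "z \<in> cbox (0, 0) (T, pi)"
        then have "\<rho> (snd z) * \<phi> z = s * l (beam_expr T \<rho> \<eta> \<psi> z)" by (intro \<rho>\<phi>) (simp only: cbox_rect)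
        then show "\<rho> (snd z) * (\<phi> z * mode j z) = s * (mode j z * l (beam_expr T \<rho> \<eta> \<psi> z))"
          by (metis mult.assoc mult.commute)
      qed
      also have "\<dots> = s * (freq j * II (\<lambda>z. \<rho> (snd z) * (mode j z * l (\<psi> z))))"
        by (simp add: beam_expr_mode[OF \<psi> l j])
      also have "II (\<lambda>z. \<rho> (snd z) * (mode j z * l (\<psi> z))) = LL.ip (\<lambda>z. l (\<psi> z)) (mode j)"
        unfolding LL.ip_def by (subst integral_weighted_continuous) (auto intro!: continuous_on_mult l\<psi> mode_continuous j simp: mult.commute)
      finally show "LL.ip \<phi> (mode j) = s * freq j * LL.ip (\<lambda>z. l (\<psi> z)) (mode j)" by simp
    next
      fix \<delta> :: real assume \<delta>: "\<delta> > 0"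
      have "spanned (\<lambda>z. l (\<psi> z))"
        using \<psi> by (intro spanned_continuous l\<psi>) (simp add: test_functions_def)
      then obtain I c where I: "finite I" "I \<subseteq> JJ" "II (\<lambda>z. \<rho> (snd z) * (l (\<psi> z) - (\<Sum>j\<in>I. c j * mode j z))\<^sup>2) < \<delta>"
        unfolding spanned_def using \<delta> by blast
      have "(LINT z|weighted. (l (\<psi> z) - LL.comb I c z)\<^sup>2) = II (\<lambda>z. \<rho> (snd z) * (l (\<psi> z) - (\<Sum>j\<in>I. c j * mode j z))\<^sup>2)"
        unfolding LL.comb_def
        by (intro integral_weighted_continuous continuous_on_power continuous_on_diff l\<psi> sum_mode_continuous I)
      then show "\<exists>I c. finite I \<and> I \<subseteq> JJ \<and> (LINT z|weighted. (l (\<psi> z) - LL.comb I c z)\<^sup>2) < \<delta>"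
        using I by (intro exI[of _ I] exI[of _ c]) simp
    qed
    note e = sol[OF this]
    have c1: "LL.ip u \<phi> = s * (LINT z|?M. u z * l (beam_expr T \<rho> \<eta> \<psi> z))"
    proof -
      have "LL.ip u \<phi> = (LINT z|?M. \<rho> (snd z) * (u z * \<phi> z))"
        unfolding LL.ip_def by (rule integral_weighted(1)) (use um meas[OF \<phi>c] in measurable)
      also have "\<dots> = (LINT z|?M. s * (u z * l (beam_expr T \<rho> \<eta> \<psi> z)))"
      proof (rule Bochner_Integration.integral_cong[OF refl])
        fix z assume "z \<in> space ?M"
        then have "z \<in> rect T" using sub by simp
        from \<rho>\<phi>[OF this] show "\<rho> (snd z) * (u z * \<phi> z) = s * (u z * l (beam_expr T \<rho> \<eta> \<psi> z))" by (metis mult.left_commute)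
      qed
      finally show ?thesis by simp
    qed
    have c2: "LL.ip (\<lambda>z. s * k z) (\<lambda>z. l (\<psi> z)) = s * (LINT z|?M. k z * (\<rho> (snd z) * l (\<psi> z)))"
      if k: "k \<in> borel_measurable ?M" for k
    proof -
      have "LL.ip (\<lambda>z. s * k z) (\<lambda>z. l (\<psi> z)) = (LINT z|?M. \<rho> (snd z) * (s * k z * l (\<psi> z)))"
        unfolding LL.ip_def by (rule integral_weighted(1)) (use k meas[OF l\<psi>] in measurable)
      also have "\<dots> = (LINT z|?M. s * (k z * (\<rho> (snd z) * l (\<psi> z))))" by (simp only: mult_ac)
      finally show ?thesis by simp
    qed
    have "s * (LINT z|?M. u z * l (beam_expr T \<rho> \<eta> \<psi> z)) + s * (LINT z|?M. g (u z) * (\<rho> (snd z) * l (\<psi> z))) = s * (LINT z|?M. F z * (\<rho> (snd z) * l (\<psi> z)))"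
      using e unfolding c1 c2[OF gum] c2[OF F(1)] .
    then show ?thesis using s by auto
  qed
  show ?thesis
  proof (rule that[OF uL])
    fix \<psi> assume \<psi>: "\<psi> \<in> test_functions T \<alpha> \<beta>"
    note c = test_function_continuous[OF \<psi>]
    have rp: "continuous_on (rect T) (\<lambda>z. \<rho> (snd z) *\<^sub>R \<psi> z)" by (intro continuous_on_scaleR rc c)
    have i1: "integrable ?M (\<lambda>z. u z *\<^sub>R beam_expr T \<rho> \<eta> \<psi> z)" by (rule integrable_scaleR_continuous[OF ui c(4)])
    have i2: "integrable ?M (\<lambda>z. (g (u z) * \<rho> (snd z)) *\<^sub>R \<psi> z)" using integrable_scaleR_continuous[OF gui rp] by simp
    have i3: "integrable ?M (\<lambda>z. (F z * \<rho> (snd z)) *\<^sub>R \<psi> z)" using integrable_scaleR_continuous[OF Fi rp] by simp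
    \<comment> \<open>The real identities for the two parts are recombined into the complex
      one.\<close>
    have "l (LINT z|?M. u z *\<^sub>R beam_expr T \<rho> \<eta> \<psi> z) + l (LINT z|?M. (g (u z) * \<rho> (snd z)) *\<^sub>R \<psi> z)
      = l (LINT z|?M. (F z * \<rho> (snd z)) *\<^sub>R \<psi> z)" if l: "bounded_linear l" for l :: "complex \<Rightarrow> real"
    proof -
      interpret l: bounded_linear l by (rule l)
      show ?thesis
        using weak[OF \<psi> l] unfolding integral_bounded_linear[OF l i1, symmetric] integral_bounded_linear[OF l i2, symmetric] integral_bounded_linear[OF l i3, symmetric]
        by (simp only: l.scaleR real_scaleR_def mult.assoc)
    qed
    from this[OF bounded_linear_Re] this[OF bounded_linear_Im]
    show "(LINT z|?M. u z *\<^sub>R beam_expr T \<rho> \<eta> \<psi> z) + (LINT z|?M. (g (u z) * \<rho> (snd z)) *\<^sub>R \<psi> z)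
      = (LINT z|?M. (F z * \<rho> (snd z)) *\<^sub>R \<psi> z)" by (intro complex_eqI) simp_all
  qed
qed

end

text \<open>The derivative of \<open>\<eta>\<close> is \<open>4 \<alpha> \<eta>\<close>, so its
  second derivative involves that of \<open>\<alpha>\<close>; this is where the regularity from
  \<open>W3\<close> is spent.\<close>

lemma beam_of_coefficients:
  assumes A1: "\<alpha> \<in> W3" "continuous_on {0..pi} \<alpha>" "\<beta> \<in> W3" "continuous_on {0..pi} \<beta>"
    and A2: "\<And>x. x \<in> {0..pi} \<Longrightarrow> \<rho> x = \<rho> 0 * exp (4 * integral {0..x} \<beta>)"
      "\<And>x. x \<in> {0..pi} \<Longrightarrow> \<rho> x > 1"
      "\<And>x. x \<in> {0..pi} \<Longrightarrow> \<eta> x = exp (4 * integral {0..x} \<alpha>)"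
  obtains \<eta>1 \<eta>2 where "beam \<rho> \<eta> \<eta>1 \<eta>2"
proof -
  obtain \<alpha>1 where \<alpha>1: "\<And>x. x \<in> {0..pi} \<Longrightarrow> (\<alpha> has_real_derivative \<alpha>1 x) (at x within {0..pi})" "continuous_on {0..pi} \<alpha>1"
    using W3_continuously_differentiable[OF A1(1,2)] by blast
  have int: "((\<lambda>x. integral {0..x} h) has_real_derivative h x) (at x within {0..pi})" if "continuous_on {0..pi} h" "x \<in> {0..pi}" for h x
    using integral_has_real_derivative[OF that] .
  have \<eta>: "(\<eta> has_real_derivative 4 * \<alpha> x * \<eta> x) (at x within {0..pi})" if x: "x \<in> {0..pi}" for x
  proof -
    have "((\<lambda>x. exp (4 * integral {0..x} \<alpha>)) has_real_derivative exp (4 * integral {0..x} \<alpha>) * (4 * \<alpha> x)) (at x within {0..pi})"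
      by (intro DERIV_chain2[OF DERIV_exp] DERIV_cmult int A1 x)
    then have "(\<eta> has_real_derivative exp (4 * integral {0..x} \<alpha>) * (4 * \<alpha> x)) (at x within {0..pi})"
      by (rule has_field_derivative_transform_within[OF _ zero_less_one x]) (simp add: A2(3))
    then show ?thesis using A2(3)[OF x] by (simp add: mult.commute)
  qed
  have \<eta>c: "continuous_on {0..pi} \<eta>" by (rule DERIV_continuous_on[OF \<eta>])
  have \<rho>c: "continuous_on {0..pi} (\<lambda>x. \<rho> 0 * exp (4 * integral {0..x} \<beta>))"
    by (intro continuous_on_mult continuous_on_const continuous_on_exp DERIV_continuous_on[OF int[OF A1(4)]])
  have "beam \<rho> \<eta> (\<lambda>x. 4 * \<alpha> x * \<eta> x) (\<lambda>x. 4 * \<alpha>1 x * \<eta> x + (4 * \<alpha> x * \<eta> x) * (4 * \<alpha> x))"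
  proof
    fix x assume x: "x \<in> {0..pi}"
    show "(\<eta> has_real_derivative 4 * \<alpha> x * \<eta> x) (at x within {0..pi})" by (rule \<eta>[OF x])
    show "((\<lambda>x. 4 * \<alpha> x * \<eta> x) has_real_derivative 4 * \<alpha>1 x * \<eta> x + (4 * \<alpha> x * \<eta> x) * (4 * \<alpha> x)) (at x within {0..pi})"
      by (intro DERIV_mult DERIV_cmult \<alpha>1 \<eta> x)
    show "\<eta> x > 0" using A2(3)[OF x] by simp
    show "\<rho> x > 0" using A2(2)[OF x] by simp
  next
    show "continuous_on {0..pi} (\<lambda>x. 4 * \<alpha>1 x * \<eta> x + (4 * \<alpha> x * \<eta> x) * (4 * \<alpha> x))"
      by (intro continuous_intros \<alpha>1 \<eta>c A1)
    show "continuous_on {0..pi} \<rho>" using \<rho>c A2(1) by (metis (no_types, lifting) continuous_on_cong)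
  qed
  then show ?thesis by (rule that)
qed

lemma mono_limits_le:
  fixes g :: "real \<Rightarrow> real"
  assumes "mono g" "(g \<longlongrightarrow> gm) at_bot" "(g \<longlongrightarrow> gp) at_top"
  shows "gm \<le> gp"
proof -
  have "gm \<le> g 0"
    by (rule tendsto_upperbound[OF assms(2)]) (use monoD[OF assms(1)] in \<open>auto intro!: eventually_at_bot_linorderI[of 0]\<close>)
  also have "g 0 \<le> gp"
    by (rule tendsto_lowerbound[OF assms(3)]) (use monoD[OF assms(1)] in \<open>auto intro!: eventually_at_top_linorderI[of 0]\<close>)
  finally show ?thesis .
qed

theorem theorem3p1:
  fixes p q :: nat
    and T a M gm gp \<epsilon> :: real
    and \<alpha> \<beta> \<rho> \<eta> g :: "real \<Rightarrow> real"
    and \<mu> b :: "nat \<Rightarrow> real"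
    and f fss :: "real \<times> real \<Rightarrow> real"
    and fs :: "real \<times> real \<Rightarrow> complex"
  assumes pq: "p > 0" "q > 0" "coprime p q"
    and T: "T = 2 * pi * real p / real q"
    and A1: "\<alpha> \<in> W3" "continuous_on {0..pi} \<alpha>" "\<beta> \<in> W3" "continuous_on {0..pi} \<beta>"
    and A2: "\<eta> 0 = 1"
      "\<And>x. x \<in> {0..pi} \<Longrightarrow> \<rho> x = \<rho> 0 * exp (4 * integral {0..x} \<beta>)"
      "\<And>x. x \<in> {0..pi} \<Longrightarrow> \<rho> x > 1"
      "\<And>x. x \<in> {0..pi} \<Longrightarrow> \<eta> x = exp (4 * integral {0..x} \<alpha>)"
      "integral {0..pi} (\<lambda>x. (\<rho> x / \<eta> x) powr (1/4)) = pi"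
    and mu: "beam_eigenvalues \<alpha> \<beta> \<rho> \<eta> \<mu>"
    and asymptotics: "bounded (range b)"
      "(\<lambda>n. \<mu> n - (real n ^ 4 + 2 * real n ^ 2 * a + b n)) \<in> o(\<lambda>n. 1 / real n)"
    and a_irrational: "a \<notin> \<rat>"
    and g: "mono g \<or> antimono g" "continuous_on UNIV g"
      "M > 0" "\<And>s. \<bar>g s\<bar> < M"
      "(g \<longlongrightarrow> gm) at_bot" "(g \<longlongrightarrow> gp) at_top"
    and A3: "(\<lambda>z. f z / \<rho> (snd z)) \<in> Linf T"
      "AE z in lebesgue_on (Omega T).
         complex_of_real (f z / \<rho> (snd z)) = fs z + complex_of_real (fss z)"
      "fs \<in> beam_range T \<alpha> \<beta> \<rho> \<eta>"
      "\<epsilon> > 0"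
      "AE z in lebesgue_on (Omega T). min gm gp + \<epsilon> \<le> fss z \<and> fss z \<le> max gm gp - \<epsilon>"
  shows "\<exists>u. weak_periodic_solution T \<alpha> \<beta> \<rho> \<eta> g f u"
proof -
  let ?M = "lebesgue_on (Omega T)"
  have Tpos: "T > 0" using pq T by simp
  note Tpq = T
  obtain \<eta>1 \<eta>2 where beam: "beam \<rho> \<eta> \<eta>1 \<eta>2" using beam_of_coefficients[OF A1 A2(2-4)] by blast
  interpret beam \<alpha> \<beta> \<rho> \<eta> \<eta>1 \<eta>2 by (rule beam)
  interpret beam_rect \<alpha> \<beta> \<rho> \<eta> \<eta>1 \<eta>2 T by unfold_locales (rule Tpos)
  obtain \<B> :: "cpi set" and eb \<nu> where
    e1: "\<And>b. b \<in> \<B> \<Longrightarrow> eigen (\<nu> b) (eb b)" and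
    e2: "\<And>b c. b \<in> \<B> \<Longrightarrow> c \<in> \<B> \<Longrightarrow> integral {0..pi} (\<lambda>x. \<rho> x * (eb b x * eb c x)) = (if b = c then 1 else 0)" and
    e3: "\<And>r. finite {b \<in> \<B>. \<bar>\<nu> b\<bar> \<le> r}" and
    e4: "\<And>u u1 u2 w1 w2 \<delta>. beam_dom u u1 u2 w1 w2 \<Longrightarrow> continuous_on {0..pi} w2 \<Longrightarrow> \<delta> > 0 \<Longrightarrow>
      \<exists>F c. finite F \<and> F \<subseteq> \<B> \<and> integral {0..pi} (\<lambda>x. \<rho> x * (u x - (\<Sum>b\<in>F. c b * eb b x))\<^sup>2) < \<delta>"
  proof (rule eigenfunction_expansion[OF countable_eigen[OF mu]], goal_cases)
    case (1 \<B> e \<nu>)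
    show ?case by (rule 1(1)[OF 1(2-5)])
  qed
  interpret beam_modes \<alpha> \<beta> \<rho> \<eta> \<eta>1 \<eta>2 T \<B> eb \<nu>
    by unfold_locales (fact e3 e1 e2 e4)+
  have \<rho>\<Omega>: "\<rho> (snd z) > 0" if "z \<in> Omega T" for z using that by (intro \<rho>_pos) (auto simp: Omega_def)
  obtain C where fm: "(\<lambda>z. f z / \<rho> (snd z)) \<in> borel_measurable ?M" and C: "AE z in ?M. norm (f z / \<rho> (snd z)) \<le> C"
    using A3(1) unfolding Linf_def by blast
  obtain w where w: "(w, fs) \<in> beam_graph T \<alpha> \<beta> \<rho> \<eta>" using A3(3) unfolding beam_range_def by blast
  have fsL: "fs \<in> L2 T \<rho>" using w unfolding beam_graph_def by blast
  have fsm: "fs \<in> borel_measurable ?M" using fsL unfolding L2_def by blast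
  have fsi: "integrable ?M fs" by (rule L2_integrable[OF fsL])
  define l r where "l = min gm gp + \<epsilon>" and "r = max gm gp - \<epsilon>"
  \<comment> \<open>The domain is not a null set, so the inequalities of (A3) hold at some point,
    which puts the two bounds in order.\<close>
  have gap: "l \<le> r"
  proof -
    have "emeasure ?M (space ?M) \<noteq> 0"
    proof
      assume "emeasure ?M (space ?M) = 0"
      then have "negligible (Omega T)" by (simp add: emeasure_restrict_space negligible_iff_emeasure0)
      moreover have "Omega T \<noteq> {}" using Tpos pi_gt_zero by (auto simp: Omega_def simp del: pi_gt_zero)
      moreover have "open (Omega T)" by (simp add: Omega_def open_Times)
      ultimately show False using open_not_negligible by blast
    qed
    then have "ae_filter ?M \<noteq> bot" using ae_filter_eq_bot_iff by blast
    from eventually_happens'[OF this A3(5)] show ?thesis unfolding l_def r_def by fastforce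
  qed
  \<comment> \<open>Truncation alters the data on a null set only and makes the bounds hold at every
    point. \<open>f2\<close> represents f** through \<open>f\<close> and \<open>fs\<close>, whose
    measurability is at hand.\<close>
  define F where "F z = max (- \<bar>C\<bar>) (min \<bar>C\<bar> (f z / \<rho> (snd z)))" for z
  define f2 where "f2 z = max l (min r (f z / \<rho> (snd z) - Re (fs z)))" for z
  have Fm: "F \<in> borel_measurable ?M" unfolding F_def using fm by measurable
  have f2m: "f2 \<in> borel_measurable ?M" unfolding f2_def using fm fsm by measurable
  have FAE: "AE z in ?M. F z = f z / \<rho> (snd z)" 
    using C unfolding real_norm_def by eventually_elim (unfold F_def, linarith)
  have f2AE: "AE z in ?M. f2 z = f z / \<rho> (snd z) - Re (fs z)"
    using A3(2) A3(5)
  proof eventually_elim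
    case (elim z)
    have "f z / \<rho> (snd z) = Re (complex_of_real (f z / \<rho> (snd z)))" by (simp only: Re_complex_of_real)
    also have "\<dots> = Re (fs z) + fss z" unfolding elim(1) by simp
    finally show ?case using elim(2) by (simp add: f2_def l_def r_def)
  qed
  \<comment> \<open>Almost everywhere \<open>F - f2\<close> is the real part of \<open>fs\<close>,
    and \<open>fs\<close>, as a member of the range, is orthogonal to the kernel modes.\<close>
  have kernel: "(LINT z|?M. \<rho> (snd z) * ((F z - f2 z) * mode j z)) = 0" if j: "j \<in> JJ" "freq j = 0" for j
  proof -
    have mc: "continuous_on (rect T) (\<lambda>z. \<rho> (snd z) * mode j z)"
      by (intro continuous_on_mult mode_continuous j continuous_on_fst_snd(2)[OF continuous_on_const \<rho>_cont])
    have mm: "mode j \<in> borel_measurable ?M" by (rule borel_measurable_integrable[OF LINT_Omega(1)[OF mode_continuous[OF j(1)]]])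
    have Re: "integrable ?M (\<lambda>z. Re (fs z))" and Im: "integrable ?M (\<lambda>z. Im (fs z))"
      using integrable_bounded_linear[OF bounded_linear_Re fsi] integrable_bounded_linear[OF bounded_linear_Im fsi] by auto
    have "integrable ?M (\<lambda>z. Re (fs z) *\<^sub>R complex_of_real (\<rho> (snd z) * mode j z) + Im (fs z) *\<^sub>R (complex_of_real (\<rho> (snd z) * mode j z) * \<i>))"
      by (intro Bochner_Integration.integrable_add integrable_scaleR_continuous Re Im continuous_on_mult_right continuous_on_of_real mc)
    moreover have "(\<lambda>z. Re (fs z) *\<^sub>R complex_of_real (\<rho> (snd z) * mode j z) + Im (fs z) *\<^sub>R (complex_of_real (\<rho> (snd z) * mode j z) * \<i>))
      = (\<lambda>z. \<rho> (snd z) *\<^sub>R (fs z * complex_of_real (mode j z)))"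
      by (simp add: fun_eq_iff complex_eq_iff)
    ultimately have i: "integrable ?M (\<lambda>z. \<rho> (snd z) *\<^sub>R (fs z * complex_of_real (mode j z)))" by simp
    have "(LINT z|?M. \<rho> (snd z) * ((F z - f2 z) * mode j z)) = (LINT z|?M. Re (\<rho> (snd z) *\<^sub>R (fs z * complex_of_real (mode j z))))"
    proof (rule integral_cong_AE)
      show "(\<lambda>z. \<rho> (snd z) * ((F z - f2 z) * mode j z)) \<in> borel_measurable ?M" using Fm f2m mm weight_measurable by measurable
      show "(\<lambda>z. Re (\<rho> (snd z) *\<^sub>R (fs z * complex_of_real (mode j z)))) \<in> borel_measurable ?M" using borel_measurable_integrable[OF i] by measurable
      show "AE z in ?M. \<rho> (snd z) * ((F z - f2 z) * mode j z) = Re (\<rho> (snd z) *\<^sub>R (fs z * complex_of_real (mode j z)))"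
        using FAE f2AE by eventually_elim simp
    qed
    also have "\<dots> = Re (LINT z|?M. \<rho> (snd z) *\<^sub>R (fs z * complex_of_real (mode j z)))"
      by (rule integral_bounded_linear[OF bounded_linear_Re i])
    also have "\<dots> = 0" by (simp only: kernel_orthogonal_mode[OF j w]) simp
    finally show ?thesis .
  qed
  \<comment> \<open>For nonincreasing \<open>g\<close> the sign exchanges the roles of the two
    limits, in accordance with the minimum and maximum in (A3).\<close>
  define s where "s = (if mono g then 1 else - 1 :: real)"
  have s: "s = 1 \<or> s = -1" by (simp add: s_def)
  have mono: "mono (\<lambda>u. s * g u)" using g(1) by (auto simp: s_def mono_def antimono_def)
  have lim: "((\<lambda>u. s * g u) \<longlongrightarrow> s * gm) at_bot" "((\<lambda>u. s * g u) \<longlongrightarrow> s * gp) at_top"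
    by (intro tendsto_mult_left g)+
  have f2b: "s * gm + \<epsilon> \<le> s * f2 z \<and> s * f2 z \<le> s * gp - \<epsilon>" for z
  proof -
    have "l \<le> f2 z" "f2 z \<le> r" using gap by (auto simp: f2_def)
    then show ?thesis using s mono_limits_le[OF mono lim] unfolding l_def r_def by (auto simp: min_def max_def split: if_splits)
  qed
  have Fb: "\<bar>F z\<bar> \<le> \<bar>C\<bar>" for z by (auto simp: F_def)
  obtain u where u: "u \<in> L2 T \<rho>" and sol: "\<And>\<psi>. \<psi> \<in> test_functions T \<alpha> \<beta> \<Longrightarrow>
    (LINT z|?M. u z *\<^sub>R beam_expr T \<rho> \<eta> \<psi> z) + (LINT z|?M. (g (u z) * \<rho> (snd z)) *\<^sub>R \<psi> z) = (LINT z|?M. (F z * \<rho> (snd z)) *\<^sub>R \<psi> z)"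
  proof (rule weak_solution_exists[OF finite_freq[OF pq(1,2) Tpq mu a_irrational asymptotics] s mono g(2,4) lim Fm Fb f2m f2b A3(4) kernel], goal_cases)
    case (3 u)
    show ?case by (rule 3(1)[OF 3(2,3)])
  qed
  have "(LINT z|?M. (F z * \<rho> (snd z)) *\<^sub>R \<psi> z) = (LINT z|?M. f z *\<^sub>R \<psi> z)" if \<psi>: "\<psi> \<in> test_functions T \<alpha> \<beta>" for \<psi>
  proof (rule integral_cong_AE)
    have \<psi>m: "\<psi> \<in> borel_measurable ?M" by (rule borel_measurable_integrable[OF LINT_Omega(1)[OF test_function_continuous(1)[OF \<psi>]]])
    have "(\<lambda>z. (f z / \<rho> (snd z)) * \<rho> (snd z)) \<in> borel_measurable ?M" using fm weight_measurable by measurable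
    moreover have "f z / \<rho> (snd z) * \<rho> (snd z) = f z" if "z \<in> space ?M" for z using \<rho>\<Omega>[of z] that by simp
    ultimately have "f \<in> borel_measurable ?M" using measurable_cong[of ?M "\<lambda>z. f z / \<rho> (snd z) * \<rho> (snd z)" f borel] by blast
    then show "(\<lambda>z. f z *\<^sub>R \<psi> z) \<in> borel_measurable ?M" using \<psi>m by measurable
    show "(\<lambda>z. (F z * \<rho> (snd z)) *\<^sub>R \<psi> z) \<in> borel_measurable ?M" using Fm weight_measurable \<psi>m by measurable
    show "AE z in ?M. (F z * \<rho> (snd z)) *\<^sub>R \<psi> z = f z *\<^sub>R \<psi> z"
      using FAE AE_space
    proof eventually_elim
      case (elim z)
      then show ?case using \<rho>\<Omega>[of z] by simp
    qed
  qed
  then have "weak_periodic_solution T \<alpha> \<beta> \<rho> \<eta> g f u" unfolding weak_periodic_solution_def using u sol by simp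
  then show ?thesis by blast
qed

end
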